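(* Let $1<p<\infty$, $q=p/(p-1)$, and let $\mathscr{U}\subset\mathbb{C}^n$ be a monomial polyhedron. Let $\eta_q(\zeta)=(q-1)|\zeta_1\cdots\zeta_n|^{2q-4}$. Then the dual space of $A^p(\mathscr{U})$ is identified with $A^q(\mathscr{U},\eta_q)$ via the pairing $$\{f,g\}_p=\int_{\mathscr{U}} f\cdot\overline{g\circ\chi_p}\,dV,\qquad f\in A^p(\mathscr{U}),\ g\in A^q(\mathscr{U},\eta_q);$$ that is, the map $g\mapsto\{\cdot,g\}_p$ is a conjugate-linear isomorphism of Banach spaces from $A^q(\mathscr{U},\eta_q)$ onto $A^p(\mathscr{U})'$.
   Context: $dV$ is Lebesgue measure. For a domain $\Omega$ and a measurable a.e. positive weight $\lambda$, $A^p(\Omega,\lambda)$ is the space of holomorphic $f$ on $\Omega$ with $\int_\Omega|f|^p\lambda\,dV<\infty$; $A^p(\Omega)=A^p(\Omega,1)$. The twisting map is $\chi_p(\zeta)=(\zeta_1|\zeta_1|^{p-2},\dots,\zeta_n|\zeta_n|^{p-2})$. For $\alpha\in\mathbb{Z}^n$, $e_\alpha(z)=z_1^{\alpha_1}\cdots z_n^{\alpha_n}$. A monomial polyhedron is a bounded domain of the form $\mathscr{U}=\{z\in\mathbb{C}^n: e_{\alpha^j}(z)\text{ is defined and }|e_{\alpha^j}(z)|<1,\ 1\le j\le n\}$ for $\alpha^1,\dots,\alpha^n\in\mathbb{Z}^n$ such that the matrix with rows $\alpha^j$ has nonzero determinant. *)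

theory Defs
  imports "HOL-Analysis.Analysis"
begin

definition holo_on :: "(complex^'n \<Rightarrow> complex) \<Rightarrow> (complex^'n) set \<Rightarrow> bool" where
  "holo_on f U \<longleftrightarrow>
     (\<forall>z\<in>U. \<exists>a::'n \<Rightarrow> complex. (f has_derivative (\<lambda>v. \<Sum>i\<in>UNIV. a i * v $ i)) (at z))"

definition monomial :: "('n::finite \<Rightarrow> int) \<Rightarrow> complex^'n \<Rightarrow> complex" where
  "monomial \<alpha> z = (\<Prod>i\<in>UNIV. (z $ i) powi (\<alpha> i))"

definition monomial_defined :: "('n::finite \<Rightarrow> int) \<Rightarrow> complex^'n \<Rightarrow> bool" where
  "monomial_defined \<alpha> z \<longleftrightarrow> (\<forall>i. \<alpha> i < 0 \<longrightarrow> z $ i \<noteq> 0)"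

definition monomial_polyhedron_set :: "('n::finite \<Rightarrow> 'n \<Rightarrow> int) \<Rightarrow> (complex^'n) set" where
  "monomial_polyhedron_set \<alpha> =
     {z. \<forall>j. monomial_defined (\<alpha> j) z \<and> cmod (monomial (\<alpha> j) z) < 1}"

definition exponent_matrix :: "('n::finite \<Rightarrow> 'n \<Rightarrow> int) \<Rightarrow> real^'n^'n" where
  "exponent_matrix \<alpha> = (\<chi> j i. real_of_int (\<alpha> j i))"

definition monomial_polyhedron :: "(complex^'n::finite) set \<Rightarrow> bool" where
  "monomial_polyhedron U \<longleftrightarrow>
     (\<exists>\<alpha>. det (exponent_matrix \<alpha>) \<noteq> 0 \<and> U = monomial_polyhedron_set \<alpha>)
     \<and> open U \<and> connected U \<and> U \<noteq> {} \<and> bounded U"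

definition twist :: "real \<Rightarrow> complex^'n \<Rightarrow> complex^'n" where
  "twist p z = (\<chi> i. z $ i * complex_of_real (cmod (z $ i) powr (p - 2)))"

definition bergman_integral :: "real \<Rightarrow> (complex^'n \<Rightarrow> real) \<Rightarrow> (complex^'n) set
     \<Rightarrow> (complex^'n \<Rightarrow> complex) \<Rightarrow> ennreal" where
  "bergman_integral p w U f = (\<integral>\<^sup>+ z\<in>U. ennreal (cmod (f z) powr p * w z) \<partial>lebesgue)"

definition bergman_space :: "real \<Rightarrow> (complex^'n \<Rightarrow> real) \<Rightarrow> (complex^'n) set
     \<Rightarrow> (complex^'n \<Rightarrow> complex) set" where
  "bergman_space p w U = {f. holo_on f U \<and> bergman_integral p w U f < \<infinity>}"

definition bergman_norm :: "real \<Rightarrow> (complex^'n \<Rightarrow> real) \<Rightarrow> (complex^'n) set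
     \<Rightarrow> (complex^'n \<Rightarrow> complex) \<Rightarrow> real" where
  "bergman_norm p w U f = enn2real (bergman_integral p w U f) powr (1 / p)"

definition eta :: "real \<Rightarrow> complex^'n::finite \<Rightarrow> real" where
  "eta q z = (q - 1) * cmod (\<Prod>i\<in>UNIV. z $ i) powr (2 * q - 4)"

definition pairing :: "real \<Rightarrow> (complex^'n) set \<Rightarrow> (complex^'n \<Rightarrow> complex)
     \<Rightarrow> (complex^'n \<Rightarrow> complex) \<Rightarrow> complex" where
  "pairing p U f g = (LINT z:U|lebesgue. f z * cnj (g (twist p z)))"

definition bounded_linear_functional :: "('a \<Rightarrow> complex) set \<Rightarrow> (('a \<Rightarrow> complex) \<Rightarrow> real)
     \<Rightarrow> (('a \<Rightarrow> complex) \<Rightarrow> complex) \<Rightarrow> bool" where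
  "bounded_linear_functional X N \<phi> \<longleftrightarrow>
     (\<forall>f\<in>X. \<forall>g\<in>X. \<phi> (\<lambda>z. f z + g z) = \<phi> f + \<phi> g) \<and>
     (\<forall>f\<in>X. \<forall>c. \<phi> (\<lambda>z. c * f z) = c * \<phi> f) \<and>
     (\<exists>K. \<forall>f\<in>X. cmod (\<phi> f) \<le> K * N f)"

end

theory Submission
  imports Defs "HOL-Complex_Analysis.Cauchy_Integral_Formula"
begin

text \<open>In the coordinates \<open>z\<^sub>i = exp (- \<Sum>\<^sub>j B\<^sub>i\<^sub>j w\<^sub>j)\<close>, where \<open>B\<close> is an integer multiple of the inverse of the
  exponent matrix, the polyhedron without the coordinate hyperplanes is the image of a product of right
  half-planes, Lebesgue measure comes from a product measure, monomials are exponentials and the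
  twisting map multiplies \<open>Re w\<close> by \<open>p - 1\<close>. Averaging over rotations shows that only monomials which are
  themselves in \<open>A\<^sup>p\<close> occur in the Laurent series of a function in \<open>A\<^sup>p\<close>. They span a dense subspace
  and the pairing is diagonal on them, which gives injectivity. For a bounded functional \<open>\<phi>\<close> the
  candidate \<open>g\<close> has the coefficients \<open>cnj (\<phi> e\<^sub>\<alpha>) / \<parallel>e\<^sub>\<alpha>\<parallel>\<^sup>p\<close>. With \<open>G\<close> the composition of \<open>g\<close> with the twisting map, the
  norm of \<open>G\<close> is bounded by applying \<open>\<phi>\<close> to the projection to \<open>A\<^sup>p\<close> of \<open>\<bar>G\<bar>\<^sup>q\<^sup>-\<^sup>2 G\<close>, cut off near the
  boundary. The kernel of this projection is dominated by a product of kernels on half-planes, to which Schur's test applies.\<close>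

text \<open>The twist is made for the identity \<open>monomial \<alpha> z * cnj (monomial \<alpha>
  (twist p z)) = cmod (monomial \<alpha> z) powr p\<close>: a twisted monomial is in L^q exactly
  when the monomial is in L^p, so one index set \<open>SS p\<close> serves both sides of the
  pairing. Without the twist the admissible exponents for p and for q differ in general, which is
  why the projection used here has the twisted monomials as its dual system and is not the
  orthogonal one.

  Two obstacles shape the argument. The map to logarithmic coordinates is in general many-to-one, so
  the measure is transported by an invariance argument, and the exponents \<open>ge \<alpha>\<close>
  form in general only a sublattice of the integer vectors, over which the kernel would not factor
  into one-variable sums. And the norm estimate for the representing function ends in an inequality
  I \<le> K C I^(1/p), from which I can be bounded only if it is finite beforehand; this is the
  reason for the cut-off, and the constant C must not depend on it.\<close>

lemma borel_measurable_vec_nth[measurable]: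
  "(\<lambda>x::'a::euclidean_space^'n. x $ i) \<in> borel_measurable borel"
  by (intro borel_measurable_continuous_onI continuous_intros)

lemma borel_measurable_vec_lambda[measurable (raw)]:
  fixes f :: "'b \<Rightarrow> 'n::finite \<Rightarrow> 'a::euclidean_space"
  assumes "\<And>i. (\<lambda>x. f x i) \<in> borel_measurable M"
  shows "(\<lambda>x. \<chi> i. f x i) \<in> borel_measurable M"
  unfolding borel_measurable_euclidean_space[where 'c="'a^'n"]
  using assms by (auto simp: Basis_vec_def inner_axis)

lemma norm_axis: "norm (axis i x) = norm (x::'a::real_inner)"
  by (simp only: norm_eq_sqrt_inner inner_axis_axis refl if_True)

section \<open>Lebesgue measure under affine maps, isometries and coordinatewise complex
  multiplication\<close>

lemma nn_integral_lborel_affine: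
  fixes t :: "'a::euclidean_space"
  assumes [measurable]: "\<phi> \<in> borel_measurable borel" and "c \<noteq> 0"
  shows "(\<integral>\<^sup>+x. \<phi> x \<partial>lborel) = ennreal (\<bar>c\<bar> ^ DIM('a)) * (\<integral>\<^sup>+x. \<phi> (t + c *\<^sub>R x) \<partial>lborel)"
proof -
  have "(\<integral>\<^sup>+x. \<phi> x \<partial>lborel) =
      (\<integral>\<^sup>+x. \<phi> x \<partial>density (distr lborel borel (\<lambda>x. t + c *\<^sub>R x)) (\<lambda>_. \<bar>c\<bar> ^ DIM('a)))"
    using lborel_affine[OF assms(2), of t] by simp
  also have "\<dots> = ennreal (\<bar>c\<bar> ^ DIM('a)) * (\<integral>\<^sup>+x. \<phi> (t + c *\<^sub>R x) \<partial>lborel)"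
    by (subst nn_integral_density, simp, simp, subst nn_integral_distr, simp, simp,
        subst nn_integral_cmult, auto)
  finally show ?thesis .
qed

lemma nn_integral_lborel_translation:
  fixes t :: "'a::euclidean_space"
  assumes [measurable]: "\<phi> \<in> borel_measurable borel"
  shows "(\<integral>\<^sup>+x. \<phi> (t + x) \<partial>lborel) = (\<integral>\<^sup>+x. \<phi> x \<partial>lborel)"
  using nn_integral_lborel_affine[OF assms, of 1 t] by simp

lemma nn_integral_lborel_reflection:
  fixes t :: "'a::euclidean_space"
  assumes [measurable]: "\<phi> \<in> borel_measurable borel"
  shows "(\<integral>\<^sup>+x. \<phi> (t - x) \<partial>lborel) = (\<integral>\<^sup>+x. \<phi> x \<partial>lborel)"
  using nn_integral_lborel_affine[OF assms, of "-1" t] by simp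

text \<open>The factor by which a linear map scales Lebesgue measure is read off the unit ball.\<close>

lemma nn_integral_lborel_isometry:
  fixes L L' :: "'a::euclidean_space \<Rightarrow> 'a"
  assumes L: "linear L" "linear L'" and inv: "\<And>x. L (L' x) = x" and iso: "\<And>x. norm (L x) = norm x"
    and [measurable]: "\<phi> \<in> borel_measurable borel"
  shows "(\<integral>\<^sup>+x. \<phi> (L x) \<partial>lborel) = (\<integral>\<^sup>+x. \<phi> x \<partial>lborel)"
proof -
  define k :: "'a \<Rightarrow> ennreal" where "k = indicator (ball 0 1)"
  have [measurable]: "k \<in> borel_measurable borel" unfolding k_def by (intro borel_measurable_indicator) simp
  have [measurable]: "L \<in> borel_measurable borel" "L' \<in> borel_measurable borel"
    using L by (auto intro!: borel_measurable_continuous_onI linear_continuous_on linear_conv_bounded_linear[THEN iffD1])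
  have Lk: "k (L x) = k x" for x by (simp add: k_def indicator_def iso dist_norm)
  define I where "I = (\<integral>\<^sup>+y. k y \<partial>lborel)"
  have I: "I \<noteq> 0" "I \<noteq> \<infinity>"
    using less_imp_neq[OF unit_ball_vol_pos[of "real DIM('a)"]] by (simp_all add: I_def k_def emeasure_ball)
  have "(\<integral>\<^sup>+x. \<phi> (L x) \<partial>lborel) * I = (\<integral>\<^sup>+y. k y * (\<integral>\<^sup>+x. \<phi> (L x) \<partial>lborel) \<partial>lborel)"
    unfolding I_def by (subst mult.commute, subst nn_integral_multc) simp_all
  also have "\<dots> = (\<integral>\<^sup>+y. k y * (\<integral>\<^sup>+x. \<phi> (L (L' y + x)) \<partial>lborel) \<partial>lborel)"
    by (subst nn_integral_lborel_translation[where \<phi>="\<lambda>x. \<phi> (L x)"]) simp_all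
  also have "\<dots> = (\<integral>\<^sup>+y. \<integral>\<^sup>+x. k y * \<phi> (y + L x) \<partial>lborel \<partial>lborel)"
    unfolding linear_add[OF L(1)] inv by (subst nn_integral_cmult) simp_all
  also have "\<dots> = (\<integral>\<^sup>+x. \<integral>\<^sup>+y. k y * \<phi> (y + L x) \<partial>lborel \<partial>lborel)"
    by (rule lborel_pair.Fubini') measurable
  also have "\<dots> = (\<integral>\<^sup>+x. \<integral>\<^sup>+y. k (y - L x) * \<phi> y \<partial>lborel \<partial>lborel)"
    proof (rule nn_integral_cong)
    fix x
    show "(\<integral>\<^sup>+y. k y * \<phi> (y + L x) \<partial>lborel) = (\<integral>\<^sup>+y. k (y - L x) * \<phi> y \<partial>lborel)"
      by (subst nn_integral_lborel_translation[symmetric, where t="- L x"]) (simp_all add: algebra_simps)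
  qed
  also have "\<dots> = (\<integral>\<^sup>+y. \<integral>\<^sup>+x. k (y - L x) * \<phi> y \<partial>lborel \<partial>lborel)"
    by (rule lborel_pair.Fubini') measurable
  \<comment> \<open>Since y = L (L' y), the argument y - L x of \<open>k\<close> is L (L' y - x);
    the reflection of x to L' y - x then decouples the two integrals.\<close>
  also have "\<dots> = (\<integral>\<^sup>+y. \<integral>\<^sup>+x. k (L (L' y - x)) * \<phi> y \<partial>lborel \<partial>lborel)"
    unfolding linear_diff[OF L(1)] inv ..
  also have "\<dots> = (\<integral>\<^sup>+y. \<integral>\<^sup>+x. k (L x) * \<phi> y \<partial>lborel \<partial>lborel)"
  proof (rule nn_integral_cong)
    fix y
    show "(\<integral>\<^sup>+x. k (L (L' y - x)) * \<phi> y \<partial>lborel) = (\<integral>\<^sup>+x. k (L x) * \<phi> y \<partial>lborel)"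
      by (rule nn_integral_lborel_reflection[where \<phi>="\<lambda>x. k (L x) * \<phi> y"]) measurable
  qed
  also have "\<dots> = (\<integral>\<^sup>+y. \<phi> y \<partial>lborel) * I"
    unfolding Lk I_def by (simp add: nn_integral_multc nn_integral_cmult mult.commute)
  finally show ?thesis using I by (metis mult_divide_eq_ennreal infinity_ennreal_def)
qed

text \<open>Polar decomposition \<open>a = u * r\<close>: \<open>u\<close> is unimodular, hence an
  isometry, and \<open>r\<close> is a positive diagonal map, for which the scaling of real
  coordinates applies. Each modulus enters squared because it acts on two real coordinates.\<close>

lemma nn_integral_lborel_cmul:
  fixes a :: "complex^'n" and \<phi> :: "complex^'n \<Rightarrow> ennreal"
  assumes [measurable]: "\<phi> \<in> borel_measurable borel" and a: "\<And>i. a $ i \<noteq> 0"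
  shows "ennreal (\<Prod>i\<in>UNIV. (cmod (a $ i))\<^sup>2) * (\<integral>\<^sup>+z. \<phi> (a * z) \<partial>lborel) = (\<integral>\<^sup>+z. \<phi> z \<partial>lborel)"
proof -
  define u :: "complex^'n" where "u = (\<chi> i. sgn (a $ i))"
  define r :: "complex^'n" where "r = (\<chi> i. complex_of_real (cmod (a $ i)))"
  define c :: "complex^'n \<Rightarrow> real" where "c b = norm (a * b)" for b
  have a_eq: "a = u * r" by (simp add: vec_eq_iff u_def r_def sgn_eq)
  have cax: "c (axis i v) = cmod (a $ i)" if "v \<in> Basis" for i v
  proof -
    have "a * axis i v = axis i (a $ i * v)" by (simp add: vec_eq_iff axis_def)
    then show ?thesis using that by (simp add: c_def norm_axis norm_mult)
  qed
  have r_eq: "r * z = 0 + (\<Sum>j\<in>Basis. (c j * (z \<bullet> j)) *\<^sub>R j)" for z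
  proof (rule euclidean_eqI)
    fix b :: "complex^'n" assume b: "b \<in> Basis"
    then obtain i v where iv: "b = axis i v" "v \<in> Basis" by (auto simp: Basis_vec_def)
    have "(r * z) \<bullet> b = (complex_of_real (cmod (a $ i)) * z $ i) \<bullet> v"
      by (simp add: iv inner_axis r_def)
    also have "\<dots> = cmod (a $ i) * (z $ i \<bullet> v)"
      by (metis inner_scaleR_left scaleR_conv_of_real)
    also have "\<dots> = c b * (z \<bullet> b)" using iv by (simp add: cax inner_axis)
    finally show "(r * z) \<bullet> b = (0 + (\<Sum>j\<in>Basis. (c j * (z \<bullet> j)) *\<^sub>R j)) \<bullet> b"
      using b by simp
  qed
  have c0: "c j \<noteq> 0" if "j \<in> Basis" for j using that a by (auto simp: Basis_vec_def cax)
  have pc: "(\<Prod>j\<in>Basis. \<bar>c j\<bar>) = (\<Prod>i\<in>UNIV. (cmod (a $ i))\<^sup>2)"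
  proof -
    have B: "(Basis :: (complex^'n) set) = (\<lambda>(i, v). axis i v) ` (UNIV \<times> Basis)"
      by (auto simp: Basis_vec_def)
    have inj: "inj_on (\<lambda>(i, v::complex). axis i v :: complex^'n) (UNIV \<times> Basis)"
      by (auto simp: inj_on_def axis_eq_axis)
    have "(\<Prod>j\<in>Basis. \<bar>c j\<bar>) = (\<Prod>i\<in>UNIV. \<Prod>v\<in>Basis. \<bar>c (axis i v)\<bar>)"
      unfolding B prod.reindex[OF inj] by (simp add: prod.cartesian_product case_prod_unfold o_def)
    also have "\<dots> = (\<Prod>i\<in>UNIV. (cmod (a $ i))\<^sup>2)"
      by (intro prod.cong refl) (simp add: cax Basis_complex_def power2_eq_square)
    finally show ?thesis .
  qed
  have [measurable]: "(\<lambda>z::complex^'n. x * z) \<in> borel_measurable borel" for x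
    unfolding times_vec_def by measurable
  have "(\<integral>\<^sup>+z. \<phi> z \<partial>lborel) = (\<integral>\<^sup>+z. \<phi> (u * z) \<partial>lborel)"
  proof (rule nn_integral_lborel_isometry[symmetric, where L'="\<lambda>z. (\<chi> i. cnj (u $ i)) * z"])
    show "linear ((*) u)" "linear (\<lambda>z. (\<chi> i. cnj (u $ i)) * z)"
      by (auto intro!: linearI simp: vec_eq_iff algebra_simps)
    show "u * ((\<chi> i. cnj (u $ i)) * x) = x" for x
      by (auto simp: vec_eq_iff u_def a sgn_eq complex_norm_square[symmetric] power2_eq_square field_simps)
    show "norm (u * x) = norm x" for x
      by (simp add: norm_vec_def norm_mult u_def norm_sgn a)
  qed simp
  also have "\<dots> = (\<integral>\<^sup>+z. \<phi> (u * z) \<partial>density (distr lborel borel ((*) r)) (\<lambda>_. (\<Prod>j\<in>Basis. \<bar>c j\<bar>)))"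
    using lborel_affine_euclidean[of c 0, OF c0] unfolding r_eq[symmetric]
    by (rule arg_cong[where f="\<lambda>M. \<integral>\<^sup>+z. \<phi> (u * z) \<partial>M"])
  also have "\<dots> = ennreal (\<Prod>i\<in>UNIV. (cmod (a $ i))\<^sup>2) * (\<integral>\<^sup>+z. \<phi> (a * z) \<partial>lborel)"
    by (subst nn_integral_density, simp, simp, subst nn_integral_distr, simp, simp,
        subst nn_integral_cmult, auto simp: pc a_eq mult.assoc)
  finally show ?thesis ..
qed

text \<open>Unfolding: insert the sum over \<open>k\<close> of
  \<open>indicator D' (x + t k)\<close>, which is 1, translate each term, and sum the indicators of
  \<open>D\<close> back to 1. It is applied to the period box and a translate of it.\<close>

lemma nn_integral_fundamental_domain:
  fixes t :: "'k::countable \<Rightarrow> 'a::euclidean_space" and \<phi> :: "'a \<Rightarrow> ennreal"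
  assumes [measurable]: "D \<in> sets borel" "D' \<in> sets borel" "\<phi> \<in> borel_measurable borel"
    and D: "\<And>x. \<exists>!k. - t k + x \<in> D" and D': "\<And>x. \<exists>!k. x + t k \<in> D'"
    and per: "\<And>x k. \<phi> (- t k + x) = \<phi> x"
  shows "(\<integral>\<^sup>+x. \<phi> x * indicator D x \<partial>lborel) = (\<integral>\<^sup>+x. \<phi> x * indicator D' x \<partial>lborel)"
proof -
  have one: "(\<integral>\<^sup>+k. indicator X (h k) \<partial>count_space UNIV) = (1::ennreal)"
    if "\<exists>!k. h k \<in> X" for h :: "'k \<Rightarrow> 'a" and X
  proof -
    from that obtain k0 where k0: "h k0 \<in> X" "\<And>k. h k \<in> X \<Longrightarrow> k = k0" by auto
    have hk: "h k \<in> X \<longleftrightarrow> k = k0" for k using k0(1) k0(2)[of k] by blast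
    have "indicator X (h k) = (indicator {k0} k :: ennreal)" for k
      by (cases "k = k0") (simp_all add: hk)
    then show ?thesis by (simp add: nn_integral_count_space_indicator)
  qed
  have "(\<integral>\<^sup>+x. \<phi> x * indicator D x \<partial>lborel) =
     (\<integral>\<^sup>+x. \<integral>\<^sup>+k. \<phi> x * indicator D x * indicator D' (x + t k) \<partial>count_space UNIV \<partial>lborel)"
    by (simp add: nn_integral_cmult one[OF D'])
  also have "\<dots> = (\<integral>\<^sup>+k. \<integral>\<^sup>+x. \<phi> x * indicator D x * indicator D' (x + t k) \<partial>lborel \<partial>count_space UNIV)"
    by (rule nn_integral_count_space_nn_integral) auto
  also have "\<dots> = (\<integral>\<^sup>+k. \<integral>\<^sup>+x. \<phi> (- t k + x) * indicator D (- t k + x) * indicator D' (- t k + x + t k) \<partial>lborel \<partial>count_space UNIV)"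
    by (rule nn_integral_cong, rule nn_integral_lborel_translation[symmetric]) measurable
  also have "\<dots> = (\<integral>\<^sup>+k. \<integral>\<^sup>+x. \<phi> x * indicator D (- t k + x) * indicator D' x \<partial>lborel \<partial>count_space UNIV)"
    unfolding per by simp
  also have "\<dots> = (\<integral>\<^sup>+x. \<integral>\<^sup>+k. \<phi> x * indicator D (- t k + x) * indicator D' x \<partial>count_space UNIV \<partial>lborel)"
    by (rule nn_integral_count_space_nn_integral[symmetric]) auto
  also have "\<dots> = (\<integral>\<^sup>+x. \<phi> x * indicator D' x \<partial>lborel)"
    using one[OF D] by (simp add: nn_integral_cmult nn_integral_multc)
  finally show ?thesis .
qed

lemma nn_integral_lborel_vec_prod:
  fixes f :: "'n::finite \<Rightarrow> real \<Rightarrow> ennreal"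
  assumes [measurable]: "\<And>i. f i \<in> borel_measurable borel"
  shows "(\<integral>\<^sup>+s. (\<Prod>i\<in>UNIV. f i (s $ i)) \<partial>(lborel :: (real^'n) measure)) = (\<Prod>i\<in>UNIV. \<integral>\<^sup>+x. f i x \<partial>lborel)"
proof -
  define g where "g b = f (THE i. b = axis i (1::real))" for b :: "real^'n"
  have g: "g (axis i 1) = f i" for i
    unfolding g_def by (rule arg_cong[where f=f]) (auto simp: axis_eq_axis)
  have B: "(Basis :: (real^'n) set) = range (\<lambda>i. axis i 1)" by (auto simp: Basis_vec_def)
  have inj: "inj (\<lambda>i. axis i 1 :: real^'n)" by (auto simp: inj_on_def axis_eq_axis)
  have "(\<integral>\<^sup>+s. (\<Prod>b\<in>Basis. g b (s \<bullet> b)) \<partial>(lborel :: (real^'n) measure)) = (\<Prod>b\<in>Basis. \<integral>\<^sup>+x. g b x \<partial>lborel)"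
    by (rule nn_integral_lborel_prod) (auto simp: g_def)
  then show ?thesis
    unfolding B prod.reindex[OF inj] o_def by (simp add: g inner_axis)
qed

section \<open>The period box, the torus and its Haar measure\<close>

definition torus_box :: "(real^'n) set" where
  "torus_box = {s. \<forall>i. 0 \<le> s $ i \<and> s $ i < 2 * pi}"

lemma torus_box_measurable[measurable]: "torus_box \<in> sets borel"
proof -
  have "torus_box = (\<Inter>i\<in>UNIV. {s \<in> space borel. 0 \<le> s $ i \<and> s $ i < 2 * pi})" by (auto simp: torus_box_def)
  also have "\<dots> \<in> sets borel" by (intro sets.finite_INT) (auto simp del: space_borel)
  finally show ?thesis .
qed

lemma indicator_torus_box:
  "(indicator torus_box s :: 'b::comm_semiring_1) = (\<Prod>i\<in>UNIV. indicator {0..<2*pi} (s $ i))"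
proof (cases "s \<in> torus_box")
  case False
  then obtain i where "indicator {0..<2*pi} (s $ i) = (0::'b)" by (auto simp: torus_box_def indicator_def)
  then have "(\<Prod>i\<in>UNIV. indicator {0..<2*pi} (s $ i)) = (0::'b)" by (intro prod_zero) auto
  then show ?thesis using False by simp
qed (auto simp: torus_box_def)

lemma emeasure_torus_box: "emeasure lborel (torus_box :: (real^'n) set) = ennreal ((2 * pi) ^ CARD('n))"
proof -
  have "emeasure lborel (torus_box :: (real^'n) set) = (\<integral>\<^sup>+s. (\<Prod>i\<in>UNIV. indicator {0..<2*pi} (s $ i)) \<partial>(lborel :: (real^'n) measure))"
    by (simp add: indicator_torus_box[symmetric])
  also have "\<dots> = ennreal ((2 * pi) ^ CARD('n))"
    by (subst nn_integral_lborel_vec_prod) (auto simp: ennreal_power)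
  finally show ?thesis .
qed

definition lat :: "int^'n \<Rightarrow> real^'n" where "lat m = (\<chi> i. 2 * pi * of_int (m $ i))"

lemma lat_uminus: "lat (- m) = - lat m" by (simp add: lat_def vec_eq_iff)

lemma ex1_lat: "\<exists>!m. x + lat m \<in> torus_box"
proof -
  have 1: "\<exists>!k::int. 0 \<le> a + 2 * pi * of_int k \<and> a + 2 * pi * of_int k < 2 * pi" for a :: real
  proof (intro ex1I[of _ "- \<lfloor>a / (2 * pi)\<rfloor>"])
    have "of_int \<lfloor>a / (2 * pi)\<rfloor> \<le> a / (2 * pi)" "a / (2 * pi) < of_int \<lfloor>a / (2 * pi)\<rfloor> + 1" by linarith+
    then have "of_int \<lfloor>a / (2 * pi)\<rfloor> * (2 * pi) \<le> a" "a < (of_int \<lfloor>a / (2 * pi)\<rfloor> + 1) * (2 * pi)"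
      by (simp_all only: pos_le_divide_eq pos_divide_less_eq pi_gt_zero zero_less_mult_iff zero_less_numeral simp_thms)
    then show "0 \<le> a + 2 * pi * of_int (- \<lfloor>a / (2 * pi)\<rfloor>) \<and> a + 2 * pi * of_int (- \<lfloor>a / (2 * pi)\<rfloor>) < 2 * pi"
      by (simp add: algebra_simps)
  next
    fix k :: int assume "0 \<le> a + 2 * pi * of_int k \<and> a + 2 * pi * of_int k < 2 * pi"
    then have "of_int (- k) \<le> a / (2 * pi)" "a / (2 * pi) < of_int (- k) + 1" by (simp_all add: field_simps)
    then show "k = - \<lfloor>a / (2 * pi)\<rfloor>" by linarith
  qed
  define m where "m = (\<chi> i. THE k::int. 0 \<le> x $ i + 2 * pi * of_int k \<and> x $ i + 2 * pi * of_int k < 2 * pi)"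
  show ?thesis
  proof (intro ex1I[of _ m])
    show "x + lat m \<in> torus_box"
      using theI'[OF 1[of "x $ _"]] by (auto simp: torus_box_def lat_def m_def)
  next
    fix m' assume "x + lat m' \<in> torus_box"
    then have "m' $ i = m $ i" for i
      using the1_equality[OF 1[of "x $ i"], of "m' $ i"] by (auto simp: torus_box_def lat_def m_def)
    then show "m' = m" by (simp add: vec_eq_iff)
  qed
qed

text \<open>The shifted box is again a fundamental domain for the lattice of the vectors
  \<open>lat m\<close>.\<close>

lemma nn_integral_torus_shift:
  fixes \<phi> :: "real^'n \<Rightarrow> ennreal"
  assumes [measurable]: "\<phi> \<in> borel_measurable borel" and per: "\<And>x m. \<phi> (x + lat m) = \<phi> x"
  shows "(\<integral>\<^sup>+s. \<phi> (v + s) * indicator torus_box s \<partial>lborel) = (\<integral>\<^sup>+s. \<phi> s * indicator torus_box s \<partial>lborel)"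
proof -
  define D where "D = (\<lambda>s. - v + s) -` torus_box"
  have Dm: "D \<in> sets borel" unfolding D_def by (rule measurable_sets_borel[OF _ torus_box_measurable]) simp
  have "(\<integral>\<^sup>+s. \<phi> (v + s) * indicator torus_box s \<partial>lborel) = (\<integral>\<^sup>+s. \<phi> s * indicator torus_box (- v + s) \<partial>lborel)"
    by (subst nn_integral_lborel_translation[symmetric, where t="-v"]) simp_all
  also have "\<dots> = (\<integral>\<^sup>+s. \<phi> s * indicator D s \<partial>lborel)"
    by (simp add: D_def indicator_def)
  also have "\<dots> = (\<integral>\<^sup>+s. \<phi> s * indicator torus_box s \<partial>lborel)"
  proof (rule nn_integral_fundamental_domain[OF Dm torus_box_measurable assms(1) _ ex1_lat])
    fix x
    from ex1_lat[of "- v + x"] obtain m where m: "- v + x + lat m \<in> torus_box"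
      and u: "\<And>m'. - v + x + lat m' \<in> torus_box \<Longrightarrow> m' = m" by auto
    show "\<exists>!k. - lat k + x \<in> D"
    proof (rule ex1I[of _ "- m"])
      show "- lat (- m) + x \<in> D" using m by (simp add: D_def lat_uminus algebra_simps)
      fix k assume "- lat k + x \<in> D"
      then have "- v + x + lat (- k) \<in> torus_box" by (simp add: D_def lat_uminus algebra_simps)
      from u[OF this] show "k = - m" by (metis minus_minus)
    qed
    show "\<phi> (- lat k + x) = \<phi> x" for k using per[of x "- k"] by (simp add: lat_uminus algebra_simps)
  qed
  finally show ?thesis .
qed

lemma nn_integral_torus_shift_prod:
  fixes \<phi> :: "(real^'n) \<times> (real^'n) \<Rightarrow> ennreal"
  assumes [measurable]: "\<phi> \<in> borel_measurable borel" and per: "\<And>y x m. \<phi> (y, x + lat m) = \<phi> (y, x)"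
  shows "(\<integral>\<^sup>+x. \<phi> (v + x) * indicator torus_box (snd x) \<partial>lborel) = (\<integral>\<^sup>+x. \<phi> x * indicator torus_box (snd x) \<partial>lborel)"
proof -
  have [measurable]: "\<phi> \<in> borel_measurable (borel \<Otimes>\<^sub>M borel)" by (simp add: borel_prod)
  have "(\<integral>\<^sup>+x. \<phi> (v + x) * indicator torus_box (snd x) \<partial>lborel)
      = (\<integral>\<^sup>+y. \<integral>\<^sup>+s. \<phi> (fst v + y, snd v + s) * indicator torus_box s \<partial>lborel \<partial>lborel)"
    unfolding lborel_prod[symmetric] by (subst lborel.nn_integral_fst[symmetric]) (simp_all add: plus_prod_def)
  also have "\<dots> = (\<integral>\<^sup>+y. \<integral>\<^sup>+s. \<phi> (fst v + y, s) * indicator torus_box s \<partial>lborel \<partial>lborel)"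
    by (rule nn_integral_cong, rule nn_integral_torus_shift) (auto simp: per)
  also have "\<dots> = (\<integral>\<^sup>+y. \<integral>\<^sup>+s. \<phi> (y, s) * indicator torus_box s \<partial>lborel \<partial>lborel)"
    by (rule nn_integral_lborel_translation[where \<phi>="\<lambda>y. \<integral>\<^sup>+s. \<phi> (y, s) * indicator torus_box s \<partial>lborel"]) simp
  also have "\<dots> = (\<integral>\<^sup>+x. \<phi> x * indicator torus_box (snd x) \<partial>lborel)"
    unfolding lborel_prod[symmetric] by (subst lborel.nn_integral_fst[symmetric]) simp_all
  finally show ?thesis .
qed

definition expi :: "real^'n \<Rightarrow> complex^'n" where "expi s = (\<chi> i. cis (s $ i))"

text \<open>Normalised Haar measure of the torus, kept as a Borel measure on all of
  \<open>complex^'n\<close> so that multiplication by a fixed vector is measurable without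
  restricting spaces; that it lives on unimodular vectors is \<open>AE_torus\<close>.\<close>

definition torus :: "(complex^'n) measure" where
  "torus = distr (density lborel (\<lambda>s. ennreal (1 / (2 * pi) ^ CARD('n)) * indicator torus_box s)) borel expi"

lemma expi_measurable[measurable]: "expi \<in> borel_measurable borel"
  unfolding expi_def cis_conv_exp by measurable

lemma expi_add: "expi (v + s) = expi v * expi s" by (simp add: expi_def vec_eq_iff cis_mult)

lemma expi_lat: "expi (s + lat m) = expi s"
  by (simp add: expi_def lat_def vec_eq_iff cis_mult[symmetric])

lemma space_torus[simp]: "space torus = UNIV" and sets_torus[measurable_cong, simp]: "sets torus = sets borel"
  by (simp_all add: torus_def)

lemma nn_integral_torus:
  fixes \<phi> :: "complex^'n \<Rightarrow> ennreal"
  assumes [measurable]: "\<phi> \<in> borel_measurable borel"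
  shows "(\<integral>\<^sup>+\<omega>. \<phi> \<omega> \<partial>torus) = ennreal (1 / (2 * pi) ^ CARD('n)) * (\<integral>\<^sup>+s. \<phi> (expi s) * indicator torus_box s \<partial>lborel)"
  unfolding torus_def
  by (subst nn_integral_distr, simp, simp, subst nn_integral_density, simp, simp, subst nn_integral_cmult[symmetric]) (simp_all add: mult_ac)

lemma emeasure_torus: "emeasure (torus :: (complex^'n) measure) UNIV = 1"
proof -
  have "emeasure torus (UNIV :: (complex^'n) set) = (\<integral>\<^sup>+\<omega>. 1 \<partial>(torus :: (complex^'n) measure))" by simp
  also have "\<dots> = 1"
    by (subst nn_integral_torus) (auto simp: emeasure_torus_box ennreal_mult[symmetric])
  finally show ?thesis .
qed

lemma finite_measure_torus: "finite_measure torus"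
  by (rule finite_measureI) (simp add: emeasure_torus)

definition unimodular :: "complex^'n \<Rightarrow> bool" where "unimodular u \<longleftrightarrow> (\<forall>i. cmod (u $ i) = 1)"

lemma AE_torus: "AE \<omega> in torus. unimodular \<omega>"
  unfolding torus_def by (subst AE_distr_iff) (auto simp: unimodular_def expi_def)

lemma unimodular_expi: "unimodular u \<Longrightarrow> \<exists>v. u = expi v"
proof (rule exI[of _ "\<chi> i. Arg (u $ i)"])
  assume "unimodular u"
  then have "cmod (u $ i) = 1" for i by (simp add: unimodular_def)
  then have "cis (Arg (u $ i)) = u $ i" for i
    by (subst cis_Arg) (auto simp: sgn_eq dest: arg_cong[where f=norm])
  then show "u = expi (\<chi> i. Arg (u $ i))" by (simp add: expi_def vec_eq_iff)
qed

lemma cmul_measurable[measurable (raw)]: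
  fixes f g :: "'a \<Rightarrow> complex^'n"
  assumes [measurable]: "f \<in> borel_measurable M" "g \<in> borel_measurable M"
  shows "(\<lambda>x. f x * g x) \<in> borel_measurable M"
  unfolding times_vec_def by measurable

lemma torus_invariant:
  fixes u :: "complex^'n"
  assumes "unimodular u"
  shows "distr torus borel ((*) u) = torus"
proof (rule measure_eqI)
  fix X :: "(complex^'n) set" assume "X \<in> sets (distr torus borel ((*) u))"
  then have [measurable]: "X \<in> sets borel" by simp
  obtain v where v: "u = expi v" using unimodular_expi[OF assms] by auto
  have "emeasure (distr torus borel ((*) u)) X = (\<integral>\<^sup>+\<omega>. indicator X \<omega> \<partial>distr torus borel ((*) u))" by simp
  also have "\<dots> = (\<integral>\<^sup>+\<omega>. indicator X (u * \<omega>) \<partial>torus)" by (subst nn_integral_distr) simp_all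
  also have "\<dots> = (\<integral>\<^sup>+\<omega>. indicator X \<omega> \<partial>torus)"
    by (subst (1 2) nn_integral_torus, simp, simp, unfold v expi_add[symmetric],
      subst nn_integral_torus_shift[where \<phi>="\<lambda>s. indicator X (expi s)"]) (simp_all add: expi_lat)
  also have "\<dots> = emeasure torus X" by simp
  finally show "emeasure (distr torus borel ((*) u)) X = emeasure torus X" .
qed simp

section \<open>Logarithmic coordinates and the transformation of Lebesgue measure\<close>

definition cvec :: "(real^'n) \<times> (real^'n) \<Rightarrow> complex^'n" where
  "cvec x = (\<chi> j. Complex (fst x $ j) (snd x $ j))"

lemma cvec_nth[simp]: "cvec x $ j = Complex (fst x $ j) (snd x $ j)" by (simp add: cvec_def)

lemma cvec_add: "cvec (x + y) = cvec x + cvec y" by (simp add: vec_eq_iff complex_eq_iff)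
lemma cvec_surj: "\<exists>x. w = cvec x"
  by (rule exI[of _ "(\<chi> j. Re (w $ j), \<chi> j. Im (w $ j))"]) (simp add: vec_eq_iff)

lemma cvec_measurable[measurable]: "cvec \<in> borel_measurable borel"
  unfolding cvec_def Complex_eq borel_prod[symmetric] by measurable

lemma prod_inverse_norm: "ennreal (\<Prod>i\<in>UNIV. (cmod (a $ i))\<^sup>2) * ennreal (\<Prod>i\<in>UNIV. inverse ((cmod (a $ i))\<^sup>2)) = 1"
    if "\<And>i. a $ i \<noteq> 0" for a :: "complex^'n"
  proof -
    have "(\<Prod>i\<in>UNIV. (cmod (a $ i))\<^sup>2) * (\<Prod>i\<in>UNIV. inverse ((cmod (a $ i))\<^sup>2)) = (\<Prod>i\<in>(UNIV :: 'n set). 1)"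
      by (subst prod.distrib[symmetric]) (use that in \<open>simp\<close>)
    then show ?thesis by (subst ennreal_mult[symmetric]) (auto intro: prod_nonneg)
  qed
lemma prod_inverse_norm_mult: "ennreal (\<Prod>i\<in>UNIV. inverse ((cmod ((a * z) $ i))\<^sup>2)) = ennreal (\<Prod>i\<in>UNIV. inverse ((cmod (a $ i))\<^sup>2)) * ennreal (\<Prod>i\<in>UNIV. inverse ((cmod (z $ i))\<^sup>2))" for a z :: "complex^'n"
  proof -
    have "(\<Prod>i\<in>UNIV. inverse ((cmod ((a * z) $ i))\<^sup>2)) = (\<Prod>i\<in>UNIV. inverse ((cmod (a $ i))\<^sup>2)) * (\<Prod>i\<in>UNIV. inverse ((cmod (z $ i))\<^sup>2))"
      by (simp add: norm_mult power_mult_distrib prod.distrib)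
    then show ?thesis by (simp only:) (rule ennreal_mult, auto intro: prod_nonneg)
  qed
lemma exp_2pi_of_int: "exp ((2 * of_int k * complex_of_real pi) * \<i>) = 1"
  unfolding exp_eq_1 by (auto intro!: exI[of _ k])

lemma fst_nth_measurable[measurable]: "(\<lambda>x::(real^'n) \<times> (real^'n). fst x $ j) \<in> borel_measurable borel"
  and snd_nth_measurable[measurable]: "(\<lambda>x::(real^'n) \<times> (real^'n). snd x $ j) \<in> borel_measurable borel"
  unfolding borel_prod[symmetric] by measurable

text \<open>\<open>A\<close> is the exponent matrix and \<open>B / d\<close> its inverse. The
  denominator is cleared because integer entries make \<open>E\<close> periodic with period 2 pi i
  in every coordinate; \<open>E\<close> then reaches every point without zero coordinates, but is in
  general not injective on a period box.\<close>

locale lattice_map =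
  fixes A B :: "'n::finite \<Rightarrow> 'n \<Rightarrow> int" and d :: int
  assumes d_pos: "d > 0"
    and AB: "\<And>j k. (\<Sum>i\<in>UNIV. A j i * B i k) = (if j = k then d else 0)"
    and BA: "\<And>i k. (\<Sum>j\<in>UNIV. B i j * A j k) = (if i = k then d else 0)"
begin

definition E :: "complex^'n \<Rightarrow> complex^'n" where
  "E w = (\<chi> i. exp (- (\<Sum>j\<in>UNIV. of_int (B i j) * w $ j)))"

text \<open>The product of the coordinates of \<open>E w\<close> has modulus exp (- \<Sum> b_j Re
  w_j), so \<open>b\<close> governs both the density of the measure in the coordinates
  \<open>w\<close> and the weight \<open>eta\<close>.\<close>

definition b :: "'n \<Rightarrow> int" where "b j = (\<Sum>i\<in>UNIV. B i j)"

lemma E_add: "E (v + w) = E v * E w"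
  by (simp add: E_def vec_eq_iff algebra_simps sum.distrib exp_add[symmetric])

lemma E_nz[simp]: "E w $ i \<noteq> 0" by (simp add: E_def)

lemma E_measurable[measurable]: "E \<in> borel_measurable borel"
  unfolding E_def by measurable

lemma E_lat: "E (cvec (y, s + lat m)) = E (cvec (y, s))"
proof -
  have "E (cvec (y, s + lat m)) = E (cvec (y, s)) * E (cvec (0, lat m))"
    by (simp add: E_add[symmetric] cvec_add[symmetric])
  also have "E (cvec (0, lat m)) = 1"
  proof (simp add: E_def vec_eq_iff, intro allI)
    fix i
    have "- (\<Sum>j\<in>UNIV. of_int (B i j) * Complex 0 (lat m $ j)) = (2 * of_int (- (\<Sum>j\<in>UNIV. B i j * m $ j)) * complex_of_real pi) * \<i>"
      by (simp add: complex_eq_iff sum_distrib_left sum_distrib_right lat_def mult_ac flip: sum_negf)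
    moreover have "exp ((2 * of_int (- (\<Sum>j\<in>UNIV. B i j * m $ j)) * complex_of_real pi) * \<i>) = 1"
      by (rule exp_2pi_of_int)
    ultimately show "exp (- (\<Sum>j\<in>UNIV. of_int (B i j) * Complex 0 (lat m $ j))) = 1"
      by (simp only:)
  qed
  finally show ?thesis by simp
qed

lemma E_surj:
  assumes "\<And>i. z $ i \<noteq> 0"
  shows "E (\<chi> j. - (\<Sum>k\<in>UNIV. of_int (A j k) * Ln (z $ k)) / of_int d) = z"
proof -
  have "- (\<Sum>j\<in>UNIV. of_int (B i j) * (- (\<Sum>k\<in>UNIV. of_int (A j k) * Ln (z $ k)) / of_int d)) = Ln (z $ i)" for i
  proof -
    have "- (\<Sum>j\<in>UNIV. of_int (B i j) * (- (\<Sum>k\<in>UNIV. of_int (A j k) * Ln (z $ k)) / of_int d))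
      = (\<Sum>j\<in>UNIV. \<Sum>k\<in>UNIV. of_int (B i j * A j k) * Ln (z $ k)) / of_int d"
      by (simp add: sum_negf sum_divide_distrib sum_distrib_left mult_ac)
    also have "\<dots> = (\<Sum>k\<in>UNIV. of_int (\<Sum>j\<in>UNIV. B i j * A j k) * Ln (z $ k)) / of_int d"
      by (subst sum.swap) (simp add: sum_distrib_right)
    also have "\<dots> = (\<Sum>k\<in>UNIV. if i = k then of_int d * Ln (z $ k) else 0) / of_int d"
      by (simp only: BA) (rule arg_cong[where f="\<lambda>x. x / _"], rule sum.cong, auto)
    also have "\<dots> = Ln (z $ i)" using d_pos by simp
    finally show ?thesis .
  qed
  then show ?thesis using assms by (simp add: E_def vec_eq_iff)
qed

lemma norm_E: "cmod (E w $ i) = exp (- (\<Sum>j\<in>UNIV. of_int (B i j) * Re (w $ j)))"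
  by (simp add: E_def)

lemma ln_norm_E: "(\<Sum>i\<in>UNIV. of_int (A j i) * ln (cmod (E w $ i))) = - of_int d * Re (w $ j)"
proof -
  have "(\<Sum>i\<in>UNIV. of_int (A j i) * ln (cmod (E w $ i))) = - (\<Sum>i\<in>UNIV. \<Sum>k\<in>UNIV. of_int (A j i * B i k) * Re (w $ k))"
    by (simp add: norm_E sum_distrib_left sum_negf mult_ac)
  also have "\<dots> = - (\<Sum>k\<in>UNIV. of_int (\<Sum>i\<in>UNIV. A j i * B i k) * Re (w $ k))"
    by (subst sum.swap) (simp add: sum_distrib_right)
  also have "\<dots> = - (\<Sum>k\<in>UNIV. if j = k then of_int d * Re (w $ k) else 0)"
    by (simp only: AB) (rule arg_cong[where f=uminus], rule sum.cong, auto)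
  finally show ?thesis by simp
qed

lemma prod_norm_E: "(\<Prod>i\<in>UNIV. (cmod (E w $ i))\<^sup>2) = exp (- 2 * (\<Sum>j\<in>UNIV. of_int (b j) * Re (w $ j)))"
proof -
  have "(\<Prod>i\<in>UNIV. (cmod (E w $ i))\<^sup>2) = exp (\<Sum>i\<in>UNIV. - 2 * (\<Sum>j\<in>UNIV. of_int (B i j) * Re (w $ j)))"
    by (subst exp_sum, simp) (simp add: norm_E exp_double[symmetric])
  also have "(\<Sum>i\<in>UNIV. - 2 * (\<Sum>j\<in>UNIV. of_int (B i j) * Re (w $ j))) = - 2 * (\<Sum>j\<in>UNIV. of_int (b j) * Re (w $ j))"
    unfolding b_def of_int_sum sum_distrib_right sum_distrib_left by (subst sum.swap) simp
  finally show ?thesis .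
qed

lemma AE_nz: "AE z in (lborel :: (complex^'n) measure). \<forall>i. z $ i \<noteq> 0"
proof -
  have "AE z in (lborel :: (complex^'n) measure). z $ i \<noteq> 0" for i
  proof -
    have "negligible {z :: complex^'n. axis i 1 \<bullet> z = 0}"
      by (rule negligible_hyperplane) (simp add: axis_eq_0_iff)
    moreover have "{z :: complex^'n. axis i 1 \<bullet> z = 0} \<in> sets lborel"
      using closed_hyperplane[of "axis i (1::complex)" 0] by simp
    ultimately have "{z :: complex^'n. axis i 1 \<bullet> z = 0} \<in> null_sets lborel"
      by (simp only: negligible_iff_null_sets null_sets_completion_iff)
    then have "AE z in lborel. z \<notin> {z :: complex^'n. axis i 1 \<bullet> z = 0}" by (rule AE_not_in)
    then show ?thesis by eventually_elim (auto simp: inner_axis')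
  qed
  then show ?thesis by (simp add: AE_all_countable eventually_all_finite)
qed

text \<open>Both sides of the formula below are, up to the weight, Haar measures of the group
  \<open>(\<complex> - {0})\<^sup>n\<close>; uniqueness is proved with Weil's double integral.\<close>

lemma nn_integral_E:
  "\<exists>c>0. \<forall>\<phi>\<in>borel_measurable borel. (\<integral>\<^sup>+z. \<phi> z \<partial>lborel) =
     ennreal c * (\<integral>\<^sup>+x. \<phi> (E (cvec x)) * ennreal (exp (- 2 * (\<Sum>j\<in>UNIV. of_int (b j) * fst x $ j))) * indicator torus_box (snd x) \<partial>lborel)"
proof -
  \<comment> \<open>Density of the measure that is invariant under multiplication by vectors without
    zero coordinates.\<close>
  define m where "m z = ennreal (\<Prod>i\<in>UNIV. inverse ((cmod (z $ i))\<^sup>2))" for z :: "complex^'n"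
  define W where "W = density lborel (\<lambda>x::(real^'n) \<times> (real^'n). indicator torus_box (snd x) :: ennreal)"
  have [measurable]: "m \<in> borel_measurable borel" unfolding m_def by measurable
  have sb[measurable]: "(\<lambda>x::(real^'n) \<times> (real^'n). indicator torus_box (snd x) :: ennreal) \<in> borel_measurable borel"
    unfolding borel_prod[symmetric] by measurable
  have W: "(\<integral>\<^sup>+x. \<phi> x \<partial>W) = (\<integral>\<^sup>+x. \<phi> x * indicator torus_box (snd x) \<partial>lborel)" if [measurable]: "\<phi> \<in> borel_measurable borel" for \<phi>
    unfolding W_def by (subst nn_integral_density) (simp_all add: mult.commute)
  have [measurable_cong, simp]: "sets W = sets borel" "space W = UNIV" by (simp_all add: W_def)
  interpret W: sigma_finite_measure W
    unfolding W_def by (subst sigma_finite_measure.sigma_finite_iff_density_finite[OF sigma_finite_lborel]) (auto split: split_indicator)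
  interpret P: pair_sigma_finite lborel W ..
  have m_mult: "m (a * z) = m a * m z" for a z unfolding m_def by (rule prod_inverse_norm_mult)
  have m_inv: "(\<integral>\<^sup>+z. m z * f (a * z) \<partial>lborel) = (\<integral>\<^sup>+z. m z * f z \<partial>lborel)"
    if [measurable]: "f \<in> borel_measurable borel" and a: "\<And>i. a $ i \<noteq> 0" for f and a :: "complex^'n"
  proof -
    have one: "ennreal (\<Prod>i\<in>UNIV. (cmod (a $ i))\<^sup>2) * m a = 1"
      unfolding m_def using a by (rule prod_inverse_norm)
    have "(\<integral>\<^sup>+z. m z * f z \<partial>lborel) = ennreal (\<Prod>i\<in>UNIV. (cmod (a $ i))\<^sup>2) * (\<integral>\<^sup>+z. m (a * z) * f (a * z) \<partial>lborel)"
      by (rule nn_integral_lborel_cmul[symmetric]) (use a in simp_all)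
    also have "\<dots> = (ennreal (\<Prod>i\<in>UNIV. (cmod (a $ i))\<^sup>2) * m a) * (\<integral>\<^sup>+z. m z * f (a * z) \<partial>lborel)"
      by (simp add: m_mult mult.assoc nn_integral_cmult)
    finally show ?thesis by (simp add: one)
  qed
  have W_inv: "(\<integral>\<^sup>+x. f (E (cvec (v + x))) * g (E (cvec x)) \<partial>W) = (\<integral>\<^sup>+x. f (E (cvec x)) * g (E (cvec (x - v))) \<partial>W)"
    if [measurable]: "f \<in> borel_measurable borel" "g \<in> borel_measurable borel" for f g and v :: "(real^'n) \<times> (real^'n)"
  proof -
    have "(\<integral>\<^sup>+x. f (E (cvec (v + x))) * g (E (cvec x)) \<partial>W) = (\<integral>\<^sup>+x. f (E (cvec (v + x))) * g (E (cvec (v + x - v))) * indicator torus_box (snd x) \<partial>lborel)"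
      by (subst W) simp_all
    also have "\<dots> = (\<integral>\<^sup>+x. f (E (cvec x)) * g (E (cvec (x - v))) * indicator torus_box (snd x) \<partial>lborel)"
    proof (rule nn_integral_torus_shift_prod[where \<phi>="\<lambda>x. f (E (cvec x)) * g (E (cvec (x - v)))"])
      fix y x m
      have "(y, x + lat m) - v = (y - fst v, (x - snd v) + lat m)" "(y, x) - v = (y - fst v, (x - snd v))" by (auto simp: prod_eq_iff)
      then show "f (E (cvec (y, x + lat m))) * g (E (cvec ((y, x + lat m) - v))) = f (E (cvec (y, x))) * g (E (cvec ((y, x) - v)))"
        by (simp only: E_lat)
    qed measurable
    also have "\<dots> = (\<integral>\<^sup>+x. f (E (cvec x)) * g (E (cvec (x - v))) \<partial>W)" by (subst W) simp_all
    finally show ?thesis .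
  qed
  \<comment> \<open>A product of annuli as test set: it only has to receive positive finite mass
    from both measures. On one side it enters after inversion, and \<open>Q'\<close> is its image
    under inversion.\<close>
  define Q :: "(complex^'n) set" where "Q = {z. \<forall>i. 1 < cmod (z $ i) \<and> cmod (z $ i) < 2}"
  define Q' :: "(complex^'n) set" where "Q' = {z. \<forall>i. 1/2 < cmod (z $ i) \<and> cmod (z $ i) < 1}"
  have Q': "open Q'"
    unfolding Q'_def by (simp only: Collect_all_eq) (intro open_INT finite ballI open_Collect_conj open_Collect_less continuous_intros)
  define k :: "complex^'n \<Rightarrow> ennreal" where "k = indicator Q"
  define iv :: "complex^'n \<Rightarrow> complex^'n" where "iv z = (\<chi> i. inverse (z $ i))" for z
  have Q: "open Q"
    unfolding Q_def by (simp only: Collect_all_eq) (intro open_INT finite ballI open_Collect_conj open_Collect_less continuous_intros)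
  have [measurable]: "k \<in> borel_measurable borel" unfolding k_def using Q by (intro borel_measurable_indicator) simp
  have [measurable]: "iv \<in> borel_measurable borel" unfolding iv_def by measurable
  have main: "(\<integral>\<^sup>+z. m z * f z \<partial>lborel) * (\<integral>\<^sup>+x. k (E (cvec x)) \<partial>W) = (\<integral>\<^sup>+x. f (E (cvec x)) \<partial>W) * (\<integral>\<^sup>+z. m z * k (iv z) \<partial>lborel)"
    if [measurable]: "f \<in> borel_measurable borel" for f
  proof -
    have "(\<integral>\<^sup>+z. m z * f z \<partial>lborel) * (\<integral>\<^sup>+x. k (E (cvec x)) \<partial>W) = (\<integral>\<^sup>+x. k (E (cvec x)) * (\<integral>\<^sup>+z. m z * f (E (cvec x) * z) \<partial>lborel) \<partial>W)"
      by (subst m_inv, simp, simp) (simp add: nn_integral_multc mult.commute)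
    also have "\<dots> = (\<integral>\<^sup>+x. \<integral>\<^sup>+z. m z * (f (E (cvec x) * z) * k (E (cvec x))) \<partial>lborel \<partial>W)"
      by (subst nn_integral_cmult[symmetric]) (simp_all add: mult_ac)
    also have "\<dots> = (\<integral>\<^sup>+z. \<integral>\<^sup>+x. m z * (f (E (cvec x) * z) * k (E (cvec x))) \<partial>W \<partial>lborel)"
      by (rule P.Fubini') measurable
    \<comment> \<open>Almost every \<open>z\<close> is some \<open>E (cvec v)\<close> by
      surjectivity, and the invariance of \<open>W\<close> under the shift by \<open>v\<close> moves
      \<open>z\<close> from \<open>f\<close> to \<open>k\<close>.\<close>
    also have "\<dots> = (\<integral>\<^sup>+z. m z * (\<integral>\<^sup>+x. f (E (cvec x)) * k (E (cvec x) * iv z) \<partial>W) \<partial>lborel)"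
    proof (rule nn_integral_cong_AE, use AE_nz in eventually_elim)
      fix z :: "complex^'n" assume z: "\<forall>i. z $ i \<noteq> 0"
      obtain w where w: "E w = z" using E_surj[of z] z by blast
      obtain v where v: "z = E (cvec v)" using cvec_surj[of w] w by blast
      have 1: "E (cvec (x - v)) = E (cvec x) * iv z" for x
      proof -
        have "E (cvec (x - v)) * z = E (cvec x)" by (simp add: v E_add[symmetric] cvec_add[symmetric])
        moreover have "z * iv z = 1" using z by (simp add: iv_def vec_eq_iff)
        ultimately show ?thesis by (metis mult.assoc mult.right_neutral)
      qed
      have "(\<integral>\<^sup>+x. m z * (f (E (cvec x) * z) * k (E (cvec x))) \<partial>W) = m z * (\<integral>\<^sup>+x. f (E (cvec (v + x))) * k (E (cvec x)) \<partial>W)"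
        by (subst nn_integral_cmult) (simp_all add: v cvec_add E_add mult.commute)
      also have "\<dots> = m z * (\<integral>\<^sup>+x. f (E (cvec x)) * k (E (cvec x) * iv z) \<partial>W)"
        unfolding 1[symmetric] by (subst W_inv) simp_all
      finally show "(\<integral>\<^sup>+x. m z * (f (E (cvec x) * z) * k (E (cvec x))) \<partial>W) = m z * (\<integral>\<^sup>+x. f (E (cvec x)) * k (E (cvec x) * iv z) \<partial>W)" .
    qed
    also have "\<dots> = (\<integral>\<^sup>+z. \<integral>\<^sup>+x. f (E (cvec x)) * (m z * k (E (cvec x) * iv z)) \<partial>W \<partial>lborel)"
      by (subst nn_integral_cmult[symmetric]) (simp_all add: mult_ac)
    also have "\<dots> = (\<integral>\<^sup>+x. \<integral>\<^sup>+z. f (E (cvec x)) * (m z * k (E (cvec x) * iv z)) \<partial>lborel \<partial>W)"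
      by (rule P.Fubini'[symmetric]) measurable
    also have "\<dots> = (\<integral>\<^sup>+x. f (E (cvec x)) * (\<integral>\<^sup>+z. m z * k (iv z) \<partial>lborel) \<partial>W)"
    proof (rule nn_integral_cong)
      fix x
      have 2: "E (cvec x) * iv (E (cvec x) * z) = iv z" for z
        unfolding vec_eq_iff iv_def by (simp add: inverse_mult_distrib)
      have "(\<integral>\<^sup>+z. m z * k (E (cvec x) * iv z) \<partial>lborel) = (\<integral>\<^sup>+z. m z * k (iv z) \<partial>lborel)"
        using m_inv[of "\<lambda>z. k (E (cvec x) * iv z)" "E (cvec x)"] by (simp add: 2)
      then show "(\<integral>\<^sup>+z. f (E (cvec x)) * (m z * k (E (cvec x) * iv z)) \<partial>lborel) = f (E (cvec x)) * (\<integral>\<^sup>+z. m z * k (iv z) \<partial>lborel)"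
        by (simp add: nn_integral_cmult)
    qed
    finally show ?thesis by (simp add: nn_integral_multc)
  qed
  define I J where "I = (\<integral>\<^sup>+x. k (E (cvec x)) \<partial>W)" and "J = (\<integral>\<^sup>+z. m z * k (iv z) \<partial>lborel)"
  have J0: "J \<noteq> 0"
  proof
    assume "J = 0"
    then have "AE z in lborel. m z * k (iv z) = 0" unfolding J_def by (subst (asm) nn_integral_0_iff_AE) simp_all
    then have "AE z in lborel. z \<notin> Q'"
    proof (eventually_elim, intro notI)
      fix z assume 0: "m z * k (iv z) = 0" and z: "z \<in> Q'"
      have z12: "1/2 < cmod (z $ i)" "cmod (z $ i) < 1" for i using z by (auto simp: Q'_def)
      have "z $ i \<noteq> 0" for i using z12(1)[of i] by auto
      then have "m z \<noteq> 0" unfolding m_def using prod_inverse_norm[of z] by (metis mult_zero_right zero_neq_one)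
      then have "iv z \<notin> Q" using 0 by (simp add: k_def indicator_eq_0_iff)
      moreover have "1 < cmod (iv z $ i) \<and> cmod (iv z $ i) < 2" for i
      proof -
        have x: "0 < cmod (z $ i)" using z12(1)[of i] by linarith
        have "1 < inverse (cmod (z $ i))" using x z12(2)[of i] by (simp add: one_less_inverse_iff)
        moreover have "inverse (cmod (z $ i)) < inverse (1/2)" using x z12(1)[of i] by (intro less_imp_inverse_less) auto
        ultimately show ?thesis by (simp add: iv_def norm_inverse)
      qed
      ultimately show False by (simp add: Q_def)
    qed
    then have "emeasure lborel Q' = 0" using Q' by (simp add: AE_iff_measurable[OF _ refl])
    moreover have "(\<chi> i. 3/4) \<in> Q'" by (simp add: Q'_def)
    ultimately show False using Q' open_not_negligible[of Q'] by (auto simp: negligible_iff_emeasure0)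
  qed
  have J1: "J \<noteq> \<infinity>"
  proof -
    have "J \<le> (\<integral>\<^sup>+z. ennreal (4 ^ CARD('n)) * indicator (cball 0 (of_nat CARD('n))) z \<partial>(lborel :: (complex^'n) measure))"
      unfolding J_def
    proof (rule nn_integral_mono)
      fix z :: "complex^'n"
      show "m z * k (iv z) \<le> ennreal (4 ^ CARD('n)) * indicator (cball 0 (of_nat CARD('n))) z"
      proof (cases "iv z \<in> Q")
        case True
        then have 1: "1 < inverse (cmod (z $ i))" "inverse (cmod (z $ i)) < 2" for i by (auto simp: Q_def iv_def norm_inverse)
        have "cmod (z $ i) \<le> 1" for i using 1[of i] by (cases "z $ i = 0") (auto simp: field_simps)
        then have "norm z \<le> of_nat CARD('n)"
          unfolding norm_vec_def using L2_set_le_sum[of UNIV "\<lambda>i. cmod (z $ i)"] sum_mono[of UNIV "\<lambda>i. cmod (z $ i)" "\<lambda>_. 1"] by simp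
        moreover have "(\<Prod>i\<in>UNIV. inverse ((cmod (z $ i))\<^sup>2)) \<le> (\<Prod>i\<in>(UNIV :: 'n set). 4)"
        proof (rule prod_mono, intro conjI)
          fix i
          have "(inverse (cmod (z $ i)))\<^sup>2 \<le> 2\<^sup>2"
            using 1[of i] by (intro power_mono) auto
          then show "inverse ((cmod (z $ i))\<^sup>2) \<le> 4" unfolding power_inverse by simp
        qed simp
        ultimately show ?thesis unfolding m_def k_def by (simp add: True indicator_def ennreal_leI)
      qed (simp add: k_def)
    qed
    also have "\<dots> < \<infinity>"
      using emeasure_bounded_finite[OF bounded_cball, of "0::complex^'n" "of_nat CARD('n)"]
      by (subst nn_integral_cmult_indicator) (simp_all add: ennreal_mult_less_top)
    finally show ?thesis by simp
  qed
  have I0: "I \<noteq> 0"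
  proof
    assume "I = 0"
    then have "(\<integral>\<^sup>+x. 1 \<partial>W) = 0" using main[of "\<lambda>_. 1", folded I_def J_def] J0 by simp
    then have "(\<integral>\<^sup>+x. indicator (UNIV \<times> (torus_box :: (real^'n) set)) (x :: (real^'n) \<times> (real^'n)) \<partial>lborel) = 0"
      by (subst (asm) W) (simp_all add: indicator_times)
    moreover have "UNIV \<times> (torus_box :: (real^'n) set) \<in> sets (lborel :: ((real^'n) \<times> (real^'n)) measure)"
      unfolding sets_lborel borel_prod[symmetric] by (intro pair_measureI) auto
    ultimately have "emeasure (lborel \<Otimes>\<^sub>M lborel) (UNIV \<times> (torus_box :: (real^'n) set)  :: ((real^'n) \<times> (real^'n)) set) = 0"
      unfolding lborel_prod by simp
    then have "emeasure lborel (UNIV :: (real^'n) set) * emeasure lborel (torus_box :: (real^'n) set) = 0"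
      by (subst (asm) lborel.emeasure_pair_measure_Times) simp_all
    then show False by (simp add: emeasure_torus_box)
  qed
  have I1: "I \<noteq> \<infinity>"
  proof -
    \<comment> \<open>On \<open>Q\<close> the logarithms of the moduli lie between 0 and 1, since ln
      x \<le> x - 1 and x < 2. By \<open>ln_norm_E\<close>, \<open>d\<close> times a real part is
      minus their combination with coefficients \<open>A j i\<close>, which \<open>R\<close>
      bounds.\<close>
    define R where "R = (\<Sum>j\<in>UNIV. \<Sum>i\<in>UNIV. real_of_int \<bar>A j i\<bar>)"
    define K where "K = (cbox (\<chi> i. - R) (\<chi> i. R) :: (real^'n) set) \<times> (cbox 0 (\<chi> i. 2 * pi) :: (real^'n) set)"
    have K: "x \<in> K" if x: "E (cvec x) \<in> Q" "snd x \<in> torus_box" for x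
    proof -
      have "\<bar>fst x $ j\<bar> \<le> R" for j
      proof -
        have "1 * \<bar>fst x $ j\<bar> \<le> of_int d * \<bar>fst x $ j\<bar>" using d_pos by (intro mult_right_mono) auto
        also have "\<dots> = \<bar>\<Sum>i\<in>UNIV. of_int (A j i) * ln (cmod (E (cvec x) $ i))\<bar>"
          using d_pos by (simp add: ln_norm_E abs_mult)
        also have "\<dots> \<le> (\<Sum>i\<in>UNIV. \<bar>of_int (A j i) * ln (cmod (E (cvec x) $ i))\<bar>)" by (rule sum_abs)
        also have "\<dots> \<le> (\<Sum>i\<in>UNIV. of_int \<bar>A j i\<bar> * 1)"
        proof (rule sum_mono)
          fix i
          have "1 < cmod (E (cvec x) $ i)" "cmod (E (cvec x) $ i) < 2" using x by (auto simp: Q_def)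
          then have "\<bar>ln (cmod (E (cvec x) $ i))\<bar> \<le> 1"
            using ln_le_minus_one[of "cmod (E (cvec x) $ i)"] ln_ge_zero[of "cmod (E (cvec x) $ i)"] by linarith
          then show "\<bar>of_int (A j i) * ln (cmod (E (cvec x) $ i))\<bar> \<le> of_int \<bar>A j i\<bar> * 1"
            unfolding abs_mult of_int_abs by (intro mult_left_mono) auto
        qed
        also have "\<dots> \<le> R" unfolding R_def by (simp, intro member_le_sum) (auto intro: sum_nonneg)
        finally show ?thesis by simp
      qed
      then have "- R \<le> fst x $ j \<and> fst x $ j \<le> R" for j by (simp add: abs_le_iff minus_le_iff)
      then show ?thesis using x(2) by (auto simp: K_def mem_Times_iff mem_box_cart torus_box_def less_imp_le)
    qed
    have "I = (\<integral>\<^sup>+x. k (E (cvec x)) * indicator torus_box (snd x) \<partial>lborel)" unfolding I_def by (subst W) simp_all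
    also have "\<dots> \<le> (\<integral>\<^sup>+x. indicator K x \<partial>lborel)"
      by (rule nn_integral_mono) (auto simp: k_def indicator_def intro: K)
    also have "\<dots> < \<infinity>"
      using emeasure_bounded_finite[of K] by (simp add: K_def bounded_Times borel_Times)
    finally show ?thesis by simp
  qed
  define c where "c = enn2real (J / I)"
  have JI: "J / I \<noteq> 0" "J / I \<noteq> \<infinity>" using I0 I1 J0 J1
    by (auto simp: ennreal_divide_eq_0_iff ennreal_divide_eq_top_iff)
  then have c: "ennreal c = J / I" "c > 0" by (auto simp: c_def enn2real_positive_iff less_top[symmetric] zero_less_iff_neq_zero)
  show ?thesis
  proof (intro exI[of _ c] conjI ballI c(2))
    fix \<phi> :: "complex^'n \<Rightarrow> ennreal" assume [measurable]: "\<phi> \<in> borel_measurable borel"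
    define f where "f z = \<phi> z * ennreal (\<Prod>i\<in>UNIV. (cmod (z $ i))\<^sup>2)" for z
    have [measurable]: "f \<in> borel_measurable borel" unfolding f_def by measurable
    have "(\<integral>\<^sup>+z. \<phi> z \<partial>lborel) = (\<integral>\<^sup>+z. m z * f z \<partial>lborel)"
    proof (rule nn_integral_cong_AE, use AE_nz in eventually_elim)
      fix z :: "complex^'n" assume z: "\<forall>i. z $ i \<noteq> 0"
      have "m z * ennreal (\<Prod>i\<in>UNIV. (cmod (z $ i))\<^sup>2) = 1"
        unfolding m_def using prod_inverse_norm[of z] z by (simp add: mult.commute)
      then show "\<phi> z = m z * f z" unfolding f_def by (metis mult.left_commute mult.right_neutral)
    qed
    also have "\<dots> = (\<integral>\<^sup>+z. m z * f z \<partial>lborel) * I / I" using I0 I1 by (simp add: mult_divide_eq_ennreal)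
    also have "\<dots> = (\<integral>\<^sup>+x. f (E (cvec x)) \<partial>W) * J / I" unfolding I_def J_def by (subst main) simp_all
    also have "\<dots> = ennreal c * (\<integral>\<^sup>+x. f (E (cvec x)) \<partial>W)"
      unfolding c by (metis ennreal_times_divide mult.commute)
    also have "(\<integral>\<^sup>+x. f (E (cvec x)) \<partial>W) = (\<integral>\<^sup>+x. \<phi> (E (cvec x)) * ennreal (exp (- 2 * (\<Sum>j\<in>UNIV. of_int (b j) * fst x $ j))) * indicator torus_box (snd x) \<partial>lborel)"
    proof -
      have "f (E (cvec x)) = \<phi> (E (cvec x)) * ennreal (exp (- 2 * (\<Sum>j\<in>UNIV. of_int (b j) * fst x $ j)))" for x
        unfolding f_def prod_norm_E by simp
      moreover have "(\<lambda>x. \<phi> (E (cvec x)) * ennreal (exp (- 2 * (\<Sum>j\<in>UNIV. of_int (b j) * fst x $ j)))) \<in> borel_measurable borel"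
        by measurable
      ultimately show ?thesis by (simp only: W)
    qed
    finally show "(\<integral>\<^sup>+z. \<phi> z \<partial>lborel) = ennreal c * (\<integral>\<^sup>+x. \<phi> (E (cvec x)) * ennreal (exp (- 2 * (\<Sum>j\<in>UNIV. of_int (b j) * fst x $ j))) * indicator torus_box (snd x) \<partial>lborel)" .
  qed
qed

end

section \<open>Holomorphic functions of several variables\<close>

lemma holo_on_continuous: "holo_on f U \<Longrightarrow> continuous_on U f"
  unfolding holo_on_def
  by (meson continuous_at_imp_continuous_on has_derivative_continuous)

lemma holo_on_const[simp]: "holo_on (\<lambda>_. c) U"
  unfolding holo_on_def by (auto intro!: exI[of _ "\<lambda>_. 0"])

lemma holo_on_add:
  assumes "holo_on f U" "holo_on g U"
  shows "holo_on (\<lambda>z. f z + g z) U"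
  unfolding holo_on_def
proof
  fix z assume z: "z \<in> U"
  obtain a where a: "(f has_derivative (\<lambda>v. \<Sum>i\<in>UNIV. a i * v $ i)) (at z)" using assms z unfolding holo_on_def by blast
  obtain b where b: "(g has_derivative (\<lambda>v. \<Sum>i\<in>UNIV. b i * v $ i)) (at z)" using assms z unfolding holo_on_def by blast
  have "((\<lambda>z. f z + g z) has_derivative (\<lambda>v. \<Sum>i\<in>UNIV. (a i + b i) * v $ i)) (at z)"
    using has_derivative_add[OF a b] by (simp add: distrib_right sum.distrib)
  then show "\<exists>a. ((\<lambda>z. f z + g z) has_derivative (\<lambda>v. \<Sum>i\<in>UNIV. a i * v $ i)) (at z)"
    by (rule exI[of _ "\<lambda>i. a i + b i"])
qed

lemma holo_on_mult:
  assumes "holo_on f U" "holo_on g U"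
  shows "holo_on (\<lambda>z. f z * g z) U"
  unfolding holo_on_def
proof
  fix z assume z: "z \<in> U"
  obtain a where a: "(f has_derivative (\<lambda>v. \<Sum>i\<in>UNIV. a i * v $ i)) (at z)" using assms z unfolding holo_on_def by blast
  obtain b where b: "(g has_derivative (\<lambda>v. \<Sum>i\<in>UNIV. b i * v $ i)) (at z)" using assms z unfolding holo_on_def by blast
  have "((\<lambda>z. f z * g z) has_derivative (\<lambda>v. \<Sum>i\<in>UNIV. (f z * b i + a i * g z) * v $ i)) (at z)"
    using has_derivative_mult[OF a b] by (simp add: algebra_simps sum.distrib sum_distrib_left)
  then show "\<exists>a. ((\<lambda>z. f z * g z) has_derivative (\<lambda>v. \<Sum>i\<in>UNIV. a i * v $ i)) (at z)"
    by (rule exI[of _ "\<lambda>i. f z * b i + a i * g z"])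
qed

lemma holo_on_cmul: "holo_on f U \<Longrightarrow> holo_on (\<lambda>z. c * f z) U"
  by (rule holo_on_mult) simp

lemma holo_on_sum:
  assumes "\<And>k. k \<in> K \<Longrightarrow> holo_on (f k) U"
  shows "holo_on (\<lambda>z. \<Sum>k\<in>K. f k z) U"
  using assms by (induction K rule: infinite_finite_induct) (auto intro: holo_on_add)

lemma holo_on_prod:
  assumes "\<And>k. k \<in> K \<Longrightarrow> holo_on (f k) U"
  shows "holo_on (\<lambda>z. \<Prod>k\<in>K. f k z) U"
  using assms by (induction K rule: infinite_finite_induct) (auto intro: holo_on_mult)

lemma holo_on_compose_nth:
  assumes "\<And>z. z \<in> U \<Longrightarrow> \<exists>D. (h has_field_derivative D) (at (z $ i))"
  shows "holo_on (\<lambda>z. h (z $ i)) U"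
  unfolding holo_on_def
proof
  fix z assume "z \<in> U"
  then obtain D where D: "(h has_field_derivative D) (at (z $ i))" using assms by blast
  have 1: "((\<lambda>z::complex^'a. z $ i) has_derivative (\<lambda>z. z $ i)) (at z)"
    by (rule bounded_linear_imp_has_derivative) (rule bounded_linear_vec_nth)
  have "((\<lambda>z. h (z $ i)) has_derivative (\<lambda>v. D * v $ i)) (at z)"
    using has_derivative_compose[OF 1 D[unfolded has_field_derivative_def]] .
  moreover have "(\<lambda>v::complex^'a. D * v $ i) = (\<lambda>v. \<Sum>j\<in>UNIV. (if j = i then D else 0) * v $ j)"
    by (simp add: if_distrib[of "\<lambda>x. x * _"] cong: if_cong)
  ultimately show "\<exists>a. ((\<lambda>z. h (z $ i)) has_derivative (\<lambda>v. \<Sum>i\<in>UNIV. a i * v $ i)) (at z)"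
    by (intro exI[of _ "\<lambda>j. if j = i then D else 0"]) simp
qed

lemma holo_on_monomial:
  assumes "\<And>z. z \<in> U \<Longrightarrow> monomial_defined \<alpha> z"
  shows "holo_on (monomial \<alpha>) U"
  unfolding monomial_def
proof (rule holo_on_prod, rule holo_on_compose_nth)
  fix i z assume "z \<in> U"
  then have "\<alpha> i < 0 \<Longrightarrow> z $ i \<noteq> 0" using assms by (auto simp: monomial_defined_def)
  then have "((\<lambda>x. x powi \<alpha> i) has_field_derivative of_int (\<alpha> i) * (z $ i) powi (\<alpha> i - 1) * 1) (at (z $ i))"
    by (intro DERIV_power_int DERIV_ident) auto
  then show "\<exists>D. ((\<lambda>x. x powi \<alpha> i) has_field_derivative D) (at (z $ i))" by blast
qed

text \<open>Restriction to a holomorphic one-parameter family of points, which makes Cauchy's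
  estimate and the integral over a period available.\<close>

lemma holo_on_slice:
  assumes "holo_on f U" and "\<And>i. ((\<lambda>\<zeta>. h \<zeta> $ i) has_field_derivative h' i) (at \<zeta>)" and "h \<zeta> \<in> U"
  shows "(\<lambda>\<zeta>. f (h \<zeta>)) field_differentiable (at \<zeta>)"
proof -
  obtain a where a: "(f has_derivative (\<lambda>v. \<Sum>i\<in>UNIV. a i * v $ i)) (at (h \<zeta>))" using assms unfolding holo_on_def by blast
  have "(h has_derivative (\<lambda>x. \<chi> i. h' i * x)) (at \<zeta>)"
  proof -
    have "((\<lambda>\<zeta>. h \<zeta> $ k \<bullet> u) has_derivative (\<lambda>x. (h' k * x) \<bullet> u)) (at \<zeta>)" for k u
      by (intro has_derivative_inner_left) (use assms(2)[of k] in \<open>simp add: has_field_derivative_def\<close>)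
    then show ?thesis
      by (subst has_derivative_componentwise_within) (auto simp: Basis_vec_def inner_axis)
  qed
  from has_derivative_compose[OF this a]
  have "((\<lambda>\<zeta>. f (h \<zeta>)) has_derivative (\<lambda>x. (\<Sum>i\<in>UNIV. a i * h' i) * x)) (at \<zeta>)"
    by (simp add: sum_distrib_right mult.assoc)
  then show ?thesis unfolding field_differentiable_def has_field_derivative_def by blast
qed

text \<open>The partial derivatives converge uniformly on a smaller ball by Cauchy's estimate in one variable.\<close>

lemma holo_on_uniform_limit:
  fixes f :: "nat \<Rightarrow> complex^'n \<Rightarrow> complex"
  assumes holo: "\<And>n. holo_on (f n) U" and "open U"
    and lim: "\<And>z. z \<in> U \<Longrightarrow> \<exists>r>0. ball z r \<subseteq> U \<and> uniform_limit (ball z r) f g sequentially"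
  shows "holo_on g U"
  unfolding holo_on_def
proof
  fix z0 assume "z0 \<in> U"
  then obtain r where r: "r > 0" "ball z0 r \<subseteq> U" and ul: "uniform_limit (ball z0 r) f g sequentially" using lim by blast
  define S where "S = ball z0 (r / 2)"
  have "\<exists>a. \<forall>z\<in>U. (f n has_derivative (\<lambda>v. \<Sum>i\<in>UNIV. a z i * v $ i)) (at z)" for n
    using holo[of n] unfolding holo_on_def by metis
  then obtain a where a: "\<And>n z. z \<in> U \<Longrightarrow> (f n has_derivative (\<lambda>v. \<Sum>i\<in>UNIV. a n z i * v $ i)) (at z)" by metis
  have cauchy: "\<exists>N. \<forall>m\<ge>N. \<forall>n\<ge>N. \<forall>x\<in>S. \<forall>h. norm ((\<Sum>i\<in>UNIV. a m x i * h $ i) - (\<Sum>i\<in>UNIV. a n x i * h $ i)) \<le> e * norm h"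
    if e: "e > 0" for e
  proof -
    \<comment> \<open>Discs of radius r / 4 about points of \<open>S\<close> stay in the ball of
      radius \<open>r\<close>. Cauchy's estimate on them turns the bound \<delta> for the functions
      into \<open>e / real CARD('n)\<close> for each partial derivative, and the partial derivatives
      together contribute \<open>e\<close>.\<close>
    define \<delta> where "\<delta> = e / real CARD('n) * (r / 4)"
    have "\<delta> > 0" using e r by (simp add: \<delta>_def)
    then obtain N where N: "\<And>m n x. m \<ge> N \<Longrightarrow> n \<ge> N \<Longrightarrow> x \<in> ball z0 r \<Longrightarrow> dist (f m x) (f n x) < \<delta>"
      using uniformly_convergent_Cauchy[of "ball z0 r" f] ul unfolding uniformly_convergent_on_def uniformly_Cauchy_on_def by meson
    show ?thesis
    proof (intro exI[of _ N] allI impI ballI)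
      fix m n x and h :: "complex^'n" assume mn: "m \<ge> N" "n \<ge> N" and x: "x \<in> S"
      have part: "cmod (a m x i - a n x i) \<le> e / real CARD('n)" for i
      proof -
        define l where "l \<zeta> = x + axis i \<zeta>" for \<zeta>
        have l_in: "l \<zeta> \<in> ball z0 r" if "\<zeta> \<in> cball 0 (r/4)" for \<zeta>
        proof -
          have "norm (axis i \<zeta> :: complex^'n) = cmod \<zeta>" by (simp only: norm_eq_sqrt_inner inner_axis_axis refl if_True)
          then have "dist x (l \<zeta>) \<le> r / 4" using that by (simp add: l_def dist_norm)
          then show ?thesis using x r dist_triangle[of z0 "l \<zeta>" x] by (simp add: S_def)
        qed
        define F where "F \<zeta> = f m (l \<zeta>) - f n (l \<zeta>)" for \<zeta>
        have dl: "((\<lambda>\<zeta>. l \<zeta> $ k) has_field_derivative (if k = i then 1 else 0)) (at \<zeta>)" for k \<zeta>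
          unfolding l_def by (cases "k = i") (auto simp: axis_def intro!: derivative_eq_intros)
        have dF: "(F has_field_derivative (a m x i - a n x i)) (at 0)"
        proof -
          have lder: "(l has_derivative axis i) (at \<zeta>)" for \<zeta>
            unfolding l_def
            by (auto intro!: derivative_eq_intros bounded_linear_imp_has_derivative linear_conv_bounded_linear[THEN iffD1]
                linearI simp: vec_eq_iff axis_def)
          have x0: "l 0 = x" by (simp add: l_def axis_eq_0_iff)
          have xU: "x \<in> U" using l_in[of 0] r x0 by auto
          have d1: "((\<lambda>\<zeta>. f k (l \<zeta>)) has_derivative (\<lambda>v. a k x i * v)) (at 0)" for k
          proof -
            have "((\<lambda>\<zeta>. f k (l \<zeta>)) has_derivative (\<lambda>v. \<Sum>j\<in>UNIV. a k x j * axis i v $ j)) (at 0)"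
              by (rule has_derivative_compose[OF lder]) (simp add: x0 a xU)
            then show ?thesis by (simp add: axis_def if_distrib[of "\<lambda>y. _ * y"] cong: if_cong)
          qed
          show ?thesis unfolding has_field_derivative_def F_def
            using has_derivative_diff[OF d1[of m] d1[of n]] unfolding left_diff_distrib[symmetric] .
        qed
        have "F field_differentiable (at \<zeta>)" if "\<zeta> \<in> cball 0 (r/4)" for \<zeta>
          unfolding F_def using l_in[OF that] r
          by (intro field_differentiable_diff holo_on_slice[OF holo dl]) auto
        then have "F holomorphic_on cball 0 (r/4)"
          unfolding holomorphic_on_def by (auto intro: field_differentiable_at_within)
        then have "norm ((deriv ^^ 1) F 0) \<le> (fact 1) * \<delta> / (r/4) ^ 1"
        proof (intro Cauchy_inequality)
          show "F holomorphic_on ball 0 (r/4)" "continuous_on (cball 0 (r/4)) F"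
            if "F holomorphic_on cball 0 (r/4)"
            using that by (auto intro: holomorphic_on_subset holomorphic_on_imp_continuous_on)
          show "cmod (F \<zeta>) \<le> \<delta>" if "cmod (0 - \<zeta>) = r / 4" for \<zeta>
            using N[OF mn l_in[of \<zeta>]] that by (simp add: F_def dist_norm less_imp_le)
        qed (use r in auto)
        then have "cmod (deriv F 0) \<le> e / real CARD('n)" using r by (simp add: \<delta>_def)
        then show ?thesis using DERIV_imp_deriv[OF dF] by simp
      qed
      have "norm ((\<Sum>i\<in>UNIV. a m x i * h $ i) - (\<Sum>i\<in>UNIV. a n x i * h $ i)) = norm (\<Sum>i\<in>UNIV. (a m x i - a n x i) * h $ i)"
        by (simp add: sum_subtractf left_diff_distrib)
      also have "\<dots> \<le> (\<Sum>i\<in>(UNIV::'n set). e / real CARD('n) * norm h)"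
        by (rule sum_norm_le, unfold norm_mult, rule mult_mono[OF part]) (use e in \<open>auto simp: Finite_Cartesian_Product.norm_nth_le\<close>)
      also have "\<dots> = e * norm h" by simp
      finally show "norm ((\<Sum>i\<in>UNIV. a m x i * h $ i) - (\<Sum>i\<in>UNIV. a n x i * h $ i)) \<le> e * norm h" .
    qed
  qed
  have S: "convex S" "z0 \<in> S" "open S" "S \<subseteq> ball z0 r" using r by (auto simp: S_def)
  have pw: "(\<lambda>n. f n x) \<longlonglongrightarrow> g x" if "x \<in> S" for x
    using tendsto_uniform_limitI[OF ul] that S by blast
  have aC: "Cauchy (\<lambda>n. a n x i)" if x: "x \<in> S" for x i
  proof (rule metric_CauchyI)
    fix e :: real assume "e > 0"
    then obtain N where N: "\<forall>m\<ge>N. \<forall>n\<ge>N. \<forall>x\<in>S. \<forall>h. norm ((\<Sum>i\<in>UNIV. a m x i * h $ i) - (\<Sum>i\<in>UNIV. a n x i * h $ i)) \<le> e / 2 * norm h"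
      using cauchy[of "e/2"] by auto
    show "\<exists>M. \<forall>m\<ge>M. \<forall>n\<ge>M. dist (a m x i) (a n x i) < e"
    proof (intro exI[of _ N] allI impI)
      fix m n assume "m \<ge> N" "n \<ge> N"
      then have "norm ((\<Sum>j\<in>UNIV. a m x j * axis i 1 $ j) - (\<Sum>j\<in>UNIV. a n x j * axis i 1 $ j)) \<le> e / 2 * norm (axis i 1 :: complex^'n)"
        using N x by blast
      moreover have "(\<Sum>j\<in>UNIV. a k x j * axis i 1 $ j) = a k x i" for k
        by (simp add: axis_def if_distrib[of "\<lambda>y. _ * y"] cong: if_cong)
      moreover have "norm (axis i 1 :: complex^'n) = 1"
        by (simp only: norm_eq_sqrt_inner inner_axis_axis refl if_True) (simp add: norm_eq_sqrt_inner[symmetric])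
      ultimately show "dist (a m x i) (a n x i) < e" using \<open>e > 0\<close> by (simp add: dist_norm)
    qed
  qed
  define G where "G x i = lim (\<lambda>n. a n x i)" for x i
  have G: "(\<lambda>n. a n x i) \<longlonglongrightarrow> G x i" if "x \<in> S" for x i
    using aC[OF that] unfolding G_def by (simp add: Cauchy_convergent_iff convergent_LIMSEQ_iff)
  have c1: "(f n has_derivative (\<lambda>v. \<Sum>i\<in>UNIV. a n x i * v $ i)) (at x within S)" if "x \<in> S" for n x
    using a that S r by (meson has_derivative_at_withinI subset_iff)
  have c2: "\<forall>\<^sub>F n in sequentially. \<forall>x\<in>S. \<forall>h. norm ((\<Sum>i\<in>UNIV. a n x i * h $ i) - (\<Sum>i\<in>UNIV. G x i * h $ i)) \<le> e * norm h"
    if e: "e > 0" for e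
  proof -
    obtain N where N: "\<forall>m\<ge>N. \<forall>n\<ge>N. \<forall>x\<in>S. \<forall>h. norm ((\<Sum>i\<in>UNIV. a m x i * h $ i) - (\<Sum>i\<in>UNIV. a n x i * h $ i)) \<le> e * norm h"
      using cauchy[OF e] by auto
    show ?thesis
    proof (rule eventually_sequentiallyI[of N], intro ballI allI)
      fix m x and h :: "complex^'n" assume m: "m \<ge> N" and x: "x \<in> S"
      have l: "(\<lambda>n. norm ((\<Sum>i\<in>UNIV. a m x i * h $ i) - (\<Sum>i\<in>UNIV. a n x i * h $ i))) \<longlonglongrightarrow> norm ((\<Sum>i\<in>UNIV. a m x i * h $ i) - (\<Sum>i\<in>UNIV. G x i * h $ i))"
        by (intro tendsto_intros G x)
      show "norm ((\<Sum>i\<in>UNIV. a m x i * h $ i) - (\<Sum>i\<in>UNIV. G x i * h $ i)) \<le> e * norm h"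
        by (rule tendsto_upperbound[OF l])
           (use N m x in \<open>auto intro!: eventually_sequentiallyI[of N]\<close>)
    qed
  qed
  have "\<exists>g'. \<forall>x\<in>S. (\<lambda>n. f n x) \<longlonglongrightarrow> g' x \<and> (g' has_derivative (\<lambda>h. \<Sum>i\<in>UNIV. G x i * h $ i)) (at x within S)"
    by (rule has_derivative_sequence[where f=f and f'="\<lambda>n x v. \<Sum>i\<in>UNIV. a n x i * v $ i" and ?x0.0=z0 and l="g z0"])
       (fact S c1 c2 pw[OF S(2)])+
  then obtain g' where g': "\<And>x. x \<in> S \<Longrightarrow> (\<lambda>n. f n x) \<longlonglongrightarrow> g' x"
    "\<And>x. x \<in> S \<Longrightarrow> (g' has_derivative (\<lambda>h. \<Sum>i\<in>UNIV. G x i * h $ i)) (at x within S)" by blast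
  have "g' x = g x" if "x \<in> S" for x using g'(1)[OF that] pw[OF that] LIMSEQ_unique by blast
  then have "(g has_derivative (\<lambda>h. \<Sum>i\<in>UNIV. G z0 i * h $ i)) (at z0 within S)"
    using has_derivative_transform[OF S(2) _ g'(2)[OF S(2)]] by simp
  then show "\<exists>a. (g has_derivative (\<lambda>v. \<Sum>i\<in>UNIV. a i * v $ i)) (at z0)"
    using S by (metis at_within_open)
qed

section \<open>Fourier analysis on the torus\<close>

definition utorus :: "(complex^'n) set" where "utorus = {u. unimodular u}"

text \<open>The restriction to \<open>utorus\<close> does not change the integral, as the measure
  lives there, but it lets integrands be controlled on the torus alone, where monomials with
  negative exponents are continuous.\<close>

definition tavg :: "(complex^'n \<Rightarrow> complex) \<Rightarrow> complex" where
  "tavg f = (LINT \<omega>:utorus|torus. f \<omega>)"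

lemma compact_utorus: "compact (utorus :: (complex^'n) set)"
proof (subst compact_eq_bounded_closed, intro conjI)
  have "norm u \<le> of_nat CARD('n)" if "u \<in> utorus" for u :: "complex^'n"
    unfolding norm_vec_def using L2_set_le_sum[of UNIV "\<lambda>i. cmod (u $ i)"] that by (simp add: utorus_def unimodular_def)
  then show "bounded (utorus :: (complex^'n) set)" by (auto simp: bounded_iff)
  have eq: "utorus = (\<Inter>i. {u :: complex^'n. cmod (u $ i) = 1})" by (auto simp: utorus_def unimodular_def)
  show "closed (utorus :: (complex^'n) set)"
    unfolding eq by (intro closed_INT ballI closed_Collect_eq continuous_intros)
qed

lemma utorus_borel[measurable]: "utorus \<in> sets borel"
  using compact_utorus compact_imp_closed by (intro borel_closed) auto

lemma utorus_ne: "1 \<in> utorus" by (simp add: utorus_def unimodular_def)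

lemma tavg_integrable:
  fixes f :: "complex^'n \<Rightarrow> complex"
  assumes "continuous_on utorus f"
  shows "set_integrable torus utorus f"
proof -
  interpret finite_measure "torus :: (complex^'n) measure" by (rule finite_measure_torus)
  have "bounded (f ` utorus)" using compact_continuous_image[OF assms compact_utorus] by (rule compact_imp_bounded)
  then obtain M where M: "\<And>u. u \<in> utorus \<Longrightarrow> norm (f u) \<le> M" by (auto simp: bounded_iff)
  show ?thesis unfolding set_integrable_def
  proof (rule integrable_const_bound[where B="max M 0"])
    show "AE x in torus. norm (indicator utorus x *\<^sub>R f x) \<le> max M 0"
      using M by (intro AE_I2) (auto simp: indicator_def max.coboundedI1)
    show "(\<lambda>x. indicator utorus x *\<^sub>R f x) \<in> borel_measurable torus"
      using borel_measurable_continuous_on_indicator[OF _ assms] by simp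
  qed
qed

lemma tavg_add: "continuous_on utorus f \<Longrightarrow> continuous_on utorus g \<Longrightarrow> tavg (\<lambda>u. f u + g u) = tavg f + tavg g"
  unfolding tavg_def by (intro set_integral_add tavg_integrable)

lemma tavg_diff: "continuous_on utorus f \<Longrightarrow> continuous_on utorus g \<Longrightarrow> tavg (\<lambda>u. f u - g u) = tavg f - tavg g"
  unfolding tavg_def by (intro set_integral_diff tavg_integrable)

lemma tavg_cmul: "tavg (\<lambda>u. c * f u) = c * tavg f"
  unfolding tavg_def by (rule set_integral_mult_right)

lemma tavg_cmulr: "tavg (\<lambda>u. f u * c) = tavg f * c"
  unfolding tavg_def by (rule set_integral_mult_left)

lemma tavg_cong: "(\<And>u. u \<in> utorus \<Longrightarrow> f u = g u) \<Longrightarrow> tavg f = tavg g"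
  unfolding tavg_def by (rule set_lebesgue_integral_cong) auto

lemma AE_utorus: "AE \<omega> in torus. \<omega> \<in> utorus"
  using AE_torus by (simp add: utorus_def)

lemma measure_torus: "measure (torus :: (complex^'n) measure) UNIV = 1"
  by (simp add: measure_def emeasure_torus)

lemma tavg_const: "tavg (\<lambda>_ :: complex^'n. c) = c"
proof -
  have "tavg (\<lambda>_ :: complex^'n. c) = (LINT \<omega>|(torus :: (complex^'n) measure). c)"
    unfolding tavg_def set_lebesgue_integral_def
    by (rule integral_cong_AE) (use AE_utorus in \<open>auto elim!: eventually_mono\<close>)
  then show ?thesis by (simp add: measure_torus)
qed

lemma tavg_shift:
  assumes f: "continuous_on utorus f" and u: "u \<in> utorus"
  shows "tavg (\<lambda>\<omega>. f (u * \<omega>)) = tavg f"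
proof -
  have [measurable]: "(\<lambda>x. indicator utorus x *\<^sub>R f x) \<in> borel_measurable borel"
    by (rule borel_measurable_continuous_on_indicator) (use f in auto)
  have ind: "indicator utorus (u * \<omega>) = (indicator utorus \<omega> :: real)" for \<omega>
    using u by (simp add: indicator_def utorus_def unimodular_def norm_mult)
  have "tavg f = (LINT \<omega>|distr torus borel ((*) u). indicator utorus \<omega> *\<^sub>R f \<omega>)"
    using torus_invariant[of u] u by (simp add: tavg_def set_lebesgue_integral_def utorus_def)
  also have "\<dots> = tavg (\<lambda>\<omega>. f (u * \<omega>))"
    by (subst integral_distr) (simp_all add: tavg_def set_lebesgue_integral_def ind)
  finally show ?thesis ..
qed

lemma tavg_norm_le:
  fixes f :: "complex^'n \<Rightarrow> complex"
  assumes f: "continuous_on utorus f" and M: "\<And>u. u \<in> utorus \<Longrightarrow> cmod (f u) \<le> M"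
  shows "cmod (tavg f) \<le> M"
proof -
  interpret finite_measure "torus :: (complex^'n) measure" by (rule finite_measure_torus)
  have M0: "0 \<le> M" using M[OF utorus_ne] norm_ge_zero order_trans by blast
  have "cmod (tavg f) \<le> (LINT \<omega>|torus. norm (indicator utorus \<omega> *\<^sub>R f \<omega>))"
    unfolding tavg_def set_lebesgue_integral_def by (rule integral_norm_bound)
  also have "\<dots> \<le> (LINT \<omega>|(torus :: (complex^'n) measure). M)"
    by (rule integral_mono[OF integrable_norm[OF tavg_integrable[OF f, unfolded set_integrable_def]]])
       (use M M0 in \<open>auto simp: indicator_def\<close>)
  finally show ?thesis by (simp add: measure_torus)
qed

lemma continuous_on_monomial:
  assumes "\<And>z. z \<in> U \<Longrightarrow> monomial_defined \<alpha> z"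
  shows "continuous_on U (monomial \<alpha>)"
  unfolding monomial_def
proof (intro continuous_on_prod)
  fix i
  show "continuous_on U (\<lambda>z. z $ i powi \<alpha> i)"
  proof (cases "\<alpha> i < 0")
    case True
    then have "z $ i \<noteq> 0" if "z \<in> U" for z using assms that by (auto simp: monomial_defined_def)
    then show ?thesis by (intro continuous_on_power_int continuous_intros) auto
  next
    case False
    then have eq: "(\<lambda>z::complex^'a. z $ i powi \<alpha> i) = (\<lambda>z. z $ i ^ nat (\<alpha> i))" by (simp add: power_int_def)
    show ?thesis unfolding eq by (intro continuous_intros)
  qed
qed

lemma monomial_mult: "monomial \<alpha> (u * v) = monomial \<alpha> u * monomial \<alpha> v"
  by (simp add: monomial_def power_int_mult_distrib prod.distrib)

lemma monomial_add_exp: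
  "(\<And>i. z $ i \<noteq> 0) \<Longrightarrow> monomial (\<lambda>i. \<alpha> i + \<beta> i) z = monomial \<alpha> z * monomial \<beta> z"
  by (simp add: monomial_def power_int_add prod.distrib)

lemma monomial_nz: "(\<And>i. z $ i \<noteq> 0) \<Longrightarrow> monomial \<alpha> z \<noteq> 0"
  by (simp add: monomial_def)

lemma utorus_nz: "u \<in> utorus \<Longrightarrow> u $ i \<noteq> 0"
  by (auto simp: utorus_def unimodular_def dest!: spec[of _ i])

lemma norm_monomial_utorus: "u \<in> utorus \<Longrightarrow> cmod (monomial \<alpha> u) = 1"
  by (simp add: monomial_def prod_norm[symmetric] norm_power_int utorus_def unimodular_def)

lemma cont_monomial_utorus[continuous_intros]: "continuous_on utorus (monomial \<alpha>)"
  by (rule continuous_on_monomial) (simp add: monomial_defined_def utorus_nz)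

lemma monomial_uminus_utorus: "u \<in> utorus \<Longrightarrow> monomial (\<lambda>i. - \<alpha> i) u * monomial \<alpha> u = 1"
  using monomial_add_exp[of u "\<lambda>i. - \<alpha> i" \<alpha>] utorus_nz[of u] by (simp add: monomial_def)

text \<open>For a nonzero exponent some rotation gives the monomial the value -1, so invariance
  makes the average equal to its own negative.\<close>

lemma tavg_monomial:
  fixes \<alpha> :: "'n::finite \<Rightarrow> int"
  shows   "tavg (monomial \<alpha>) = (if \<alpha> = (\<lambda>_. 0) then 1 else 0)"
proof (cases "\<alpha> = (\<lambda>_. 0)")
  case True
  have "tavg (monomial \<alpha>) = tavg (\<lambda>_ :: complex^'n. 1)" by (intro tavg_cong) (simp add: True monomial_def)
  then show ?thesis using True by (simp add: tavg_const)
next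
  case False
  then obtain i where i: "\<alpha> i \<noteq> 0" by auto
  define u :: "complex^'n" where "u = (\<chi> k. if k = i then cis (pi / of_int (\<alpha> i)) else 1)"
  have u: "u \<in> utorus" by (simp add: utorus_def unimodular_def u_def)
  have "monomial \<alpha> u = (\<Prod>k\<in>UNIV. if k = i then cis (pi / of_int (\<alpha> i)) powi \<alpha> i else 1)"
    unfolding monomial_def u_def by (intro prod.cong) auto
  also have "\<dots> = -1" using i by (simp add: cis_power_int)
  finally have m: "monomial \<alpha> u = -1" .
  have "tavg (monomial \<alpha>) = tavg (\<lambda>\<omega>. monomial \<alpha> (u * \<omega>))"
    by (rule tavg_shift[symmetric]) (auto intro: continuous_intros u)
  also have "\<dots> = - tavg (monomial \<alpha>)" by (simp add: monomial_mult m tavg_cmul[of "-1", simplified])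
  finally show ?thesis using False by simp
qed

text \<open>By rotation invariance all balls of radius \<open>e\<close> about points of the torus
  have the same measure, and finitely many of them cover it; if one were null, the total mass would
  be 0.\<close>

lemma torus_ball_pos:
  fixes \<omega>0 :: "complex^'n"
  assumes "\<omega>0 \<in> utorus" "e > 0"
  shows "emeasure torus (ball \<omega>0 e) \<noteq> 0"
proof
  assume 0: "emeasure torus (ball \<omega>0 e) = 0"
  have "emeasure torus (ball \<omega> e) = 0" if w: "\<omega> \<in> utorus" for \<omega> :: "complex^'n"
  proof -
    define u where "u = (\<chi> i. \<omega> $ i * cnj (\<omega>0 $ i))"
    have u: "unimodular u" using w assms by (simp add: u_def unimodular_def utorus_def norm_mult)
    have "cnj (\<omega>0 $ i) * \<omega>0 $ i = 1" for i
      using assms complex_norm_square[of "\<omega>0 $ i"] by (simp add: utorus_def unimodular_def mult.commute)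
    then have uw: "u * \<omega>0 = \<omega>" by (simp add: vec_eq_iff u_def mult.assoc)
    have "norm (u * x) = norm x" for x using u by (simp add: norm_vec_def norm_mult unimodular_def)
    then have "dist \<omega> (u * x) = dist \<omega>0 x" for x
      unfolding uw[symmetric] dist_norm right_diff_distrib[symmetric] .
    then have "(*) u -` ball \<omega> e \<inter> space torus = ball \<omega>0 e" by auto
    then have "emeasure (distr torus borel ((*) u)) (ball \<omega> e) = 0"
      using 0 by (subst emeasure_distr) simp_all
    then show ?thesis by (simp add: torus_invariant[OF u])
  qed
  then have nl: "ball \<omega> e \<in> null_sets torus" if "\<omega> \<in> utorus" for \<omega> :: "complex^'n" using that by (simp add: null_setsI)
  have "(utorus :: (complex^'n) set) \<subseteq> (\<Union>\<omega>\<in>utorus. ball \<omega> e)" using assms(2) by auto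
  then obtain T where T: "T \<subseteq> utorus" "finite T" "(utorus :: (complex^'n) set) \<subseteq> (\<Union>\<omega>\<in>T. ball \<omega> e)"
    using compactE_image[OF compact_utorus, of utorus "\<lambda>\<omega>. ball \<omega> e"] by (metis open_ball)
  have "(\<Union>\<omega>\<in>T. ball \<omega> e) \<in> null_sets torus" using T nl by (intro null_sets.finite_UN) auto
  then have "AE \<omega> in (torus :: (complex^'n) measure). \<omega> \<notin> (\<Union>\<omega>\<in>T. ball \<omega> e)" by (rule AE_not_in)
  with AE_utorus have "AE \<omega> in (torus :: (complex^'n) measure). False" by eventually_elim (use T in blast)
  then have "emeasure (torus :: (complex^'n) measure) UNIV = 0" using AE_iff_null[of torus "\<lambda>_ :: complex^'n. False"] by auto
  then show False by (simp add: emeasure_torus)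
qed

definition nofourier :: "(complex^'n \<Rightarrow> complex) \<Rightarrow> bool" where
  "nofourier f \<longleftrightarrow> continuous_on utorus f \<and> (\<forall>\<alpha>. tavg (\<lambda>u. f u * monomial \<alpha> u) = 0)"

text \<open>The functions that preserve vanishing of all Fourier coefficients under multiplication form an
  algebra containing the coordinates, hence all polynomials.\<close>

definition fmult :: "(complex^'n \<Rightarrow> complex) \<Rightarrow> bool" where
  "fmult P \<longleftrightarrow> (\<forall>f. nofourier f \<longrightarrow> nofourier (\<lambda>u. f u * P u))"

lemma nofourier_cong:
  assumes "\<And>u. u \<in> utorus \<Longrightarrow> f u = g u"
  shows "nofourier f = nofourier g"
proof -
  have "tavg (\<lambda>u. f u * monomial \<alpha> u) = tavg (\<lambda>u. g u * monomial \<alpha> u)" for \<alpha>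
    by (rule tavg_cong) (simp add: assms)
  moreover have "continuous_on utorus f = continuous_on utorus g" by (rule continuous_on_cong) (simp_all add: assms)
  ultimately show ?thesis by (simp add: nofourier_def)
qed

lemma fmult_const: "fmult (\<lambda>_. c)"
  unfolding fmult_def nofourier_def
proof (intro allI impI conjI)
  fix f \<alpha> assume f: "continuous_on utorus f \<and> (\<forall>\<alpha>. tavg (\<lambda>u. f u * monomial \<alpha> u) = 0)"
  then show "continuous_on utorus (\<lambda>u. f u * c)" by (auto intro!: continuous_intros)
  have "tavg (\<lambda>u. f u * c * monomial \<alpha> u) = tavg (\<lambda>u. (f u * monomial \<alpha> u) * c)" by (simp add: mult_ac)
  also have "\<dots> = 0" unfolding tavg_cmulr using f by simp
  finally show "tavg (\<lambda>u. f u * c * monomial \<alpha> u) = 0" .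
qed

lemma fmult_mult: "fmult P \<Longrightarrow> fmult Q \<Longrightarrow> fmult (\<lambda>u. P u * Q u)"
  unfolding fmult_def by (simp add: mult.assoc[symmetric])

lemma fmult_add:
  assumes "fmult P" "fmult Q"
  shows "fmult (\<lambda>u. P u + Q u)"
  unfolding fmult_def
proof (intro allI impI)
  fix f :: "complex^'a \<Rightarrow> complex" assume "nofourier f"
  then have f: "continuous_on utorus (\<lambda>u. f u * P u)" "continuous_on utorus (\<lambda>u. f u * Q u)"
    "\<And>\<alpha>. tavg (\<lambda>u. f u * P u * monomial \<alpha> u) = 0" "\<And>\<alpha>. tavg (\<lambda>u. f u * Q u * monomial \<alpha> u) = 0"
    using assms unfolding fmult_def nofourier_def by auto
  show "nofourier (\<lambda>u. f u * (P u + Q u))"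
    unfolding nofourier_def distrib_left distrib_right
  proof (intro conjI allI)
    show "continuous_on utorus (\<lambda>u. f u * P u + f u * Q u)" by (rule continuous_on_add[OF f(1,2)])
    show "tavg (\<lambda>u. f u * P u * monomial \<alpha> u + f u * Q u * monomial \<alpha> u) = 0" for \<alpha>
      by (subst tavg_add) (simp_all add: f continuous_on_mult[OF f(1) cont_monomial_utorus] continuous_on_mult[OF f(2) cont_monomial_utorus])
  qed
qed

lemma fmult_monomial: fixes \<alpha> :: "'n::finite \<Rightarrow> int" shows "fmult (monomial \<alpha>)"
  unfolding fmult_def nofourier_def
proof (intro allI impI conjI)
  fix f :: "complex^'n \<Rightarrow> complex" and \<beta> :: "'n \<Rightarrow> int"
  assume f: "continuous_on utorus f \<and> (\<forall>\<alpha>. tavg (\<lambda>u. f u * monomial \<alpha> u) = 0)"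
  then show "continuous_on utorus (\<lambda>u. f u * monomial \<alpha> u)" by (auto intro!: continuous_intros)
  have "tavg (\<lambda>u. f u * monomial \<alpha> u * monomial \<beta> u) = tavg (\<lambda>u. f u * monomial (\<lambda>i. \<alpha> i + \<beta> i) u)"
    by (rule tavg_cong) (simp add: monomial_add_exp utorus_nz mult.assoc)
  then show "tavg (\<lambda>u. f u * monomial \<alpha> u * monomial \<beta> u) = 0" using f by simp
qed

lemma fmult_cong: "(\<And>u. u \<in> utorus \<Longrightarrow> P u = Q u) \<Longrightarrow> fmult P \<Longrightarrow> fmult Q"
  unfolding fmult_def by (metis (mono_tags, lifting) nofourier_cong)

lemma monomial_single: "monomial (\<lambda>j. if j = i then k else 0) z = z $ i powi k"
proof -
  have "monomial (\<lambda>j. if j = i then k else 0) z = (\<Prod>j\<in>UNIV. if j = i then z $ i powi k else 1)"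
    unfolding monomial_def by (rule prod.cong) auto
  then show ?thesis by simp
qed

lemma fmult_nth: "fmult (\<lambda>u. u $ i)"
  by (rule fmult_cong[OF _ fmult_monomial[of "\<lambda>j. if j = i then 1 else 0"]]) (simp add: monomial_single)

lemma fmult_cnj_nth: "fmult (\<lambda>u. cnj (u $ i))"
proof (rule fmult_cong[OF _ fmult_monomial[of "\<lambda>j. if j = i then -1 else 0"]])
  fix u :: "complex^'a" assume "u \<in> utorus"
  then have "cnj (u $ i) * u $ i = 1"
    using complex_norm_square[of "u $ i"] by (simp add: utorus_def unimodular_def mult.commute)
  then show "monomial (\<lambda>j. if j = i then - 1 else 0) u = cnj (u $ i)"
    using utorus_nz[OF \<open>u \<in> utorus\<close>, of i] by (simp add: monomial_single power_int_minus field_simps)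
qed

lemma fmult_sum: "finite I \<Longrightarrow> (\<And>i. i \<in> I \<Longrightarrow> fmult (P i)) \<Longrightarrow> fmult (\<lambda>u. \<Sum>i\<in>I. P i u)"
  by (induction I rule: finite_induct) (auto intro: fmult_const fmult_add)

lemma fmult_real_polynomial:
  assumes "real_polynomial_function (p :: complex^'n \<Rightarrow> real)"
  shows "fmult (\<lambda>u. complex_of_real (p u))"
  using assms
proof induction
  case (linear p)
  interpret bounded_linear p by fact
  have "p u = (\<Sum>i\<in>UNIV. Re (u $ i) * p (axis i 1) + Im (u $ i) * p (axis i \<i>))" for u
  proof -
    have "u = (\<Sum>i\<in>UNIV. Re (u $ i) *\<^sub>R axis i 1 + Im (u $ i) *\<^sub>R axis i \<i>)"
    proof (subst vec_eq_iff, intro allI)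
      fix k
      have "(\<Sum>i\<in>UNIV. Re (u $ i) *\<^sub>R axis i 1 + Im (u $ i) *\<^sub>R axis i \<i>) $ k
        = (\<Sum>i\<in>UNIV. if k = i then u $ k else 0)"
        unfolding sum_component by (rule sum.cong) (auto simp: axis_def complex_eq_iff)
      then show "u $ k = (\<Sum>i\<in>UNIV. Re (u $ i) *\<^sub>R axis i 1 + Im (u $ i) *\<^sub>R axis i \<i>) $ k" by simp
    qed
    then show ?thesis using sum[of "\<lambda>i. Re (u $ i) *\<^sub>R axis i 1 + Im (u $ i) *\<^sub>R axis i \<i>" UNIV]
      by (simp add: add scaleR)
  qed
  \<comment> \<open>Real and imaginary part are written through \<open>z\<close> and
    \<open>cnj z\<close>; on the torus the conjugate of a coordinate is its inverse, again a
    monomial.\<close>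
  moreover have c: "complex_of_real (Re z * x + Im z * y) = (z + cnj z) * (x / 2) + (z + (-1) * cnj z) * (- \<i> * y / 2)" for z x y
    by (simp add: complex_eq_iff)
  ultimately have eq: "complex_of_real (p u) = (\<Sum>i\<in>UNIV. (u $ i + cnj (u $ i)) * (p (axis i 1) / 2) + (u $ i + (-1) * cnj (u $ i)) * (- \<i> * p (axis i \<i>) / 2))" for u
    unfolding c[symmetric] of_real_sum[symmetric] by metis
  show ?case
    by (rule fmult_cong[OF eq[symmetric]]) (intro fmult_sum finite fmult_add fmult_mult fmult_const fmult_nth fmult_cnj_nth)
qed (auto intro: fmult_const fmult_add fmult_mult)

text \<open>Approximate \<open>cnj f\<close> uniformly by a polynomial \<open>g\<close>. The average
  of \<open>f * g\<close> vanishes, because multiplication by polynomials preserves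
  \<open>nofourier\<close>, so the average of \<open>f * cnj f\<close> is arbitrarily small. By
  continuity a nonzero value would persist on a ball of positive measure.\<close>

lemma nofourier_zero:
  fixes f :: "complex^'n \<Rightarrow> complex"
  assumes f: "nofourier f" and \<omega>: "\<omega> \<in> utorus"
  shows "f \<omega> = 0"
proof (rule ccontr)
  assume nz: "f \<omega> \<noteq> 0"
  have cf: "continuous_on utorus f" using f by (simp add: nofourier_def)
  then have ccf: "continuous_on utorus (\<lambda>u. cnj (f u))" by (intro continuous_intros)
  obtain M where M: "\<And>u. u \<in> utorus \<Longrightarrow> cmod (f u) \<le> M"
    using compact_imp_bounded[OF compact_continuous_image[OF cf compact_utorus]] by (auto simp: bounded_iff)
  have "M > 0" using M[OF \<omega>] nz by (metis norm_ge_zero norm_le_zero_iff not_le order.strict_iff_order order_trans)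
  have "cmod (tavg (\<lambda>u. f u * cnj (f u))) \<le> e" if "e > 0" for e
  proof -
    obtain g where g: "polynomial_function g" "\<And>u. u \<in> utorus \<Longrightarrow> norm (cnj (f u) - g u) < e / M"
      using Stone_Weierstrass_polynomial_function[OF compact_utorus ccf, of "e / M"] \<open>M > 0\<close> \<open>e > 0\<close> by auto
    have "real_polynomial_function (\<lambda>u. Re (g u))" "real_polynomial_function (\<lambda>u. Im (g u))"
      using g(1) bounded_linear_Re bounded_linear_Im unfolding polynomial_function_def o_def by auto
    then have "fmult (\<lambda>u. complex_of_real (Re (g u)) + \<i> * complex_of_real (Im (g u)))"
      by (intro fmult_add fmult_mult fmult_const fmult_real_polynomial)
    then have "fmult g" by (simp add: complex_eq[symmetric])
    then have ng: "nofourier (\<lambda>u. f u * g u)" using f by (simp add: fmult_def)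
    then have z: "tavg (\<lambda>u. f u * g u) = 0"
      unfolding nofourier_def by (auto dest!: spec[of _ "\<lambda>_. 0"] simp: monomial_def)
    have cg: "continuous_on utorus (\<lambda>u. f u * g u)" using ng by (simp add: nofourier_def)
    have "tavg (\<lambda>u. f u * cnj (f u)) = tavg (\<lambda>u. f u * cnj (f u)) - tavg (\<lambda>u. f u * g u)" using z by simp
    also have "\<dots> = tavg (\<lambda>u. f u * cnj (f u) - f u * g u)"
      by (rule tavg_diff[symmetric, OF continuous_on_mult[OF cf ccf] cg])
    also have "cmod \<dots> \<le> M * (e / M)"
    proof (rule tavg_norm_le)
      show "continuous_on utorus (\<lambda>u. f u * cnj (f u) - f u * g u)"
        by (rule continuous_on_diff[OF continuous_on_mult[OF cf ccf] cg])
      show "cmod (f u * cnj (f u) - f u * g u) \<le> M * (e / M)" if "u \<in> utorus" for u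
        unfolding right_diff_distrib[symmetric] norm_mult using M[OF that] g(2)[OF that] \<open>M > 0\<close>
        by (intro mult_mono) auto
    qed
    finally show ?thesis using \<open>M > 0\<close> by simp
  qed
  then have "tavg (\<lambda>u. f u * cnj (f u)) = 0"
    by (meson dense_ge norm_le_zero_iff)
  then have 0: "(LINT u|torus. indicator utorus u *\<^sub>R (f u * cnj (f u))) = 0" by (simp add: tavg_def set_lebesgue_integral_def)
  have eq: "indicator utorus u *\<^sub>R (f u * cnj (f u)) = complex_of_real (indicator utorus u * (cmod (f u))\<^sup>2)" for u
    by (simp add: complex_norm_square[symmetric] scaleR_conv_of_real)
  have int: "integrable torus (\<lambda>u. indicator utorus u * (cmod (f u))\<^sup>2)"
    using integrable_Re[OF tavg_integrable[of "\<lambda>u. f u * cnj (f u)", unfolded set_integrable_def]] cf ccf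
    unfolding eq by (simp add: continuous_on_mult)
  have "(LINT u|torus. indicator utorus u * (cmod (f u))\<^sup>2) = 0"
    using 0 unfolding eq integral_complex_of_real by simp
  then have AE: "AE u in torus. indicator utorus u * (cmod (f u))\<^sup>2 = 0"
    by (subst (asm) integral_nonneg_eq_0_iff_AE[OF int]) auto
  have "\<exists>e>0. \<forall>u\<in>utorus. dist u \<omega> < e \<longrightarrow> dist (f u) (f \<omega>) < cmod (f \<omega>)"
    using cf \<omega> nz unfolding continuous_on_iff by auto
  then obtain e where e: "e > 0" "\<And>u. u \<in> utorus \<Longrightarrow> dist u \<omega> < e \<Longrightarrow> f u \<noteq> 0"
    by (metis dist_0_norm dist_norm less_irrefl)
  have "AE u in torus. u \<notin> ball \<omega> e"
    using AE AE_utorus by eventually_elim (use e(2) in \<open>auto simp: dist_commute\<close>)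
  then have "emeasure torus (ball \<omega> e) = 0" by (subst (asm) AE_iff_measurable[OF _ refl]) (auto simp: ball_def)
  then show False using torus_ball_pos[OF \<omega> e(1)] by simp
qed

section \<open>One-variable estimates\<close>

text \<open>The integral over a period is independent of the real part because its derivative is the integral of a derivative along the period.\<close>

lemma periodic_integral_const:
  fixes \<psi> :: "complex \<Rightarrow> complex"
  assumes holo: "\<And>\<zeta>. Re \<zeta> > 0 \<Longrightarrow> \<psi> field_differentiable (at \<zeta>)"
    and per: "\<And>\<zeta>. Re \<zeta> > 0 \<Longrightarrow> \<psi> (\<zeta> + 2 * pi * \<i>) = \<psi> \<zeta>"
    and x: "x > 0" "x' > 0"
  shows "integral {0..2*pi} (\<lambda>s. \<psi> (Complex x s)) = integral {0..2*pi} (\<lambda>s. \<psi> (Complex x' s))"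
proof -
  define J where "J x = integral (cbox 0 (2*pi)) (\<lambda>s. \<psi> (Complex x s))" for x
  have op: "open {\<zeta>. Re \<zeta> > 0}" by (rule open_halfspace_Re_gt)
  have hol: "\<psi> holomorphic_on {\<zeta>. Re \<zeta> > 0}"
    unfolding holomorphic_on_def using holo by (auto intro: field_differentiable_at_within)
  have cont: "continuous_on {\<zeta>. Re \<zeta> > 0} \<psi>" using hol by (rule holomorphic_on_imp_continuous_on)
  have contd: "continuous_on {\<zeta>. Re \<zeta> > 0} (deriv \<psi>)"
    by (rule holomorphic_on_imp_continuous_on[OF holomorphic_deriv[OF hol op]])
  have cC: "continuous_on A (\<lambda>p. Complex (fst p) (snd p))" for A
    unfolding Complex_eq by (intro continuous_intros)
  have der: "(\<psi> has_field_derivative deriv \<psi> \<zeta>) (at \<zeta>)" if "Re \<zeta> > 0" for \<zeta>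
    using holo[OF that] by (simp add: DERIV_deriv_iff_field_differentiable)
  have "(J has_vector_derivative 0) (at x within {0<..})" if x: "x > 0" for x
  proof -
    have "((\<lambda>x. integral (cbox 0 (2*pi)) (\<lambda>s. \<psi> (Complex x s))) has_vector_derivative integral (cbox 0 (2*pi)) (\<lambda>s. deriv \<psi> (Complex x s))) (at x within {0<..})"
    proof (rule leibniz_rule_vector_derivative)
      fix x s :: real assume x: "x \<in> {0<..}"
      have "((\<lambda>x. Complex x s) has_vector_derivative 1) (at x within {0<..})"
        unfolding Complex_eq by (auto intro!: derivative_eq_intros)
      from field_vector_diff_chain_within[OF this, of \<psi> "deriv \<psi> (Complex x s)"] der[of "Complex x s"] x
      show "((\<lambda>x. \<psi> (Complex x s)) has_vector_derivative deriv \<psi> (Complex x s)) (at x within {0<..})"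
        by (auto simp: o_def intro: has_field_derivative_at_within)
    next
      fix x :: real assume x: "x \<in> {0<..}"
      show "(\<lambda>s. \<psi> (Complex x s)) integrable_on cbox 0 (2*pi)"
        by (intro integrable_continuous continuous_on_compose2[OF cont, of _ "\<lambda>s. Complex x s"])
           (use x in \<open>auto simp: Complex_eq intro!: continuous_intros\<close>)
    next
      show "continuous_on ({0<..} \<times> cbox 0 (2 * pi)) (\<lambda>(x, t). deriv \<psi> (Complex x t))"
        unfolding case_prod_unfold by (rule continuous_on_compose2[OF contd cC]) auto
    qed (use x in auto)
    moreover have "((\<lambda>s. deriv \<psi> (Complex x s)) has_integral (\<psi> (Complex x (2*pi)) / \<i> - \<psi> (Complex x 0) / \<i>)) {0..2*pi}"
    proof (rule fundamental_theorem_of_calculus)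
      fix s
      have 1: "((\<lambda>s. Complex x s) has_vector_derivative \<i>) (at s within {0..2*pi})"
        unfolding Complex_eq by (auto intro!: derivative_eq_intros)
      have 2: "((\<lambda>\<zeta>. \<psi> \<zeta> / \<i>) has_field_derivative deriv \<psi> (Complex x s) / \<i>) (at (Complex x s))"
        by (rule DERIV_cdivide[OF der]) (use x in simp)
      show "((\<lambda>s. \<psi> (Complex x s) / \<i>) has_vector_derivative deriv \<psi> (Complex x s)) (at s within {0..2*pi})"
        using field_vector_diff_chain_within[OF 1 has_field_derivative_at_within[OF 2]] by (simp add: o_def)
    qed simp
    moreover have "\<psi> (Complex x (2*pi)) = \<psi> (Complex x 0)"
      using per[of "Complex x 0"] x by (simp add: Complex_eq algebra_simps)
    ultimately show ?thesis unfolding J_def by (simp add: integral_unique)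
  qed
  then obtain c where "\<And>x. x \<in> {0<..} \<Longrightarrow> J x = c"
    using has_vector_derivative_zero_constant[of "{0<..}" J] by auto
  then show ?thesis using x unfolding J_def by auto
qed

text \<open>With u = exp (- Complex x (t + s)), the Poisson kernel Re ((1 + u) / (1 - u)) is the
  integrand times \<open>1 - exp (-2*x)\<close>. The integral of the holomorphic function over a
  period is independent of \<open>x\<close>, and letting \<open>x\<close> tend to infinity gives the
  value 2 pi.\<close>

lemma poisson_integral:
  fixes x t :: real
  assumes x: "x > 0"
  shows "((\<lambda>s. 1 / (cmod (1 - exp (- Complex x (t + s))))\<^sup>2) has_integral 2 * pi / (1 - exp (-2*x))) {0..2*pi}"
proof -
  define \<psi> where "\<psi> \<zeta> = (1 + exp (-\<zeta> - \<i> * t)) / (1 - exp (-\<zeta> - \<i> * t))" for \<zeta>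
  have ne: "1 - exp (-\<zeta> - \<i> * t) \<noteq> 0" if "Re \<zeta> > 0" for \<zeta>
  proof
    assume "1 - exp (-\<zeta> - \<i> * t) = 0"
    moreover have "cmod (exp (-\<zeta> - \<i> * t)) < 1" unfolding norm_exp_eq_Re using that by simp
    ultimately show False by (metis eq_iff_diff_eq_0 less_irrefl norm_one)
  qed
  have cont: "continuous_on {0..2*pi} (\<lambda>s. \<psi> (Complex y s))" if "y > 0" for y
    unfolding \<psi>_def Complex_eq by (intro continuous_intros ballI ne) (use that in auto)
  have J: "integral {0..2*pi} (\<lambda>s. \<psi> (Complex x s)) = integral {0..2*pi} (\<lambda>s. \<psi> (Complex y s))" if y: "y > 0" for y
  proof (rule periodic_integral_const[OF _ _ x y])
    fix \<zeta> assume \<zeta>: "Re \<zeta> > 0"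
    have "\<psi> holomorphic_on {\<zeta>. Re \<zeta> > 0}" unfolding \<psi>_def
      by (intro holomorphic_intros) (use ne in auto)
    then show "\<psi> field_differentiable at \<zeta>"
      using \<zeta> holomorphic_on_imp_differentiable_at[OF _ open_halfspace_Re_gt] by blast
    have "exp (- (\<zeta> + 2 * pi * \<i>) - \<i> * t) = exp (-\<zeta> - \<i> * t)"
      using exp_plus_2pin[of "-\<zeta> - \<i> * t" "-1"] by (simp add: algebra_simps)
    then show "\<psi> (\<zeta> + 2 * pi * \<i>) = \<psi> \<zeta>" by (simp only: \<psi>_def)
  qed
  have "cmod (integral {0..2*pi} (\<lambda>s. \<psi> (Complex x s)) - 2 * pi) \<le> 4 * pi * exp (-y) / (1 - exp (-y))" if y: "y > 0" for y
  proof -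
    have i: "(\<lambda>s. \<psi> (Complex y s)) integrable_on {0..2*pi}" by (rule integrable_continuous_real[OF cont[OF y]])
    have "integral {0..2*pi} (\<lambda>s. \<psi> (Complex y s)) - 2 * pi = integral {0..2*pi} (\<lambda>s. \<psi> (Complex y s) - 1)"
      by (subst integral_diff[OF i]) (auto simp: scaleR_conv_of_real)
    also have "cmod \<dots> \<le> 2 * exp (-y) / (1 - exp (-y)) * (2 * pi - 0)"
    proof (rule integral_bound)
      show "continuous_on {0..2*pi} (\<lambda>s. \<psi> (Complex y s) - 1)" by (intro continuous_intros cont y)
      fix s
      define u where "u = exp (- Complex y s - \<i> * t)"
      have u: "cmod u = exp (-y)" by (simp add: u_def)
      have "1 - u \<noteq> 0" using ne[of "Complex y s"] y by (simp add: u_def)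
      then have "\<psi> (Complex y s) - 1 = 2 * u / (1 - u)" unfolding \<psi>_def u_def[symmetric] by (simp add: field_simps)
      moreover have "1 - exp (-y) \<le> cmod (1 - u)" using norm_triangle_ineq2[of 1 u] u by simp
      ultimately show "cmod (\<psi> (Complex y s) - 1) \<le> 2 * exp (-y) / (1 - exp (-y))"
        using y by (simp add: norm_divide norm_mult u frac_le)
    qed simp
    finally show ?thesis by (subst J[OF y]) (simp add: mult_ac)
  qed
  moreover have "((\<lambda>y::real. 4 * pi * exp (-y) / (1 - exp (-y))) \<longlongrightarrow> 4 * pi * 0 / (1 - 0)) at_top"
    by (intro tendsto_intros filterlim_compose[OF exp_at_bot] filterlim_uminus_at_bot_at_top) auto
  ultimately have "cmod (integral {0..2*pi} (\<lambda>s. \<psi> (Complex x s)) - 2 * pi) \<le> 4 * pi * 0 / (1 - 0)"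
    by (intro tendsto_lowerbound[where F=at_top]) (auto intro: eventually_mono[OF eventually_gt_at_top[of 0]])
  then have "integral {0..2*pi} (\<lambda>s. \<psi> (Complex x s)) = 2 * pi" by simp
  then have "((\<lambda>s. \<psi> (Complex x s)) has_integral 2 * pi) {0..2*pi}"
    using integrable_continuous_real[OF cont[OF x]] by (metis has_integral_integral)
  then have "((\<lambda>s. Re (\<psi> (Complex x s))) has_integral 2 * pi) {0..2*pi}"
    using has_integral_linear[OF _ bounded_linear_Re, of "\<lambda>s. \<psi> (Complex x s)" "2 * complex_of_real pi" "{0..2*pi}"] by (simp add: o_def)
  from has_integral_divide[OF this, of "1 - exp (-2*x)"]
  have "((\<lambda>s. Re (\<psi> (Complex x s)) / (1 - exp (-2*x))) has_integral 2 * pi / (1 - exp (-2*x))) {0..2*pi}" .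
  moreover have "Re (\<psi> (Complex x s)) / (1 - exp (-2*x)) = 1 / (cmod (1 - exp (- Complex x (t + s))))\<^sup>2" for s
  proof -
    define u where "u = exp (- Complex x s - \<i> * t)"
    have u': "u = exp (- Complex x (t + s))" by (simp add: u_def Complex_eq algebra_simps)
    have nu: "(cmod u)\<^sup>2 = exp (-2*x)" by (simp add: u_def exp_double[symmetric])
    have "Re ((1 + u) / (1 - u)) = (1 - (cmod u)\<^sup>2) / (cmod (1 - u))\<^sup>2"
    proof -
      have "(1 + u) / (1 - u) = (1 + u) * cnj (1 - u) / of_real ((cmod (1 - u))\<^sup>2)" by (subst complex_div_cnj) simp
      then have "Re ((1 + u) / (1 - u)) = Re ((1 + u) * cnj (1 - u)) / (cmod (1 - u))\<^sup>2" by (simp only: Re_divide_of_real)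
      also have "Re ((1 + u) * cnj (1 - u)) = 1 - (cmod u)\<^sup>2" unfolding cmod_power2 by (simp add: power2_eq_square algebra_simps)
      finally show ?thesis .
    qed
    moreover have "1 - exp (-2*x) \<noteq> 0" using x by simp
    ultimately show ?thesis unfolding \<psi>_def u_def[symmetric] u'[symmetric] nu by simp
  qed
  ultimately show ?thesis by simp
qed

text \<open>In the application \<open>a\<close> is the factor of \<open>NN\<close> at the lowest
  exponent and \<open>u = exp (- Om p j v w)\<close>, so this is the kernel of one coordinate in
  closed form.\<close>

lemma arith_geometric_sums:
  fixes u :: complex and a p :: real
  assumes u: "cmod u < 1"
  shows "(\<lambda>l. of_real (p * real l + a) * u ^ l) sums (of_real p / (1 - u)\<^sup>2 + of_real (a - p) / (1 - u))"
proof -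
  have "(\<lambda>l. of_real p * (of_nat (Suc l) * u ^ l) + of_real (a - p) * u ^ l) sums (of_real p * (1 / (1 - u)\<^sup>2) + of_real (a - p) * (1 / (1 - u)))"
    by (intro sums_add sums_mult geometric_deriv_sums geometric_sums u)
  then show ?thesis by (simp add: algebra_simps)
qed

text \<open>Only the double pole is kept; the simple pole is absorbed through
  \<open>cmod (1 - u) \<le> 2\<close>.\<close>

lemma arith_geometric_bound:
  fixes u :: complex and a p :: real
  assumes u: "cmod u < 1"
  shows "cmod (of_real p / (1 - u)\<^sup>2 + of_real (a - p) / (1 - u)) \<le> (\<bar>p\<bar> + 2 * \<bar>a - p\<bar>) / (cmod (1 - u))\<^sup>2"
proof -
  have nz: "1 - u \<noteq> 0" using u by auto
  then have "of_real p / (1 - u)\<^sup>2 + of_real (a - p) / (1 - u) = (of_real p + of_real (a - p) * (1 - u)) / (1 - u)\<^sup>2"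
    by (simp add: add_divide_distrib power2_eq_square)
  also have "cmod \<dots> = cmod (of_real p + of_real (a - p) * (1 - u)) / (cmod (1 - u))\<^sup>2"
    by (simp add: norm_divide norm_power)
  also have "\<dots> \<le> (\<bar>p\<bar> + 2 * \<bar>a - p\<bar>) / (cmod (1 - u))\<^sup>2"
  proof (rule divide_right_mono)
    have "cmod (of_real p + of_real (a - p) * (1 - u)) \<le> cmod (of_real p) + cmod (of_real (a - p) * (1 - u))" by (rule norm_triangle_ineq)
    also have "\<dots> = \<bar>p\<bar> + \<bar>a - p\<bar> * cmod (1 - u)" by (simp only: norm_mult norm_of_real)
    also have "\<dots> \<le> \<bar>p\<bar> + \<bar>a - p\<bar> * 2"
      using norm_triangle_ineq4[of 1 u] u by (intro add_left_mono mult_left_mono) auto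
    finally show "cmod (of_real p + of_real (a - p) * (1 - u)) \<le> \<bar>p\<bar> + 2 * \<bar>a - p\<bar>" by simp
  qed simp
  finally show ?thesis .
qed

text \<open>The angular integral of the kernel behaves like 1 / X near 0 but only stays bounded at
  infinity; the factor \<open>exp (- \<epsilon> * X)\<close> restores the decay 1 / X there, at the
  price of a constant growing like 1 / \<epsilon>.\<close>

lemma exp_kernel_bound:
  fixes \<epsilon> X :: real
  assumes "\<epsilon> > 0" "X > 0"
  shows "exp (- \<epsilon> * X) * (2 * pi / (1 - exp (- 2 * X))) \<le> pi * (1 + 2 / \<epsilon>) / X"
proof -
  have e: "1 + 2 * X \<le> exp (2 * X)" by (rule exp_ge_add_one_self)
  have "exp (- 2 * X) = 1 / exp (2 * X)" by (simp add: exp_minus inverse_eq_divide)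
  also have "\<dots> \<le> 1 / (1 + 2 * X)" using e assms by (intro divide_left_mono) auto
  finally have "2 * X / (1 + 2 * X) \<le> 1 - exp (- 2 * X)" using assms by (simp add: field_simps)
  then have "2 * pi / (1 - exp (- 2 * X)) \<le> 2 * pi / (2 * X / (1 + 2 * X))"
    using assms by (intro divide_left_mono mult_pos_pos) auto
  also have "\<dots> = pi * (1 + 2 * X) / X" using assms by (simp add: field_simps)
  finally have "exp (- \<epsilon> * X) * (2 * pi / (1 - exp (- 2 * X))) \<le> exp (- \<epsilon> * X) * (pi * (1 + 2 * X) / X)"
    by (rule mult_left_mono) simp
  also have "\<dots> = pi * (exp (- \<epsilon> * X) + 2 * (X * exp (- \<epsilon> * X))) / X" by (simp add: field_simps)
  also have "\<dots> \<le> pi * (1 + 2 / \<epsilon>) / X"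
  proof (intro divide_right_mono mult_left_mono)
    have "\<epsilon> * X \<le> exp (\<epsilon> * X)" using exp_ge_add_one_self[of "\<epsilon> * X"] by linarith
    then have "X * exp (- \<epsilon> * X) \<le> 1 / \<epsilon>" using assms by (simp add: exp_minus field_simps)
    moreover have "exp (- \<epsilon> * X) \<le> 1" using assms by simp
    ultimately have "exp (- \<epsilon> * X) + 2 * (X * exp (- \<epsilon> * X)) \<le> 1 + 2 * (1 / \<epsilon>)" by linarith
    then show "exp (- \<epsilon> * X) + 2 * (X * exp (- \<epsilon> * X)) \<le> 1 + 2 / \<epsilon>" by simp
  qed (use assms in auto)
  finally show ?thesis .
qed

text \<open>Hilbert's inequality tested on a power: below \<open>y\<close> the denominator is at
  least \<open>c1 * y\<close>, above \<open>y\<close> at least \<open>c2 * x\<close>, and 0 < a < 1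
  makes both power integrals converge.\<close>

lemma nn_integral_hilbert:
  fixes a y c1 c2 :: real
  assumes a: "0 < a" "a < 1" and pos: "y > 0" "c1 > 0" "c2 > 0"
  shows "(\<integral>\<^sup>+x. ennreal (x powr (-a) / (c1 * y + c2 * x)) * indicator {0<..} x \<partial>lborel)
     \<le> ennreal ((1 / (c1 * (1 - a)) + 1 / (c2 * a)) * y powr (-a))"
proof -
  define f where "f x = (indicator {0..y} x * x powr (-a)) / (c1 * y)" for x
  define g where "g x = (indicator {y..} x * x powr (-a-1)) / c2" for x
  have I1: "((\<lambda>x. x powr (-a)) has_integral (y powr (-a+1) / (-a+1))) {0..y}"
    by (rule has_integral_powr_from_0) (use a pos in auto)
  have I2: "((\<lambda>x. x powr (-a-1)) has_integral -(y powr (-a-1+1)) / (-a-1+1)) {y..}"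
    by (rule has_integral_powr_to_inf) (use a pos in auto)
  have i1: "((\<lambda>x. indicator {0..y} x * x powr (-a)) has_integral (y powr (-a+1) / (-a+1))) UNIV"
    using I1 by (subst (asm) has_integral_restrict_UNIV[symmetric]) (simp add: indicator_def if_distrib[of "\<lambda>x. x * _"] of_bool_def cong: if_cong)
  have i2: "((\<lambda>x. indicator {y..} x * x powr (-a-1)) has_integral -(y powr (-a-1+1)) / (-a-1+1)) UNIV"
    using I2 by (subst (asm) has_integral_restrict_UNIV[symmetric]) (simp add: indicator_def if_distrib[of "\<lambda>x. x * _"] of_bool_def cong: if_cong)
  have "integral\<^sup>N lborel f = y powr (-a+1) / (-a+1) / (c1 * y)" unfolding f_def
    by (rule nn_integral_has_integral_lborel) (use pos has_integral_divide[OF i1, of "c1 * y"] in auto)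
  moreover have "integral\<^sup>N lborel g = -(y powr (-a-1+1)) / (-a-1+1) / c2" unfolding g_def
    by (rule nn_integral_has_integral_lborel) (use pos has_integral_divide[OF i2, of c2] in auto)
  moreover have "(\<integral>\<^sup>+x. ennreal (x powr (-a) / (c1 * y + c2 * x)) * indicator {0<..} x \<partial>lborel) \<le> (\<integral>\<^sup>+x. ennreal (f x) + ennreal (g x) \<partial>lborel)"
  proof (rule nn_integral_mono)
    fix x :: real
    have "x powr (-a) / (c1 * y + c2 * x) \<le> f x + g x" if x: "x > 0"
    proof (cases "x \<le> y")
      case True
      have "x powr (-a) / (c1 * y + c2 * x) \<le> x powr (-a) / (c1 * y)"
        using x pos by (intro divide_left_mono) (auto intro!: add_pos_pos mult_pos_pos)
      also have "\<dots> \<le> f x + g x" using True x pos by (simp add: f_def g_def)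
      finally show ?thesis .
    next
      case False
      have "x powr (-a) / (c1 * y + c2 * x) \<le> x powr (-a) / (c2 * x)"
        using x pos by (intro divide_left_mono) (auto intro!: add_pos_pos mult_pos_pos)
      also have "\<dots> = x powr (-a-1) / c2" using x by (simp add: powr_diff)
      also have "\<dots> \<le> f x + g x" using False x pos by (simp add: f_def g_def)
      finally show ?thesis .
    qed
    moreover have "f x \<ge> 0" "g x \<ge> 0" using pos by (auto simp: f_def g_def)
    ultimately show "ennreal (x powr (-a) / (c1 * y + c2 * x)) * indicator {0<..} x \<le> ennreal (f x) + ennreal (g x)"
      by (auto simp: indicator_def ennreal_plus[symmetric] simp del: ennreal_plus intro!: ennreal_leI)
  qed
  moreover have "(\<integral>\<^sup>+x. ennreal (f x) + ennreal (g x) \<partial>lborel) = integral\<^sup>N lborel f + integral\<^sup>N lborel g"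
    by (rule nn_integral_add) (auto simp: f_def g_def)
  moreover have "y powr (-a+1) / (-a+1) / (c1 * y) = 1 / (c1 * (1 - a)) * y powr (-a)"
  proof -
    have "y powr (-a+1) = y powr (-a) * y" using pos powr_add[of y "-a" 1] by simp
    moreover have "1 - a \<noteq> 0" "-a + 1 = 1 - a" using a by auto
    ultimately show ?thesis using pos by (simp only:) (simp add: divide_simps)
  qed
  moreover have "-(y powr (-a-1+1)) / (-a-1+1) / c2 = 1 / (c2 * a) * y powr (-a)" by (simp add: field_simps)
  ultimately show ?thesis using a pos
    by (simp add: ennreal_plus[symmetric] distrib_right mult.commute[of a c2] del: ennreal_plus)
qed

section \<open>Lebesgue spaces\<close>

definition lpI :: "real \<Rightarrow> 'a measure \<Rightarrow> ('a \<Rightarrow> complex) \<Rightarrow> ennreal" where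
  "lpI p M f = (\<integral>\<^sup>+x. ennreal (cmod (f x) powr p) \<partial>M)"

definition lpN :: "real \<Rightarrow> 'a measure \<Rightarrow> ('a \<Rightarrow> complex) \<Rightarrow> real" where
  "lpN p M f = enn2real (lpI p M f) powr (1 / p)"

definition lpS :: "real \<Rightarrow> 'a measure \<Rightarrow> ('a \<Rightarrow> complex) \<Rightarrow> bool" where
  "lpS p M f \<longleftrightarrow> f \<in> borel_measurable M \<and> lpI p M f < \<infinity>"

lemma lpN_nonneg[simp]: "0 \<le> lpN p M f" by (simp add: lpN_def)

lemma lpI_eq: "p > 0 \<Longrightarrow> lpI p M f < \<infinity> \<Longrightarrow> lpI p M f = ennreal (lpN p M f powr p)"
  by (simp add: lpN_def powr_powr)

lemma lpN_le:
  assumes "p > 0" "0 \<le> C" "lpI p M f \<le> ennreal (C powr p)"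
  shows "lpN p M f \<le> C"
proof -
  have "enn2real (lpI p M f) \<le> C powr p" using assms by (intro enn2real_leI) auto
  then have "lpN p M f \<le> (C powr p) powr (1 / p)" unfolding lpN_def using assms by (intro powr_mono2) auto
  then show ?thesis using assms by (simp add: powr_powr)
qed

lemma powr_convex_comb:
  fixes x y l m p :: real
  assumes "p \<ge> 1" "0 \<le> x" "0 \<le> y" "0 < l" "0 < m" "l + m = 1"
  shows "(l * x + m * y) powr p \<le> l * x powr p + m * y powr p"
proof -
  have le: "(m * y) powr p \<le> m * y powr p" if "0 < m" "m \<le> 1" "0 \<le> y" for m y :: real
  proof -
    have "m powr p \<le> m powr 1" using that assms by (intro powr_mono') auto
    then show ?thesis using that by (simp add: powr_mult mult_right_mono)
  qed
  consider "x = 0" | "y = 0" | "x > 0" "y > 0" using assms by linarith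
  then show ?thesis
  proof cases
    case 1 then show ?thesis using le[of m y] assms by simp
  next
    case 2 then show ?thesis using le[of l x] assms by simp
  next
    case 3
    have l: "l = 1 - m" using assms by simp
    show ?thesis unfolding l
      using convex_onD[OF powr_convex[OF assms(1)], of m x y] 3 assms by simp
  qed
qed

text \<open>Lets the inequalities of Hoelder and Minkowski be proved with numbers strictly above the
  norms, so that no division by a vanishing norm occurs.\<close>

lemma le_of_perturb:
  fixes a b :: real and h :: "real \<Rightarrow> real"
  assumes "\<And>e. e > 0 \<Longrightarrow> x \<le> ennreal (h e)" "isCont h 0"
  shows "x \<le> ennreal (h 0)"
proof (rule tendsto_lowerbound)
  show "((\<lambda>e. ennreal (h e)) \<longlongrightarrow> ennreal (h 0)) (at_right 0)"
    using assms(2) by (intro tendsto_ennrealI) (auto simp: isCont_def intro: filterlim_at_within_not_equal tendsto_within_subset)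
  show "\<forall>\<^sub>F e in at_right 0. x \<le> ennreal (h e)"
    using assms(1) by (auto simp: eventually_at_right_less intro: eventually_mono[OF eventually_at_right_less])
qed simp

lemma hoelder:
  assumes pq: "p > 1" "q > 1" "1 / p + 1 / q = 1" and f: "lpS p M f" and g: "lpS q M g"
  shows "(\<integral>\<^sup>+x. ennreal (cmod (f x) * cmod (g x)) \<partial>M) \<le> ennreal (lpN p M f * lpN q M g)"
proof -
  have [measurable]: "f \<in> borel_measurable M" "g \<in> borel_measurable M" using f g by (auto simp: lpS_def)
  define A B where "A = lpN p M f" and "B = lpN q M g"
  have AB: "A \<ge> 0" "B \<ge> 0" by (auto simp: A_def B_def)
  have I: "lpI p M f = ennreal (A powr p)" "lpI q M g = ennreal (B powr q)"
    using f g pq by (auto simp: lpS_def A_def B_def intro!: lpI_eq)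
  have "(\<integral>\<^sup>+x. ennreal (cmod (f x) * cmod (g x)) \<partial>M) \<le> ennreal ((A + e) * (B + e))" if e: "e > 0" for e
  proof -
    define a b where "a = A + e" and "b = B + e"
    have ab: "a > 0" "b > 0" "A \<le> a" "B \<le> b" using AB e by (auto simp: a_def b_def)
    have "(\<integral>\<^sup>+x. ennreal (cmod (f x) * cmod (g x)) \<partial>M)
       \<le> (\<integral>\<^sup>+x. ennreal (a * b / (p * a powr p)) * ennreal (cmod (f x) powr p) + ennreal (a * b / (q * b powr q)) * ennreal (cmod (g x) powr q) \<partial>M)"
    proof (rule nn_integral_mono)
      fix x
      have "cmod (f x) / a * (cmod (g x) / b) \<le> (cmod (f x) / a) powr p / p + (cmod (g x) / b) powr q / q"
        by (rule Youngs_inequality) (use pq ab in auto)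
      then have "a * b * (cmod (f x) / a * (cmod (g x) / b)) \<le> a * b * ((cmod (f x) / a) powr p / p + (cmod (g x) / b) powr q / q)"
        using ab by (intro mult_left_mono) auto
      also have "\<dots> = a * b / (p * a powr p) * cmod (f x) powr p + a * b / (q * b powr q) * cmod (g x) powr q"
        using ab by (simp add: powr_divide field_simps)
      finally have "cmod (f x) * cmod (g x) \<le> a * b / (p * a powr p) * cmod (f x) powr p + a * b / (q * b powr q) * cmod (g x) powr q"
        using ab by simp
      then show "ennreal (cmod (f x) * cmod (g x)) \<le> ennreal (a * b / (p * a powr p)) * ennreal (cmod (f x) powr p) + ennreal (a * b / (q * b powr q)) * ennreal (cmod (g x) powr q)"
        using ab pq by (simp add: ennreal_mult[symmetric] ennreal_plus[symmetric] ennreal_leI del: ennreal_plus)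
    qed
    also have "\<dots> = ennreal (a * b / (p * a powr p)) * ennreal (A powr p) + ennreal (a * b / (q * b powr q)) * ennreal (B powr q)"
      unfolding I[symmetric] lpI_def by (subst nn_integral_add) (simp_all add: nn_integral_cmult)
    also have "\<dots> = ennreal (a * b / (p * a powr p) * A powr p + a * b / (q * b powr q) * B powr q)"
      using ab pq by (simp add: ennreal_mult[symmetric] ennreal_plus[symmetric] del: ennreal_plus)
    also have "\<dots> \<le> ennreal (a * b)"
    proof (rule ennreal_leI)
      have "A powr p \<le> a powr p" "B powr q \<le> b powr q" using AB ab pq by (auto intro!: powr_mono2)
      then have "a * b / (p * a powr p) * A powr p + a * b / (q * b powr q) * B powr q \<le> a * b / (p * a powr p) * a powr p + a * b / (q * b powr q) * b powr q"
        using ab pq by (intro add_mono mult_left_mono) auto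
      also have "\<dots> = a * b * (1 / p + 1 / q)" using ab by (simp add: field_simps)
      finally show "a * b / (p * a powr p) * A powr p + a * b / (q * b powr q) * B powr q \<le> a * b" using pq by simp
    qed
    finally show ?thesis by (simp add: a_def b_def)
  qed
  then have "(\<integral>\<^sup>+x. ennreal (cmod (f x) * cmod (g x)) \<partial>M) \<le> ennreal ((A + 0) * (B + 0))"
    by (rule le_of_perturb) (auto intro!: continuous_intros)
  then show ?thesis by (simp add: A_def B_def)
qed

lemma borel_measurable_cnj[measurable]: "cnj \<in> borel_measurable borel"
  by (intro borel_measurable_continuous_onI continuous_intros)

lemma hoelder_integral:
  assumes pq: "p > 1" "q > 1" "1 / p + 1 / q = 1" and f: "lpS p M f" and g: "lpS q M g"
  shows "integrable M (\<lambda>x. f x * cnj (g x))" "cmod (LINT x|M. f x * cnj (g x)) \<le> lpN p M f * lpN q M g"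
proof -
  have [measurable]: "f \<in> borel_measurable M" "g \<in> borel_measurable M" using f g by (auto simp: lpS_def)
  have le: "(\<integral>\<^sup>+x. ennreal (norm (f x * cnj (g x))) \<partial>M) \<le> ennreal (lpN p M f * lpN q M g)"
    using hoelder[OF assms] by (simp add: norm_mult)
  show i: "integrable M (\<lambda>x. f x * cnj (g x))"
  proof (rule integrableI_bounded)
    show "(\<lambda>x. f x * cnj (g x)) \<in> borel_measurable M"
      by measurable
  qed (use le in \<open>auto intro: le_less_trans\<close>)
  have "ennreal (cmod (LINT x|M. f x * cnj (g x))) \<le> (\<integral>\<^sup>+x. ennreal (norm (f x * cnj (g x))) \<partial>M)"
    using i by (rule integral_norm_bound_ennreal)
  then show "cmod (LINT x|M. f x * cnj (g x)) \<le> lpN p M f * lpN q M g"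
    using le by (meson order_trans ennreal_le_iff mult_nonneg_nonneg lpN_nonneg)
qed

lemma minkowski:
  assumes p: "p \<ge> 1" and f: "lpS p M f" and g: "lpS p M g"
  shows "lpS p M (\<lambda>x. f x + g x)" "lpN p M (\<lambda>x. f x + g x) \<le> lpN p M f + lpN p M g"
proof -
  have [measurable]: "f \<in> borel_measurable M" "g \<in> borel_measurable M" using f g by (auto simp: lpS_def)
  define A B where "A = lpN p M f" and "B = lpN p M g"
  have AB: "A \<ge> 0" "B \<ge> 0" by (auto simp: A_def B_def)
  have I: "lpI p M f = ennreal (A powr p)" "lpI p M g = ennreal (B powr p)"
    using f g p by (auto simp: lpS_def A_def B_def intro!: lpI_eq)
  have "lpI p M (\<lambda>x. f x + g x) \<le> ennreal ((A + \<bar>e\<bar> + (B + \<bar>e\<bar>)) powr p)" if e: "e > 0" for e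
  proof -
    define a b s where "a = A + e" and "b = B + e" and "s = a + b"
    have ab: "a > 0" "b > 0" "A \<le> a" "B \<le> b" "s > 0" using AB e by (auto simp: a_def b_def s_def)
    have lpI_le: "lpI p M (\<lambda>x. f x + g x)
       \<le> (\<integral>\<^sup>+x. ennreal (s powr p * (a / s) / a powr p) * ennreal (cmod (f x) powr p) + ennreal (s powr p * (b / s) / b powr p) * ennreal (cmod (g x) powr p) \<partial>M)"
      unfolding lpI_def
    proof (rule nn_integral_mono)
      fix x
      have "cmod (f x + g x) powr p \<le> (cmod (f x) + cmod (g x)) powr p"
        using p by (intro powr_mono2 norm_triangle_ineq) auto
      also have "\<dots> = (s * (a / s * (cmod (f x) / a) + b / s * (cmod (g x) / b))) powr p"
        using ab by (simp add: distrib_left)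
      also have "\<dots> = s powr p * (a / s * (cmod (f x) / a) + b / s * (cmod (g x) / b)) powr p"
        using ab by (subst powr_mult) auto
      also have "\<dots> \<le> s powr p * (a / s * (cmod (f x) / a) powr p + b / s * (cmod (g x) / b) powr p)"
        using ab p by (intro mult_left_mono powr_convex_comb) (auto simp: s_def add_divide_distrib[symmetric])
      also have "\<dots> = s powr p * (a / s) / a powr p * cmod (f x) powr p + s powr p * (b / s) / b powr p * cmod (g x) powr p"
        using ab by (simp add: powr_divide distrib_left)
      finally show "ennreal (cmod (f x + g x) powr p) \<le> ennreal (s powr p * (a / s) / a powr p) * ennreal (cmod (f x) powr p) + ennreal (s powr p * (b / s) / b powr p) * ennreal (cmod (g x) powr p)"
        using ab by (simp add: ennreal_mult[symmetric] ennreal_plus[symmetric] ennreal_leI del: ennreal_plus)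
    qed
    also have "\<dots> = ennreal (s powr p * (a / s) / a powr p) * ennreal (A powr p) + ennreal (s powr p * (b / s) / b powr p) * ennreal (B powr p)"
      unfolding I[symmetric] lpI_def by (subst nn_integral_add) (simp_all add: nn_integral_cmult)
    also have "\<dots> = ennreal (s powr p * (a / s) / a powr p * A powr p + s powr p * (b / s) / b powr p * B powr p)"
      using ab by (simp add: ennreal_mult[symmetric] ennreal_plus[symmetric] del: ennreal_plus)
    also have "\<dots> \<le> ennreal (s powr p)"
    proof (rule ennreal_leI)
      have "A powr p \<le> a powr p" "B powr p \<le> b powr p" using AB ab p by (auto intro!: powr_mono2)
      then have "s powr p * (a / s) / a powr p * A powr p + s powr p * (b / s) / b powr p * B powr p
         \<le> s powr p * (a / s) / a powr p * a powr p + s powr p * (b / s) / b powr p * b powr p"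
        using ab by (intro add_mono mult_left_mono) auto
      also have "\<dots> = s powr p * ((a + b) / s)" using ab by (simp add: field_simps)
      finally show "s powr p * (a / s) / a powr p * A powr p + s powr p * (b / s) / b powr p * B powr p \<le> s powr p"
        using ab by (simp add: s_def)
    qed
    finally show ?thesis using e by (simp add: a_def b_def s_def)
  qed
  moreover have "isCont (\<lambda>e. (A + \<bar>e\<bar> + (B + \<bar>e\<bar>)) powr p) 0"
    unfolding isCont_def using p AB by (intro tendsto_powr' tendsto_intros) auto
  ultimately have le: "lpI p M (\<lambda>x. f x + g x) \<le> ennreal ((A + \<bar>0\<bar> + (B + \<bar>0\<bar>)) powr p)"
    by (rule le_of_perturb)
  then show "lpS p M (\<lambda>x. f x + g x)" by (auto simp: lpS_def intro: le_less_trans)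
  show "lpN p M (\<lambda>x. f x + g x) \<le> lpN p M f + lpN p M g"
    by (rule lpN_le) (use le p AB in \<open>auto simp: A_def B_def\<close>)
qed

lemma lp_cmul:
  assumes p: "p > 0" and f: "lpS p M f"
  shows "lpS p M (\<lambda>x. c * f x)" "lpN p M (\<lambda>x. c * f x) = cmod c * lpN p M f"
proof -
  have [measurable]: "f \<in> borel_measurable M" using f by (auto simp: lpS_def)
  have I: "lpI p M (\<lambda>x. c * f x) = ennreal (cmod c powr p) * lpI p M f"
    unfolding lpI_def by (subst nn_integral_cmult[symmetric]) (auto simp: norm_mult powr_mult ennreal_mult)
  then show "lpS p M (\<lambda>x. c * f x)" using f by (auto simp: lpS_def ennreal_mult_less_top)
  show "lpN p M (\<lambda>x. c * f x) = cmod c * lpN p M f"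
    unfolding lpN_def I using p by (simp add: enn2real_mult powr_mult powr_powr)
qed

lemma lp_fatou:
  assumes p: "p > 0" and f: "\<And>n. f n \<in> borel_measurable M" and g: "g \<in> borel_measurable M"
    and lim: "\<And>x. x \<in> space M \<Longrightarrow> (\<lambda>n. f n x) \<longlonglongrightarrow> g x"
    and C: "0 \<le> C" "\<And>n. lpI p M (f n) \<le> ennreal (C powr p)"
  shows "lpS p M g" "lpN p M g \<le> C"
proof -
  have [measurable]: "\<And>n. f n \<in> borel_measurable M" "g \<in> borel_measurable M" by fact+
  have "lpI p M g = (\<integral>\<^sup>+x. liminf (\<lambda>n. ennreal (cmod (f n x) powr p)) \<partial>M)"
    unfolding lpI_def
  proof (rule nn_integral_cong)
    fix x assume x: "x \<in> space M"
    have "(\<lambda>n. ennreal (cmod (f n x) powr p)) \<longlonglongrightarrow> ennreal (cmod (g x) powr p)"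
      using p by (intro tendsto_ennrealI tendsto_powr' tendsto_norm lim x tendsto_const) auto
    then show "ennreal (cmod (g x) powr p) = liminf (\<lambda>n. ennreal (cmod (f n x) powr p))"
      by (metis lim_imp_Liminf trivial_limit_sequentially)
  qed
  also have "\<dots> \<le> liminf (\<lambda>n. lpI p M (f n))" unfolding lpI_def by (rule nn_integral_liminf) simp
  also have "\<dots> \<le> ennreal (C powr p)" using C by (intro Liminf_le always_eventually) auto
  finally have le: "lpI p M g \<le> ennreal (C powr p)" .
  then show "lpS p M g" using g by (auto simp: lpS_def intro: le_less_trans)
  show "lpN p M g \<le> C" by (rule lpN_le[OF p C(1) le])
qed

lemma powr_diff_bound:
  fixes a b :: complex
  assumes "p > 0"
  shows "cmod (a - b) powr p \<le> 2 powr p * (cmod a powr p + cmod b powr p)"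
proof -
  have "cmod (a - b) \<le> 2 * max (cmod a) (cmod b)" using norm_triangle_ineq4[of a b] by linarith
  then have "cmod (a - b) powr p \<le> (2 * max (cmod a) (cmod b)) powr p" using assms by (intro powr_mono2) auto
  also have "\<dots> = 2 powr p * max (cmod a) (cmod b) powr p" by (subst powr_mult) auto
  also have "\<dots> \<le> 2 powr p * (cmod a powr p + cmod b powr p)" by (intro mult_left_mono) (auto simp: max_def)
  finally show ?thesis .
qed

text \<open>Scheffe's lemma gives L^1 convergence of the p-th powers \<open>F n\<close> to
  \<open>G\<close>. As the p-th power of the difference is at most 2^p (|F n - G| + 2 G), its excess
  over 2^p |F n - G| is at most the truncation \<open>H n\<close>, to which dominated convergence
  applies.\<close>

lemma lp_tendsto:
  assumes p: "p > 0" and f: "\<And>n. f n \<in> borel_measurable M" and g: "lpS p M g"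
    and lim: "\<And>x. x \<in> space M \<Longrightarrow> (\<lambda>n. f n x) \<longlonglongrightarrow> g x"
    and le: "\<And>n. lpI p M (f n) \<le> lpI p M g"
  shows "(\<lambda>n. lpN p M (\<lambda>x. f n x - g x)) \<longlonglongrightarrow> 0"
proof -
  have [measurable]: "\<And>n. f n \<in> borel_measurable M" "g \<in> borel_measurable M" using f g by (auto simp: lpS_def)
  define F where "F n x = cmod (f n x) powr p" for n x
  define G where "G x = cmod (g x) powr p" for x
  have [measurable]: "\<And>n. F n \<in> borel_measurable M" "G \<in> borel_measurable M" unfolding F_def G_def by measurable
  have Gfin: "(\<integral>\<^sup>+x. ennreal (G x) \<partial>M) < \<infinity>" using g by (simp add: lpS_def lpI_def G_def)
  have FG: "(\<lambda>n. F n x) \<longlonglongrightarrow> G x" if "x \<in> space M" for x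
    unfolding F_def G_def using p by (intro tendsto_powr' tendsto_norm lim that tendsto_const) auto
  have S: "(\<lambda>n. \<integral>\<^sup>+x. ennreal (norm (F n x - G x)) \<partial>M) \<longlonglongrightarrow> 0"
  proof (rule Scheffe_lemma2)
    show "integrable M G" using Gfin by (intro integrableI_bounded) (auto simp: G_def)
    show "(\<integral>\<^sup>+x. ennreal (norm (F n x)) \<partial>M) \<le> (\<integral>\<^sup>+x. ennreal (norm (G x)) \<partial>M)" for n
      using le[of n] by (simp add: F_def G_def lpI_def)
  qed (auto intro: FG)
  define H where "H n x = min (cmod (f n x - g x) powr p) (2 * 2 powr p * G x)" for n x
  have [measurable]: "\<And>n. H n \<in> borel_measurable M" unfolding H_def by measurable
  have D: "(\<lambda>n. \<integral>\<^sup>+x. ennreal (H n x) \<partial>M) \<longlonglongrightarrow> (\<integral>\<^sup>+x. 0 \<partial>M)"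
  proof (rule nn_integral_dominated_convergence[where w="\<lambda>x. ennreal (2 * 2 powr p * G x)"])
    have "(\<integral>\<^sup>+x. ennreal (2 * 2 powr p * G x) \<partial>M) = ennreal (2 * 2 powr p) * (\<integral>\<^sup>+x. ennreal (G x) \<partial>M)"
      by (subst nn_integral_cmult[symmetric]) (auto simp: ennreal_mult G_def)
    then show "(\<integral>\<^sup>+x. ennreal (2 * 2 powr p * G x) \<partial>M) < \<infinity>" using Gfin by (simp add: ennreal_mult_less_top)
    show "AE x in M. (\<lambda>n. ennreal (H n x)) \<longlonglongrightarrow> 0"
    proof (rule AE_I2)
      fix x assume x: "x \<in> space M"
      have "(\<lambda>n. cmod (f n x - g x) powr p) \<longlonglongrightarrow> 0 powr p"
        using p lim[OF x] by (intro tendsto_powr' tendsto_const tendsto_norm_zero) (auto simp: LIM_zero)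
      then have "(\<lambda>n. H n x) \<longlonglongrightarrow> min 0 (2 * 2 powr p * G x)" unfolding H_def by (intro tendsto_intros) auto
      then have "(\<lambda>n. ennreal (H n x)) \<longlonglongrightarrow> ennreal 0" by (intro tendsto_ennrealI) (simp add: G_def)
      then show "(\<lambda>n. ennreal (H n x)) \<longlonglongrightarrow> 0" by simp
    qed
  qed (auto simp: H_def intro!: ennreal_leI)
  have "(\<lambda>n. ennreal (2 powr p) * (\<integral>\<^sup>+x. ennreal (norm (F n x - G x)) \<partial>M) + (\<integral>\<^sup>+x. ennreal (H n x) \<partial>M)) \<longlonglongrightarrow> ennreal (2 powr p) * 0 + 0"
    using S D by (intro tendsto_add ennreal_tendsto_cmult) auto
  then have lim0: "(\<lambda>n. ennreal (2 powr p) * (\<integral>\<^sup>+x. ennreal (norm (F n x - G x)) \<partial>M) + (\<integral>\<^sup>+x. ennreal (H n x) \<partial>M)) \<longlonglongrightarrow> 0" by simp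
  have up: "lpI p M (\<lambda>x. f n x - g x) \<le> ennreal (2 powr p) * (\<integral>\<^sup>+x. ennreal (norm (F n x - G x)) \<partial>M) + (\<integral>\<^sup>+x. ennreal (H n x) \<partial>M)" for n
  proof -
    have "lpI p M (\<lambda>x. f n x - g x) \<le> (\<integral>\<^sup>+x. ennreal (2 powr p) * ennreal (norm (F n x - G x)) + ennreal (H n x) \<partial>M)"
      unfolding lpI_def
    proof (rule nn_integral_mono)
      fix x
      have "cmod (f n x - g x) powr p \<le> 2 powr p * (F n x + G x)" using powr_diff_bound[OF p] by (simp add: F_def G_def)
      also have "\<dots> \<le> 2 powr p * (norm (F n x - G x) + 2 * G x)" by (intro mult_left_mono) auto
      finally have "cmod (f n x - g x) powr p \<le> 2 powr p * norm (F n x - G x) + H n x"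
        by (auto simp: H_def min_def algebra_simps)
      moreover have "H n x \<ge> 0" by (simp add: H_def G_def)
      ultimately show "ennreal (cmod (f n x - g x) powr p) \<le> ennreal (2 powr p) * ennreal (norm (F n x - G x)) + ennreal (H n x)"
        by (simp add: ennreal_mult[symmetric] ennreal_plus[symmetric] ennreal_leI del: ennreal_plus)
    qed
    then show ?thesis by (simp add: nn_integral_add nn_integral_cmult)
  qed
  have "(\<lambda>n. lpI p M (\<lambda>x. f n x - g x)) \<longlonglongrightarrow> 0"
    by (rule tendsto_sandwich[OF _ _ tendsto_const lim0]) (use up in auto)
  then have "(\<lambda>n. enn2real (lpI p M (\<lambda>x. f n x - g x))) \<longlonglongrightarrow> enn2real 0"
    by (intro tendsto_enn2real) auto
  then have "(\<lambda>n. enn2real (lpI p M (\<lambda>x. f n x - g x)) powr (1/p)) \<longlonglongrightarrow> 0 powr (1/p)"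
    using p by (intro tendsto_powr' tendsto_const) auto
  then show ?thesis by (simp add: lpN_def)
qed

text \<open>Young's inequality is applied to the product of the kernel with both functions, so that no
  powers of integrals occur.\<close>

lemma schur_test:
  fixes k :: "'a \<Rightarrow> 'a \<Rightarrow> real" and \<theta> h g :: "'a \<Rightarrow> real"
  assumes M: "sigma_finite_measure M"
    and pq: "p > 1" "q > 1" "1 / p + 1 / q = 1" and C: "C > 0"
    and k_meas: "(\<lambda>(v, w). k v w) \<in> borel_measurable (M \<Otimes>\<^sub>M M)" and k: "\<And>v w. k v w \<ge> 0"
    and \<theta>_meas: "\<theta> \<in> borel_measurable M" and \<theta>: "\<And>v. \<theta> v > 0"
    and s1: "\<And>w. w \<in> space M \<Longrightarrow> (\<integral>\<^sup>+v. ennreal (k v w * \<theta> v powr p) \<partial>M) \<le> ennreal (C * \<theta> w powr p)"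
    and s2: "\<And>v. v \<in> space M \<Longrightarrow> (\<integral>\<^sup>+w. ennreal (k v w * \<theta> w powr q) \<partial>M) \<le> ennreal (C * \<theta> v powr q)"
    and h_meas: "h \<in> borel_measurable M" and h: "\<And>x. h x \<ge> 0"
    and g_meas: "g \<in> borel_measurable M" and g: "\<And>x. g x \<ge> 0"
    and gk: "\<And>v. v \<in> space M \<Longrightarrow> ennreal (g v) \<le> (\<integral>\<^sup>+w. ennreal (k v w * h w) \<partial>M)"
    and gfin: "(\<integral>\<^sup>+v. ennreal (g v powr p) \<partial>M) < \<infinity>" and hfin: "(\<integral>\<^sup>+v. ennreal (h v powr p) \<partial>M) < \<infinity>"
  shows "(\<integral>\<^sup>+v. ennreal (g v powr p) \<partial>M) \<le> ennreal (C powr p) * (\<integral>\<^sup>+v. ennreal (h v powr p) \<partial>M)"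
proof -
  interpret sigma_finite_measure M by fact
  interpret P: pair_sigma_finite M M ..
  note [measurable] = k_meas \<theta>_meas h_meas g_meas
  obtain G where G: "(\<integral>\<^sup>+v. ennreal (g v powr p) \<partial>M) = ennreal G" "G \<ge> 0" using gfin by (cases "(\<integral>\<^sup>+v. ennreal (g v powr p) \<partial>M)") auto
  obtain H where H: "(\<integral>\<^sup>+v. ennreal (h v powr p) \<partial>M) = ennreal H" "H \<ge> 0" using hfin by (cases "(\<integral>\<^sup>+v. ennreal (h v powr p) \<partial>M)") auto
  \<comment> \<open>The scaling of the dual factor for which \<open>C * l powr q = l\<close>: the
    second half of Young's inequality then returns \<open>l * G / q\<close>, which is absorbed into
    \<open>l * G\<close> on the left. This subtraction relies on the finiteness of
    \<open>G\<close>.\<close>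
  define l where "l = C powr (- (p - 1))"
  have l: "l > 0" using C by (simp add: l_def)
  have q_eq: "q = p / (p - 1)" using pq by (simp add: field_simps)
  have "(p - 1) * q = p" using pq q_eq by simp
  then have psi_q: "(l * g v powr (p - 1)) powr q = l powr q * g v powr p" for v
    using l g[of v] by (simp add: powr_mult powr_powr)
  have "- (p - 1) * q = - p" using \<open>(p - 1) * q = p\<close> by linarith
  then have "l powr q = C powr (- p)" by (simp add: l_def powr_powr)
  then have Clq: "C * l powr q = l" using C powr_add[of C 1 "-p"] by (simp add: l_def)
  have "ennreal (l * G) = (\<integral>\<^sup>+v. ennreal (g v) * ennreal (l * g v powr (p - 1)) \<partial>M)"
  proof -
    have e: "g v * (l * g v powr (p - 1)) = l * g v powr p" for v
      using g[of v] powr_add[of "g v" 1 "p - 1"] by (cases "g v = 0") auto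
    have "ennreal (g v) * ennreal (l * g v powr (p - 1)) = ennreal l * ennreal (g v powr p)" for v
      using g l e[of v] by (metis ennreal_mult less_imp_le mult_nonneg_nonneg powr_ge_zero)
    then have "(\<integral>\<^sup>+v. ennreal (g v) * ennreal (l * g v powr (p - 1)) \<partial>M) = (\<integral>\<^sup>+v. ennreal l * ennreal (g v powr p) \<partial>M)"
      by simp
    also have "\<dots> = ennreal (l * G)" using l G by (simp add: nn_integral_cmult ennreal_mult)
    finally show ?thesis ..
  qed
  also have "\<dots> \<le> (\<integral>\<^sup>+v. (\<integral>\<^sup>+w. ennreal (k v w * h w) \<partial>M) * ennreal (l * g v powr (p - 1)) \<partial>M)"
    by (rule nn_integral_mono) (intro mult_right_mono gk, auto)
  also have "\<dots> = (\<integral>\<^sup>+v. \<integral>\<^sup>+w. ennreal (k v w * h w) * ennreal (l * g v powr (p - 1)) \<partial>M \<partial>M)"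
    by (rule nn_integral_cong, rule nn_integral_multc[symmetric]) simp
  also have "\<dots> \<le> (\<integral>\<^sup>+v. \<integral>\<^sup>+w. ennreal (k v w * \<theta> v powr p) * ennreal (h w powr p * \<theta> w powr (-p) / p) + ennreal (k v w * \<theta> w powr q) * ennreal (l powr q * g v powr p * \<theta> v powr (-q) / q) \<partial>M \<partial>M)"
  proof (intro nn_integral_mono)
    fix v w
    have "h w * \<theta> v / \<theta> w * (l * g v powr (p - 1) * \<theta> w / \<theta> v) \<le> (h w * \<theta> v / \<theta> w) powr p / p + (l * g v powr (p - 1) * \<theta> w / \<theta> v) powr q / q"
      by (rule Youngs_inequality) (use pq h l \<theta>[of v] \<theta>[of w] in \<open>auto simp: less_imp_le\<close>)
    moreover have "h w * \<theta> v / \<theta> w * (l * g v powr (p - 1) * \<theta> w / \<theta> v) = h w * (l * g v powr (p - 1))"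
      using \<theta>[of v] \<theta>[of w] by simp
    moreover have "(h w * \<theta> v / \<theta> w) powr p = \<theta> v powr p * (h w powr p * \<theta> w powr (-p))"
      using \<theta>[of v] \<theta>[of w] h[of w] by (simp add: powr_mult powr_divide powr_minus field_simps)
    moreover have "(l * g v powr (p - 1) * \<theta> w / \<theta> v) powr q = \<theta> w powr q * (l powr q * g v powr p * \<theta> v powr (-q))"
      using \<theta>[of v] \<theta>[of w] l psi_q[of v] by (simp add: powr_mult powr_divide powr_minus field_simps)
    ultimately have "h w * (l * g v powr (p - 1)) \<le> \<theta> v powr p * (h w powr p * \<theta> w powr (-p) / p) + \<theta> w powr q * (l powr q * g v powr p * \<theta> v powr (-q) / q)"
      by simp
    then have "k v w * (h w * (l * g v powr (p - 1))) \<le> k v w * (\<theta> v powr p * (h w powr p * \<theta> w powr (-p) / p) + \<theta> w powr q * (l powr q * g v powr p * \<theta> v powr (-q) / q))"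
      by (intro mult_left_mono k)
    then have "k v w * h w * (l * g v powr (p - 1)) \<le> k v w * \<theta> v powr p * (h w powr p * \<theta> w powr (-p) / p) + k v w * \<theta> w powr q * (l powr q * g v powr p * \<theta> v powr (-q) / q)"
      by (simp only: distrib_left mult.assoc)
    then show "ennreal (k v w * h w) * ennreal (l * g v powr (p - 1)) \<le> ennreal (k v w * \<theta> v powr p) * ennreal (h w powr p * \<theta> w powr (-p) / p) + ennreal (k v w * \<theta> w powr q) * ennreal (l powr q * g v powr p * \<theta> v powr (-q) / q)"
      using k[of v w] h[of w] g[of v] l pq by (simp add: ennreal_mult[symmetric] ennreal_plus[symmetric] ennreal_leI del: ennreal_plus)
  qed
  also have "\<dots> = (\<integral>\<^sup>+v. \<integral>\<^sup>+w. ennreal (k v w * \<theta> v powr p) * ennreal (h w powr p * \<theta> w powr (-p) / p) \<partial>M \<partial>M) + (\<integral>\<^sup>+v. \<integral>\<^sup>+w. ennreal (k v w * \<theta> w powr q) * ennreal (l powr q * g v powr p * \<theta> v powr (-q) / q) \<partial>M \<partial>M)"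
    by (subst nn_integral_add[symmetric]) (auto intro!: nn_integral_cong nn_integral_add)
  also have "(\<integral>\<^sup>+v. \<integral>\<^sup>+w. ennreal (k v w * \<theta> v powr p) * ennreal (h w powr p * \<theta> w powr (-p) / p) \<partial>M \<partial>M) \<le> ennreal (C * H / p)"
  proof -
    have "(\<integral>\<^sup>+v. \<integral>\<^sup>+w. ennreal (k v w * \<theta> v powr p) * ennreal (h w powr p * \<theta> w powr (-p) / p) \<partial>M \<partial>M)
      = (\<integral>\<^sup>+w. \<integral>\<^sup>+v. ennreal (k v w * \<theta> v powr p) * ennreal (h w powr p * \<theta> w powr (-p) / p) \<partial>M \<partial>M)"
      by (rule P.Fubini'[symmetric]) measurable
    also have "\<dots> \<le> (\<integral>\<^sup>+w. ennreal (C / p) * ennreal (h w powr p) \<partial>M)"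
    proof (rule nn_integral_mono)
      fix w assume w: "w \<in> space M"
      have "(\<integral>\<^sup>+v. ennreal (k v w * \<theta> v powr p) * ennreal (h w powr p * \<theta> w powr (-p) / p) \<partial>M) = (\<integral>\<^sup>+v. ennreal (k v w * \<theta> v powr p) \<partial>M) * ennreal (h w powr p * \<theta> w powr (-p) / p)"
        using w by (intro nn_integral_multc) measurable
      also have "\<dots> \<le> ennreal (C * \<theta> w powr p) * ennreal (h w powr p * \<theta> w powr (-p) / p)"
        by (intro mult_right_mono s1 w) auto
      also have "\<dots> = ennreal (C / p) * ennreal (h w powr p)"
        using C \<theta>[of w] pq by (simp add: ennreal_mult[symmetric] powr_minus field_simps)
      finally show "(\<integral>\<^sup>+v. ennreal (k v w * \<theta> v powr p) * ennreal (h w powr p * \<theta> w powr (-p) / p) \<partial>M) \<le> ennreal (C / p) * ennreal (h w powr p)" .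
    qed
    also have "\<dots> = ennreal (C / p * H)" using C pq H(2) by (subst nn_integral_cmult) (simp_all add: H(1) ennreal_mult[symmetric])
    finally show ?thesis by simp
  qed
  also have "(\<integral>\<^sup>+v. \<integral>\<^sup>+w. ennreal (k v w * \<theta> w powr q) * ennreal (l powr q * g v powr p * \<theta> v powr (-q) / q) \<partial>M \<partial>M) \<le> ennreal (l * G / q)"
  proof -
    have "(\<integral>\<^sup>+v. \<integral>\<^sup>+w. ennreal (k v w * \<theta> w powr q) * ennreal (l powr q * g v powr p * \<theta> v powr (-q) / q) \<partial>M \<partial>M)
      \<le> (\<integral>\<^sup>+v. ennreal (l / q) * ennreal (g v powr p) \<partial>M)"
    proof (rule nn_integral_mono)
      fix v assume v: "v \<in> space M"
      have "(\<integral>\<^sup>+w. ennreal (k v w * \<theta> w powr q) * ennreal (l powr q * g v powr p * \<theta> v powr (-q) / q) \<partial>M) = (\<integral>\<^sup>+w. ennreal (k v w * \<theta> w powr q) \<partial>M) * ennreal (l powr q * g v powr p * \<theta> v powr (-q) / q)"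
        using v by (intro nn_integral_multc) measurable
      also have "\<dots> \<le> ennreal (C * \<theta> v powr q) * ennreal (l powr q * g v powr p * \<theta> v powr (-q) / q)"
        by (intro mult_right_mono s2 v) auto
      also have "\<dots> = ennreal (C * l powr q / q) * ennreal (g v powr p)"
        using C \<theta>[of v] pq by (simp add: ennreal_mult[symmetric] powr_minus field_simps)
      finally show "(\<integral>\<^sup>+w. ennreal (k v w * \<theta> w powr q) * ennreal (l powr q * g v powr p * \<theta> v powr (-q) / q) \<partial>M) \<le> ennreal (l / q) * ennreal (g v powr p)"
        by (simp add: Clq)
    qed
    also have "\<dots> = ennreal (l / q * G)" using l pq G(2) by (subst nn_integral_cmult) (simp_all add: G(1) ennreal_mult[symmetric])
    finally show ?thesis by simp
  qed
  finally have "ennreal (l * G) \<le> ennreal (C * H / p + l * G / q)"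
    using C H l G pq by (simp add: ennreal_plus[symmetric] add_mono del: ennreal_plus)
  then have "l * G \<le> C * H / p + l * G / q" using C H l G pq by (subst (asm) ennreal_le_iff) auto
  moreover have "l * G / q = l * G - l * G / p"
  proof -
    have "l * G = l * G * (1 / p + 1 / q)" using pq by simp
    then show ?thesis by (simp add: distrib_left)
  qed
  ultimately have "l * G / p \<le> C * H / p" by linarith
  then have "l * G \<le> C * H" using pq by (simp add: divide_le_cancel)
  then have "C powr (p - 1) * (l * G) \<le> C powr (p - 1) * (C * H)" by (intro mult_left_mono) auto
  moreover have "C powr (p - 1) * l = 1" using C unfolding l_def by (subst powr_add[symmetric]) simp
  moreover have "C powr (p - 1) * C = C powr p" using C powr_add[of C "p - 1" 1] by simp
  ultimately have "G \<le> C powr p * H" by (metis mult.assoc mult_1)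
  then show ?thesis unfolding G H using H C by (simp add: ennreal_mult[symmetric] ennreal_leI)
qed

section \<open>Monomial polyhedra in logarithmic coordinates\<close>

locale polyhedron = lattice_map A B d for A B :: "'n::finite \<Rightarrow> 'n \<Rightarrow> int" and d +
  fixes U :: "(complex^'n) set"
  assumes U_eq: "U = monomial_polyhedron_set A" and U_open: "open U" and U_bounded: "bounded U"
begin

text \<open>The exponents of a monomial in logarithmic coordinates: the modulus of
  \<open>monomial \<alpha> (E w)\<close> is exp (- \<Sum> ge \<alpha> j Re w_j).\<close>

definition ge :: "('n \<Rightarrow> int) \<Rightarrow> 'n \<Rightarrow> int" where "ge \<alpha> j = (\<Sum>i\<in>UNIV. B i j * \<alpha> i)"

lemma exp_sum_powi: "exp (- (z::complex)) powi k = exp (- of_int k * z)"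
  by (simp add: exp_power_int)

lemma monomial_E: "monomial \<alpha> (E w) = exp (- (\<Sum>j\<in>UNIV. of_int (ge \<alpha> j) * w $ j))"
proof -
  have "monomial \<alpha> (E w) = (\<Prod>i\<in>UNIV. exp (- (\<Sum>j\<in>UNIV. of_int (\<alpha> i * B i j) * w $ j)))"
    unfolding monomial_def by (rule prod.cong) (simp_all add: E_def exp_sum_powi sum_distrib_left sum_negf mult_ac)
  also have "\<dots> = exp (\<Sum>i\<in>UNIV. - (\<Sum>j\<in>UNIV. of_int (\<alpha> i * B i j) * w $ j))" by (simp add: exp_sum)
  also have "(\<Sum>i\<in>UNIV. - (\<Sum>j\<in>UNIV. of_int (\<alpha> i * B i j) * w $ j)) = - (\<Sum>j\<in>UNIV. \<Sum>i\<in>UNIV. of_int (\<alpha> i * B i j) * w $ j)"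
    by (subst sum.swap) (simp add: sum_negf)
  also have "\<dots> = - (\<Sum>j\<in>UNIV. of_int (ge \<alpha> j) * w $ j)"
    by (simp add: ge_def sum_distrib_right sum_distrib_left mult_ac)
  finally show ?thesis .
qed

lemma norm_monomial_E: "cmod (monomial \<alpha> (E w)) = exp (- (\<Sum>j\<in>UNIV. of_int (ge \<alpha> j) * Re (w $ j)))"
  by (simp add: monomial_E)

lemma ge_A: "ge (A j) k = (if j = k then d else 0)"
  using AB[of j k] by (simp add: ge_def mult.commute)

lemma norm_A_E: "cmod (monomial (A j) (E w)) = exp (- of_int d * Re (w $ j))"
proof -
  have "(\<Sum>k\<in>UNIV. of_int (ge (A j) k) * Re (w $ k)) = (\<Sum>k\<in>UNIV. if j = k then of_int d * Re (w $ k) else 0)"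
    by (rule sum.cong) (auto simp: ge_A)
  then show ?thesis by (simp add: norm_monomial_E)
qed

lemma E_in_U: "E w \<in> U \<longleftrightarrow> (\<forall>j. Re (w $ j) > 0)"
proof -
  have "cmod (monomial (A j) (E w)) < 1 \<longleftrightarrow> Re (w $ j) > 0" for j
    using d_pos by (simp add: norm_A_E zero_less_mult_iff)
  then show ?thesis by (simp add: U_eq monomial_polyhedron_set_def monomial_defined_def)
qed

definition Ust :: "(complex^'n) set" where "Ust = {z\<in>U. \<forall>i. z $ i \<noteq> 0}"

lemma Ust_E:
  assumes "z \<in> Ust"
  shows "\<exists>w. z = E w \<and> (\<forall>j. Re (w $ j) > 0)"
proof -
  obtain w where w: "E w = z" using E_surj[of z] assms unfolding Ust_def by blast
  then have "E w \<in> U" using assms by (simp add: Ust_def)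
  then have "\<forall>j. Re (w $ j) > 0" by (rule E_in_U[THEN iffD1])
  with w show ?thesis by blast
qed

lemma E_Ust: "(\<And>j. Re (w $ j) > 0) \<Longrightarrow> E w \<in> Ust"
  unfolding Ust_def by (simp add: E_in_U)

text \<open>Boundedness of \<open>U\<close>: with a negative entry \<open>B i j\<close>, letting
  \<open>Re (w $ j)\<close> tend to infinity while the other coordinates stay fixed would make the
  i-th coordinate of \<open>E w\<close> unbounded.\<close>

lemma B_nonneg: "B i j \<ge> 0"
proof (rule ccontr)
  assume "\<not> B i j \<ge> 0"
  then have Bneg: "B i j \<le> -1" by simp
  obtain M where M: "\<And>z. z \<in> U \<Longrightarrow> norm z \<le> M" using U_bounded by (auto simp: bounded_iff)
  define S where "S = (\<Sum>k\<in>UNIV - {j}. real_of_int (B i k))"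
  define t where "t = max 1 (S + \<bar>M\<bar> + 1)"
  define w :: "complex^'n" where "w = (\<chi> k. if k = j then of_real t else 1)"
  have "E w \<in> U" unfolding E_in_U by (auto simp: w_def t_def)
  then have "cmod (E w $ i) \<le> M" using M Finite_Cartesian_Product.norm_nth_le[of "E w" i] order_trans by blast
  moreover have "(\<Sum>k\<in>UNIV. of_int (B i k) * Re (w $ k)) = of_int (B i j) * t + S"
    by (subst sum.remove[of _ j]) (auto simp: w_def S_def intro!: sum.cong)
  moreover have "of_int (B i j) * t \<le> -1 * t" using Bneg by (intro mult_right_mono) (auto simp: t_def)
  moreover have "t \<ge> S + \<bar>M\<bar> + 1" by (simp add: t_def)
  ultimately have "exp (\<bar>M\<bar> + 1) \<le> M" by (simp add: norm_E) (rule order_trans[of _ "exp (- (of_int (B i j) * t) - S)"], simp_all)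
  moreover have "\<bar>M\<bar> + 1 < exp (\<bar>M\<bar> + 1)" by (smt (verit) exp_ge_add_one_self)
  ultimately show False by linarith
qed

lemma b_pos: "b j > 0"
proof -
  have "\<exists>i. B i j \<noteq> 0"
  proof (rule ccontr)
    assume "\<not> ?thesis"
    then have "(\<Sum>i\<in>UNIV. A j i * B i j) = 0" by simp
    then show False using AB[of j j] d_pos by simp
  qed
  then obtain i where "B i j \<noteq> 0" by blast
  then have "B i j > 0" using B_nonneg[of i j] by simp
  then show ?thesis unfolding b_def using B_nonneg by (intro sum_pos2[where i=i]) auto
qed

definition J0 :: "'n \<Rightarrow> bool" where "J0 j \<longleftrightarrow> (\<exists>i. A j i > 0 \<and> (\<exists>z\<in>U. z $ i = 0))"

lemma A_nonneg: "z \<in> U \<Longrightarrow> z $ i = 0 \<Longrightarrow> A j i \<ge> 0"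
  unfolding U_eq monomial_polyhedron_set_def monomial_defined_def using not_less by blast

text \<open>If \<open>U\<close> meets the hyperplane \<open>z $ i = 0\<close>, column
  \<open>i\<close> of \<open>A\<close> is nonnegative. The off-diagonal entries of B A = d I in that
  column are then vanishing sums of nonnegative terms, and \<open>A j i > 0\<close> forces
  \<open>B i' j = 0\<close> for all i' \<noteq> i. So the j-th logarithmic coordinate sees only the
  exponent \<open>\<alpha> i\<close>.\<close>

lemma ge_single:
  assumes "z \<in> U" "z $ i = 0" "A j i > 0"
  shows "ge \<alpha> j = B i j * \<alpha> i"
proof -
  have "B i' j = 0" if "i' \<noteq> i" for i'
  proof -
    have "(\<Sum>k\<in>UNIV. B i' k * A k i) = 0" using BA[of i' i] that by simp
    then have "\<forall>k\<in>UNIV. B i' k * A k i = 0"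
      by (subst (asm) sum_nonneg_eq_0_iff) (auto intro!: mult_nonneg_nonneg B_nonneg A_nonneg[OF assms(1,2)])
    then have "B i' j * A j i = 0" by blast
    then show ?thesis using assms(3) by simp
  qed
  then have "ge \<alpha> j = (\<Sum>k\<in>UNIV. if k = i then B i j * \<alpha> i else 0)"
    unfolding ge_def by (intro sum.cong) auto
  then show ?thesis by simp
qed

lemma ex_single:
  assumes "z \<in> U" "z $ i = 0"
  shows "\<exists>j. A j i > 0 \<and> B i j > 0"
proof -
  have "(\<Sum>j\<in>UNIV. B i j * A j i) > 0" using BA[of i i] d_pos by simp
  then obtain j where j: "B i j * A j i > 0" using sum_nonpos[of UNIV "\<lambda>j. B i j * A j i"] by (meson not_le)
  then have "B i j \<noteq> 0" "A j i \<noteq> 0" by auto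
  then have "B i j > 0" "A j i > 0" using B_nonneg[of i j] A_nonneg[OF assms, of j] by linarith+
  then show ?thesis by blast
qed

text \<open>Near a point of \<open>U\<close> on a coordinate hyperplane some \<open>y\<^sub>j\<close> (those with \<open>J0 j\<close>) tend to infinity; there
  the exponents must be nonnegative for the monomial to be holomorphic, and for the other indices
  only integrability matters.\<close>

definition kk :: "real \<Rightarrow> 'n \<Rightarrow> int" where
  "kk p j = (if J0 j then 0 else \<lfloor>- 2 * of_int (b j) / p\<rfloor> + 1)"

definition SS :: "real \<Rightarrow> ('n \<Rightarrow> int) set" where
  "SS p = {\<alpha>. \<forall>j. kk p j \<le> ge \<alpha> j}"

lemma kk_pos: "p > 0 \<Longrightarrow> p * of_int (kk p j) + 2 * of_int (b j) > 0"
proof (cases "J0 j")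
  case False
  assume p: "p > 0"
  have "- 2 * of_int (b j) / p < of_int (\<lfloor>- 2 * of_int (b j) / p\<rfloor> + 1)" by linarith
  then have "- 2 * of_int (b j) < of_int (\<lfloor>- 2 * of_int (b j) / p\<rfloor> + 1) * p" using p by (simp only: pos_divide_less_eq)
  then show ?thesis using False by (simp add: kk_def mult.commute)
qed (use b_pos[of j] in \<open>simp add: kk_def\<close>)

lemma SS_pos:
  assumes "p > 0" "\<alpha> \<in> SS p"
  shows "p * of_int (ge \<alpha> j) + 2 * of_int (b j) > 0"
proof -
  have "p * of_int (kk p j) \<le> p * of_int (ge \<alpha> j)" using assms by (intro mult_left_mono) (auto simp: SS_def)
  then show ?thesis using kk_pos[OF assms(1), of j] by linarith
qed

lemma SS_defined: "\<alpha> \<in> SS p \<Longrightarrow> z \<in> U \<Longrightarrow> monomial_defined \<alpha> z"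
  unfolding monomial_defined_def
proof (intro allI impI notI)
  fix i assume \<alpha>: "\<alpha> \<in> SS p" and z: "z \<in> U" "z $ i = 0" and neg: "\<alpha> i < 0"
  obtain j where j: "A j i > 0" "B i j > 0" using ex_single[OF z] by blast
  then have "J0 j" using z by (auto simp: J0_def)
  then have "ge \<alpha> j \<ge> 0" using \<alpha> by (auto simp: SS_def kk_def dest!: spec[of _ j])
  then have "B i j * \<alpha> i \<ge> 0" using ge_single[OF z j(1)] by simp
  then show False using j(2) neg by (simp add: zero_le_mult_iff)
qed

text \<open>Converse of \<open>SS_pos\<close> and \<open>SS_defined\<close>: \<open>SS p\<close>
  consists exactly of the exponents whose monomials are holomorphic on \<open>U\<close> and
  p-integrable.\<close>

lemma SS_I:
  assumes p: "p > 0" and pos: "\<And>j. p * of_int (ge \<alpha> j) + 2 * of_int (b j) > 0"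
    and def: "\<And>z. z \<in> U \<Longrightarrow> monomial_defined \<alpha> z"
  shows "\<alpha> \<in> SS p"
  unfolding SS_def
proof (intro CollectI allI)
  fix j
  show "kk p j \<le> ge \<alpha> j"
  proof (cases "J0 j")
    case True
    then obtain i z where iz: "A j i > 0" "z \<in> U" "z $ i = 0" by (auto simp: J0_def)
    have "\<alpha> i \<ge> 0" using def[OF iz(2)] iz(3) by (force simp: monomial_defined_def)
    then show ?thesis using True B_nonneg by (simp add: kk_def ge_single[OF iz(2,3,1)])
  next
    case False
    have "- 2 * of_int (b j) < of_int (ge \<alpha> j) * p" using pos[of j] by (simp add: mult.commute)
    then have "- 2 * of_int (b j) / p < of_int (ge \<alpha> j)" using p by (simp only: pos_divide_less_eq)
    then show ?thesis using False by (simp add: kk_def) linarith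
  qed
qed

lemma ge_inj: "ge \<alpha> = ge \<beta> \<Longrightarrow> \<alpha> = \<beta>"
proof
  fix k assume eq: "ge \<alpha> = ge \<beta>"
  have "(\<Sum>j\<in>UNIV. A j k * ge \<alpha> j) = d * \<alpha> k" for \<alpha>
  proof -
    have "(\<Sum>j\<in>UNIV. A j k * ge \<alpha> j) = (\<Sum>i\<in>UNIV. (\<Sum>j\<in>UNIV. B i j * A j k) * \<alpha> i)"
      unfolding ge_def sum_distrib_left sum_distrib_right by (subst sum.swap) (simp add: mult_ac)
    also have "\<dots> = (\<Sum>i\<in>UNIV. if i = k then d * \<alpha> i else 0)" by (intro sum.cong) (auto simp: BA)
    finally show ?thesis by simp
  qed
  from this[of \<alpha>] this[of \<beta>] eq d_pos show "\<alpha> k = \<beta> k" by simp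
qed

lemma Ust_dense: "open (X :: (complex^'n) set) \<Longrightarrow> X \<subseteq> U \<Longrightarrow> X \<noteq> {} \<Longrightarrow> \<exists>z\<in>X. z \<in> Ust"
proof (rule ccontr)
  assume X: "open X" "X \<subseteq> U" "X \<noteq> {}" and "\<not> (\<exists>z\<in>X. z \<in> Ust)"
  then have "AE z in lborel. z \<notin> X" using AE_nz by (auto elim!: eventually_mono simp: Ust_def)
  then have "emeasure lborel X = 0" using X(1) by (subst (asm) AE_iff_measurable[OF _ refl]) auto
  then show False using open_not_negligible[OF X(1,3)] X(1) by (simp add: negligible_iff_emeasure0)
qed

text \<open>The logarithmic coordinates reach only \<open>Ust\<close>; bounds are carried to the
  coordinate hyperplanes by density and continuity.\<close>

lemma cont_le_dense:
  assumes "continuous_on U f" "z \<in> U" "e > 0" and le: "\<And>z'. z' \<in> Ust \<Longrightarrow> dist z z' < e \<Longrightarrow> cmod (f z') \<le> C"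
  shows "cmod (f z) \<le> C"
proof (rule ccontr)
  assume neg: "\<not> cmod (f z) \<le> C"
  define X where "X = {z'\<in>U. cmod (f z') > C} \<inter> ball z e"
  have "open {z'\<in>U. cmod (f z') > C}"
  proof -
    have "open (U \<inter> (\<lambda>z. cmod (f z)) -` {C<..})"
      by (intro continuous_open_preimage continuous_on_norm assms(1) U_open open_greaterThan)
    then show ?thesis by (simp add: vimage_def Int_def)
  qed
  then have "open X" "X \<subseteq> U" "z \<in> X" using neg assms by (auto simp: X_def)
  then obtain z' where "z' \<in> X" "z' \<in> Ust" using Ust_dense[of X] by blast
  then show False using le[of z'] by (auto simp: X_def)
qed

section \<open>Lebesgue measure on the polyhedron and its form in logarithmic coordinates\<close>

definition V :: "(complex^'n) measure" where "V = restrict_space lborel U"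

lemma space_V[simp]: "space V = U" by (simp add: V_def space_restrict_space)

lemma U_sets[measurable]: "U \<in> sets borel" using U_open by simp

lemma sets_V: "sets V = sets (restrict_space borel U)"
  unfolding V_def by (rule sets_restrict_space_cong) simp

lemma V_measurable_cont:
  fixes f :: "complex^'n \<Rightarrow> 'b::topological_space"
  assumes "continuous_on U f" shows "f \<in> borel_measurable V"
  using borel_measurable_continuous_on_restrict[OF assms] measurable_cong_sets[OF sets_V refl, of "borel :: 'b measure"] by blast

lemma nn_integral_V: "(\<integral>\<^sup>+z. f z \<partial>V) = (\<integral>\<^sup>+z. f z * indicator U z \<partial>lborel)"
  unfolding V_def by (rule nn_integral_restrict_space) simp

lemma AE_V: "AE z in V. z \<in> Ust"
  unfolding V_def by (subst AE_restrict_space_iff) (use AE_nz in \<open>auto elim!: eventually_mono simp: Ust_def\<close>)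

text \<open>A choice from the existence statement \<open>nn_integral_E\<close>, which gives no
  formula for the constant.\<close>

definition c0 :: real where
  "c0 = (SOME c. c > 0 \<and> (\<forall>\<phi>\<in>borel_measurable borel. (\<integral>\<^sup>+z. \<phi> z \<partial>lborel) =
     ennreal c * (\<integral>\<^sup>+x. \<phi> (E (cvec x)) * ennreal (exp (- 2 * (\<Sum>j\<in>UNIV. of_int (b j) * fst x $ j))) * indicator torus_box (snd x) \<partial>lborel)))"

lemma c0: "c0 > 0" "\<phi> \<in> borel_measurable borel \<Longrightarrow> (\<integral>\<^sup>+z. \<phi> z \<partial>lborel) =
     ennreal c0 * (\<integral>\<^sup>+x. \<phi> (E (cvec x)) * ennreal (exp (- 2 * (\<Sum>j\<in>UNIV. of_int (b j) * fst x $ j))) * indicator torus_box (snd x) \<partial>lborel)"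
  using someI_ex[OF nn_integral_E, folded c0_def] by blast+

definition DD :: "((real^'n) \<times> (real^'n)) set" where "DD = {x. (\<forall>j. fst x $ j > 0) \<and> snd x \<in> torus_box}"

definition wt :: "(real^'n) \<times> (real^'n) \<Rightarrow> real" where
  "wt x = c0 * exp (- 2 * (\<Sum>j\<in>UNIV. of_int (b j) * fst x $ j))"

text \<open>Normalised so that \<open>V\<close> is exactly its image under \<open>EC\<close>
  (\<open>V_distr\<close>), although \<open>EC\<close> need not be injective on
  \<open>DD\<close>.\<close>

definition W :: "((real^'n) \<times> (real^'n)) measure" where
  "W = density (restrict_space lborel DD) (\<lambda>x. ennreal (wt x))"

lemma DD_sets[measurable]: "DD \<in> sets borel"
proof -
  have "DD = (\<Inter>j. {x \<in> space borel. fst x $ j > 0}) \<inter> (UNIV \<times> torus_box)" by (auto simp: DD_def)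
  also have "\<dots> \<in> sets borel"
  proof (intro sets.Int sets.finite_INT)
    show "UNIV \<times> torus_box \<in> sets (borel :: ((real^'n) \<times> (real^'n)) measure)"
      unfolding borel_prod[symmetric] by (intro pair_measureI) auto
  qed (auto simp del: space_borel)
  finally show ?thesis .
qed

lemma wt_measurable[measurable]: "wt \<in> borel_measurable borel" unfolding wt_def by measurable

lemma wt_pos: "wt x > 0" using c0(1) by (simp add: wt_def)

lemma space_W[simp]: "space W = DD" by (simp add: W_def space_restrict_space)

lemma sets_W[measurable_cong]: "sets W = sets (restrict_space borel DD)"
  unfolding W_def sets_density by (rule sets_restrict_space_cong) simp

lemma nn_integral_W:
  assumes "f \<in> borel_measurable W"
  shows "(\<integral>\<^sup>+x. f x \<partial>W) = (\<integral>\<^sup>+x. ennreal (wt x) * f x * indicator DD x \<partial>lborel)"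
proof -
  have [measurable]: "f \<in> borel_measurable (restrict_space lborel DD)"
    using assms by (simp add: W_def)
  have [measurable]: "(\<lambda>x. ennreal (wt x)) \<in> borel_measurable (restrict_space lborel DD)"
    by (intro measurable_restrict_space1) simp
  show ?thesis unfolding W_def by (subst nn_integral_density, simp, simp, subst nn_integral_restrict_space) auto
qed

definition EC :: "(real^'n) \<times> (real^'n) \<Rightarrow> complex^'n" where "EC x = E (cvec x)"

lemma EC_U: "x \<in> DD \<Longrightarrow> EC x \<in> Ust"
  unfolding EC_def DD_def by (intro E_Ust) simp

lemma EC_measurable[measurable]: "EC \<in> measurable W V"
proof -
  have "EC \<in> measurable (restrict_space borel DD) (restrict_space borel U)"
  proof (rule measurable_restrict_space3)
    show "EC \<in> borel_measurable borel" unfolding EC_def[abs_def] by measurable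
    show "EC \<in> DD \<rightarrow> U" using EC_U unfolding Ust_def by blast
  qed
  then show ?thesis using measurable_cong_sets[OF sets_W sets_V] by blast
qed

lemma nn_integral_V_W:
  assumes f: "f \<in> borel_measurable V"
  shows "(\<integral>\<^sup>+z. f z \<partial>V) = (\<integral>\<^sup>+x. f (EC x) \<partial>W)"
proof -
  have [measurable]: "(\<lambda>z. f z * indicator U z) \<in> borel_measurable borel"
    using f unfolding V_def by (subst (asm) borel_measurable_restrict_space_iff_ennreal) auto
  have "(\<integral>\<^sup>+z. f z \<partial>V) = ennreal c0 * (\<integral>\<^sup>+x. (f (E (cvec x)) * indicator U (E (cvec x))) * ennreal (exp (- 2 * (\<Sum>j\<in>UNIV. of_int (b j) * fst x $ j))) * indicator torus_box (snd x) \<partial>lborel)"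
    unfolding nn_integral_V by (rule c0(2)) measurable
  also have "\<dots> = (\<integral>\<^sup>+x. ennreal c0 * ((f (E (cvec x)) * indicator U (E (cvec x))) * ennreal (exp (- 2 * (\<Sum>j\<in>UNIV. of_int (b j) * fst x $ j))) * indicator torus_box (snd x)) \<partial>lborel)"
  proof (rule nn_integral_cmult[symmetric])
    have [measurable]: "(\<lambda>x::(real^'n) \<times> (real^'n). indicator torus_box (snd x) :: ennreal) \<in> borel_measurable borel"
      unfolding borel_prod[symmetric] by measurable
    show "(\<lambda>x. (f (E (cvec x)) * indicator U (E (cvec x))) * ennreal (exp (- 2 * (\<Sum>j\<in>UNIV. of_int (b j) * fst x $ j))) * indicator torus_box (snd x)) \<in> borel_measurable lborel"
      by measurable
  qed
  also have "\<dots> = (\<integral>\<^sup>+x. ennreal (wt x) * f (EC x) * indicator DD x \<partial>lborel)"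
  proof (rule nn_integral_cong)
    fix x :: "(real^'n) \<times> (real^'n)"
    have "E (cvec x) \<in> U \<longleftrightarrow> (\<forall>j. fst x $ j > 0)" by (simp add: E_in_U)
    then show "ennreal c0 * ((f (E (cvec x)) * indicator U (E (cvec x))) * ennreal (exp (- 2 * (\<Sum>j\<in>UNIV. of_int (b j) * fst x $ j))) * indicator torus_box (snd x)) = ennreal (wt x) * f (EC x) * indicator DD x"
      using c0(1) by (cases "E (cvec x) \<in> U"; cases "snd x \<in> torus_box")
        (simp_all add: wt_def EC_def DD_def ennreal_mult mult_ac)
  qed
  also have "\<dots> = (\<integral>\<^sup>+x. f (EC x) \<partial>W)"
    by (rule nn_integral_W[symmetric]) (rule measurable_compose[OF EC_measurable f])
  finally show ?thesis .
qed

lemma V_distr: "V = distr W V EC"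
proof (rule measure_eqI)
  fix X assume [measurable]: "X \<in> sets V"
  have "emeasure V X = (\<integral>\<^sup>+z. indicator X z \<partial>V)" by simp
  also have "\<dots> = (\<integral>\<^sup>+x. indicator X (EC x) \<partial>W)" by (rule nn_integral_V_W) simp
  also have "\<dots> = (\<integral>\<^sup>+x. indicator X x \<partial>distr W V EC)" by (rule nn_integral_distr[symmetric]) measurable
  finally show "emeasure V X = emeasure (distr W V EC) X" by simp
qed simp

end

context polyhedron begin

lemma integral_V_W:
  fixes f :: "complex^'n \<Rightarrow> complex"
  assumes "f \<in> borel_measurable V"
  shows "(LINT z|V. f z) = (LINT x|W. f (EC x))"
proof -
  have "integral\<^sup>L V f = integral\<^sup>L (distr W V EC) f"
    using V_distr by (rule arg_cong[where f="\<lambda>M. integral\<^sup>L M f"])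
  also have "\<dots> = (LINT x|W. f (EC x))" by (rule integral_distr[OF EC_measurable assms])
  finally show ?thesis .
qed

lemma finite_measure_V: "finite_measure V"
proof (rule finite_measureI)
  have "(\<integral>\<^sup>+z. 1 \<partial>V) = (\<integral>\<^sup>+z. 1 * indicator U z \<partial>lborel)" by (rule nn_integral_V)
  also have "\<dots> = emeasure lborel U" by (simp only: mult_1) (rule nn_integral_indicator, simp)
  also have "\<dots> < \<infinity>" using U_bounded by (rule emeasure_bounded_finite)
  finally show "emeasure V (space V) \<noteq> \<infinity>" by (simp only: nn_integral_const mult_1 infinity_ennreal_def less_top not_False_eq_True simp_thms)
qed

lemma finite_measure_W: "finite_measure W"
proof (rule finite_measureI)
  have "(\<integral>\<^sup>+z. 1 \<partial>V) = (\<integral>\<^sup>+x. 1 \<partial>W)" by (rule nn_integral_V_W) (rule measurable_const, rule UNIV_I[THEN space_borel[THEN equalityD2, THEN subsetD]])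
  then have "emeasure V (space V) = emeasure W (space W)" by (simp only: nn_integral_const mult_1)
  then show "emeasure W (space W) \<noteq> \<infinity>"
    using finite_measure.emeasure_finite[OF finite_measure_V, of "space V"] by (simp only: infinity_ennreal_def not_False_eq_True)
qed


lemma unimodular_U:
  assumes "u \<in> utorus" shows "u * z \<in> U \<longleftrightarrow> z \<in> U"
proof -
  have "cmod (monomial \<alpha> (u * z)) = cmod (monomial \<alpha> z)" for \<alpha>
    by (simp add: monomial_mult norm_mult norm_monomial_utorus[OF assms])
  moreover have "monomial_defined \<alpha> (u * z) = monomial_defined \<alpha> z" for \<alpha>
    using utorus_nz[OF assms] by (simp add: monomial_defined_def)
  ultimately show ?thesis by (simp add: U_eq monomial_polyhedron_set_def)
qed

lemma mult_measurable_V: "u \<in> utorus \<Longrightarrow> (*) u \<in> measurable V V"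
proof -
  assume u: "u \<in> utorus"
  have "(*) u \<in> measurable (restrict_space borel U) (restrict_space borel U)"
    by (rule measurable_restrict_space3) (use unimodular_U[OF u] in auto)
  then show ?thesis using measurable_cong_sets[OF sets_V sets_V] by blast
qed

lemma V_rotation:
  assumes u: "u \<in> utorus" shows "distr V V ((*) u) = V"
proof (rule measure_eqI)
  fix X assume "X \<in> sets (distr V V ((*) u))"
  then have X: "X \<in> sets V" by simp
  have ind: "indicator X \<in> borel_measurable V" using X by simp
  have [measurable]: "(\<lambda>z. indicator X z * indicator U z :: ennreal) \<in> borel_measurable borel"
    using ind unfolding V_def by (subst (asm) borel_measurable_restrict_space_iff_ennreal) auto
  have one: "ennreal (\<Prod>i\<in>UNIV. (cmod (u $ i))\<^sup>2) = 1" using u by (simp add: utorus_def unimodular_def)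
  have "emeasure (distr V V ((*) u)) X = (\<integral>\<^sup>+z. indicator X z \<partial>distr V V ((*) u))" using X by simp
  also have "\<dots> = (\<integral>\<^sup>+z. indicator X (u * z) \<partial>V)"
    by (rule nn_integral_distr[OF mult_measurable_V[OF u]]) (use ind in simp)
  also have "\<dots> = (\<integral>\<^sup>+z. indicator X (u * z) * indicator U (u * z) \<partial>lborel)"
    unfolding nn_integral_V using unimodular_U[OF u] by (intro nn_integral_cong) (simp add: indicator_def)
  also have "\<dots> = (\<integral>\<^sup>+z. indicator X z * indicator U z \<partial>lborel)"
    using nn_integral_lborel_cmul[of "\<lambda>z. indicator X z * indicator U z" u] utorus_nz[OF u] by (simp only: one mult_1) simp
  also have "\<dots> = emeasure V X" unfolding nn_integral_V[symmetric] using X by simp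
  finally show "emeasure (distr V V ((*) u)) X = emeasure V X" .
qed simp

lemma measurable_EC: "f \<in> borel_measurable V \<Longrightarrow> (\<lambda>x. f (EC x)) \<in> borel_measurable W"
  by (rule measurable_compose[OF EC_measurable])

lemma measurable_V_borel: "f \<in> borel_measurable borel \<Longrightarrow> f \<in> borel_measurable V"
  unfolding V_def by (rule measurable_restrict_space1) simp

lemma measurable_W_borel: "f \<in> borel_measurable borel \<Longrightarrow> f \<in> borel_measurable W"
  using measurable_restrict_space1[of f borel _ DD] measurable_cong_sets[OF sets_W refl] by blast

lemma indicator_DD: "(indicator DD x :: ennreal) = (\<Prod>j\<in>UNIV. indicator {0<..} (fst x $ j) * indicator {0..<2*pi} (snd x $ j))"
proof (cases "x \<in> DD")
  case True
  then show ?thesis by (simp add: DD_def torus_box_def)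
next
  case False
  then obtain j where "indicator {0<..} (fst x $ j) * indicator {0..<2*pi} (snd x $ j) = (0::ennreal)"
    by (force simp: DD_def torus_box_def indicator_def split: if_splits)
  then have "(\<Prod>j\<in>UNIV. indicator {0<..} (fst x $ j) * indicator {0..<2*pi} (snd x $ j)) = (0::ennreal)"
    by (intro prod_zero) auto
  then show ?thesis using False by simp
qed

text \<open>The density and the indicator of \<open>DD\<close> are products over the coordinates, so
  the integral of a product splits into double integrals over half-strips.\<close>

lemma nn_integral_W_prod:
  fixes f :: "'n \<Rightarrow> real \<Rightarrow> real \<Rightarrow> ennreal"
  assumes f[measurable]: "\<And>j. (\<lambda>(y, s). f j y s) \<in> borel_measurable (borel \<Otimes>\<^sub>M borel)"
  shows "(\<integral>\<^sup>+x. (\<Prod>j\<in>UNIV. f j (fst x $ j) (snd x $ j)) \<partial>W) =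
    ennreal c0 * (\<Prod>j\<in>UNIV. \<integral>\<^sup>+y. \<integral>\<^sup>+s. f j y s * ennreal (exp (- 2 * of_int (b j) * y)) * indicator {0<..} y * indicator {0..<2*pi} s \<partial>lborel \<partial>lborel)"
proof -
  have fm[measurable]: "(\<lambda>x::(real^'n) \<times> (real^'n). f j (fst x $ j) (snd x $ j)) \<in> borel_measurable borel" for j
    using measurable_compose[OF measurable_Pair[OF fst_nth_measurable snd_nth_measurable] f[of j]] by simp
  define F where "F j y s = f j y s * ennreal (exp (- 2 * of_int (b j) * y)) * indicator {0<..} y * indicator {0..<2*pi} s" for j y s
  have Fm[measurable]: "(\<lambda>(y, s). F j y s) \<in> borel_measurable (borel \<Otimes>\<^sub>M borel)" for j
    unfolding F_def using f[of j] by measurable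
  have Fm'[measurable]: "(\<lambda>x. (\<Prod>j\<in>UNIV. F j (fst x $ j) (snd x $ j))) \<in> borel_measurable ((borel :: (real^'n) measure) \<Otimes>\<^sub>M (borel :: (real^'n) measure))"
  proof (rule borel_measurable_prod_ennreal)
    fix j
    have "(\<lambda>x. (fst x $ j, snd x $ j)) \<in> measurable ((borel :: (real^'n) measure) \<Otimes>\<^sub>M (borel :: (real^'n) measure)) (borel \<Otimes>\<^sub>M borel)" by measurable
    from measurable_compose[OF this Fm[of j]]
    show "(\<lambda>x. F j (fst x $ j) (snd x $ j)) \<in> borel_measurable ((borel :: (real^'n) measure) \<Otimes>\<^sub>M (borel :: (real^'n) measure))" by simp
  qed
  have wt_eq: "ennreal (wt x) = ennreal c0 * (\<Prod>j\<in>UNIV. ennreal (exp (- 2 * of_int (b j) * fst x $ j)))" for x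
  proof -
    have "exp (- 2 * (\<Sum>j\<in>UNIV. of_int (b j) * fst x $ j)) = (\<Prod>j\<in>UNIV. exp (- 2 * of_int (b j) * fst x $ j))"
      by (simp add: exp_sum[symmetric] sum_distrib_left mult.assoc)
    then show ?thesis using c0(1) by (simp add: wt_def prod_ennreal ennreal_mult prod_nonneg)
  qed
  have "(\<integral>\<^sup>+x. (\<Prod>j\<in>UNIV. f j (fst x $ j) (snd x $ j)) \<partial>W) = (\<integral>\<^sup>+x. ennreal (wt x) * (\<Prod>j\<in>UNIV. f j (fst x $ j) (snd x $ j)) * indicator DD x \<partial>lborel)"
    by (rule nn_integral_W) (rule measurable_W_borel, measurable)
  also have "\<dots> = (\<integral>\<^sup>+x. ennreal c0 * (\<Prod>j\<in>UNIV. F j (fst x $ j) (snd x $ j)) \<partial>lborel)"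
    unfolding wt_eq indicator_DD F_def by (simp add: prod.distrib mult_ac)
  also have "\<dots> = ennreal c0 * (\<integral>\<^sup>+x. (\<Prod>j\<in>UNIV. F j (fst x $ j) (snd x $ j)) \<partial>(lborel \<Otimes>\<^sub>M lborel))"
    unfolding lborel_prod[symmetric] by (rule nn_integral_cmult) simp
  also have "(\<integral>\<^sup>+x. (\<Prod>j\<in>UNIV. F j (fst x $ j) (snd x $ j)) \<partial>(lborel \<Otimes>\<^sub>M lborel)) = (\<integral>\<^sup>+y. \<integral>\<^sup>+s. (\<Prod>j\<in>UNIV. F j (y $ j) (s $ j)) \<partial>(lborel :: (real^'n) measure) \<partial>(lborel :: (real^'n) measure))"
    by (subst lborel.nn_integral_fst[symmetric]) simp_all
  also have "\<dots> = (\<integral>\<^sup>+y. (\<Prod>j\<in>UNIV. \<integral>\<^sup>+s. F j (y $ j) s \<partial>lborel) \<partial>(lborel :: (real^'n) measure))"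
  proof (rule nn_integral_cong, rule nn_integral_lborel_vec_prod)
    fix y :: "real^'n" and j
    show "F j (y $ j) \<in> borel_measurable borel"
      using measurable_compose[OF measurable_Pair1' Fm[of j], of "y $ j"] by simp
  qed
  also have "\<dots> = (\<Prod>j\<in>UNIV. \<integral>\<^sup>+y. \<integral>\<^sup>+s. F j y s \<partial>lborel \<partial>lborel)"
  proof (rule nn_integral_lborel_vec_prod)
    fix j
    show "(\<lambda>y. \<integral>\<^sup>+s. F j y s \<partial>lborel) \<in> borel_measurable borel"
      using lborel.borel_measurable_nn_integral_fst[of "\<lambda>(y, s). F j y s" borel] by simp
  qed
  finally show ?thesis unfolding F_def .
qed

end

section \<open>Norms of the monomials\<close>

lemma nn_integral_exp_tail:
  "(\<integral>\<^sup>+y. ennreal (exp (- a * y)) * indicator {0<..} y \<partial>lborel) = (if a > 0 then ennreal (1 / a) else \<infinity>)"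
proof (cases "a > 0")
  case True
  have "((\<lambda>y. exp (- a * y)) has_integral 1 / a) {0..}"
    using has_integral_exp_minus_to_infinity[OF True, of 0] by simp
  then have "((\<lambda>y. indicator {0..} y * exp (- a * y)) has_integral 1 / a) UNIV"
    by (subst (asm) has_integral_restrict_UNIV[symmetric]) (simp add: indicator_def if_distrib[of "\<lambda>x. x * _"] of_bool_def cong: if_cong)
  then have "(\<integral>\<^sup>+y. ennreal (indicator {0..} y * exp (- a * y)) \<partial>lborel) = ennreal (1 / a)"
    by (intro nn_integral_has_integral_lborel) auto
  moreover have "(\<integral>\<^sup>+y. ennreal (exp (- a * y)) * indicator {0<..} y \<partial>lborel) = (\<integral>\<^sup>+y. ennreal (indicator {0..} y * exp (- a * y)) \<partial>lborel)"
  proof (rule nn_integral_cong_AE)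
    have "AE y in lborel. y \<noteq> (0::real)" by (rule AE_lborel_singleton)
    then show "AE y in lborel. ennreal (exp (- a * y)) * indicator {0<..} y = ennreal (indicator {0..} y * exp (- a * y))"
      by eventually_elim (auto simp: indicator_def)
  qed
  ultimately show ?thesis using True by simp
next
  case False
  have "emeasure lborel {0::real<..} = \<infinity>"
  proof (rule ccontr)
    assume fin: "emeasure lborel {0::real<..} \<noteq> \<infinity>"
    then obtain m where m: "emeasure lborel {0::real<..} = ennreal m" "m \<ge> 0" by (cases "emeasure lborel {0::real<..}") auto
    have "emeasure lborel {0<..<m + 1} \<le> emeasure lborel {0::real<..}" by (rule emeasure_mono) auto
    then have "ennreal (m + 1) \<le> ennreal m" using m by simp
    then show False using m(2) by (simp add: ennreal_le_iff)
  qed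
  then have "\<infinity> = (\<integral>\<^sup>+y. indicator {0::real<..} y \<partial>lborel)" by simp
  also have "\<dots> \<le> (\<integral>\<^sup>+y. ennreal (exp (- a * y)) * indicator {0<..} y \<partial>lborel)"
  proof (rule nn_integral_mono)
    fix y :: real
    have "1 \<le> exp (- a * y)" if "y > 0" using that False by (simp add: mult_nonpos_nonneg)
    then show "indicator {0<..} y \<le> ennreal (exp (- a * y)) * indicator {0<..} y"
      by (auto simp: indicator_def)
  qed
  finally show ?thesis using False by (simp add: top_unique)
qed

lemma borel_measurable_power_int[measurable (raw)]:
  fixes f :: "'a \<Rightarrow> complex"
  assumes [measurable]: "f \<in> borel_measurable M"
  shows "(\<lambda>x. f x powi k) \<in> borel_measurable M"
  unfolding power_int_def by (cases "k \<ge> 0") simp_all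

lemma monomial_measurable[measurable]: "monomial \<alpha> \<in> borel_measurable borel"
  unfolding monomial_def by measurable

context polyhedron begin

lemma lpI_monomial_prod:
  assumes p: "p > 0"
  shows "lpI p V (monomial \<alpha>) = ennreal c0 * (\<Prod>j\<in>UNIV. (if p * of_int (ge \<alpha> j) + 2 * of_int (b j) > 0
     then ennreal (1 / (p * of_int (ge \<alpha> j) + 2 * of_int (b j))) else \<infinity>) * ennreal (2 * pi))"
proof -
  have "lpI p V (monomial \<alpha>) = (\<integral>\<^sup>+x. ennreal (cmod (monomial \<alpha> (EC x)) powr p) \<partial>W)"
    unfolding lpI_def by (rule nn_integral_V_W) (rule measurable_V_borel, measurable)
  also have "\<dots> = (\<integral>\<^sup>+x. (\<Prod>j\<in>UNIV. ennreal (exp (- p * of_int (ge \<alpha> j) * fst x $ j))) \<partial>W)"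
  proof (rule nn_integral_cong)
    fix x
    have "cmod (monomial \<alpha> (EC x)) powr p = exp (\<Sum>j\<in>UNIV. - p * of_int (ge \<alpha> j) * fst x $ j)"
      by (simp add: EC_def norm_monomial_E exp_powr_real sum_distrib_right sum_distrib_left sum_negf mult_ac)
    also have "\<dots> = (\<Prod>j\<in>UNIV. exp (- p * of_int (ge \<alpha> j) * fst x $ j))" by (simp add: exp_sum)
    finally show "ennreal (cmod (monomial \<alpha> (EC x)) powr p) = (\<Prod>j\<in>UNIV. ennreal (exp (- p * of_int (ge \<alpha> j) * fst x $ j)))"
      by (simp add: prod_ennreal)
  qed
  also have "\<dots> = ennreal c0 * (\<Prod>j\<in>UNIV. \<integral>\<^sup>+y. \<integral>\<^sup>+s. ennreal (exp (- p * of_int (ge \<alpha> j) * y)) * ennreal (exp (- 2 * of_int (b j) * y)) * indicator {0<..} y * indicator {0..<2*pi} s \<partial>lborel \<partial>lborel)"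
    by (rule nn_integral_W_prod[of "\<lambda>j y s. ennreal (exp (- p * of_int (ge \<alpha> j) * y))"]) measurable
  also have "(\<lambda>j. \<integral>\<^sup>+y. \<integral>\<^sup>+s. ennreal (exp (- p * of_int (ge \<alpha> j) * y)) * ennreal (exp (- 2 * of_int (b j) * y)) * indicator {0<..} y * indicator {0..<2*pi} s \<partial>lborel \<partial>lborel)
     = (\<lambda>j. (if p * of_int (ge \<alpha> j) + 2 * of_int (b j) > 0 then ennreal (1 / (p * of_int (ge \<alpha> j) + 2 * of_int (b j))) else \<infinity>) * ennreal (2 * pi))"
  proof
    fix j
    have e: "ennreal (exp (- p * of_int (ge \<alpha> j) * y)) * ennreal (exp (- 2 * of_int (b j) * y)) = ennreal (exp (- (p * of_int (ge \<alpha> j) + 2 * of_int (b j)) * y))" for y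
      by (simp add: ennreal_mult[symmetric] exp_add[symmetric] algebra_simps)
    have "(\<integral>\<^sup>+y. \<integral>\<^sup>+s. ennreal (exp (- p * of_int (ge \<alpha> j) * y)) * ennreal (exp (- 2 * of_int (b j) * y)) * indicator {0<..} y * indicator {0..<2*pi} s \<partial>lborel \<partial>lborel)
      = (\<integral>\<^sup>+y. ennreal (exp (- (p * of_int (ge \<alpha> j) + 2 * of_int (b j)) * y)) * indicator {0<..} y * ennreal (2 * pi) \<partial>lborel)"
      unfolding e by (simp add: nn_integral_cmult)
    also have "\<dots> = (\<integral>\<^sup>+y. ennreal (exp (- (p * of_int (ge \<alpha> j) + 2 * of_int (b j)) * y)) * indicator {0<..} y \<partial>lborel) * ennreal (2 * pi)"
      by (rule nn_integral_multc) measurable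
    finally show "(\<integral>\<^sup>+y. \<integral>\<^sup>+s. ennreal (exp (- p * of_int (ge \<alpha> j) * y)) * ennreal (exp (- 2 * of_int (b j) * y)) * indicator {0<..} y * indicator {0..<2*pi} s \<partial>lborel \<partial>lborel) = (if p * of_int (ge \<alpha> j) + 2 * of_int (b j) > 0 then ennreal (1 / (p * of_int (ge \<alpha> j) + 2 * of_int (b j))) else \<infinity>) * ennreal (2 * pi)"
      by (simp only: nn_integral_exp_tail)
  qed
  finally show ?thesis .
qed

text \<open>\<open>K0 / NN p \<alpha>\<close> is the p-th power of the norm of the monomial, for
  \<alpha> in \<open>SS p\<close>; \<open>NN\<close> thus supplies the polynomial factors of the
  kernel.\<close>

definition NN :: "real \<Rightarrow> ('n \<Rightarrow> int) \<Rightarrow> real" where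
  "NN p \<alpha> = (\<Prod>j\<in>UNIV. p * of_int (ge \<alpha> j) + 2 * of_int (b j))"

definition K0 :: real where "K0 = c0 * (2 * pi) ^ CARD('n)"

lemma K0_pos: "K0 > 0" using c0(1) by (simp add: K0_def)

lemma lpI_monomial:
  assumes p: "p > 0" and pos: "\<And>j. p * of_int (ge \<alpha> j) + 2 * of_int (b j) > 0"
  shows "lpI p V (monomial \<alpha>) = ennreal (K0 / NN p \<alpha>)"
proof -
  have "lpI p V (monomial \<alpha>) = ennreal c0 * (\<Prod>j\<in>UNIV. ennreal (1 / (p * of_int (ge \<alpha> j) + 2 * of_int (b j)) * (2 * pi)))"
  proof -
    have "(if p * of_int (ge \<alpha> j) + 2 * of_int (b j) > 0 then ennreal (1 / (p * of_int (ge \<alpha> j) + 2 * of_int (b j))) else \<infinity>) * ennreal (2 * pi)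
      = ennreal (1 / (p * of_int (ge \<alpha> j) + 2 * of_int (b j)) * (2 * pi))" for j
      unfolding if_P[OF pos] by (rule ennreal_mult[symmetric]) (use pos[of j] in auto)
    then show ?thesis by (simp only: lpI_monomial_prod[OF p])
  qed
  also have "\<dots> = ennreal c0 * ennreal (\<Prod>j\<in>UNIV. 1 / (p * of_int (ge \<alpha> j) + 2 * of_int (b j)) * (2 * pi))"
    using pos by (subst prod_ennreal) (auto simp: less_imp_le)
  also have "(\<Prod>j\<in>UNIV. 1 / (p * of_int (ge \<alpha> j) + 2 * of_int (b j)) * (2 * pi)) = (2 * pi) ^ CARD('n) / NN p \<alpha>"
    unfolding prod.distrib NN_def by (simp add: prod_dividef)
  finally show ?thesis using c0(1) pos by (simp add: K0_def NN_def ennreal_mult[symmetric] prod_nonneg less_imp_le)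
qed

text \<open>One divergent factor makes the product infinite, because no other factor is 0.\<close>

lemma lpI_monomial_finite:
  assumes p: "p > 0" and fin: "lpI p V (monomial \<alpha>) < \<infinity>"
  shows "p * of_int (ge \<alpha> j) + 2 * of_int (b j) > 0"
proof (rule ccontr)
  assume neg: "\<not> ?thesis"
  define F where "F j = (if p * of_int (ge \<alpha> j) + 2 * of_int (b j) > 0 then ennreal (1 / (p * of_int (ge \<alpha> j) + 2 * of_int (b j))) else \<infinity>) * ennreal (2 * pi)" for j
  have F0: "F k \<noteq> 0" for k by (auto simp: F_def)
  have "lpI p V (monomial \<alpha>) = ennreal c0 * (F j * (\<Prod>k\<in>UNIV - {j}. F k))"
    unfolding lpI_monomial_prod[OF p] F_def[symmetric] by (subst prod.remove[of UNIV j]) auto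
  moreover have "F j = \<infinity>" using neg by (simp add: F_def ennreal_mult_eq_top_iff)
  moreover have "(\<Prod>k\<in>UNIV - {j}. F k) \<noteq> 0" using F0 by (simp add: prod_zero_iff)
  ultimately show False using fin c0(1) by (simp add: ennreal_mult_eq_top_iff)
qed

lemma NN_pos: "p > 0 \<Longrightarrow> \<alpha> \<in> SS p \<Longrightarrow> NN p \<alpha> > 0"
  unfolding NN_def by (intro prod_pos) (simp add: SS_pos)

lemma lpS_monomial: "p > 0 \<Longrightarrow> \<alpha> \<in> SS p \<Longrightarrow> lpS p V (monomial \<alpha>)"
  unfolding lpS_def by (subst lpI_monomial) (auto simp: SS_pos intro: measurable_V_borel)

lemma lpN_monomial: "p > 0 \<Longrightarrow> \<alpha> \<in> SS p \<Longrightarrow> lpN p V (monomial \<alpha>) = (K0 / NN p \<alpha>) powr (1 / p)"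
  unfolding lpN_def using K0_pos NN_pos[of p \<alpha>] by (subst lpI_monomial) (auto simp: SS_pos less_imp_le)

end

section \<open>The twisting map\<close>

lemma twist_measurable[measurable]: "twist p \<in> borel_measurable borel"
  unfolding twist_def by measurable

lemma twist_mult: "u \<in> utorus \<Longrightarrow> twist p (u * z) = u * twist p z"
  by (simp add: twist_def vec_eq_iff norm_mult utorus_def unimodular_def)

lemma norm_twist: "p > 1 \<Longrightarrow> cmod (twist p z $ i) = cmod (z $ i) powr (p - 1)"
proof -
  assume p: "p > 1"
  show ?thesis
  proof (cases "z $ i = 0")
    case False
    then have "cmod (z $ i) * cmod (z $ i) powr (p - 2) = cmod (z $ i) powr (1 + (p - 2))"
      by (subst powr_add) simp
    then show ?thesis by (simp add: twist_def norm_mult)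
  qed (use p in \<open>simp add: twist_def\<close>)
qed

lemma twist_eq_0: "p > 1 \<Longrightarrow> twist p z $ i = 0 \<longleftrightarrow> z $ i = 0"
  using norm_twist[of p z i] by (metis norm_eq_zero powr_eq_0_iff)

lemma powr_powi: "r \<ge> 0 \<Longrightarrow> c > 0 \<Longrightarrow> r > 0 \<or> k \<ge> 0 \<Longrightarrow> (r powr c) powi k = (r powi k) powr c" for r c :: real
proof (cases "r = 0")
  case True
  assume "c > 0" "r > 0 \<or> k \<ge> 0"
  then show ?thesis using True by (cases "k = 0") (simp_all add: power_int_0_left_if)
next
  case False
  assume "r \<ge> 0"
  then have r: "r > 0" using False by simp
  have "(r powr c) powi k = (r powr c) powr (of_int k)" using r by (simp add: powr_real_of_int')
  also have "\<dots> = (r powr (of_int k)) powr c" by (simp add: powr_powr mult.commute)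
  finally show ?thesis using r by (simp add: powr_real_of_int')
qed

lemma norm_monomial_twist:
  assumes p: "p > 1" and def: "monomial_defined \<alpha> z"
  shows "cmod (monomial \<alpha> (twist p z)) = cmod (monomial \<alpha> z) powr (p - 1)"
proof -
  have "cmod (monomial \<alpha> (twist p z)) = (\<Prod>i\<in>UNIV. (cmod (z $ i) powr (p - 1)) powi \<alpha> i)"
    by (simp add: monomial_def prod_norm[symmetric] norm_power_int norm_twist[OF p])
  also have "\<dots> = (\<Prod>i\<in>UNIV. (cmod (z $ i) powi \<alpha> i) powr (p - 1))"
  proof (intro prod.cong refl powr_powi)
    show "0 < cmod (z $ i) \<or> 0 \<le> \<alpha> i" for i
      using def by (cases "\<alpha> i < 0") (auto simp: monomial_defined_def)
  qed (use p in auto)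
  also have "\<dots> = (\<Prod>i\<in>UNIV. cmod (z $ i) powi \<alpha> i) powr (p - 1)"
    by (rule prod_powr_distrib[symmetric])
  finally show ?thesis by (simp add: monomial_def prod_norm[symmetric] norm_power_int)
qed

definition scl :: "real \<Rightarrow> (real^'n) \<times> (real^'n) \<Rightarrow> (real^'n) \<times> (real^'n)" where
  "scl p x = ((p - 1) *\<^sub>R fst x, snd x)"

lemma nn_integral_scl:
  fixes \<phi> :: "(real^'n) \<times> (real^'n) \<Rightarrow> ennreal"
  assumes m: "\<phi> \<in> borel_measurable borel" and p: "p > 1"
  shows "(\<integral>\<^sup>+x. \<phi> x \<partial>lborel) = ennreal ((p - 1) ^ CARD('n)) * (\<integral>\<^sup>+x. \<phi> (scl p x) \<partial>lborel)"
proof -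
  have [measurable]: "\<phi> \<in> borel_measurable (borel \<Otimes>\<^sub>M borel)" using m by (simp add: borel_prod)
  have "(\<integral>\<^sup>+x. \<phi> x \<partial>lborel) = (\<integral>\<^sup>+y. \<integral>\<^sup>+s. \<phi> (y, s) \<partial>lborel \<partial>lborel)"
    unfolding lborel_prod[symmetric] by (subst lborel.nn_integral_fst[symmetric]) simp_all
  also have "\<dots> = ennreal ((p - 1) ^ CARD('n)) * (\<integral>\<^sup>+y. \<integral>\<^sup>+s. \<phi> ((p - 1) *\<^sub>R y, s) \<partial>lborel \<partial>lborel)"
    by (subst nn_integral_lborel_affine[where c="p - 1" and t=0 and \<phi>="\<lambda>y. \<integral>\<^sup>+s. \<phi> (y, s) \<partial>lborel"]) (use p in simp_all)
  also have "(\<integral>\<^sup>+y. \<integral>\<^sup>+s. \<phi> ((p - 1) *\<^sub>R y, s) \<partial>lborel \<partial>lborel) = (\<integral>\<^sup>+x. \<phi> (scl p x) \<partial>lborel)"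
    unfolding lborel_prod[symmetric] scl_def by (subst lborel.nn_integral_fst[symmetric]) simp_all
  finally show ?thesis .
qed

context polyhedron begin

lemma twist_EC: "twist p (EC x) = EC (scl p x)"
proof (subst vec_eq_iff, intro allI)
  fix i
  define \<zeta> where "\<zeta> = - (\<Sum>j\<in>UNIV. of_int (B i j) * cvec x $ j)"
  have 1: "EC x $ i = exp \<zeta>" by (simp add: EC_def E_def \<zeta>_def)
  have 2: "- (\<Sum>j\<in>UNIV. of_int (B i j) * cvec (scl p x) $ j) = \<zeta> + of_real ((p - 2) * Re \<zeta>)"
  proof (rule complex_eqI)
    have "Re (- (\<Sum>j\<in>UNIV. of_int (B i j) * cvec (scl p x) $ j)) = (p - 1) * Re \<zeta>"
      by (simp add: \<zeta>_def scl_def sum_distrib_left mult_ac)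
    then show "Re (- (\<Sum>j\<in>UNIV. of_int (B i j) * cvec (scl p x) $ j)) = Re (\<zeta> + of_real ((p - 2) * Re \<zeta>))"
      by (simp add: algebra_simps)
    show "Im (- (\<Sum>j\<in>UNIV. of_int (B i j) * cvec (scl p x) $ j)) = Im (\<zeta> + of_real ((p - 2) * Re \<zeta>))"
      by (simp add: \<zeta>_def scl_def)
  qed
  have "twist p (EC x) $ i = exp \<zeta> * of_real (exp ((p - 2) * Re \<zeta>))"
    by (simp add: twist_def 1 exp_powr_real mult.commute)
  also have "\<dots> = exp (\<zeta> + of_real ((p - 2) * Re \<zeta>))" by (simp only: exp_add exp_of_real)
  also have "\<dots> = EC (scl p x) $ i" unfolding 2[symmetric] by (simp add: EC_def E_def)
  finally show "twist p (EC x) $ i = EC (scl p x) $ i" .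
qed

lemma twist_U: "p > 1 \<Longrightarrow> z \<in> U \<Longrightarrow> twist p z \<in> U"
proof -
  assume p: "p > 1" and z: "z \<in> U"
  have "cmod (monomial (A j) (twist p z)) < 1" if "monomial_defined (A j) z" "cmod (monomial (A j) z) < 1" for j
    unfolding norm_monomial_twist[OF p that(1)] using that(2) p powr_less_mono2[of "p - 1" "cmod (monomial (A j) z)" 1] by simp
  then show ?thesis using z unfolding U_eq monomial_polyhedron_set_def monomial_defined_def by (auto simp: twist_eq_0[OF p])
qed

lemma twist_measurable_V: "p > 1 \<Longrightarrow> twist p \<in> measurable V V"
proof -
  assume p: "p > 1"
  have "twist p \<in> measurable (restrict_space borel U) (restrict_space borel U)"
    by (rule measurable_restrict_space3[OF twist_measurable]) (use twist_U[OF p] in auto)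
  then show ?thesis using measurable_cong_sets[OF sets_V sets_V] by blast
qed

lemma twist_Ust: "p > 1 \<Longrightarrow> z \<in> Ust \<Longrightarrow> twist p z \<in> Ust"
  unfolding Ust_def by (simp add: twist_U twist_eq_0)

lemma norm_prod_EC: "cmod (\<Prod>i\<in>UNIV. EC x $ i) = exp (- (\<Sum>j\<in>UNIV. of_int (b j) * fst x $ j))"
proof -
  have "(cmod (\<Prod>i\<in>UNIV. EC x $ i))\<^sup>2 = exp (- 2 * (\<Sum>j\<in>UNIV. of_int (b j) * Re (cvec x $ j)))"
    unfolding prod_norm_E[symmetric] EC_def by (simp add: prod_norm[symmetric] prod_power_distrib)
  also have "\<dots> = (exp (- (\<Sum>j\<in>UNIV. of_int (b j) * fst x $ j)))\<^sup>2" by (simp add: exp_double[symmetric])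
  finally show ?thesis by (rule power2_eq_imp_eq) auto
qed

lemma bergman_one: "bergman_integral p (\<lambda>_. 1) U f = lpI p V f"
  unfolding bergman_integral_def lpI_def nn_integral_V by (simp add: nn_integral_completion)

text \<open>In logarithmic coordinates composition with the twist is the substitution of (p - 1) y
  for y, with Jacobian (p - 1)^n. The weight \<open>eta\<close> is the matching density quotient:
  \<open>wt\<close> times \<open>eta\<close> at the scaled point is (q - 1) times \<open>wt\<close>
  at the original one, because (q - 1) (p - 1) = 1.\<close>

lemma bergman_eta:
  assumes p: "p > 1" and q: "q = p / (p - 1)" and g: "g \<in> borel_measurable V"
  shows "bergman_integral q (eta q) U g = ennreal ((q - 1) * (p - 1) ^ CARD('n)) * lpI q V (\<lambda>z. g (twist p z))"
proof -
  have q1: "q > 1" using p q by simp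
  have qp: "(q - 1) * (p - 1) = 1" using p q by (simp add: field_simps)
  have [measurable]: "g \<in> borel_measurable V" by fact
  have em[measurable]: "(\<lambda>z. eta q z) \<in> borel_measurable (borel :: (complex^'n) measure)"
    unfolding eta_def by measurable
  have [measurable]: "(\<lambda>z. eta q z) \<in> borel_measurable V" by (rule measurable_V_borel) (rule em)
  define \<phi> where "\<phi> x = ennreal (wt x) * ennreal (cmod (g (EC x)) powr q * eta q (EC x)) * indicator DD x" for x
  have fm: "(\<lambda>x. ennreal (cmod (g (EC x)) powr q * eta q (EC x))) \<in> borel_measurable W"
    by measurable
  then have "(\<lambda>x. ennreal (cmod (g (EC x)) powr q * eta q (EC x)) * indicator DD x) \<in> borel_measurable borel"
    unfolding measurable_cong_sets[OF sets_W refl] by (subst (asm) borel_measurable_restrict_space_iff_ennreal) auto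
  then have \<phi>m[measurable]: "\<phi> \<in> borel_measurable borel" unfolding \<phi>_def mult.assoc by measurable
  have "bergman_integral q (eta q) U g = (\<integral>\<^sup>+z. ennreal (cmod (g z) powr q * eta q z) \<partial>V)"
    unfolding bergman_integral_def nn_integral_V by (simp add: nn_integral_completion)
  also have "\<dots> = (\<integral>\<^sup>+x. ennreal (cmod (g (EC x)) powr q * eta q (EC x)) \<partial>W)"
    by (rule nn_integral_V_W) measurable
  also have "\<dots> = (\<integral>\<^sup>+x. \<phi> x \<partial>lborel)" unfolding \<phi>_def by (rule nn_integral_W[OF fm])
  also have "\<dots> = ennreal ((p - 1) ^ CARD('n)) * (\<integral>\<^sup>+x. \<phi> (scl p x) \<partial>lborel)" by (rule nn_integral_scl[OF \<phi>m p])
  also have "(\<integral>\<^sup>+x. \<phi> (scl p x) \<partial>lborel) = (\<integral>\<^sup>+x. ennreal (wt x) * (ennreal (q - 1) * ennreal (cmod (g (twist p (EC x))) powr q)) * indicator DD x \<partial>lborel)"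
  proof (rule nn_integral_cong)
    fix x :: "(real^'n) \<times> (real^'n)"
    define Y where "Y = (\<Sum>j\<in>UNIV. of_int (b j) * fst x $ j)"
    have Ys: "(\<Sum>j\<in>UNIV. of_int (b j) * fst (scl p x) $ j) = (p - 1) * Y"
      by (simp add: Y_def scl_def sum_distrib_left mult_ac)
    have "eta q (EC (scl p x)) = (q - 1) * exp (- ((p - 1) * Y) * (2 * q - 4))"
      unfolding eta_def norm_prod_EC Ys by (simp add: exp_powr_real)
    then have "wt (scl p x) * eta q (EC (scl p x)) = (q - 1) * (c0 * (exp (- 2 * ((p - 1) * Y)) * exp (- ((p - 1) * Y) * (2 * q - 4))))"
      unfolding wt_def Ys by simp
    also have "exp (- 2 * ((p - 1) * Y)) * exp (- ((p - 1) * Y) * (2 * q - 4)) = exp (- 2 * ((q - 1) * (p - 1)) * Y)"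
      unfolding exp_add[symmetric] by (rule arg_cong[where f=exp]) (simp add: algebra_simps)
    finally have e0: "wt (scl p x) * eta q (EC (scl p x)) = (q - 1) * (c0 * exp (- 2 * ((q - 1) * (p - 1)) * Y))" .
    have w: "wt x = c0 * exp (- 2 * 1 * Y)" by (simp add: wt_def Y_def)
    have e: "wt (scl p x) * eta q (EC (scl p x)) = wt x * (q - 1)" unfolding e0 qp w by (rule mult.commute)
    have dd: "indicator DD (scl p x) = (indicator DD x :: ennreal)"
      using p by (simp add: indicator_def DD_def scl_def zero_less_mult_iff)
    have eta0: "eta q (EC (scl p x)) \<ge> 0" using q1 by (simp add: eta_def)
    have "ennreal (wt (scl p x)) * ennreal (cmod (g (EC (scl p x))) powr q * eta q (EC (scl p x)))
      = ennreal (wt (scl p x) * eta q (EC (scl p x)) * cmod (g (EC (scl p x))) powr q)"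
      using wt_pos[of "scl p x"] eta0 by (simp add: ennreal_mult[symmetric] mult_ac)
    also have "\<dots> = ennreal (wt x) * (ennreal (q - 1) * ennreal (cmod (g (EC (scl p x))) powr q))"
      unfolding e using wt_pos[of x] q1 by (simp add: ennreal_mult[symmetric] mult.assoc)
    finally show "\<phi> (scl p x) = ennreal (wt x) * (ennreal (q - 1) * ennreal (cmod (g (twist p (EC x))) powr q)) * indicator DD x"
      by (simp only: \<phi>_def dd twist_EC)
  qed
  also have "\<dots> = (\<integral>\<^sup>+x. ennreal (q - 1) * ennreal (cmod (g (twist p (EC x))) powr q) \<partial>W)"
  proof (rule nn_integral_W[symmetric])
    have [measurable]: "(\<lambda>z. g (twist p z)) \<in> borel_measurable V" by (rule measurable_compose[OF twist_measurable_V[OF p] g])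
    have [measurable]: "(\<lambda>x. g (twist p (EC x))) \<in> borel_measurable W" by (rule measurable_EC) measurable
    show "(\<lambda>x. ennreal (q - 1) * ennreal (cmod (g (twist p (EC x))) powr q)) \<in> borel_measurable W" by measurable
  qed
  also have "\<dots> = (\<integral>\<^sup>+z. ennreal (q - 1) * ennreal (cmod (g (twist p z)) powr q) \<partial>V)"
  proof (rule nn_integral_V_W[symmetric])
    have [measurable]: "(\<lambda>z. g (twist p z)) \<in> borel_measurable V" by (rule measurable_compose[OF twist_measurable_V[OF p] g])
    show "(\<lambda>z. ennreal (q - 1) * ennreal (cmod (g (twist p z)) powr q)) \<in> borel_measurable V" by measurable
  qed
  also have "\<dots> = ennreal (q - 1) * lpI q V (\<lambda>z. g (twist p z))"
    unfolding lpI_def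
  proof (rule nn_integral_cmult)
    have [measurable]: "(\<lambda>z. g (twist p z)) \<in> borel_measurable V" by (rule measurable_compose[OF twist_measurable_V[OF p] g])
    show "(\<lambda>z. ennreal (cmod (g (twist p z)) powr q)) \<in> borel_measurable V" by measurable
  qed
  finally show ?thesis using p q1 by (simp add: ennreal_mult mult_ac)
qed

lemma integrable_lebesgue_V:
  assumes "h \<in> borel_measurable V"
  shows "set_integrable lebesgue U h \<longleftrightarrow> integrable V (h :: complex^'n \<Rightarrow> complex)"
    and "(LINT z:U|lebesgue. h z) = (LINT z|V. h z)"
proof -
  have m: "(\<lambda>z. indicator U z *\<^sub>R h z) \<in> borel_measurable lborel"
    using assms unfolding V_def by (subst (asm) borel_measurable_restrict_space_iff) auto
  show "set_integrable lebesgue U h \<longleftrightarrow> integrable V h"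
    unfolding set_integrable_def V_def integrable_completion[OF m]
    by (subst integrable_restrict_space) auto
  show "(LINT z:U|lebesgue. h z) = (LINT z|V. h z)"
    unfolding set_lebesgue_integral_def V_def integral_completion[OF m]
    by (subst integral_restrict_space) auto
qed

end

section \<open>Monomial series\<close>

lemma prod_sum_PiE:
  fixes f :: "'a \<Rightarrow> 'b \<Rightarrow> 'c::{real_normed_field,banach}"
  assumes "finite A" "\<And>x. x \<in> A \<Longrightarrow> finite (B x)"
  shows "(\<Sum>g\<in>PiE A B. \<Prod>x\<in>A. f x (g x)) = (\<Prod>x\<in>A. \<Sum>y\<in>B x. f x y)"
proof -
  have fin: "finite (PiE A B)" using assms by (rule finite_PiE)
  have "infsum (\<lambda>g. \<Prod>x\<in>A. f x (g x)) (PiE A B) = (\<Prod>x\<in>A. infsum (f x) (B x))"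
    by (rule infsum_prod_PiE_abs) (use assms in auto)
  then show ?thesis using assms fin by simp
qed

lemma sum_int_interval:
  "(\<Sum>m\<in>{k..k + int N}. f m) = (\<Sum>l\<le>N. f (k + int l))"
  by (rule sum.reindex_bij_witness[of _ "\<lambda>l. k + int l" "\<lambda>m. nat (m - k)"]) auto

lemma summable_arith_exp:
  fixes \<delta> :: real assumes "\<delta> > 0"
  shows "summable (\<lambda>l. (p * real l + a) * exp (- \<delta> * real l))"
proof -
  have c: "cmod (of_real (exp (- \<delta>))) < 1" using assms by simp
  have "summable (\<lambda>l. of_real (p * real l + a) * (of_real (exp (- \<delta>)) :: complex) ^ l)"
    using arith_geometric_sums[OF c] by (rule sums_summable)
  then have "summable (\<lambda>l. (p * real l + a) * exp (- \<delta>) ^ l)"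
    unfolding of_real_power[symmetric] of_real_mult[symmetric] summable_of_real_iff .
  then show ?thesis by (simp add: exp_of_nat_mult[symmetric] mult.commute)
qed

lemma norm_infsum_diff_le:
  fixes f :: "'a \<Rightarrow> complex" and g :: "'a \<Rightarrow> real"
  assumes g: "g summable_on S" and fg: "\<And>a. a \<in> S \<Longrightarrow> cmod (f a) \<le> g a" and F: "finite F" "F \<subseteq> S"
  shows "(\<lambda>a. cmod (f a)) summable_on S" "cmod (infsum f S - sum f F) \<le> infsum g S - sum g F"
proof -
  have S: "(\<lambda>a. cmod (f a)) summable_on X" if "X \<subseteq> S" for X
  proof (rule summable_on_comparison_test)
    show "g summable_on X" by (rule summable_on_subset_banach[OF g that])
  qed (use fg that in auto)
  then show "(\<lambda>a. cmod (f a)) summable_on S" by simp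
  have split: "infsum h S = infsum h (S - F) + sum h F" if "h summable_on S" for h :: "'a \<Rightarrow> 'b::banach"
  proof -
    have "infsum h ((S - F) \<union> F) = infsum h (S - F) + infsum h F"
      by (rule infsum_Un_disjoint) (use that F in \<open>auto intro: summable_on_subset_banach\<close>)
    then show ?thesis using F by (simp add: Un_absorb2)
  qed
  have "infsum f S - sum f F = infsum f (S - F)"
    using split[of f] abs_summable_summable[OF S[of S]] by simp
  also have "cmod \<dots> \<le> infsum (\<lambda>a. cmod (f a)) (S - F)" by (rule norm_infsum_bound) (rule S, auto)
  also have "\<dots> \<le> infsum g (S - F)"
    by (rule infsum_mono) (use S[of "S - F"] g fg in \<open>auto intro: summable_on_subset_banach\<close>)
  also have "\<dots> = infsum g S - sum g F" using split[OF g] by simp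
  finally show "cmod (infsum f S - sum f F) \<le> infsum g S - sum g F" .
qed

lemma lp_sum:
  assumes p: "p \<ge> 1" and f: "\<And>a. a \<in> F \<Longrightarrow> lpS p M (f a)"
  shows "lpS p M (\<lambda>x. \<Sum>a\<in>F. c a * f a x) \<and> lpN p M (\<lambda>x. \<Sum>a\<in>F. c a * f a x) \<le> (\<Sum>a\<in>F. cmod (c a) * lpN p M (f a))"
  using f
proof (induction F rule: infinite_finite_induct)
  case (insert a F)
  have 1: "lpS p M (\<lambda>x. c a * f a x)" "lpN p M (\<lambda>x. c a * f a x) = cmod (c a) * lpN p M (f a)"
    using lp_cmul[of p M "f a" "c a"] p insert.prems by auto
  have IH: "lpS p M (\<lambda>x. \<Sum>a\<in>F. c a * f a x)" "lpN p M (\<lambda>x. \<Sum>a\<in>F. c a * f a x) \<le> (\<Sum>a\<in>F. cmod (c a) * lpN p M (f a))"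
    using insert by auto
  show ?case using minkowski[OF p 1(1) IH(1)] 1(2) IH(2) insert.hyps by simp
qed (use p in \<open>simp_all add: lpS_def lpI_def lpN_def\<close>)

context polyhedron begin

text \<open>Truncation by boxes in the exponents \<open>ge\<close>, cofinal among the finite subsets
  of \<open>SS p\<close>. Boxes are used because the partial sums of the kernel over them
  factor.\<close>

definition SN :: "real \<Rightarrow> nat \<Rightarrow> ('n \<Rightarrow> int) set" where
  "SN p N = {\<alpha>\<in>SS p. \<forall>j. ge \<alpha> j \<le> kk p j + int N}"

definition box :: "real \<Rightarrow> nat \<Rightarrow> ('n \<Rightarrow> int) set" where
  "box p N = PiE UNIV (\<lambda>j. {kk p j..kk p j + int N})"

lemma finite_box: "finite (box p N)" unfolding box_def by (rule finite_PiE) auto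

lemma ge_SN: "ge ` SN p N \<subseteq> box p N" by (auto simp: box_def SN_def SS_def)

lemma inj_ge: "inj_on ge X" by (auto simp: inj_on_def intro: ge_inj)

lemma finite_SN: "finite (SN p N)"
  using finite_subset[OF ge_SN finite_box] finite_imageD[OF _ inj_ge] by blast

lemma SN_subset: "SN p N \<subseteq> SS p" by (auto simp: SN_def)

lemma SN_mono: "M \<le> N \<Longrightarrow> SN p M \<subseteq> SN p N"
  unfolding SN_def by (auto intro: order_trans[of _ "kk p _ + int M"])

lemma SN_exhaust: "finite F \<Longrightarrow> F \<subseteq> SS p \<Longrightarrow> \<exists>N. F \<subseteq> SN p N"
proof (induction F rule: finite_induct)
  case (insert a F)
  then obtain N where N: "F \<subseteq> SN p N" by auto
  define M where "M = max N (nat (Max (range (\<lambda>j. ge a j - kk p j))))"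
  have "ge a j - kk p j \<le> Max (range (\<lambda>j. ge a j - kk p j))" for j by (rule Max_ge) auto
  then have "ge a j \<le> kk p j + int M" for j unfolding M_def by (smt (verit, best) int_nat_eq of_nat_max max.cobounded2)
  then have "a \<in> SN p M" using insert.prems by (auto simp: SN_def)
  moreover have "F \<subseteq> SN p M" using N SN_mono[of N M p] by (auto simp: M_def)
  ultimately show ?case by blast
qed auto

lemma SN_filterlim: "filterlim (SN p) (finite_subsets_at_top (SS p)) sequentially"
  unfolding filterlim_finite_subsets_at_top
proof (intro allI impI)
  fix F assume "finite F \<and> F \<subseteq> SS p"
  then obtain N where "F \<subseteq> SN p N" using SN_exhaust by blast
  then show "\<forall>\<^sub>F n in sequentially. finite (SN p n) \<and> F \<subseteq> SN p n \<and> SN p n \<subseteq> SS p"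
    using SN_mono finite_SN SN_subset by (intro eventually_sequentiallyI[of N]) blast
qed

lemma SN_tendsto:
  fixes f :: "('n \<Rightarrow> int) \<Rightarrow> 'b::{topological_comm_monoid_add,t2_space}"
  assumes "f summable_on SS p"
  shows "(\<lambda>N. sum f (SN p N)) \<longlonglongrightarrow> infsum f (SS p)"
  using has_sum_infsum[OF assms] SN_filterlim[of p] unfolding has_sum_def by (rule filterlim_compose)

text \<open>Decay counted from the lowest exponents \<open>kk\<close>; up to a constant, the
  majorant of all monomials where every \<open>Re (w $ j)\<close> is at least \<delta> and those
  with \<open>\<not> J0 j\<close> are bounded.\<close>

definition dec :: "real \<Rightarrow> real \<Rightarrow> ('n \<Rightarrow> int) \<Rightarrow> real" where
  "dec p \<delta> \<alpha> = (\<Prod>j\<in>UNIV. exp (- \<delta> * of_int (ge \<alpha> j - kk p j)))"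

lemma dec_pos: "dec p \<delta> \<alpha> > 0" by (simp add: dec_def prod_pos)

text \<open>By injectivity of \<open>ge\<close> a finite partial sum is at most a sum over a box of
  integer vectors, which is a product of one-dimensional arithmetic-geometric sums.\<close>

lemma summable_dec:
  assumes p: "p > 0" and \<delta>: "\<delta> > 0"
  shows "(\<lambda>\<alpha>. NN p \<alpha> * dec p \<delta> \<alpha>) summable_on SS p"
proof (rule nonneg_bdd_above_summable_on)
  show "0 \<le> NN p \<alpha> * dec p \<delta> \<alpha>" if "\<alpha> \<in> SS p" for \<alpha>
    using NN_pos[OF p that] dec_pos[of p \<delta> \<alpha>] by simp
  define t where "t j m = (p * of_int m + 2 * of_int (b j)) * exp (- \<delta> * of_int (m - kk p j))" for j m
  have t0: "t j m \<ge> 0" if "m \<ge> kk p j" for j m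
  proof -
    have "p * of_int (kk p j) \<le> p * of_int m" using that p by (intro mult_left_mono) auto
    then show ?thesis using kk_pos[OF p, of j] by (simp add: t_def)
  qed
  define C where "C j = (\<Sum>l. (p * real l + (p * of_int (kk p j) + 2 * of_int (b j))) * exp (- \<delta> * real l))" for j
  have tC: "(\<Sum>m\<in>{kk p j..kk p j + int N}. t j m) \<le> C j" for j N
  proof -
    have "(\<Sum>m\<in>{kk p j..kk p j + int N}. t j m) = (\<Sum>l\<in>{..N}. (p * real l + (p * of_int (kk p j) + 2 * of_int (b j))) * exp (- \<delta> * real l))"
      unfolding sum_int_interval by (rule sum.cong) (simp_all add: t_def algebra_simps)
    also have "\<dots> \<le> C j" unfolding C_def
      using kk_pos[OF p, of j] p by (intro sum_le_suminf summable_arith_exp \<delta>) auto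
    finally show ?thesis .
  qed
  show "bdd_above (sum (\<lambda>\<alpha>. NN p \<alpha> * dec p \<delta> \<alpha>) ` {F. F \<subseteq> SS p \<and> finite F})"
  proof (rule bdd_aboveI2)
    fix F assume "F \<in> {F. F \<subseteq> SS p \<and> finite F}"
    then obtain N where F: "finite F" "F \<subseteq> SN p N" "F \<subseteq> SS p" using SN_exhaust by blast
    have "(\<Sum>\<alpha>\<in>F. NN p \<alpha> * dec p \<delta> \<alpha>) = (\<Sum>\<alpha>\<in>F. \<Prod>j\<in>UNIV. t j (ge \<alpha> j))"
      by (simp add: NN_def dec_def t_def prod.distrib)
    also have "\<dots> = (\<Sum>g\<in>ge ` F. \<Prod>j\<in>UNIV. t j (g j))"
      by (subst sum.reindex[OF inj_ge]) simp
    also have "\<dots> \<le> (\<Sum>g\<in>box p N. \<Prod>j\<in>UNIV. t j (g j))"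
    proof (rule sum_mono2[OF finite_box])
      show "ge ` F \<subseteq> box p N" using F(2) ge_SN[of p N] by blast
      show "0 \<le> (\<Prod>j\<in>UNIV. t j (g j))" if "g \<in> box p N - ge ` F" for g
        using that by (intro prod_nonneg t0) (auto simp: box_def PiE_iff)
    qed
    also have "\<dots> = (\<Prod>j\<in>UNIV. \<Sum>m\<in>{kk p j..kk p j + int N}. t j m)"
      unfolding box_def by (rule prod_sum_PiE) auto
    also have "\<dots> \<le> (\<Prod>j\<in>UNIV. C j)" by (rule prod_mono) (auto intro!: tC sum_nonneg t0)
    finally show "(\<Sum>\<alpha>\<in>F. NN p \<alpha> * dec p \<delta> \<alpha>) \<le> (\<Prod>j\<in>UNIV. C j)" .
  qed
qed

text \<open>An upper bound for \<open>Re (w $ j)\<close> is asked only where \<open>J0 j\<close>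
  fails: in the other coordinates the lowest exponent is 0 and causes no growth. This is what admits
  neighbourhoods of points on the hyperplanes.\<close>

lemma monomial_dec_bound:
  assumes \<delta>: "\<delta> > 0" and R: "R \<ge> 0" and w: "\<And>j. Re (w $ j) \<ge> \<delta>" "\<And>j. \<not> J0 j \<Longrightarrow> Re (w $ j) \<le> R"
    and \<alpha>: "\<alpha> \<in> SS p"
  shows "cmod (monomial \<alpha> (E w)) \<le> (\<Prod>j\<in>UNIV. exp (\<bar>of_int (kk p j)\<bar> * R)) * dec p \<delta> \<alpha>"
proof -
  have "cmod (monomial \<alpha> (E w)) = (\<Prod>j\<in>UNIV. exp (- (of_int (ge \<alpha> j) * Re (w $ j))))"
    by (simp add: norm_monomial_E exp_sum[symmetric] sum_negf)
  also have "\<dots> \<le> (\<Prod>j\<in>UNIV. exp (\<bar>of_int (kk p j)\<bar> * R) * exp (- \<delta> * of_int (ge \<alpha> j - kk p j)))"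
  proof (rule prod_mono, intro conjI)
    fix j
    define y where "y = Re (w $ j)"
    have y: "y \<ge> \<delta>" using w by (simp add: y_def)
    have "- (of_int (kk p j) * y) \<le> \<bar>of_int (kk p j)\<bar> * R"
    proof (cases "J0 j")
      case True then show ?thesis using R by (simp add: kk_def)
    next
      case False
      have "- (of_int (kk p j) * y) \<le> \<bar>of_int (kk p j)\<bar> * y"
      proof -
        have "(- of_int (kk p j)) * y \<le> \<bar>of_int (kk p j)\<bar> * y"
          by (intro mult_right_mono) (use y \<delta> in auto)
        then show ?thesis by simp
      qed
      also have "\<dots> \<le> \<bar>of_int (kk p j)\<bar> * R" using w(2)[OF False] by (intro mult_left_mono) (auto simp: y_def)
      finally show ?thesis .
    qed
    moreover have "of_int (ge \<alpha> j - kk p j) * \<delta> \<le> of_int (ge \<alpha> j - kk p j) * y"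
      using \<alpha> y by (intro mult_left_mono) (auto simp: SS_def)
    ultimately have "- (of_int (ge \<alpha> j) * y) \<le> \<bar>of_int (kk p j)\<bar> * R + - \<delta> * of_int (ge \<alpha> j - kk p j)"
      by (simp add: algebra_simps)
    then show "exp (- (of_int (ge \<alpha> j) * Re (w $ j))) \<le> exp (\<bar>of_int (kk p j)\<bar> * R) * exp (- \<delta> * of_int (ge \<alpha> j - kk p j))"
      by (simp add: exp_add[symmetric] y_def)
  qed simp
  also have "\<dots> = (\<Prod>j\<in>UNIV. exp (\<bar>of_int (kk p j)\<bar> * R)) * dec p \<delta> \<alpha>" by (simp add: dec_def prod.distrib)
  finally show ?thesis .
qed

lemma continuous_monomial_SS: "\<alpha> \<in> SS p \<Longrightarrow> continuous_on U (monomial \<alpha>)"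
  by (rule continuous_on_monomial) (rule SS_defined)

lemma A_defined: "z \<in> U \<Longrightarrow> monomial_defined (A j) z" and A_less: "z \<in> U \<Longrightarrow> cmod (monomial (A j) z) < 1"
  by (auto simp: U_eq monomial_polyhedron_set_def)

text \<open>Valid also at points on coordinate hyperplanes:
  \<open>cmod (monomial (A j) z0) < 1\<close> bounds the j-th real part from below nearby, and where
  \<open>J0 j\<close> fails the monomial does not vanish at \<open>z0\<close>, which bounds it from
  above. The estimate obtained on \<open>Ust\<close> extends by
  \<open>cont_le_dense\<close>.\<close>

lemma local_bound:
  assumes z0: "z0 \<in> U"
  shows "\<exists>r>0. \<exists>\<delta>>0. \<exists>C>0. ball z0 r \<subseteq> U \<and> (\<forall>\<alpha>\<in>SS p. \<forall>z\<in>ball z0 r. cmod (monomial \<alpha> z) \<le> C * dec p \<delta> \<alpha>)"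
proof -
  define m where "m j z = cmod (monomial (A j) z)" for j z
  have mc: "continuous_on U (m j)" for j
    unfolding m_def by (intro continuous_on_norm continuous_on_monomial A_defined)
  define M where "M = Max (range (\<lambda>j. m j z0))"
  have mM: "m j z0 \<le> M" for j unfolding M_def by (rule Max_ge) auto
  have "M \<in> range (\<lambda>j. m j z0)" unfolding M_def by (rule Max_in) auto
  then have M: "M < 1" "M \<ge> 0" using A_less[OF z0] by (auto simp: m_def)
  \<comment> \<open>(1 + M) / 2 lies strictly between \<open>M\<close> and 1, and \<delta> is the
    real part at which \<open>cmod (monomial (A j) (E w))\<close> takes this value.\<close>
  define \<delta> where "\<delta> = - ln ((1 + M) / 2) / of_int d"
  have \<delta>: "\<delta> > 0" using M d_pos by (simp add: \<delta>_def divide_less_0_iff)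
  have e\<delta>: "exp (- of_int d * \<delta>) = (1 + M) / 2" using M d_pos by (simp add: \<delta>_def)
  define R where "R = (\<Sum>j\<in>UNIV. \<bar>ln (m j z0 / 2)\<bar>) / of_int d"
  have R: "R \<ge> 0" using d_pos by (simp add: R_def sum_nonneg)
  have eR: "exp (- of_int d * R) < m j z0" if "\<not> J0 j" for j
  proof -
    have nz: "monomial (A j) z0 \<noteq> 0"
    proof
      assume "monomial (A j) z0 = 0"
      then obtain i where i: "z0 $ i powi A j i = 0" by (auto simp: monomial_def)
      then have "z0 $ i = 0" "A j i \<noteq> 0" by (auto simp: power_int_eq_0_iff)
      then have "A j i > 0" using A_nonneg[OF z0, of i j] by linarith
      then show False using that z0 \<open>z0 $ i = 0\<close> by (auto simp: J0_def)
    qed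
    then have pos: "m j z0 > 0" by (simp add: m_def)
    have "- ln (m j z0 / 2) \<le> of_int d * R"
    proof -
      have "- ln (m j z0 / 2) \<le> \<bar>ln (m j z0 / 2)\<bar>" by simp
      also have "\<dots> \<le> (\<Sum>j\<in>UNIV. \<bar>ln (m j z0 / 2)\<bar>)" by (rule member_le_sum) auto
      finally show ?thesis using d_pos by (simp add: R_def)
    qed
    then have "exp (- of_int d * R) \<le> exp (ln (m j z0 / 2))" by simp
    also have "\<dots> < m j z0" using pos by simp
    finally show ?thesis .
  qed
  \<comment> \<open>For \<open>J0 j\<close> the lower bound -1 imposes no condition on a
    modulus.\<close>
  define X where "X = (\<Inter>j\<in>UNIV. U \<inter> m j -` {if J0 j then -1 else exp (- of_int d * R) <..< exp (- of_int d * \<delta>)})"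
  have "open X" unfolding X_def
    by (intro open_INT finite ballI continuous_open_preimage mc U_open open_greaterThanLessThan)
  moreover have "z0 \<in> X"
  proof -
    have "m j z0 < exp (- of_int d * \<delta>)" for j
    proof -
      have "M < (1 + M) / 2" using M by simp
      then show ?thesis unfolding e\<delta> using mM[of j] by (rule le_less_trans[rotated])
    qed
    moreover have "(if J0 j then -1 else exp (- of_int d * R)) < m j z0" for j
    proof (cases "J0 j")
      case True
      have "0 \<le> m j z0" by (simp add: m_def)
      then show ?thesis using True by simp
    qed (use eR in simp)
    ultimately show ?thesis using z0 by (simp add: X_def)
  qed
  ultimately obtain r where r: "r > 0" "ball z0 r \<subseteq> X" by (meson open_contains_ball)
  have XU: "X \<subseteq> U" by (auto simp: X_def)
  define C where "C = (\<Prod>j\<in>UNIV. exp (\<bar>of_int (kk p j)\<bar> * R))"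
  have "cmod (monomial \<alpha> z) \<le> C * dec p \<delta> \<alpha>" if \<alpha>: "\<alpha> \<in> SS p" and z: "z \<in> ball z0 r" for \<alpha> z
  proof -
    obtain e where e: "e > 0" "ball z e \<subseteq> ball z0 r" using z open_ball by (meson open_contains_ball)
    show ?thesis
    proof (rule cont_le_dense[OF continuous_monomial_SS[OF \<alpha>] _ e(1)])
      show "z \<in> U" using z r XU by blast
      fix z' assume z': "z' \<in> Ust" "dist z z' < e"
      then have "z' \<in> X" using e r by auto
      obtain w where w: "z' = E w" "\<And>j. Re (w $ j) > 0" using Ust_E[OF z'(1)] by blast
      have mw: "m j z' = exp (- of_int d * Re (w $ j))" for j by (simp only: m_def w(1) norm_A_E)
      have "exp (- of_int d * Re (w $ j)) < exp (- of_int d * \<delta>)" for j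
        using \<open>z' \<in> X\<close> unfolding mw[symmetric] X_def by auto
      then have 1: "Re (w $ j) \<ge> \<delta>" for j using d_pos by (simp add: less_imp_le)
      have "exp (- of_int d * R) < exp (- of_int d * Re (w $ j))" if "\<not> J0 j" for j
        using \<open>z' \<in> X\<close> that unfolding mw[symmetric] X_def by (auto dest!: spec[of _ j])
      then have 2: "Re (w $ j) \<le> R" if "\<not> J0 j" for j using d_pos that by (simp add: less_imp_le)
      show "cmod (monomial \<alpha> z') \<le> C * dec p \<delta> \<alpha>"
        unfolding w(1) C_def by (rule monomial_dec_bound[OF \<delta> R 1 2 \<alpha>])
    qed
  qed
  moreover have "C > 0" by (simp add: C_def prod_pos)
  ultimately show ?thesis using r XU \<delta> by blast
qed

definition ser :: "real \<Rightarrow> (('n \<Rightarrow> int) \<Rightarrow> complex) \<Rightarrow> complex^'n \<Rightarrow> complex" where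
  "ser p x z = infsum (\<lambda>\<alpha>. x \<alpha> * monomial \<alpha> z) (SS p)"

text \<open>Polynomial growth in the exponents, so that the decay \<open>dec\<close> makes the
  series converge. The coefficients of the projection of a cut-off function and those obtained from
  a bounded functional both satisfy it.\<close>

definition growth :: "real \<Rightarrow> (('n \<Rightarrow> int) \<Rightarrow> complex) \<Rightarrow> bool" where
  "growth p x \<longleftrightarrow> (\<exists>M>0. \<forall>\<alpha>\<in>SS p. cmod (x \<alpha>) \<le> M * NN p \<alpha>)"

lemma growth_bound:
  assumes p: "p > 0" and x: "growth p x" and \<delta>: "\<delta> > 0" and C: "C \<ge> 0"
  obtains t where "t summable_on SS p"
    "\<And>\<alpha> z. \<alpha> \<in> SS p \<Longrightarrow> cmod (monomial \<alpha> z) \<le> C * dec p \<delta> \<alpha> \<Longrightarrow> cmod (x \<alpha> * monomial \<alpha> z) \<le> t \<alpha>"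
proof -
  obtain M where M: "M > 0" "\<And>\<alpha>. \<alpha> \<in> SS p \<Longrightarrow> cmod (x \<alpha>) \<le> M * NN p \<alpha>" using x by (auto simp: growth_def)
  show ?thesis
  proof
    show "(\<lambda>\<alpha>. (M * C) * (NN p \<alpha> * dec p \<delta> \<alpha>)) summable_on SS p"
      by (rule summable_on_cmult_right[OF summable_dec[OF p \<delta>]])
    fix \<alpha> z assume \<alpha>: "\<alpha> \<in> SS p" "cmod (monomial \<alpha> z) \<le> C * dec p \<delta> \<alpha>"
    have "cmod (x \<alpha>) * cmod (monomial \<alpha> z) \<le> (M * NN p \<alpha>) * (C * dec p \<delta> \<alpha>)"
      using M NN_pos[OF p \<alpha>(1)] \<alpha> by (intro mult_mono) auto
    then show "cmod (x \<alpha> * monomial \<alpha> z) \<le> (M * C) * (NN p \<alpha> * dec p \<delta> \<alpha>)" by (simp add: norm_mult mult_ac)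
  qed
qed

lemma ser_abs_summable:
  assumes p: "p > 0" and x: "growth p x" and z: "z \<in> U"
  shows "(\<lambda>\<alpha>. cmod (x \<alpha> * monomial \<alpha> z)) summable_on SS p"
proof -
  obtain r \<delta> C where rdc: "r > 0" "\<delta> > 0" "C > 0" "\<And>\<alpha> z'. \<alpha> \<in> SS p \<Longrightarrow> z' \<in> ball z r \<Longrightarrow> cmod (monomial \<alpha> z') \<le> C * dec p \<delta> \<alpha>"
    using local_bound[OF z, of p] by blast
  obtain t where t: "t summable_on SS p"
    "\<And>\<alpha> z. \<alpha> \<in> SS p \<Longrightarrow> cmod (monomial \<alpha> z) \<le> C * dec p \<delta> \<alpha> \<Longrightarrow> cmod (x \<alpha> * monomial \<alpha> z) \<le> t \<alpha>"
    using growth_bound[OF p x rdc(2), of C] rdc(3) by (metis less_imp_le)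
  show ?thesis by (rule norm_infsum_diff_le(1)[OF t(1), of _ "{}"]) (use t(2) rdc in auto)
qed

lemma ser_holo:
  assumes p: "p > 0" and x: "growth p x"
  shows "holo_on (ser p x) U"
proof (rule holo_on_uniform_limit[where f="\<lambda>N z. \<Sum>\<alpha>\<in>SN p N. x \<alpha> * monomial \<alpha> z", OF _ U_open])
  show "holo_on (\<lambda>z. \<Sum>\<alpha>\<in>SN p N. x \<alpha> * monomial \<alpha> z) U" for N
    by (intro holo_on_sum holo_on_cmul holo_on_monomial SS_defined[of _ p]) (use SN_subset in blast)
  fix z assume z: "z \<in> U"
  obtain r \<delta> C where rdc: "r > 0" "\<delta> > 0" "C > 0" "ball z r \<subseteq> U"
    "\<And>\<alpha> z'. \<alpha> \<in> SS p \<Longrightarrow> z' \<in> ball z r \<Longrightarrow> cmod (monomial \<alpha> z') \<le> C * dec p \<delta> \<alpha>"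
    using local_bound[OF z, of p] by blast
  obtain t where t: "t summable_on SS p"
    "\<And>\<alpha> z. \<alpha> \<in> SS p \<Longrightarrow> cmod (monomial \<alpha> z) \<le> C * dec p \<delta> \<alpha> \<Longrightarrow> cmod (x \<alpha> * monomial \<alpha> z) \<le> t \<alpha>"
    using growth_bound[OF p x rdc(2), of C] rdc(3) by (metis less_imp_le)
  have "uniform_limit (ball z r) (\<lambda>N z. \<Sum>\<alpha>\<in>SN p N. x \<alpha> * monomial \<alpha> z) (ser p x) sequentially"
  proof (rule uniform_limitI)
    fix e :: real assume "e > 0"
    then have "\<forall>\<^sub>F N in sequentially. dist (sum t (SN p N)) (infsum t (SS p)) < e"
      using SN_tendsto[OF t(1)] by (simp add: tendsto_iff)
    then show "\<forall>\<^sub>F N in sequentially. \<forall>z'\<in>ball z r. dist (\<Sum>\<alpha>\<in>SN p N. x \<alpha> * monomial \<alpha> z') (ser p x z') < e"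
    proof (rule eventually_mono, intro ballI)
      fix N z' assume N: "dist (sum t (SN p N)) (infsum t (SS p)) < e" and z': "z' \<in> ball z r"
      have "cmod (ser p x z' - (\<Sum>\<alpha>\<in>SN p N. x \<alpha> * monomial \<alpha> z')) \<le> infsum t (SS p) - sum t (SN p N)"
        unfolding ser_def by (rule norm_infsum_diff_le(2)[OF t(1) _ finite_SN SN_subset]) (use t(2) rdc(5)[OF _ z'] in blast)
      then show "dist (\<Sum>\<alpha>\<in>SN p N. x \<alpha> * monomial \<alpha> z') (ser p x z') < e"
        using N by (simp add: dist_norm norm_minus_commute)
    qed
  qed
  then show "\<exists>r>0. ball z r \<subseteq> U \<and> uniform_limit (ball z r) (\<lambda>N z. \<Sum>\<alpha>\<in>SN p N. x \<alpha> * monomial \<alpha> z) (ser p x) sequentially"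
    using rdc by blast
qed

lemma ser_tendsto:
  assumes "p > 0" "growth p x" "z \<in> U"
  shows "(\<lambda>N. \<Sum>\<alpha>\<in>SN p N. x \<alpha> * monomial \<alpha> z) \<longlonglongrightarrow> ser p x z"
  unfolding ser_def by (rule SN_tendsto[OF abs_summable_summable[OF ser_abs_summable[OF assms]]])

lemma NN_lower: "p > 0 \<Longrightarrow> \<exists>\<nu>>0. \<forall>\<alpha>\<in>SS p. \<nu> \<le> NN p \<alpha>"
proof (intro exI conjI ballI)
  assume p: "p > 0"
  show "0 < (\<Prod>j\<in>UNIV. p * of_int (kk p j) + 2 * of_int (b j))" by (intro prod_pos) (simp add: kk_pos[OF p])
  fix \<alpha> assume "\<alpha> \<in> SS p"
  then show "(\<Prod>j\<in>UNIV. p * of_int (kk p j) + 2 * of_int (b j)) \<le> NN p \<alpha>"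
    unfolding NN_def using kk_pos[OF p] p by (intro prod_mono) (auto simp: SS_def less_imp_le)
qed

text \<open>Powers \<open>c\<close> between 0 and 1 are covered because \<open>NN\<close> is bounded
  below by a positive constant on \<open>SS p\<close>.\<close>

lemma growth_powr:
  assumes p: "p > 0" and c: "0 \<le> c" "c \<le> 1" and M: "M > 0"
    and x: "\<And>\<alpha>. \<alpha> \<in> SS p \<Longrightarrow> cmod (x \<alpha>) \<le> M * NN p \<alpha> powr c"
  shows "growth p x"
proof -
  obtain \<nu> where \<nu>: "\<nu> > 0" "\<And>\<alpha>. \<alpha> \<in> SS p \<Longrightarrow> \<nu> \<le> NN p \<alpha>" using NN_lower[OF p] by blast
  show ?thesis unfolding growth_def
  proof (intro exI[of _ "M * \<nu> powr (c - 1)"] conjI ballI)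
    fix \<alpha> assume \<alpha>: "\<alpha> \<in> SS p"
    have "NN p \<alpha> powr c = NN p \<alpha> * NN p \<alpha> powr (c - 1)"
      using powr_add[of "NN p \<alpha>" 1 "c - 1"] NN_pos[OF p \<alpha>] by simp
    also have "\<dots> \<le> NN p \<alpha> * \<nu> powr (c - 1)"
      using \<nu> \<alpha> c NN_pos[OF p \<alpha>] by (intro mult_left_mono powr_mono2') auto
    finally have "M * NN p \<alpha> powr c \<le> M * (NN p \<alpha> * \<nu> powr (c - 1))" using M by (intro mult_left_mono) auto
    then show "cmod (x \<alpha>) \<le> M * \<nu> powr (c - 1) * NN p \<alpha>" using x[OF \<alpha>] by (simp add: mult_ac)
  qed (use M \<nu> in simp)
qed

text \<open>Differences of partial sums are bounded in norm by the tail of the summable majorant;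
  Fatou's lemma passes this bound to the limit, which gives membership and convergence at
  once.\<close>

lemma ser_lp:
  assumes p: "p \<ge> 1" and x: "(\<lambda>\<alpha>. cmod (x \<alpha>) * lpN p V (monomial \<alpha>)) summable_on SS p"
  shows "growth p x" "lpS p V (ser p x)"
    "(\<lambda>N. lpN p V (\<lambda>z. ser p x z - (\<Sum>\<alpha>\<in>SN p N. x \<alpha> * monomial \<alpha> z))) \<longlonglongrightarrow> 0"
    "lpS p V (\<lambda>z. ser p x z - (\<Sum>\<alpha>\<in>SN p N. x \<alpha> * monomial \<alpha> z))"
proof -
  define t where "t \<alpha> = cmod (x \<alpha>) * lpN p V (monomial \<alpha>)" for \<alpha>
  define T where "T = infsum t (SS p)"
  have ts: "t summable_on SS p" using x unfolding t_def[abs_def] .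
  have tail: "sum t F \<le> T" if "finite F" "F \<subseteq> SS p" for F
    unfolding T_def by (rule finite_sum_le_infsum[OF ts that]) (simp add: t_def)
  have T0: "T \<ge> 0" using tail[of "{}"] by simp
  have p0: "p > 0" using p by simp
  show g: "growth p x"
  \<comment> \<open>A single term is at most \<open>T\<close> and the norm of the monomial is
    \<open>(K0 / NN p \<alpha>) powr (1 / p)\<close>, whence the exponent 1 / p. The summand 1 keeps
    the constant positive.\<close>
  proof (rule growth_powr[OF p0, of "1 / p" "(T + 1) * K0 powr (- 1 / p)"])
    fix \<alpha> assume \<alpha>: "\<alpha> \<in> SS p"
    have "cmod (x \<alpha>) * (K0 / NN p \<alpha>) powr (1 / p) \<le> T + 1"
      using tail[of "{\<alpha>}"] \<alpha> by (simp add: t_def lpN_monomial[OF p0 \<alpha>])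
    moreover have "(K0 / NN p \<alpha>) powr (1 / p) = K0 powr (1 / p) / NN p \<alpha> powr (1 / p)"
      using K0_pos NN_pos[OF p0 \<alpha>] by (simp add: powr_divide)
    moreover have "K0 powr (- 1 / p) = 1 / K0 powr (1 / p)" by (simp add: powr_minus_divide)
    moreover have "NN p \<alpha> powr (1 / p) > 0" "K0 powr (1 / p) > 0" using K0_pos NN_pos[OF p0 \<alpha>] by auto
    ultimately have le: "cmod (x \<alpha>) * (K0 powr (1 / p) / NN p \<alpha> powr (1 / p)) \<le> T + 1"
      and pos: "NN p \<alpha> powr (1 / p) > 0" "K0 powr (1 / p) > 0" and km: "K0 powr (- 1 / p) = 1 / K0 powr (1 / p)" by simp_all
    have "cmod (x \<alpha>) = cmod (x \<alpha>) * (K0 powr (1 / p) / NN p \<alpha> powr (1 / p)) * (NN p \<alpha> powr (1 / p) / K0 powr (1 / p))"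
      using pos by simp
    also have "\<dots> \<le> (T + 1) * (NN p \<alpha> powr (1 / p) / K0 powr (1 / p))"
      using le pos by (intro mult_right_mono) auto
    finally show "cmod (x \<alpha>) \<le> (T + 1) * K0 powr (- 1 / p) * NN p \<alpha> powr (1 / p)"
      unfolding km by simp
  qed (use p T0 K0_pos in auto)
  have part: "lpS p V (\<lambda>z. \<Sum>\<alpha>\<in>F. x \<alpha> * monomial \<alpha> z)" "lpN p V (\<lambda>z. \<Sum>\<alpha>\<in>F. x \<alpha> * monomial \<alpha> z) \<le> sum t F"
    if "F \<subseteq> SS p" for F
    using lp_sum[OF p, of F V monomial x] lpS_monomial[OF p0] that by (auto simp: t_def)
  have sm: "ser p x \<in> borel_measurable V" by (rule V_measurable_cont[OF holo_on_continuous[OF ser_holo[OF p0 g]]])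
  have diff: "lpS p V (\<lambda>z. ser p x z - (\<Sum>\<alpha>\<in>SN p N. x \<alpha> * monomial \<alpha> z)) \<and> lpN p V (\<lambda>z. ser p x z - (\<Sum>\<alpha>\<in>SN p N. x \<alpha> * monomial \<alpha> z)) \<le> T - sum t (SN p N)" for N
  proof -
    define D where "D M z = (\<Sum>\<alpha>\<in>SN p (N + M) - SN p N. x \<alpha> * monomial \<alpha> z)" for M z
    have Deq: "D M z = (\<Sum>\<alpha>\<in>SN p (N + M). x \<alpha> * monomial \<alpha> z) - (\<Sum>\<alpha>\<in>SN p N. x \<alpha> * monomial \<alpha> z)" for M z
      unfolding D_def by (rule sum_diff[OF finite_SN SN_mono]) simp
    have Dp: "lpS p V (D M)" "lpN p V (D M) \<le> T - sum t (SN p N)" for M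
    proof -
      have sub: "SN p (N + M) - SN p N \<subseteq> SS p" using SN_subset by blast
      show "lpS p V (D M)" using part(1)[OF sub] by (simp add: D_def[abs_def])
      have "lpN p V (D M) \<le> sum t (SN p (N + M) - SN p N)" using part(2)[OF sub] by (simp add: D_def[abs_def])
      also have "\<dots> = sum t (SN p (N + M)) - sum t (SN p N)" by (rule sum_diff[OF finite_SN SN_mono]) simp
      also have "\<dots> \<le> T - sum t (SN p N)" using tail[OF finite_SN SN_subset] by simp
      finally show "lpN p V (D M) \<le> T - sum t (SN p N)" .
    qed
    have C0: "0 \<le> T - sum t (SN p N)" using tail[OF finite_SN SN_subset] by simp
    have gm: "(\<lambda>z. ser p x z - (\<Sum>\<alpha>\<in>SN p N. x \<alpha> * monomial \<alpha> z)) \<in> borel_measurable V"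
      using sm part(1)[OF SN_subset, of N] by (intro borel_measurable_diff) (auto simp: lpS_def)
    have lim: "(\<lambda>M. D M z) \<longlonglongrightarrow> ser p x z - (\<Sum>\<alpha>\<in>SN p N. x \<alpha> * monomial \<alpha> z)" if "z \<in> space V" for z
      unfolding Deq using LIMSEQ_ignore_initial_segment[OF ser_tendsto[OF p0 g, of z], of N] that
      by (intro tendsto_diff tendsto_const) (simp add: add.commute)
    have le: "lpI p V (D M) \<le> ennreal ((T - sum t (SN p N)) powr p)" for M
    proof -
      have "lpI p V (D M) = ennreal (lpN p V (D M) powr p)" using Dp(1)[of M] p0 by (intro lpI_eq) (auto simp: lpS_def)
      also have "\<dots> \<le> ennreal ((T - sum t (SN p N)) powr p)" using Dp(2)[of M] p0 by (intro ennreal_leI powr_mono2) auto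
      finally show ?thesis .
    qed
    show ?thesis
      using lp_fatou[OF p0 _ gm lim C0 le] Dp(1) by (auto simp: lpS_def)
  qed
  then show "lpS p V (\<lambda>z. ser p x z - (\<Sum>\<alpha>\<in>SN p N. x \<alpha> * monomial \<alpha> z))" by blast
  have e0: "SN p 0 \<subseteq> SS p" by (rule SN_subset)
  show "lpS p V (ser p x)"
    using minkowski(1)[OF p conjunct1[OF diff[of 0]] part(1)[OF e0]] by simp
  show "(\<lambda>N. lpN p V (\<lambda>z. ser p x z - (\<Sum>\<alpha>\<in>SN p N. x \<alpha> * monomial \<alpha> z))) \<longlonglongrightarrow> 0"
  proof (rule tendsto_sandwich[OF _ _ tendsto_const])
    have "(\<lambda>N. T - sum t (SN p N)) \<longlonglongrightarrow> T - T"
      unfolding T_def by (intro tendsto_intros SN_tendsto ts)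
    then show "(\<lambda>N. T - sum t (SN p N)) \<longlonglongrightarrow> 0" by simp
  qed (use diff in auto)
qed

end

section \<open>Laurent coefficients\<close>

text \<open>Jensen's inequality, obtained from Hoelder's with the constant 1 as second factor; the
  total mass 1 makes its norm 1.\<close>

lemma tavg_lp_bound:
  assumes r: "r > 1" and f: "continuous_on utorus f"
  shows "ennreal (cmod (tavg f) powr r) \<le> (\<integral>\<^sup>+\<omega>. ennreal (indicator utorus \<omega> * cmod (f \<omega>) powr r) \<partial>(torus :: (complex^'n) measure))"
proof -
  define F where "F = (\<lambda>\<omega>. indicator utorus \<omega> *\<^sub>R f \<omega>)"
  define r' where "r' = r / (r - 1)"
  have r': "r' > 1" "1 / r + 1 / r' = 1" using r by (simp_all add: r'_def field_simps)
  have Fm: "F \<in> borel_measurable torus" unfolding F_def using borel_measurable_continuous_on_indicator[OF _ f] by simp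
  have I: "lpI r torus F = (\<integral>\<^sup>+\<omega>. ennreal (indicator utorus \<omega> * cmod (f \<omega>) powr r) \<partial>torus)"
    unfolding lpI_def F_def using r by (intro nn_integral_cong) (auto simp: indicator_def)
  obtain M where M: "\<And>u. u \<in> utorus \<Longrightarrow> cmod (f u) \<le> M"
    using compact_imp_bounded[OF compact_continuous_image[OF f compact_utorus]] by (auto simp: bounded_iff)
  have "lpI r torus F \<le> (\<integral>\<^sup>+\<omega>. ennreal (\<bar>M\<bar> powr r) \<partial>(torus :: (complex^'n) measure))"
    unfolding lpI_def F_def
  proof (rule nn_integral_mono, rule ennreal_leI, rule powr_mono2)
    show "cmod (indicator utorus \<omega> *\<^sub>R f \<omega>) \<le> \<bar>M\<bar>" for \<omega> using M[of \<omega>] by (cases "\<omega> \<in> utorus") auto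
  qed (use r in auto)
  also have "\<dots> < \<infinity>" by (simp add: emeasure_torus)
  finally have F: "lpS r torus F" using Fm by (simp add: lpS_def)
  have one: "lpI r' torus (\<lambda>_ :: complex^'n. 1) = 1" by (simp add: lpI_def emeasure_torus)
  have "cmod (LINT \<omega>|torus. F \<omega> * cnj 1) \<le> lpN r torus F * lpN r' torus (\<lambda>_ :: complex^'n. 1)"
    by (rule hoelder_integral(2)[OF r r' F]) (simp add: lpS_def one)
  then have le: "cmod (tavg f) \<le> lpN r torus F" by (simp add: tavg_def set_lebesgue_integral_def F_def lpN_def one)
  have "ennreal (cmod (tavg f) powr r) \<le> ennreal (lpN r torus F powr r)"
    using le r by (intro ennreal_leI powr_mono2) auto
  also have "\<dots> = lpI r torus F" using F r by (subst lpI_eq) (auto simp: lpS_def)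
  finally show ?thesis unfolding I .
qed

lemma tavg_limit:
  assumes f: "\<And>N. continuous_on utorus (f N)" and lim: "uniform_limit utorus f g sequentially"
  shows "(\<lambda>N. tavg (f N)) \<longlonglongrightarrow> tavg g" "continuous_on utorus g"
proof -
  show g: "continuous_on utorus g" by (rule uniform_limit_theorem[OF _ lim]) (simp_all add: f)
  show "(\<lambda>N. tavg (f N)) \<longlonglongrightarrow> tavg g"
  proof (rule LIMSEQ_I)
    fix e :: real assume e: "e > 0"
    then obtain N where N: "\<And>n u. n \<ge> N \<Longrightarrow> u \<in> utorus \<Longrightarrow> dist (f n u) (g u) < e / 2"
      using uniform_limitD[OF lim, of "e / 2"] by (auto simp: eventually_sequentially)
    show "\<exists>N. \<forall>n\<ge>N. norm (tavg (f n) - tavg g) < e"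
    proof (intro exI allI impI)
      fix n assume n: "n \<ge> N"
      have "cmod (tavg (\<lambda>u. f n u - g u)) \<le> e / 2"
        by (rule tavg_norm_le) (use N[OF n] f g in \<open>auto simp: dist_norm less_imp_le intro!: continuous_on_diff\<close>)
      then show "norm (tavg (f n) - tavg g) < e" using e by (simp add: tavg_diff[OF f g])
    qed
  qed
qed

lemma tavg_fubini:
  fixes G :: "complex^'n \<Rightarrow> real \<Rightarrow> complex"
  assumes G: "continuous_on (utorus \<times> {0..2*pi}) (\<lambda>(\<omega>, t). G \<omega> t)"
  shows "integral {0..2*pi} (\<lambda>t. tavg (\<lambda>\<omega>. G \<omega> t)) = tavg (\<lambda>\<omega>. integral {0..2*pi} (G \<omega>))"
proof -
  interpret T: finite_measure "torus :: (complex^'n) measure" by (rule finite_measure_torus)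
  interpret P: pair_sigma_finite "torus :: (complex^'n) measure" "lborel :: real measure" ..
  define K where "K = (utorus :: (complex^'n) set) \<times> {0..2*pi}"
  define F where "F = (\<lambda>\<omega> t. indicator K (\<omega>, t) *\<^sub>R G \<omega> t)"
  have cK: "compact K" unfolding K_def by (intro compact_Times compact_utorus) auto
  have F_eq: "F \<omega> t = indicator utorus \<omega> *\<^sub>R (indicator {0..2*pi} t *\<^sub>R G \<omega> t)" for \<omega> t
    by (auto simp: F_def K_def indicator_def)
  obtain M where M: "\<And>x. x \<in> K \<Longrightarrow> cmod (case_prod G x) \<le> M"
    using compact_imp_bounded[OF compact_continuous_image[OF G compact_Times[OF compact_utorus compact_Icc]]] by (auto simp: bounded_iff K_def)
  have "(\<lambda>x. indicator K x *\<^sub>R case_prod G x) \<in> borel_measurable borel"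
    by (rule borel_measurable_continuous_on_indicator) (use cK G in \<open>auto simp: K_def intro: borel_compact\<close>)
  moreover have "sets (torus \<Otimes>\<^sub>M lborel) = sets (borel :: ((complex^'n) \<times> real) measure)"
    unfolding borel_prod[symmetric] by (rule sets_pair_measure_cong) simp_all
  moreover have "(\<lambda>x. indicator K x *\<^sub>R case_prod G x) = case_prod F" by (auto simp: F_def fun_eq_iff)
  ultimately have Fm: "case_prod F \<in> borel_measurable (torus \<Otimes>\<^sub>M lborel)"
    by (simp add: measurable_cong_sets[of "torus \<Otimes>\<^sub>M lborel" "borel :: ((complex^'n) \<times> real) measure" borel borel])
  have Ks: "K \<in> sets (torus \<Otimes>\<^sub>M lborel)" unfolding K_def by (intro pair_measureI) auto
  have int: "integrable (torus \<Otimes>\<^sub>M lborel) (case_prod F)"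
  proof (rule integrableI_bounded_set[OF Ks Fm, where B="max M 0"])
    show "emeasure (torus \<Otimes>\<^sub>M lborel) K < \<infinity>"
    proof -
      have "emeasure (torus :: (complex^'n) measure) utorus < top" by (simp add: less_top[symmetric] T.emeasure_finite)
      then show ?thesis unfolding K_def by (subst lborel.emeasure_pair_measure_Times) (auto simp: ennreal_mult_less_top)
    qed
    show "AE x in torus \<Otimes>\<^sub>M lborel. x \<in> K \<longrightarrow> cmod (case_prod F x) \<le> max M 0"
      using M by (intro AE_I2) (auto simp: F_def max.coboundedI1)
    show "AE x in torus \<Otimes>\<^sub>M lborel. x \<notin> K \<longrightarrow> case_prod F x = 0"
      by (intro AE_I2) (auto simp: F_def)
  qed
  have contt: "continuous_on {0..2*pi} (G \<omega>)" if "\<omega> \<in> utorus" for \<omega>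
  proof -
    have c: "continuous_on {0..2*pi} (\<lambda>t. (\<omega>, t))" by (intro continuous_intros)
    have "(\<lambda>t. (\<omega>, t)) ` {0..2*pi} \<subseteq> utorus \<times> {0..2*pi}" using that by auto
    from continuous_on_compose2[OF G c this] show ?thesis by simp
  qed
  have inner: "(LINT t|lborel. F \<omega> t) = indicator utorus \<omega> *\<^sub>R integral {0..2*pi} (G \<omega>)" for \<omega>
  proof (cases "\<omega> \<in> utorus")
    case True
    then have "(LINT t|lborel. F \<omega> t) = (LINT t:{0..2*pi}|lborel. G \<omega> t)" by (simp add: F_eq set_lebesgue_integral_def)
    also have "\<dots> = integral {0..2*pi} (G \<omega>)"
      by (rule set_borel_integral_eq_integral(2)) (rule borel_integrable_atLeastAtMost', rule contt[OF True])
    finally show ?thesis using True by simp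
  qed (simp add: F_eq)
  have outer: "(LINT \<omega>|torus. F \<omega> t) = indicator {0..2*pi} t *\<^sub>R tavg (\<lambda>\<omega>. G \<omega> t)" for t
    by (cases "t \<in> {0..2*pi}") (simp_all add: F_eq tavg_def set_lebesgue_integral_def)
  have "(LINT t|lborel. LINT \<omega>|torus. F \<omega> t) = (LINT \<omega>|torus. LINT t|lborel. F \<omega> t)"
    by (rule P.Fubini_integral[OF int])
  moreover have "(LINT t|lborel. LINT \<omega>|torus. F \<omega> t) = integral {0..2*pi} (\<lambda>t. tavg (\<lambda>\<omega>. G \<omega> t))"
  proof -
    have "integrable lborel (\<lambda>t. LINT \<omega>|torus. F \<omega> t)" by (rule P.integrable_snd[OF int])
    then have "set_integrable lborel {0..2*pi} (\<lambda>t. tavg (\<lambda>\<omega>. G \<omega> t))" unfolding outer set_integrable_def .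
    from set_borel_integral_eq_integral(2)[OF this] show ?thesis unfolding outer set_lebesgue_integral_def .
  qed
  ultimately show ?thesis unfolding inner by (simp add: tavg_def set_lebesgue_integral_def)
qed

context polyhedron begin

text \<open>The component of \<open>f\<close> of degree \<alpha> under rotations, evaluated at
  \<open>z\<close>; it makes sense before any series is available.\<close>

definition co :: "(complex^'n \<Rightarrow> complex) \<Rightarrow> ('n \<Rightarrow> int) \<Rightarrow> complex^'n \<Rightarrow> complex" where
  "co f \<alpha> z = tavg (\<lambda>\<omega>. f (\<omega> * z) * monomial (\<lambda>i. - \<alpha> i) \<omega>)"

lemma cont_cmul: "continuous_on X f \<Longrightarrow> continuous_on X g \<Longrightarrow> continuous_on X (\<lambda>x. (f x :: complex^'n) * g x)"
  unfolding times_vec_def by (intro continuous_intros)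

lemma cont_rot:
  assumes f: "continuous_on U f" and z: "z \<in> U"
  shows "continuous_on utorus (\<lambda>\<omega>. f (\<omega> * z))"
  by (rule continuous_on_compose2[OF f]) (use z unimodular_U in \<open>auto intro!: cont_cmul continuous_intros\<close>)

lemma co_rot:
  assumes f: "continuous_on U f" and z: "z \<in> U" and u: "u \<in> utorus"
  shows "co f \<alpha> (u * z) = monomial \<alpha> u * co f \<alpha> z"
proof -
  have "co f \<alpha> z = tavg (\<lambda>\<omega>. f (u * \<omega> * z) * monomial (\<lambda>i. - \<alpha> i) (u * \<omega>))"
    unfolding co_def
    by (rule tavg_shift[symmetric, of "\<lambda>\<omega>. f (\<omega> * z) * monomial (\<lambda>i. - \<alpha> i) \<omega>"])
       (auto intro!: continuous_on_mult cont_rot[OF f z] cont_monomial_utorus u)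
  also have "\<dots> = monomial (\<lambda>i. - \<alpha> i) u * co f \<alpha> (u * z)"
    unfolding co_def tavg_cmul[symmetric] by (rule tavg_cong) (simp add: monomial_mult mult_ac)
  finally show ?thesis
    using monomial_uminus_utorus[OF u, of \<alpha>] by (metis mult.assoc mult.commute mult_1)
qed

definition repl :: "complex^'n \<Rightarrow> 'n \<Rightarrow> complex \<Rightarrow> complex^'n" where
  "repl w j \<zeta> = (\<chi> k. if k = j then \<zeta> else w $ k)"

lemma E_axis_utorus: "E (axis j (\<i> * of_real t)) \<in> utorus"
  by (simp add: utorus_def unimodular_def norm_E axis_def if_distrib[of Re] cong: if_cong)

lemma E_repl_im: "E (repl w j (Complex x (s + t))) = E (axis j (\<i> * of_real t)) * E (repl w j (Complex x s))"
proof -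
  have "repl w j (Complex x (s + t)) = axis j (\<i> * of_real t) + repl w j (Complex x s)"
    by (auto simp: repl_def vec_eq_iff axis_def complex_eq_iff)
  then show ?thesis by (simp add: E_add)
qed

lemma E_repl_deriv: "((\<lambda>\<zeta>. E (repl w j \<zeta>) $ k) has_field_derivative - of_int (B k j) * E (repl w j \<zeta>) $ k) (at \<zeta>)"
proof -
  have s: "(\<Sum>l\<in>UNIV. of_int (B k l) * repl w j \<zeta> $ l) = of_int (B k j) * \<zeta> + (\<Sum>l\<in>UNIV - {j}. of_int (B k l) * w $ l)" for \<zeta>
    by (subst sum.remove[of _ j]) (auto simp: repl_def intro!: sum.cong)
  show ?thesis unfolding E_def vec_lambda_beta s by (auto intro!: derivative_eq_intros)
qed

lemma E_repl_period: "E (repl w j (\<zeta> + 2 * pi * \<i>)) = E (repl w j \<zeta>)"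
proof -
  have "repl w j (\<zeta> + 2 * pi * \<i>) = repl w j \<zeta> + cvec (0, lat (axis j 1))"
    by (auto simp: repl_def vec_eq_iff lat_def axis_def complex_eq_iff)
  then have "E (repl w j (\<zeta> + 2 * pi * \<i>)) = E (repl w j \<zeta>) * E (cvec (0, lat (axis j 1)))" by (simp only: E_add)
  also have "E (cvec (0, lat (axis j 1))) = E (cvec (0, 0))" using E_lat[of 0 0 "axis j 1"] by simp
  also have "cvec (0, 0) = 0" by (simp add: vec_eq_iff complex_eq_iff)
  also have "E (repl w j \<zeta>) * E 0 = E (repl w j \<zeta>)" unfolding E_add[symmetric] by simp
  finally show ?thesis .
qed

text \<open>The candidate for the Laurent coefficient, as a function of the logarithmic coordinates:
  homogeneity under rotations makes it independent of the imaginary parts, and holomorphy of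
  \<open>f\<close> makes it independent of the real parts.\<close>

definition uu :: "(complex^'n \<Rightarrow> complex) \<Rightarrow> ('n \<Rightarrow> int) \<Rightarrow> complex^'n \<Rightarrow> complex" where
  "uu f \<alpha> w = co f \<alpha> (E w) / monomial \<alpha> (E w)"

lemma uu_im:
  assumes f: "continuous_on U f" and w: "E (repl w j (Complex x s)) \<in> U"
  shows "uu f \<alpha> (repl w j (Complex x (s + t))) = uu f \<alpha> (repl w j (Complex x s))"
  unfolding uu_def E_repl_im co_rot[OF f w E_axis_utorus] monomial_mult
  by (simp add: monomial_nz utorus_nz[OF E_axis_utorus])

text \<open>Averaging over one more rotation reduces the independence of \<open>Re w\<^sub>j\<close> to one complex variable.\<close>

lemma uu_re:
  assumes f: "holo_on f U" and w: "\<And>k. Re (w $ k) > 0" and x: "x > 0" "x' > 0"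
  shows "uu f \<alpha> (repl w j (Complex x 0)) = uu f \<alpha> (repl w j (Complex x' 0))"
proof -
  have cf: "continuous_on U f" by (rule holo_on_continuous[OF f])
  have rU: "E (repl w j \<zeta>) \<in> U" if "Re \<zeta> > 0" for \<zeta>
    unfolding E_in_U using w that by (simp add: repl_def)
  define \<Psi> where "\<Psi> \<omega> \<zeta> = f (\<omega> * E (repl w j \<zeta>)) * monomial (\<lambda>i. - \<alpha> i) \<omega> / monomial \<alpha> (E (repl w j \<zeta>))" for \<omega> \<zeta>
  have avg: "2 * pi * uu f \<alpha> (repl w j (Complex x 0)) = tavg (\<lambda>\<omega>. integral {0..2*pi} (\<lambda>t. \<Psi> \<omega> (Complex x t)))" if x: "x > 0" for x
  proof -
    have "2 * pi * uu f \<alpha> (repl w j (Complex x 0)) = integral {0..2*pi} (\<lambda>t. uu f \<alpha> (repl w j (Complex x 0)))"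
      by (simp add: scaleR_conv_of_real)
    also have "\<dots> = integral {0..2*pi} (\<lambda>t. tavg (\<lambda>\<omega>. \<Psi> \<omega> (Complex x t)))"
    proof (rule integral_cong)
      fix t
      have "uu f \<alpha> (repl w j (Complex x 0)) = uu f \<alpha> (repl w j (Complex x t))"
        using x uu_im[OF cf rU[of "Complex x 0"], where t=t] by simp
      also have "\<dots> = tavg (\<lambda>\<omega>. \<Psi> \<omega> (Complex x t))"
        unfolding uu_def co_def \<Psi>_def divide_inverse tavg_cmulr ..
      finally show "uu f \<alpha> (repl w j (Complex x 0)) = tavg (\<lambda>\<omega>. \<Psi> \<omega> (Complex x t))" .
    qed
    also have "\<dots> = tavg (\<lambda>\<omega>. integral {0..2*pi} (\<lambda>t. \<Psi> \<omega> (Complex x t)))"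
    proof (rule tavg_fubini)
      have cE: "continuous_on X (\<lambda>y::(complex^'n) \<times> real. E (repl w j (Complex x (snd y))))" for X
      proof -
        have "continuous_on X (\<lambda>y::(complex^'n) \<times> real. repl w j (Complex x (snd y)) $ k)" for k
          by (cases "k = j") (simp_all add: repl_def Complex_eq continuous_intros)
        then show ?thesis unfolding E_def
          by (intro continuous_on_vec_lambda continuous_on_exp continuous_on_minus continuous_on_sum continuous_on_mult continuous_on_const)
      qed
      have c1: "continuous_on (utorus \<times> {0..2*pi}) (\<lambda>y. f (fst y * E (repl w j (Complex x (snd y)))))"
      proof (rule continuous_on_compose2[OF cf])
        show "continuous_on (utorus \<times> {0..2*pi}) (\<lambda>y. fst y * E (repl w j (Complex x (snd y))))"
          by (intro cont_cmul cE continuous_intros)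
        show "(\<lambda>y. fst y * E (repl w j (Complex x (snd y)))) ` (utorus \<times> {0..2*pi}) \<subseteq> U"
          using x by (auto simp: unimodular_U intro!: rU)
      qed
      have c2: "continuous_on (utorus \<times> {0..2*pi}) (\<lambda>y. monomial (\<lambda>i. - \<alpha> i) (fst y))"
        by (rule continuous_on_compose2[OF cont_monomial_utorus]) (auto intro!: continuous_intros)
      have c3: "continuous_on (utorus \<times> {0..2*pi}) (\<lambda>y::(complex^'n) \<times> real. monomial \<alpha> (E (repl w j (Complex x (snd y)))))"
      proof -
        have m: "continuous_on {z. \<forall>i. z $ i \<noteq> 0} (monomial \<alpha>)" by (rule continuous_on_monomial) (simp add: monomial_defined_def)
        show ?thesis by (rule continuous_on_compose2[OF m], rule cE) auto
      qed
      show "continuous_on (utorus \<times> {0..2*pi}) (\<lambda>(\<omega>, t). \<Psi> \<omega> (Complex x t))"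
        unfolding \<Psi>_def case_prod_unfold by (intro continuous_on_divide continuous_on_mult c1 c2 c3) (simp add: monomial_nz)
    qed
    finally show ?thesis .
  qed
  have "integral {0..2*pi} (\<lambda>t. \<Psi> \<omega> (Complex x t)) = integral {0..2*pi} (\<lambda>t. \<Psi> \<omega> (Complex x' t))" if \<omega>: "\<omega> \<in> utorus" for \<omega>
  proof (rule periodic_integral_const[OF _ _ x])
    fix \<zeta> assume \<zeta>: "Re \<zeta> > 0"
    show "\<Psi> \<omega> (\<zeta> + 2 * pi * \<i>) = \<Psi> \<omega> \<zeta>" by (simp only: \<Psi>_def E_repl_period)
    have "(\<lambda>\<zeta>. f (\<omega> * E (repl w j \<zeta>))) field_differentiable at \<zeta>"
    proof (rule holo_on_slice[OF f])
      show "((\<lambda>\<zeta>. (\<omega> * E (repl w j \<zeta>)) $ k) has_field_derivative \<omega> $ k * (- of_int (B k j) * E (repl w j \<zeta>) $ k)) (at \<zeta>)" for k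
        unfolding vector_mult_component by (rule DERIV_cmult[OF E_repl_deriv])
      show "\<omega> * E (repl w j \<zeta>) \<in> U" by (simp add: unimodular_U[OF \<omega>] rU[OF \<zeta>])
    qed
    moreover have "(\<lambda>\<zeta>. monomial \<alpha> (E (repl w j \<zeta>))) field_differentiable at \<zeta>"
      by (rule holo_on_slice[OF holo_on_monomial[of "{z. \<forall>i. z $ i \<noteq> 0}" \<alpha>] E_repl_deriv]) (auto simp: monomial_defined_def)
    ultimately show "\<Psi> \<omega> field_differentiable at \<zeta>"
      unfolding \<Psi>_def by (intro field_differentiable_divide field_differentiable_mult field_differentiable_const) (auto simp: monomial_nz)
  qed
  then have "tavg (\<lambda>\<omega>. integral {0..2*pi} (\<lambda>t. \<Psi> \<omega> (Complex x t))) = tavg (\<lambda>\<omega>. integral {0..2*pi} (\<lambda>t. \<Psi> \<omega> (Complex x' t)))"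
    by (rule tavg_cong)
  then have "2 * pi * uu f \<alpha> (repl w j (Complex x 0)) = 2 * pi * uu f \<alpha> (repl w j (Complex x' 0))"
    by (simp only: avg[OF x(1)] avg[OF x(2)])
  then show ?thesis by simp
qed

lemma uu_repl:
  assumes f: "holo_on f U" and w: "\<And>k. Re (w $ k) > 0" and \<zeta>: "Re \<zeta> > 0"
  shows "uu f \<alpha> (repl w j \<zeta>) = uu f \<alpha> w"
proof -
  have cf: "continuous_on U f" by (rule holo_on_continuous[OF f])
  have rU: "E (repl w j \<zeta>) \<in> U" if "Re \<zeta> > 0" for \<zeta>
    unfolding E_in_U using w that by (simp add: repl_def)
  have im: "uu f \<alpha> (repl w j \<zeta>) = uu f \<alpha> (repl w j (Complex (Re \<zeta>) 0))" if "Re \<zeta> > 0" for \<zeta>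
    using uu_im[OF cf rU[of "Complex (Re \<zeta>) 0"], where t="Im \<zeta>"] that by simp
  have "repl w j (w $ j) = w" by (simp add: repl_def vec_eq_iff)
  then show ?thesis using im[OF \<zeta>] im[OF w[of j]] uu_re[OF f w \<zeta> w[of j]] by simp
qed

lemma uu_const:
  assumes f: "holo_on f U" and w: "\<And>k. Re (w $ k) > 0" and v: "\<And>k. Re (v $ k) > 0"
  shows "uu f \<alpha> v = uu f \<alpha> w"
proof -
  have "uu f \<alpha> (\<chi> k. if k \<in> J then v $ k else w $ k) = uu f \<alpha> w" if "finite J" for J
    using that
  proof induction
    case (insert j J)
    have "(\<chi> k. if k \<in> insert j J then v $ k else w $ k) = repl (\<chi> k. if k \<in> J then v $ k else w $ k) j (v $ j)"
      by (auto simp: repl_def vec_eq_iff)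
    then have "uu f \<alpha> (\<chi> k. if k \<in> insert j J then v $ k else w $ k) = uu f \<alpha> (\<chi> k. if k \<in> J then v $ k else w $ k)"
      using uu_repl[OF f, of "\<chi> k. if k \<in> J then v $ k else w $ k" "v $ j"] w v by simp
    then show ?case using insert by simp
  qed simp
  from this[of UNIV] show ?thesis by simp
qed

definition lc :: "(complex^'n \<Rightarrow> complex) \<Rightarrow> ('n \<Rightarrow> int) \<Rightarrow> complex" where
  "lc f \<alpha> = uu f \<alpha> (\<chi> k. 1)"

lemma co_eq:
  assumes f: "holo_on f U" and z: "z \<in> Ust"
  shows "co f \<alpha> z = lc f \<alpha> * monomial \<alpha> z"
proof -
  obtain w where w: "z = E w" "\<And>k. Re (w $ k) > 0" using Ust_E[OF z] by blast
  have "uu f \<alpha> w = lc f \<alpha>" unfolding lc_def by (rule uu_const[OF f _ w(2)]) simp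
  then show ?thesis using w(1) by (simp add: uu_def monomial_nz field_simps)
qed

lemma lc_bound:
  assumes f: "holo_on f U" and z: "z \<in> Ust" and M: "\<And>\<omega>. \<omega> \<in> utorus \<Longrightarrow> cmod (f (\<omega> * z)) \<le> M"
  shows "cmod (lc f \<alpha>) * cmod (monomial \<alpha> z) \<le> M"
proof -
  have "cmod (co f \<alpha> z) \<le> M" unfolding co_def
    by (rule tavg_norm_le) (use M z cont_rot[OF holo_on_continuous[OF f], of z]
      in \<open>auto simp: norm_mult norm_monomial_utorus Ust_def intro!: continuous_on_mult cont_monomial_utorus\<close>)
  then show ?thesis by (simp add: co_eq[OF f z] norm_mult)
qed

text \<open>On approach to a point of the hyperplane \<open>f\<close> stays bounded along the
  rotated path, which is compact in \<open>U\<close>, while t^(\<alpha> i) with \<alpha> i < 0 is at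
  least 1 / t; by \<open>lc_bound\<close> the coefficient must vanish.\<close>

lemma lc_defined:
  assumes f: "holo_on f U" and nz: "lc f \<alpha> \<noteq> 0" and z: "z \<in> U"
  shows "monomial_defined \<alpha> z"
  unfolding monomial_defined_def
proof (intro allI impI notI)
  fix i assume neg: "\<alpha> i < 0" and zi: "z $ i = 0"
  obtain r where r: "r > 0" "cball z r \<subseteq> U" using z U_open by (meson open_contains_cball)
  define e where "e = r / (real CARD('n))"
  have e: "e > 0" using r by (simp add: e_def)
  \<comment> \<open>The remaining zero coordinates of \<open>z\<close> are moved to
    \<open>e\<close>, so that the point lies in \<open>Ust\<close> for t > 0. Every coordinate moves
    by at most \<open>e\<close>, hence the path stays in the ball of radius
    \<open>r\<close>.\<close>
  define zt where "zt t = (\<chi> k. if k = i then complex_of_real t else if z $ k = 0 then of_real e else z $ k)" for t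
  have zU: "zt t \<in> U" if "t \<in> {0..e}" for t
  proof -
    have "norm (zt t - z) \<le> (\<Sum>k\<in>UNIV. cmod ((zt t - z) $ k))"
      unfolding norm_vec_def by (rule L2_set_le_sum) simp
    also have "\<dots> \<le> (\<Sum>k\<in>(UNIV :: 'n set). e)"
      by (rule sum_mono) (use that e zi in \<open>auto simp: zt_def\<close>)
    also have "\<dots> = r" by (simp add: e_def)
    finally have "zt t \<in> cball z r" by (simp add: dist_norm norm_minus_commute)
    then show ?thesis using r by blast
  qed
  have zst: "zt t \<in> Ust" if "0 < t" "t \<le> e" for t
    using zU[of t] that e by (auto simp: Ust_def zt_def)
  define K where "K = (\<lambda>x. fst x * zt (snd x)) ` (utorus \<times> {0..e})"
  have "continuous_on (utorus \<times> {0..e}) (\<lambda>x :: (complex^'n) \<times> real. if k = i then complex_of_real (snd x) else if z $ k = 0 then of_real e else z $ k)" (is "continuous_on _ (?c k)") for k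
    by (cases "k = i"; cases "z $ k = 0") (auto intro!: continuous_intros)
  from continuous_on_vec_lambda[of _ ?c, OF this]
  have "continuous_on (utorus \<times> {0..e}) (\<lambda>x :: (complex^'n) \<times> real. zt (snd x))" unfolding zt_def .
  then have "compact K" unfolding K_def
    by (intro compact_continuous_image cont_cmul continuous_intros compact_Times compact_utorus) auto
  moreover have "K \<subseteq> U" unfolding K_def using zU by (auto simp: unimodular_U)
  ultimately have "compact (f ` K)"
    using holo_on_continuous[OF f] by (intro compact_continuous_image) (auto intro: continuous_on_subset)
  then obtain M where "\<forall>y\<in>K. cmod (f y) \<le> M" by (auto dest!: compact_imp_bounded simp: bounded_iff)
  then have M: "\<And>y. y \<in> K \<Longrightarrow> cmod (f y) \<le> M" by blast
  define L where "L = cmod (\<Prod>k\<in>UNIV - {i}. zt 0 $ k powi \<alpha> k)"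
  have L: "L > 0" using e by (auto simp: L_def zt_def)
  have le: "cmod (lc f \<alpha>) * L \<le> M * t" if t: "0 < t" "t \<le> e" "t \<le> 1" for t
  proof -
    have "monomial \<alpha> (zt t) = of_real t powi \<alpha> i * (\<Prod>k\<in>UNIV - {i}. zt t $ k powi \<alpha> k)"
      unfolding monomial_def by (subst prod.remove[of _ i]) (auto simp: zt_def)
    also have "(\<Prod>k\<in>UNIV - {i}. zt t $ k powi \<alpha> k) = (\<Prod>k\<in>UNIV - {i}. zt 0 $ k powi \<alpha> k)"
      by (rule prod.cong) (auto simp: zt_def)
    finally have m: "cmod (monomial \<alpha> (zt t)) = t powi \<alpha> i * L" using t by (simp add: L_def norm_mult norm_power_int)
    have "cmod (lc f \<alpha>) * cmod (monomial \<alpha> (zt t)) \<le> M"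
    proof (rule lc_bound[OF f zst])
      show "cmod (f (\<omega> * zt t)) \<le> M" if "\<omega> \<in> utorus" for \<omega>
        by (rule M) (use that t in \<open>auto simp: K_def intro!: image_eqI[of _ _ "(\<omega>, t)"]\<close>)
    qed (use t in auto)
    then have "cmod (lc f \<alpha>) * L * t powi \<alpha> i \<le> M" by (simp add: m mult_ac)
    moreover have "1 / t \<le> t powi \<alpha> i"
    proof -
      have "t ^ nat (- \<alpha> i) \<le> t ^ 1" using t neg by (intro power_decreasing) auto
      moreover have "t powi \<alpha> i = 1 / t ^ nat (- \<alpha> i)" using neg by (simp add: power_int_def divide_inverse power_inverse)
      ultimately show ?thesis using t by (simp add: frac_le)
    qed
    ultimately have "cmod (lc f \<alpha>) * L * (1 / t) \<le> M"
      using L by (meson mult_left_mono norm_ge_zero mult_nonneg_nonneg less_imp_le order_trans)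
    then show ?thesis using t by (simp add: field_simps)
  qed
  have "cmod (lc f \<alpha>) * L \<le> M * 0"
  proof (rule tendsto_lowerbound)
    show "((\<lambda>t. M * t) \<longlongrightarrow> M * 0) (at_right 0)" by (intro tendsto_intros)
    show "\<forall>\<^sub>F t in at_right 0. cmod (lc f \<alpha>) * L \<le> M * t"
      using eventually_at_right_less[of "0::real"] eventually_at_right[of 0 "min e 1"] e
      by (auto simp: eventually_at_right_field intro!: exI[of _ "min e 1"] le)
  qed simp
  then show False using L nz by (simp add: mult_le_0_iff)
qed

end

section \<open>Laurent expansion in the Bergman space\<close>

lemma lpI_cong_AE:
  assumes "AE x in M. f x = g x" shows "lpI p M f = lpI p M g"
  unfolding lpI_def by (rule nn_integral_cong_AE) (use assms in \<open>auto elim: eventually_mono\<close>)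

lemma lpN_cong_AE:
  assumes "AE x in M. f x = g x" shows "lpN p M f = lpN p M g"
  unfolding lpN_def by (simp add: lpI_cong_AE[OF assms])

lemma tavg_sum:
  assumes "finite F" "\<And>a. a \<in> F \<Longrightarrow> continuous_on utorus (f a)"
  shows "tavg (\<lambda>u. \<Sum>a\<in>F. f a u) = (\<Sum>a\<in>F. tavg (f a))"
  using assms
proof (induction F)
  case (insert a F)
  have "continuous_on utorus (\<lambda>u. \<Sum>a\<in>F. f a u)" by (intro continuous_on_sum) (use insert in auto)
  then show ?case using insert by (simp add: tavg_add)
qed (simp add: tavg_const)

lemma monomial_one[simp]: "monomial \<alpha> 1 = 1" by (simp add: monomial_def)

lemma one_utorus[simp]: "1 \<in> utorus" by (simp add: utorus_def unimodular_def)

lemma cnj_monomial_utorus: "u \<in> utorus \<Longrightarrow> cnj (monomial \<alpha> u) = monomial (\<lambda>i. - \<alpha> i) u"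
proof -
  assume u: "u \<in> utorus"
  have "cnj (monomial \<alpha> u) * monomial \<alpha> u = 1"
    using norm_monomial_utorus[OF u, of \<alpha>] complex_norm_square[of "monomial \<alpha> u"] by (simp add: mult.commute)
  then have "cnj (monomial \<alpha> u) * monomial \<alpha> u = monomial (\<lambda>i. - \<alpha> i) u * monomial \<alpha> u"
    by (simp add: monomial_uminus_utorus[OF u])
  then show ?thesis using monomial_nz[OF utorus_nz[OF u], of \<alpha>] by simp
qed

context polyhedron begin

lemma measurable_id_V: "(\<lambda>z. z) \<in> borel_measurable V"
  by (rule measurable_V_borel) simp

lemma measurable_extend:
  assumes "f \<in> borel_measurable V" shows "(\<lambda>z. if z \<in> U then f z else (0::complex)) \<in> borel_measurable borel"
proof -
  have "(\<lambda>z. indicator U z *\<^sub>R f z) \<in> borel_measurable lborel"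
    using assms unfolding V_def by (subst (asm) borel_measurable_restrict_space_iff) auto
  moreover have "(\<lambda>z. indicator U z *\<^sub>R f z) = (\<lambda>z. if z \<in> U then f z else 0)" by auto
  ultimately show ?thesis by simp
qed

lemma holo_V: "holo_on f U \<Longrightarrow> f \<in> borel_measurable V"
  by (rule V_measurable_cont) (rule holo_on_continuous)

lemma measurable_rotate:
  assumes f: "f \<in> borel_measurable V" and m: "m \<in> measurable V V"
  shows "(\<lambda>x. if fst x * m (snd x) \<in> U then f (fst x * m (snd x)) else (0::complex))
    \<in> borel_measurable ((torus :: (complex^'n) measure) \<Otimes>\<^sub>M V)"
proof -
  have [measurable]: "m \<in> borel_measurable V" using measurable_compose[OF m measurable_id_V] .
  have "(\<lambda>x. fst x * m (snd x)) \<in> borel_measurable (torus \<Otimes>\<^sub>M V)" by measurable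
  from measurable_compose[OF this measurable_extend[OF f]] show ?thesis .
qed

lemma sigma_finite_V: "sigma_finite_measure V"
  using finite_measure_V by (rule finite_measure.axioms(1))

text \<open>Jensen's inequality on each rotation orbit, then Fubini and rotation invariance of
  \<open>V\<close>. The map \<open>m\<close> is the identity for functions in A^p and the twist for
  functions on the dual side.\<close>

lemma lc_lp:
  assumes r: "r > 1" and f: "holo_on f U" and m: "m \<in> measurable V V"
    and rot: "\<And>u z. u \<in> utorus \<Longrightarrow> m (u * z) = u * m z" and st: "\<And>z. z \<in> Ust \<Longrightarrow> m z \<in> Ust"
  shows "ennreal (cmod (lc f \<alpha>) powr r) * lpI r V (\<lambda>z. monomial \<alpha> (m z)) \<le> lpI r V (\<lambda>z. f (m z))"
proof -
  interpret T: finite_measure "torus :: (complex^'n) measure" by (rule finite_measure_torus)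
  interpret V: sigma_finite_measure V by (rule sigma_finite_V)
  interpret P: pair_sigma_finite "torus :: (complex^'n) measure" V ..
  have mU: "m z \<in> U" if "z \<in> U" for z using measurable_space[OF m] that by simp
  define F where "F = (\<lambda>z. if z \<in> U then f z else 0)"
  define G :: "complex^'n \<Rightarrow> complex^'n \<Rightarrow> ennreal" where "G = (\<lambda>\<omega> z. ennreal (indicator utorus \<omega> * cmod (F (\<omega> * m z)) powr r))"
  have [measurable]: "(\<lambda>x. F (fst x * m (snd x))) \<in> borel_measurable ((torus :: (complex^'n) measure) \<Otimes>\<^sub>M V)"
    unfolding F_def by (rule measurable_rotate[OF holo_V[OF f] m])
  have Gm: "case_prod G \<in> borel_measurable (torus \<Otimes>\<^sub>M V)" unfolding G_def case_prod_unfold by measurable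
  have [measurable]: "(\<lambda>z. monomial \<alpha> (m z)) \<in> borel_measurable V"
    using measurable_compose[OF measurable_compose[OF m measurable_id_V] monomial_measurable] .
  have "ennreal (cmod (lc f \<alpha>) powr r) * lpI r V (\<lambda>z. monomial \<alpha> (m z))
      = (\<integral>\<^sup>+z. ennreal (cmod (lc f \<alpha>) powr r) * ennreal (cmod (monomial \<alpha> (m z)) powr r) \<partial>V)"
    unfolding lpI_def by (rule nn_integral_cmult[symmetric]) measurable
  also have "\<dots> \<le> (\<integral>\<^sup>+z. \<integral>\<^sup>+\<omega>. G \<omega> z \<partial>torus \<partial>V)"
  proof (rule nn_integral_mono_AE, rule AE_mp[OF AE_V], rule AE_I2, rule impI)
    fix z assume z: "z \<in> Ust"
    note mz = st[OF z]
    have mzU: "m z \<in> U" using mz by (simp add: Ust_def)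
    have "ennreal (cmod (lc f \<alpha>) powr r) * ennreal (cmod (monomial \<alpha> (m z)) powr r) = ennreal (cmod (co f \<alpha> (m z)) powr r)"
      by (simp add: co_eq[OF f mz] norm_mult powr_mult ennreal_mult)
    also have "\<dots> \<le> (\<integral>\<^sup>+\<omega>. ennreal (indicator utorus \<omega> * cmod (f (\<omega> * m z) * monomial (\<lambda>i. - \<alpha> i) \<omega>) powr r) \<partial>torus)"
      unfolding co_def
      by (rule tavg_lp_bound[OF r]) (intro continuous_on_mult cont_rot[OF holo_on_continuous[OF f] mzU] cont_monomial_utorus)
    also have "\<dots> = (\<integral>\<^sup>+\<omega>. G \<omega> z \<partial>torus)"
    proof (rule nn_integral_cong)
      fix \<omega> :: "complex^'n"
      show "ennreal (indicator utorus \<omega> * cmod (f (\<omega> * m z) * monomial (\<lambda>i. - \<alpha> i) \<omega>) powr r) = G \<omega> z"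
        by (cases "\<omega> \<in> utorus") (simp_all add: G_def F_def unimodular_U mzU norm_mult norm_monomial_utorus)
    qed
    finally show "ennreal (cmod (lc f \<alpha>) powr r) * ennreal (cmod (monomial \<alpha> (m z)) powr r) \<le> (\<integral>\<^sup>+\<omega>. G \<omega> z \<partial>torus)" .
  qed
  also have "\<dots> = (\<integral>\<^sup>+\<omega>. \<integral>\<^sup>+z. G \<omega> z \<partial>V \<partial>torus)" by (rule P.Fubini'[OF Gm])
  also have "\<dots> \<le> (\<integral>\<^sup>+\<omega>. lpI r V (\<lambda>z. f (m z)) \<partial>(torus :: (complex^'n) measure))"
  proof (rule nn_integral_mono)
    fix \<omega> :: "complex^'n"
    show "(\<integral>\<^sup>+z. G \<omega> z \<partial>V) \<le> lpI r V (\<lambda>z. f (m z))"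
    proof (cases "\<omega> \<in> utorus")
      case True
      have fm: "(\<lambda>z. f (m z)) \<in> borel_measurable V" by (rule measurable_compose[OF m holo_V[OF f]])
      have "(\<integral>\<^sup>+z. G \<omega> z \<partial>V) = (\<integral>\<^sup>+z. ennreal (cmod (f (m (\<omega> * z))) powr r) \<partial>V)"
        by (rule nn_integral_cong) (simp add: G_def F_def True unimodular_U mU rot)
      also have "\<dots> = (\<integral>\<^sup>+z. ennreal (cmod (f (m z)) powr r) \<partial>distr V V ((*) \<omega>))"
        by (rule nn_integral_distr[symmetric]) (use mult_measurable_V[OF True] fm in measurable)
      finally show ?thesis by (simp add: V_rotation[OF True] lpI_def)
    qed (simp add: G_def)
  qed
  also have "\<dots> = lpI r V (\<lambda>z. f (m z))" by (simp add: emeasure_torus)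
  finally show ?thesis .
qed

lemma lpI_monomial_twist:
  assumes p: "p > 1" and q: "q = p / (p - 1)"
  shows "lpI q V (\<lambda>z. monomial \<alpha> (twist p z)) = lpI p V (monomial \<alpha>)"
  unfolding lpI_def
proof (rule nn_integral_cong_AE, rule AE_mp[OF AE_V], rule AE_I2, rule impI)
  fix z assume "z \<in> Ust"
  then have "monomial_defined \<alpha> z" by (simp add: Ust_def monomial_defined_def)
  then show "ennreal (cmod (monomial \<alpha> (twist p z)) powr q) = ennreal (cmod (monomial \<alpha> z) powr p)"
    using p by (simp add: norm_monomial_twist q powr_powr)
qed

text \<open>A nonzero coefficient makes its monomial p-integrable, by the coefficient bound, and
  holomorphic on \<open>U\<close>, by \<open>lc_defined\<close>; together this is membership in
  \<open>SS p\<close>.\<close>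

lemma lc_zero_aux:
  assumes p: "p > 1" and f: "holo_on f U" and L: "L < \<infinity>" and le: "ennreal (cmod (lc f \<alpha>) powr r) * lpI p V (monomial \<alpha>) \<le> L"
    and \<alpha>: "\<alpha> \<notin> SS p"
  shows "lc f \<alpha> = 0"
proof (rule ccontr)
  assume nz: "lc f \<alpha> \<noteq> 0"
  have "lpI p V (monomial \<alpha>) < \<infinity>"
  proof (rule ccontr)
    assume "\<not> ?thesis"
    then have "lpI p V (monomial \<alpha>) = \<infinity>" by (simp add: less_top[symmetric])
    then show False using le L nz by (simp add: ennreal_mult_top)
  qed
  then have "\<alpha> \<in> SS p" using p lc_defined[OF f nz] by (intro SS_I lpI_monomial_finite) auto
  then show False using \<alpha> by simp
qed

lemma lc_zero:
  assumes p: "p > 1" and f: "holo_on f U" "lpI p V f < \<infinity>" and \<alpha>: "\<alpha> \<notin> SS p"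
  shows "lc f \<alpha> = 0"
  by (rule lc_zero_aux[OF p f(1) f(2) _ \<alpha>, of p]) (use lc_lp[OF p f(1), of "\<lambda>z. z" \<alpha>] in simp)

lemma lc_zero_twist:
  assumes p: "p > 1" and q: "q = p / (p - 1)" and f: "holo_on f U" "lpI q V (\<lambda>z. f (twist p z)) < \<infinity>" and \<alpha>: "\<alpha> \<notin> SS p"
  shows "lc f \<alpha> = 0"
proof (rule lc_zero_aux[OF p f(1) f(2) _ \<alpha>])
  have "q > 1" using p by (simp add: q field_simps)
  from lc_lp[OF this f(1) twist_measurable_V[OF p] twist_mult twist_Ust[OF p], of \<alpha>]
  show "ennreal (cmod (lc f \<alpha>) powr q) * lpI p V (monomial \<alpha>) \<le> lpI q V (\<lambda>z. f (twist p z))"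
    by (simp add: lpI_monomial_twist[OF p q])
qed

text \<open>Rotation does not change the moduli of the terms, so absolute convergence at
  \<open>z\<close> is uniform along its orbit and the average may be taken term by term.\<close>

lemma ser_fourier:
  assumes sm: "(\<lambda>\<alpha>. cmod (x \<alpha> * monomial \<alpha> z)) summable_on SS p"
  shows "continuous_on utorus (\<lambda>\<omega>. ser p x (\<omega> * z))"
    "tavg (\<lambda>\<omega>. ser p x (\<omega> * z) * monomial (\<lambda>i. - \<beta> i) \<omega>) = (if \<beta> \<in> SS p then x \<beta> * monomial \<beta> z else 0)"
proof -
  define g where "g = (\<lambda>\<alpha>. cmod (x \<alpha> * monomial \<alpha> z))"
  define h where "h = (\<lambda>N \<omega>. \<Sum>\<alpha>\<in>SN p N. x \<alpha> * monomial \<alpha> (\<omega> * z))"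
  have hc: "continuous_on utorus (h N)" for N
    unfolding h_def monomial_mult by (intro continuous_on_sum continuous_on_mult continuous_on_const cont_monomial_utorus)
  have le: "cmod (ser p x (\<omega> * z) - h N \<omega>) \<le> infsum g (SS p) - sum g (SN p N)" if "\<omega> \<in> utorus" for \<omega> N
    unfolding ser_def h_def
    by (rule norm_infsum_diff_le(2)) (use sm that in \<open>auto simp: g_def monomial_mult norm_mult norm_monomial_utorus finite_SN SN_subset\<close>)
  have lim: "(\<lambda>N. sum g (SN p N)) \<longlonglongrightarrow> infsum g (SS p)" by (rule SN_tendsto) (use sm g_def in simp)
  have unif: "uniform_limit utorus h (\<lambda>\<omega>. ser p x (\<omega> * z)) sequentially"
  proof (rule uniform_limitI)
    fix e :: real assume "e > 0"
    then have "\<forall>\<^sub>F N in sequentially. dist (sum g (SN p N)) (infsum g (SS p)) < e" using lim by (rule tendstoD[rotated])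
    then show "\<forall>\<^sub>F N in sequentially. \<forall>\<omega>\<in>utorus. dist (h N \<omega>) (ser p x (\<omega> * z)) < e"
    proof eventually_elim
      case (elim N)
      show ?case
      proof
        fix \<omega> :: "complex^'n" assume "\<omega> \<in> utorus"
        from le[OF this, of N] elim show "dist (h N \<omega>) (ser p x (\<omega> * z)) < e"
          by (simp add: dist_norm norm_minus_commute)
      qed
    qed
  qed
  from tavg_limit(2)[OF hc unif] show cont: "continuous_on utorus (\<lambda>\<omega>. ser p x (\<omega> * z))" .
  have unif2: "uniform_limit utorus (\<lambda>N \<omega>. h N \<omega> * monomial (\<lambda>i. - \<beta> i) \<omega>) (\<lambda>\<omega>. ser p x (\<omega> * z) * monomial (\<lambda>i. - \<beta> i) \<omega>) sequentially"
  proof (rule uniform_limitI)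
    fix e :: real assume "e > 0"
    from uniform_limitD[OF unif this]
    show "\<forall>\<^sub>F N in sequentially. \<forall>\<omega>\<in>utorus. dist (h N \<omega> * monomial (\<lambda>i. - \<beta> i) \<omega>) (ser p x (\<omega> * z) * monomial (\<lambda>i. - \<beta> i) \<omega>) < e"
      by eventually_elim (simp add: dist_norm left_diff_distrib[symmetric] norm_mult norm_monomial_utorus)
  qed
  have "(\<lambda>N. tavg (\<lambda>\<omega>. h N \<omega> * monomial (\<lambda>i. - \<beta> i) \<omega>)) \<longlonglongrightarrow> tavg (\<lambda>\<omega>. ser p x (\<omega> * z) * monomial (\<lambda>i. - \<beta> i) \<omega>)"
    by (rule tavg_limit(1)[OF _ unif2]) (intro continuous_on_mult hc cont_monomial_utorus)
  moreover have t: "tavg (\<lambda>\<omega>. h N \<omega> * monomial (\<lambda>i. - \<beta> i) \<omega>) = (if \<beta> \<in> SN p N then x \<beta> * monomial \<beta> z else 0)" for N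
  proof -
    have "tavg (\<lambda>\<omega>. h N \<omega> * monomial (\<lambda>i. - \<beta> i) \<omega>) = tavg (\<lambda>\<omega>. \<Sum>\<alpha>\<in>SN p N. x \<alpha> * monomial \<alpha> z * monomial (\<lambda>i. \<alpha> i + - \<beta> i) \<omega>)"
      unfolding h_def sum_distrib_right
      by (rule tavg_cong, rule sum.cong) (simp_all add: monomial_mult monomial_add_exp[OF utorus_nz] mult_ac del: add_uminus_conv_diff)
    also have "\<dots> = (\<Sum>\<alpha>\<in>SN p N. x \<alpha> * monomial \<alpha> z * (if \<alpha> = \<beta> then 1 else 0))"
    proof (subst tavg_sum[OF finite_SN])
      have "tavg (\<lambda>u. x \<alpha> * monomial \<alpha> z * monomial (\<lambda>i. \<alpha> i + - \<beta> i) u) = x \<alpha> * monomial \<alpha> z * (if \<alpha> = \<beta> then 1 else 0)" for \<alpha>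
        unfolding tavg_cmul tavg_monomial by (auto simp: fun_eq_iff)
      then show "(\<Sum>\<alpha>\<in>SN p N. tavg (\<lambda>u. x \<alpha> * monomial \<alpha> z * monomial (\<lambda>i. \<alpha> i + - \<beta> i) u)) = (\<Sum>\<alpha>\<in>SN p N. x \<alpha> * monomial \<alpha> z * (if \<alpha> = \<beta> then 1 else 0))"
        by simp
    qed (intro continuous_on_mult continuous_on_const cont_monomial_utorus)
    also have "\<dots> = (if \<beta> \<in> SN p N then x \<beta> * monomial \<beta> z else 0)"
      by (simp add: finite_SN sum.delta' if_distrib[of "\<lambda>y. _ * y"] cong: if_cong)
    finally show ?thesis .
  qed
  moreover have "\<forall>\<^sub>F N in sequentially. (if \<beta> \<in> SN p N then x \<beta> * monomial \<beta> z else 0) = (if \<beta> \<in> SS p then x \<beta> * monomial \<beta> z else 0)"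
  proof (cases "\<beta> \<in> SS p")
    case True
    then obtain N where "{\<beta>} \<subseteq> SN p N" using SN_exhaust[of "{\<beta>}" p] by auto
    then show ?thesis using SN_mono[of N _ p] True by (auto simp: eventually_sequentially intro!: exI[of _ N])
  next
    case False
    then have "\<beta> \<notin> SN p N" for N using SN_subset[of p N] by blast
    then show ?thesis using False by simp
  qed
  ultimately have "(\<lambda>N. if \<beta> \<in> SS p then x \<beta> * monomial \<beta> z else 0) \<longlonglongrightarrow> tavg (\<lambda>\<omega>. ser p x (\<omega> * z) * monomial (\<lambda>i. - \<beta> i) \<omega>)"
    by (simp only: t) (rule Lim_transform_eventually)
  then show "tavg (\<lambda>\<omega>. ser p x (\<omega> * z) * monomial (\<lambda>i. - \<beta> i) \<omega>) = (if \<beta> \<in> SS p then x \<beta> * monomial \<beta> z else 0)"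
    by (simp add: LIMSEQ_const_iff)
qed

text \<open>On the orbit of \<open>z\<close> the function and the series have the same Fourier
  coefficients; \<open>nofourier_zero\<close> gives equality, read off at the rotation 1.\<close>

lemma laurent:
  assumes f: "holo_on f U" and van: "\<And>\<alpha>. \<alpha> \<notin> SS p \<Longrightarrow> lc f \<alpha> = 0" and z: "z \<in> Ust"
    and sm: "(\<lambda>\<alpha>. cmod (lc f \<alpha> * monomial \<alpha> z)) summable_on SS p"
  shows "f z = ser p (lc f) z"
proof -
  have zU: "z \<in> U" using z by (simp add: Ust_def)
  note cf = cont_rot[OF holo_on_continuous[OF f] zU] and cs = ser_fourier(1)[OF sm]
  have "nofourier (\<lambda>\<omega>. f (\<omega> * z) - ser p (lc f) (\<omega> * z))"
    unfolding nofourier_def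
  proof (intro conjI allI continuous_on_diff cf cs)
    fix \<alpha> :: "'n \<Rightarrow> int"
    define \<beta> where "\<beta> = (\<lambda>i. - \<alpha> i)"
    have \<alpha>: "\<alpha> = (\<lambda>i. - \<beta> i)" by (simp add: \<beta>_def)
    have "tavg (\<lambda>u. (f (u * z) - ser p (lc f) (u * z)) * monomial \<alpha> u) = co f \<beta> z - (if \<beta> \<in> SS p then lc f \<beta> * monomial \<beta> z else 0)"
      unfolding left_diff_distrib \<alpha> co_def ser_fourier(2)[OF sm, symmetric]
      by (rule tavg_diff) (intro continuous_on_mult cf cs cont_monomial_utorus)+
    also have "\<dots> = 0" using van by (simp add: co_eq[OF f z])
    finally show "tavg (\<lambda>u. (f (u * z) - ser p (lc f) (u * z)) * monomial \<alpha> u) = 0" .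
  qed
  from nofourier_zero[OF this one_utorus] show ?thesis by simp
qed

lemma EE1: "E (\<chi> k. 1) \<in> Ust" by (rule E_Ust) simp

lemma lc_ser:
  assumes p: "p > 0" and x: "growth p x" and \<alpha>: "\<alpha> \<in> SS p"
  shows "lc (ser p x) \<alpha> = x \<alpha>"
proof -
  have U: "E (\<chi> k. 1) \<in> U" using EE1 by (simp add: Ust_def)
  have "lc (ser p x) \<alpha> * monomial \<alpha> (E (\<chi> k. 1)) = co (ser p x) \<alpha> (E (\<chi> k. 1))"
    by (rule co_eq[OF ser_holo[OF p x] EE1, symmetric])
  also have "\<dots> = x \<alpha> * monomial \<alpha> (E (\<chi> k. 1))"
    unfolding co_def using ser_fourier(2)[OF ser_abs_summable[OF p x U], of \<alpha>] \<alpha> by simp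
  finally show ?thesis by (simp add: monomial_nz)
qed

lemma holo_eq_zero:
  assumes f: "holo_on f U" and van: "\<And>\<alpha>. lc f \<alpha> = 0" and z: "z \<in> U"
  shows "f z = 0"
proof -
  have "f z' = 0" if "z' \<in> Ust" for z'
    using laurent[OF f _ that, of 1] van by (simp add: ser_def)
  then have "cmod (f z) \<le> 0" by (intro cont_le_dense[OF holo_on_continuous[OF f] z zero_less_one]) simp
  then show ?thesis by simp
qed

end

section \<open>Density of monomials and the pairing\<close>

lemma holo_on_cmul_arg:
  fixes f :: "complex^'n \<Rightarrow> complex"
  assumes f: "holo_on f U" and c: "\<And>z. z \<in> U \<Longrightarrow> c * z \<in> U"
  shows "holo_on (\<lambda>z. f (c * z)) U"
  unfolding holo_on_def
proof
  fix z assume "z \<in> U"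
  then obtain a where a: "(f has_derivative (\<lambda>v. \<Sum>i\<in>UNIV. a i * v $ i)) (at (c * z))"
    using f c unfolding holo_on_def by blast
  have "linear ((*) c)" by (rule linearI) (simp_all add: distrib_left)
  then have "((*) c has_derivative (*) c) (at z)"
    by (simp add: bounded_linear_imp_has_derivative linear_conv_bounded_linear)
  from has_derivative_compose[OF this a]
  have "((\<lambda>z. f (c * z)) has_derivative (\<lambda>v. \<Sum>i\<in>UNIV. (a i * c $ i) * v $ i)) (at z)" by (simp add: mult_ac)
  then show "\<exists>a'. ((\<lambda>z. f (c * z)) has_derivative (\<lambda>v. \<Sum>i\<in>UNIV. a' i * v $ i)) (at z)"
    by (rule exI[where x="\<lambda>i. a i * c $ i"])
qed

context polyhedron begin

text \<open>Multiplication by \<open>dil t\<close> shifts every logarithmic coordinate by the real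
  number \<open>t\<close>. For t > 0 it maps \<open>U\<close> into itself and gives the monomials
  factors decaying like \<open>dec p t\<close>.\<close>

definition dil :: "real \<Rightarrow> complex^'n" where "dil t = E (\<chi> _. complex_of_real t)"

lemma dil_U: "t \<ge> 0 \<Longrightarrow> z \<in> U \<Longrightarrow> dil t * z \<in> U"
proof -
  assume t: "t \<ge> 0" and z: "z \<in> U"
  have "cmod (monomial (A j) (dil t * z)) < 1" for j
  proof -
    have "cmod (monomial (A j) (dil t)) \<le> 1" using t d_pos by (simp add: dil_def norm_A_E)
    then have "cmod (monomial (A j) (dil t)) * cmod (monomial (A j) z) \<le> 1 * cmod (monomial (A j) z)"
      by (rule mult_right_mono) simp
    then show ?thesis using A_less[OF z, of j] by (simp add: monomial_mult norm_mult)
  qed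
  then show ?thesis using A_defined[OF z] by (simp add: U_eq monomial_polyhedron_set_def monomial_defined_def dil_def)
qed

lemma dil_Ust: "t \<ge> 0 \<Longrightarrow> z \<in> Ust \<Longrightarrow> dil t * z \<in> Ust"
  using dil_U by (simp add: Ust_def dil_def)

lemma norm_monomial_dil: "cmod (monomial \<alpha> (dil t)) = exp (- t * (\<Sum>j\<in>UNIV. of_int (kk p j))) * dec p t \<alpha>"
proof -
  have "(\<Sum>j\<in>UNIV. of_int (ge \<alpha> j) * t) = t * (\<Sum>j\<in>UNIV. of_int (kk p j)) + (\<Sum>j\<in>UNIV. t * of_int (ge \<alpha> j - kk p j))"
    by (simp add: sum_distrib_left sum.distrib[symmetric] algebra_simps)
  then show ?thesis
    by (simp add: dil_def norm_monomial_E dec_def exp_sum[symmetric] exp_add[symmetric] sum_negf)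
qed

text \<open>The scalar is the p-th root of the Jacobian of the dilation. Since the dilation maps
  \<open>U\<close> into itself, only a part of the integral of \<open>f\<close> is collected, so the
  norm cannot grow.\<close>

lemma lpI_dil:
  assumes f: "f \<in> borel_measurable V" and t: "t \<ge> 0" and p: "p > 0"
  shows "lpI p V (\<lambda>z. of_real (exp (- 2 * t * (\<Sum>j\<in>UNIV. of_int (b j)) / p)) * f (dil t * z)) \<le> lpI p V f"
proof -
  define F where "F = (\<lambda>z. if z \<in> U then f z else 0)"
  have Fm[measurable]: "F \<in> borel_measurable borel" unfolding F_def by (rule measurable_extend[OF f])
  define c where "c = exp (- 2 * t * (\<Sum>j\<in>UNIV. of_int (b j)))"
  have c: "c = (\<Prod>i\<in>UNIV. (cmod (dil t $ i))\<^sup>2)" by (simp add: c_def dil_def prod_norm_E sum_distrib_left mult_ac)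
  have "lpI p V (\<lambda>z. of_real (exp (- 2 * t * (\<Sum>j\<in>UNIV. of_int (b j)) / p)) * f (dil t * z))
      = (\<integral>\<^sup>+z. ennreal c * ennreal (cmod (F (dil t * z)) powr p) \<partial>V)"
    unfolding lpI_def
  proof (rule nn_integral_cong)
    fix z assume "z \<in> space V"
    then have "dil t * z \<in> U" using dil_U[OF t] by simp
    then show "ennreal (cmod (of_real (exp (- 2 * t * (\<Sum>j\<in>UNIV. of_int (b j)) / p)) * f (dil t * z)) powr p)
       = ennreal c * ennreal (cmod (F (dil t * z)) powr p)"
      using p by (simp add: norm_mult powr_mult c_def F_def ennreal_mult exp_powr_real)
  qed
  also have "\<dots> \<le> (\<integral>\<^sup>+z. ennreal c * ennreal (cmod (F (dil t * z)) powr p) \<partial>lborel)"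
    unfolding nn_integral_V by (rule nn_integral_mono) (simp add: indicator_def)
  also have "\<dots> = ennreal c * (\<integral>\<^sup>+z. ennreal (cmod (F (dil t * z)) powr p) \<partial>lborel)"
    by (rule nn_integral_cmult) measurable
  also have "\<dots> = (\<integral>\<^sup>+z. ennreal (cmod (F z) powr p) \<partial>lborel)"
    unfolding c by (rule nn_integral_lborel_cmul) (auto simp: dil_def)
  also have "\<dots> = lpI p V f"
    unfolding lpI_def nn_integral_V by (rule nn_integral_cong) (use p in \<open>auto simp: F_def indicator_def\<close>)
  finally show ?thesis .
qed

lemma lc_lpN:
  assumes p: "p > 1" and f: "holo_on f U" "lpI p V f < \<infinity>" and \<alpha>: "\<alpha> \<in> SS p"
  shows "cmod (lc f \<alpha>) * lpN p V (monomial \<alpha>) \<le> lpN p V f"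
proof -
  have "ennreal (cmod (lc f \<alpha>) powr p) * lpI p V (monomial \<alpha>) \<le> lpI p V f"
    using lc_lp[OF p f(1), of "\<lambda>z. z" \<alpha>] by simp
  moreover have "lpI p V (monomial \<alpha>) = ennreal (lpN p V (monomial \<alpha>) powr p)" "lpI p V f = ennreal (lpN p V f powr p)"
    using lpS_monomial[of p \<alpha>] p f \<alpha> by (auto intro!: lpI_eq simp: lpS_def)
  ultimately have "(cmod (lc f \<alpha>) * lpN p V (monomial \<alpha>)) powr p \<le> lpN p V f powr p"
    by (simp add: ennreal_mult[symmetric] powr_mult)
  moreover have "lpN p V f powr p < (cmod (lc f \<alpha>) * lpN p V (monomial \<alpha>)) powr p" if "\<not> ?thesis"
    using that p by (intro powr_less_mono2) auto
  ultimately show ?thesis by fastforce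
qed

text \<open>The normalised dilates converge to \<open>f\<close> in norm by
  \<open>lp_tendsto\<close>; the normalisation supplies its norm condition. Each dilate has a series
  that converges absolutely in norm: the terms \<open>lc f \<alpha> * monomial \<alpha>\<close> are
  bounded in norm by \<open>f\<close>, and the dilation multiplies them with summable
  factors.\<close>

lemma dense_monomials:
  assumes p: "p > 1" and f: "holo_on f U" "lpI p V f < \<infinity>" and e: "e > 0"
  shows "\<exists>F c. finite F \<and> F \<subseteq> SS p \<and> lpN p V (\<lambda>z. f z - (\<Sum>\<alpha>\<in>F. c \<alpha> * monomial \<alpha> z)) < e"
proof -
  have fV: "f \<in> borel_measurable V" by (rule holo_V[OF f(1)])
  have fS: "lpS p V f" using fV f by (simp add: lpS_def)
  define T where "T = (\<lambda>n. 1 / real (Suc n))"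
  have T: "T n > 0" for n by (simp add: T_def)
  have Tlim: "T \<longlonglongrightarrow> 0" unfolding T_def by (rule LIMSEQ_Suc[OF lim_1_over_n])
  define C where "C = (\<lambda>n. complex_of_real (exp (- 2 * T n * (\<Sum>j\<in>UNIV. of_int (b j)) / p)))"
  define D where "D = (\<lambda>n z. f (dil (T n) * z))"
  have Dh: "holo_on (D n) U" for n unfolding D_def by (rule holo_on_cmul_arg[OF f(1)]) (use dil_U T less_imp_le in blast)
  have le: "lpI p V (\<lambda>z. C n * D n z) \<le> lpI p V f" for n
    unfolding C_def D_def by (rule lpI_dil[OF fV]) (use T[of n] p in auto)
  have CDm: "(\<lambda>z. C n * D n z) \<in> borel_measurable V" for n by (rule holo_V) (rule holo_on_cmul[OF Dh])
  have CDS: "lpS p V (\<lambda>z. C n * D n z)" for n using CDm le[of n] f by (auto simp: lpS_def)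
  have lim: "(\<lambda>n. C n * D n z) \<longlonglongrightarrow> f z" if z: "z \<in> space V" for z
  proof -
    have "dil = (\<lambda>t. \<chi> i. exp (- (\<Sum>j\<in>UNIV. of_int (B i j) * complex_of_real t)))"
      by (simp add: dil_def E_def fun_eq_iff)
    then have "continuous_on UNIV dil"
      by (simp only:) (intro continuous_on_vec_lambda continuous_on_exp continuous_on_minus continuous_on_sum continuous_on_mult continuous_on_const continuous_on_of_real continuous_on_id)
    then have "isCont dil 0" by (simp add: continuous_on_eq_continuous_at)
    then have "(\<lambda>n. dil (T n)) \<longlonglongrightarrow> dil 0" using Tlim by (rule isCont_tendsto_compose)
    moreover have "dil 0 = 1" by (simp add: dil_def E_def vec_eq_iff)
    ultimately have "(\<lambda>n. dil (T n) * z) \<longlonglongrightarrow> 1 * z"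
      unfolding times_vec_def by (intro tendsto_intros) auto
    then have "(\<lambda>n. dil (T n) * z) \<longlonglongrightarrow> z" by simp
    moreover have "isCont f z"
      using holo_on_continuous[OF f(1)] U_open z by (simp add: continuous_on_eq_continuous_at)
    ultimately have "(\<lambda>n. f (dil (T n) * z)) \<longlonglongrightarrow> f z" by (rule isCont_tendsto_compose[rotated])
    moreover have "C \<longlonglongrightarrow> of_real (exp (- 2 * 0 * (\<Sum>j\<in>UNIV. of_int (b j)) / p))"
      unfolding C_def by (intro tendsto_intros Tlim) (use p in auto)
    ultimately have "(\<lambda>n. C n * f (dil (T n) * z)) \<longlonglongrightarrow> of_real (exp (- 2 * 0 * (\<Sum>j\<in>UNIV. of_int (b j)) / p)) * f z"
      by (rule tendsto_mult[rotated])
    then show ?thesis by (simp add: D_def)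
  qed
  have "(\<lambda>n. lpN p V (\<lambda>z. C n * D n z - f z)) \<longlonglongrightarrow> 0"
    by (rule lp_tendsto[OF _ CDm fS lim le]) (use p in simp)
  then have "\<forall>\<^sub>F n in sequentially. lpN p V (\<lambda>z. C n * D n z - f z) < e / 2" by (rule order_tendstoD) (use e in simp)
  then obtain n where n: "lpN p V (\<lambda>z. C n * D n z - f z) < e / 2" by (auto simp: eventually_sequentially)
  define x where "x = (\<lambda>\<alpha>. lc f \<alpha> * monomial \<alpha> (dil (T n)))"
  obtain \<nu> where \<nu>: "\<nu> > 0" "\<And>\<alpha>. \<alpha> \<in> SS p \<Longrightarrow> \<nu> \<le> NN p \<alpha>" using NN_lower[of p] p by auto
  have xs: "(\<lambda>\<alpha>. cmod (x \<alpha>) * lpN p V (monomial \<alpha>)) summable_on SS p"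
  proof (rule summable_on_comparison_test)
    define c1 where "c1 = lpN p V f * exp (- T n * (\<Sum>j\<in>UNIV. of_int (kk p j))) / \<nu>"
    have c1: "c1 \<ge> 0" using \<nu> by (simp add: c1_def)
    show "(\<lambda>\<alpha>. c1 * (NN p \<alpha> * dec p (T n) \<alpha>)) summable_on SS p"
      by (intro summable_on_cmult_right summable_dec) (use p T in auto)
    show "cmod (x \<alpha>) * lpN p V (monomial \<alpha>) \<le> c1 * (NN p \<alpha> * dec p (T n) \<alpha>)" if \<alpha>: "\<alpha> \<in> SS p" for \<alpha>
    proof -
      have "cmod (x \<alpha>) * lpN p V (monomial \<alpha>) = cmod (lc f \<alpha>) * lpN p V (monomial \<alpha>) * cmod (monomial \<alpha> (dil (T n)))"
        by (simp add: x_def norm_mult)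
      also have "\<dots> \<le> lpN p V f * cmod (monomial \<alpha> (dil (T n)))"
        by (intro mult_right_mono lc_lpN[OF p f \<alpha>]) simp
      also have "\<dots> = c1 * (\<nu> * dec p (T n) \<alpha>)" using \<nu> by (simp add: c1_def norm_monomial_dil[of \<alpha> _ p])
      also have "\<dots> \<le> c1 * (NN p \<alpha> * dec p (T n) \<alpha>)"
        by (intro mult_left_mono mult_right_mono \<nu>(2)[OF \<alpha>] c1) (simp add: dec_pos less_imp_le)
      finally show ?thesis .
    qed
  qed simp
  have p1: "p \<ge> 1" "p > 0" using p by auto
  note S = ser_lp[OF p1(1) xs]
  have eq: "D n z = ser p x z" if z: "z \<in> Ust" for z
  proof -
    have zU: "z \<in> U" using z by (simp add: Ust_def)
    have "(\<lambda>\<alpha>. cmod (lc f \<alpha> * monomial \<alpha> (dil (T n) * z))) summable_on SS p"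
      using ser_abs_summable[OF p1(2) S(1) zU] by (simp add: x_def monomial_mult mult_ac)
    then have "D n z = ser p (lc f) (dil (T n) * z)" unfolding D_def
      by (intro laurent f dil_Ust z lc_zero[OF p f]) (use T less_imp_le in auto)
    then show ?thesis by (simp add: ser_def x_def monomial_mult mult_ac)
  qed
  have "\<forall>\<^sub>F N in sequentially. lpN p V (\<lambda>z. ser p x z - (\<Sum>\<alpha>\<in>SN p N. x \<alpha> * monomial \<alpha> z)) < e / 2 / (cmod (C n) + 1)"
    by (rule order_tendstoD[OF S(3)]) (use e in \<open>simp add: add_nonneg_pos\<close>)
  then obtain N where N: "lpN p V (\<lambda>z. ser p x z - (\<Sum>\<alpha>\<in>SN p N. x \<alpha> * monomial \<alpha> z)) < e / 2 / (cmod (C n) + 1)"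
    by (auto simp: eventually_sequentially)
  define R where "R = (\<lambda>z. ser p x z - (\<Sum>\<alpha>\<in>SN p N. x \<alpha> * monomial \<alpha> z))"
  have RS: "lpS p V R" unfolding R_def by (rule S(4))
  define Q where "Q = (\<lambda>z. - 1 * (C n * D n z + - 1 * f z))"
  have QS: "lpS p V Q" unfolding Q_def by (intro lp_cmul minkowski CDS fS p1)
  have QN: "lpN p V Q < e / 2"
  proof -
    have "lpN p V Q = cmod (- 1) * lpN p V (\<lambda>z. C n * D n z + - 1 * f z)"
      unfolding Q_def by (rule lp_cmul(2)[OF p1(2)]) (intro lp_cmul minkowski CDS fS p1)
    then show ?thesis using n by simp
  qed
  have CR: "lpN p V (\<lambda>z. C n * R z) < e / 2"
  proof -
    have "lpN p V (\<lambda>z. C n * R z) = cmod (C n) * lpN p V R" by (rule lp_cmul(2)[OF p1(2) RS])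
    also have "\<dots> \<le> (cmod (C n) + 1) * lpN p V R" by (intro mult_right_mono) auto
    also have "\<dots> < e / 2"
      using N pos_less_divide_eq[of "cmod (C n) + 1" "lpN p V R" "e / 2"] by (simp add: R_def mult.commute add_nonneg_pos)
    finally show ?thesis .
  qed
  have "lpN p V (\<lambda>z. f z - (\<Sum>\<alpha>\<in>SN p N. (C n * x \<alpha>) * monomial \<alpha> z)) = lpN p V (\<lambda>z. Q z + C n * R z)"
  proof (rule lpN_cong_AE, rule AE_mp[OF AE_V], rule AE_I2, rule impI)
    fix z assume "z \<in> Ust"
    from eq[OF this] show "f z - (\<Sum>\<alpha>\<in>SN p N. (C n * x \<alpha>) * monomial \<alpha> z) = Q z + C n * R z"
      by (simp add: Q_def R_def right_diff_distrib sum_distrib_left mult_ac)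
  qed
  also have "\<dots> \<le> lpN p V Q + lpN p V (\<lambda>z. C n * R z)" by (intro minkowski QS lp_cmul RS p1)
  also have "\<dots> < e" using QN CR by simp
  finally show ?thesis using finite_SN SN_subset by (intro exI[of _ "SN p N"] exI[of _ "\<lambda>\<alpha>. C n * x \<alpha>"]) auto
qed

definition AA :: "real \<Rightarrow> (complex^'n \<Rightarrow> complex) set" where
  "AA p = {f. holo_on f U \<and> lpI p V f < \<infinity>}"

lemma AA_lpS: "f \<in> AA p \<Longrightarrow> lpS p V f" by (simp add: AA_def lpS_def holo_V)

lemma AA_add: "p \<ge> 1 \<Longrightarrow> f \<in> AA p \<Longrightarrow> g \<in> AA p \<Longrightarrow> (\<lambda>z. f z + g z) \<in> AA p"
  using minkowski(1)[of p V f g] AA_lpS[of f p] AA_lpS[of g p] by (auto simp: AA_def lpS_def holo_on_add)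

lemma AA_cmul: "p > 0 \<Longrightarrow> f \<in> AA p \<Longrightarrow> (\<lambda>z. c * f z) \<in> AA p"
  using lp_cmul(1)[of p V f c] AA_lpS[of f p] by (auto simp: AA_def lpS_def holo_on_cmul)

lemma AA_monomial: "p > 0 \<Longrightarrow> \<alpha> \<in> SS p \<Longrightarrow> monomial \<alpha> \<in> AA p"
  using lpS_monomial[of p \<alpha>] SS_defined by (auto simp: AA_def lpS_def intro: holo_on_monomial)

lemma AA_sum:
  assumes p: "p \<ge> 1" and F: "finite F" "F \<subseteq> SS p"
  shows "(\<lambda>z. \<Sum>\<alpha>\<in>F. c \<alpha> * monomial \<alpha> z) \<in> AA p"
  using F
proof (induction F)
  case empty
  show ?case using p by (simp add: AA_def lpI_def)
next
  case (insert \<alpha> F)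
  have "(\<lambda>z. c \<alpha> * monomial \<alpha> z + (\<Sum>\<alpha>\<in>F. c \<alpha> * monomial \<alpha> z)) \<in> AA p"
    by (intro AA_add AA_cmul AA_monomial) (use insert p in auto)
  then show ?case using insert by simp
qed

lemma functional_sum:
  assumes p: "p \<ge> 1" and add: "\<And>f g. f \<in> AA p \<Longrightarrow> g \<in> AA p \<Longrightarrow> \<phi> (\<lambda>z. f z + g z) = \<phi> f + \<phi> g"
    and cmul: "\<And>f c. f \<in> AA p \<Longrightarrow> \<phi> (\<lambda>z. c * f z) = c * (\<phi> f :: complex)"
    and F: "finite F" "F \<subseteq> SS p"
  shows "\<phi> (\<lambda>z. \<Sum>\<alpha>\<in>F. c \<alpha> * monomial \<alpha> z) = (\<Sum>\<alpha>\<in>F. c \<alpha> * \<phi> (monomial \<alpha>))"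
  using F
proof (induction F)
  case empty
  have "(\<lambda>_. 0) \<in> AA p" using p by (simp add: AA_def lpI_def)
  from cmul[OF this, of 0] show ?case by simp
next
  case (insert \<alpha> F)
  have m: "monomial \<alpha> \<in> AA p" by (rule AA_monomial) (use insert p in auto)
  have "\<phi> (\<lambda>z. c \<alpha> * monomial \<alpha> z + (\<Sum>\<alpha>\<in>F. c \<alpha> * monomial \<alpha> z)) = \<phi> (\<lambda>z. c \<alpha> * monomial \<alpha> z) + \<phi> (\<lambda>z. \<Sum>\<alpha>\<in>F. c \<alpha> * monomial \<alpha> z)"
    by (intro add AA_cmul AA_sum m) (use insert p in auto)
  then show ?case using insert by (simp add: cmul[OF m])
qed

text \<open>Approximation by combinations of monomials within
  \<open>cmod (\<phi> f) / (\<bar>K\<bar> + 1)\<close> contradicts boundedness unless the value is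
  0. It identifies a functional with a pairing from their values on monomials.\<close>

lemma functional_ext:
  assumes p: "p > 1" and add: "\<And>f g. f \<in> AA p \<Longrightarrow> g \<in> AA p \<Longrightarrow> \<phi> (\<lambda>z. f z + g z) = \<phi> f + \<phi> g"
    and cmul: "\<And>f c. f \<in> AA p \<Longrightarrow> \<phi> (\<lambda>z. c * f z) = c * (\<phi> f :: complex)"
    and bd: "\<And>f. f \<in> AA p \<Longrightarrow> cmod (\<phi> f) \<le> K * lpN p V f"
    and z: "\<And>\<alpha>. \<alpha> \<in> SS p \<Longrightarrow> \<phi> (monomial \<alpha>) = 0" and f: "f \<in> AA p"
  shows "\<phi> f = 0"
proof (rule ccontr)
  assume nz: "\<phi> f \<noteq> 0"
  have p1: "p \<ge> 1" "p > 0" using p by auto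
  define e where "e = cmod (\<phi> f) / (\<bar>K\<bar> + 1)"
  have "e > 0" using nz by (simp add: e_def)
  then obtain F c where F: "finite F" "F \<subseteq> SS p" "lpN p V (\<lambda>z. f z - (\<Sum>\<alpha>\<in>F. c \<alpha> * monomial \<alpha> z)) < e"
    using dense_monomials[OF p, of f e] f by (auto simp: AA_def)
  define h where "h = (\<lambda>z. \<Sum>\<alpha>\<in>F. c \<alpha> * monomial \<alpha> z)"
  have h: "h \<in> AA p" unfolding h_def by (rule AA_sum[OF p1(1) F(1,2)])
  have "\<phi> h = (\<Sum>\<alpha>\<in>F. c \<alpha> * \<phi> (monomial \<alpha>))" unfolding h_def by (rule functional_sum[where \<phi>=\<phi>, OF p1(1) add cmul F(1,2)])
  also have "\<dots> = 0" by (rule sum.neutral) (use z F in auto)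
  finally have h0: "\<phi> h = 0" .
  have d: "(\<lambda>z. f z + - 1 * h z) \<in> AA p" by (intro AA_add AA_cmul f h p1)
  have "\<phi> (\<lambda>z. f z + - 1 * h z) = \<phi> f + - 1 * \<phi> h" by (subst add[OF f AA_cmul[OF p1(2) h]]) (simp only: cmul[OF h])
  then have "cmod (\<phi> f) \<le> K * lpN p V (\<lambda>z. f z - h z)" using bd[OF d] h0 by simp
  also have "\<dots> \<le> \<bar>K\<bar> * lpN p V (\<lambda>z. f z - h z)" by (intro mult_right_mono) auto
  also have "\<dots> \<le> \<bar>K\<bar> * e" using F(3) by (intro mult_left_mono) (auto simp: h_def)
  also have "\<dots> < cmod (\<phi> f)" using nz by (simp add: e_def field_simps)
  finally show False by simp
qed

lemma monomial_twist_cnj: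
  assumes p: "p > 1" and z: "z \<in> Ust"
  shows "monomial \<alpha> z * cnj (monomial \<alpha> (twist p z)) = of_real (cmod (monomial \<alpha> z) powr p)"
proof -
  have nz: "\<And>i. z $ i \<noteq> 0" using z by (simp add: Ust_def)
  define R where "R = (\<Prod>i\<in>UNIV. (cmod (z $ i) powr (p - 2)) powi \<alpha> i)"
  have R: "R \<ge> 0" unfolding R_def by (intro prod_nonneg) auto
  have t: "monomial \<alpha> (twist p z) = monomial \<alpha> z * of_real R"
    by (simp add: monomial_def twist_def R_def power_int_mult_distrib prod.distrib)
  have def: "monomial_defined \<alpha> z" using nz by (simp add: monomial_defined_def)
  have n: "cmod (monomial \<alpha> z) * R = cmod (monomial \<alpha> z) powr (p - 1)"
    using norm_monomial_twist[OF p def] R by (simp add: t norm_mult)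
  have mp: "cmod (monomial \<alpha> z) > 0" using monomial_nz[OF nz, of \<alpha>] by simp
  have "monomial \<alpha> z * cnj (monomial \<alpha> (twist p z)) = of_real ((cmod (monomial \<alpha> z))\<^sup>2 * R)"
  proof -
    have cn: "of_real ((cmod (monomial \<alpha> z))\<^sup>2) = monomial \<alpha> z * cnj (monomial \<alpha> z)"
      using complex_norm_square[of "monomial \<alpha> z"] by simp
    show ?thesis by (simp only: t complex_cnj_mult complex_cnj_complex_of_real of_real_mult cn mult_ac)
  qed
  also have "(cmod (monomial \<alpha> z))\<^sup>2 * R = cmod (monomial \<alpha> z) powr 1 * cmod (monomial \<alpha> z) powr (p - 1)"
    using mp by (simp add: n[symmetric] power2_eq_square)
  also have "\<dots> = cmod (monomial \<alpha> z) powr p" using powr_mult_base[of "cmod (monomial \<alpha> z)" "p - 1"] by simp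
  finally show ?thesis .
qed

lemma tavg_cnj: "tavg (\<lambda>u. cnj (f u)) = cnj (tavg f)"
  unfolding tavg_def set_lebesgue_integral_def complex_cnj_scaleR[symmetric] by (rule Bochner_Integration.integral_cnj)

text \<open>Averaging the integrand over rotations keeps the integral and, since the twist commutes
  with rotations, replaces \<open>g\<close> by its component of degree \<alpha>, a multiple of the
  monomial. By \<open>monomial_twist_cnj\<close> the p-th power of the norm remains.\<close>

lemma pair_monomial:
  assumes p: "p > 1" and q: "q = p / (p - 1)" and g: "holo_on g U" "lpS q V (\<lambda>z. g (twist p z))" and \<alpha>: "\<alpha> \<in> SS p"
  shows "(LINT z|V. monomial \<alpha> z * cnj (g (twist p z))) = cnj (lc g \<alpha>) * of_real (K0 / NN p \<alpha>)"
proof -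
  interpret T: finite_measure "torus :: (complex^'n) measure" by (rule finite_measure_torus)
  interpret V: sigma_finite_measure V by (rule sigma_finite_V)
  interpret P: pair_sigma_finite "torus :: (complex^'n) measure" V ..
  have q1: "q > 1" "1 / p + 1 / q = 1" using p by (simp_all add: q field_simps)
  have p0: "p > 0" using p by simp
  define H where "H = (\<lambda>z. monomial \<alpha> z * cnj (g (twist p z)))"
  have Hi: "integrable V H" unfolding H_def by (rule hoelder_integral(1)[OF p q1 lpS_monomial[OF p0 \<alpha>] g(2)])
  have Hm: "H \<in> borel_measurable V" using Hi by simp
  define \<Phi> where "\<Phi> = (\<lambda>\<omega> z. indicator utorus \<omega> *\<^sub>R (if \<omega> * z \<in> U then H (\<omega> * z) else 0))"
  have Pm: "(\<lambda>x. \<Phi> (fst x) (snd x)) \<in> borel_measurable (torus \<Otimes>\<^sub>M V)"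
  proof -
    have [measurable]: "(\<lambda>x. if fst x * snd x \<in> U then H (fst x * snd x) else 0) \<in> borel_measurable ((torus :: (complex^'n) measure) \<Otimes>\<^sub>M V)"
      using measurable_rotate[OF Hm, of "\<lambda>z. z"] by simp
    show ?thesis unfolding \<Phi>_def by measurable
  qed
  have \<Phi>V: "\<Phi> \<omega> z = indicator utorus \<omega> *\<^sub>R H (\<omega> * z)" if "z \<in> space V" for \<omega> z
    using that by (cases "\<omega> \<in> utorus") (auto simp: \<Phi>_def unimodular_U)
  have rot: "(LINT z|V. h (\<omega> * z)) = (LINT z|V. h z)" "integrable V (\<lambda>z. h (\<omega> * z)) = integrable V h"
    if "\<omega> \<in> utorus" "h \<in> borel_measurable V" for \<omega> and h :: "complex^'n \<Rightarrow> 'b::{banach, second_countable_topology}"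
    using integral_distr[OF mult_measurable_V[OF that(1)] that(2)] integrable_distr_eq[OF mult_measurable_V[OF that(1)] that(2)]
    by (simp_all add: V_rotation[OF that(1)])
  have inner: "(LINT z|V. \<Phi> \<omega> z) = indicator utorus \<omega> *\<^sub>R (LINT z|V. H z)" for \<omega>
  proof (cases "\<omega> \<in> utorus")
    case True
    have "(LINT z|V. \<Phi> \<omega> z) = (LINT z|V. H (\<omega> * z))" by (rule Bochner_Integration.integral_cong) (simp_all add: \<Phi>V True)
    then show ?thesis using rot(1)[OF True Hm] True by simp
  qed (simp add: \<Phi>_def)
  have int: "integrable (torus \<Otimes>\<^sub>M V) (case_prod \<Phi>)"
  proof (rule P.Fubini_integrable)
    show "case_prod \<Phi> \<in> borel_measurable (torus \<Otimes>\<^sub>M V)" using Pm by (simp add: case_prod_unfold)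
    have "(LINT z|V. norm (case_prod \<Phi> (\<omega>, z))) = indicator utorus \<omega> *\<^sub>R (LINT z|V. norm (H z))" for \<omega>
    proof (cases "\<omega> \<in> utorus")
      case True
      have "(LINT z|V. norm (case_prod \<Phi> (\<omega>, z))) = (LINT z|V. norm (H (\<omega> * z)))"
        by (rule Bochner_Integration.integral_cong) (simp_all add: \<Phi>V True)
      then show ?thesis using rot(1)[OF True, of "\<lambda>z. norm (H z)"] Hm True by simp
    qed (simp add: \<Phi>_def)
    then show "integrable torus (\<lambda>\<omega>. LINT z|V. norm (case_prod \<Phi> (\<omega>, z)))"
      by (simp only:) (rule T.integrable_const_bound[where B="\<bar>LINT z|V. norm (H z)\<bar>"], auto simp: indicator_def)
    show "AE \<omega> in torus. integrable V (\<lambda>z. case_prod \<Phi> (\<omega>, z))"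
    proof (rule AE_I2)
      fix \<omega> :: "complex^'n"
      show "integrable V (\<lambda>z. case_prod \<Phi> (\<omega>, z))"
      proof (cases "\<omega> \<in> utorus")
        case True
        have "integrable V (\<lambda>z. H (\<omega> * z))" using rot(2)[OF True Hm] Hi by simp
        then show ?thesis by (rule Bochner_Integration.integrable_cong[THEN iffD1, rotated 2]) (simp_all add: \<Phi>V True)
      qed (simp add: \<Phi>_def)
    qed
  qed
  have "(LINT z|V. LINT \<omega>|torus. \<Phi> \<omega> z) = (LINT \<omega>|torus. LINT z|V. \<Phi> \<omega> z)"
    by (rule P.Fubini_integral[OF int])
  also have "\<dots> = tavg (\<lambda>\<omega> :: complex^'n. LINT z|V. H z)" unfolding inner tavg_def set_lebesgue_integral_def ..
  also have "\<dots> = (LINT z|V. H z)" by (rule tavg_const)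
  finally have "(LINT z|V. H z) = (LINT z|V. LINT \<omega>|torus. \<Phi> \<omega> z)" ..
  also have "\<dots> = (LINT z|V. cnj (lc g \<alpha>) * of_real (cmod (monomial \<alpha> z) powr p))"
  proof (rule integral_cong_AE)
    show "(\<lambda>z. LINT \<omega>|torus. \<Phi> \<omega> z) \<in> borel_measurable V"
      using P.integrable_snd[OF int] by simp
    show "(\<lambda>z. cnj (lc g \<alpha>) * of_real (cmod (monomial \<alpha> z) powr p)) \<in> borel_measurable V"
      by (rule measurable_V_borel) measurable
    show "AE z in V. (LINT \<omega>|torus. \<Phi> \<omega> z) = cnj (lc g \<alpha>) * of_real (cmod (monomial \<alpha> z) powr p)"
    proof (rule AE_mp[OF AE_V], rule AE_I2, rule impI)
      fix z assume zU: "z \<in> space V" and z: "z \<in> Ust"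
      have "(LINT \<omega>|torus. \<Phi> \<omega> z) = tavg (\<lambda>\<omega>. H (\<omega> * z))"
        using zU by (simp add: \<Phi>V tavg_def set_lebesgue_integral_def)
      also have "\<dots> = tavg (\<lambda>\<omega>. monomial \<alpha> z * cnj (g (\<omega> * twist p z) * monomial (\<lambda>i. - \<alpha> i) \<omega>))"
        by (rule tavg_cong) (simp add: H_def twist_mult monomial_mult cnj_monomial_utorus[symmetric] mult_ac)
      also have "\<dots> = monomial \<alpha> z * cnj (co g \<alpha> (twist p z))"
        by (simp only: tavg_cmul tavg_cnj co_def)
      also have "\<dots> = cnj (lc g \<alpha>) * (monomial \<alpha> z * cnj (monomial \<alpha> (twist p z)))"
        by (simp add: co_eq[OF g(1) twist_Ust[OF p z]] mult_ac)
      finally show "(LINT \<omega>|torus. \<Phi> \<omega> z) = cnj (lc g \<alpha>) * of_real (cmod (monomial \<alpha> z) powr p)"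
        by (simp add: monomial_twist_cnj[OF p z])
    qed
  qed
  also have "\<dots> = cnj (lc g \<alpha>) * of_real (LINT z|V. cmod (monomial \<alpha> z) powr p)" by simp
  also have "(LINT z|V. cmod (monomial \<alpha> z) powr p) = enn2real (lpI p V (monomial \<alpha>))"
    unfolding lpI_def by (rule integral_eq_nn_integral) (auto intro!: measurable_V_borel)
  also have "\<dots> = K0 / NN p \<alpha>"
    using lpI_monomial[OF p0 SS_pos[OF p0 \<alpha>]] NN_pos[OF p0 \<alpha>] K0_pos by simp
  finally show ?thesis unfolding H_def .
qed

end

section \<open>The kernel estimate\<close>

text \<open>The angular integral is the Poisson integral, the exponential factor reduces it to a
  multiple of 1 / X, and what remains is the Hilbert-type integral in \<open>y\<close>.\<close>

lemma schur_one_dim: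
  fixes \<epsilon> a c1 c2 x t :: real
  assumes \<epsilon>: "\<epsilon> > 0" and a: "0 < a" "a < 1" and c: "c1 > 0" "c2 > 0" and x: "x > 0"
  shows "(\<integral>\<^sup>+y. \<integral>\<^sup>+s. ennreal (exp (- \<epsilon> * (c1 * x + c2 * y)) / (cmod (1 - exp (- Complex (c1 * x + c2 * y) (t + s))))\<^sup>2 * y powr (- a))
       * indicator {0<..} y * indicator {0..<2*pi} s \<partial>lborel \<partial>lborel)
    \<le> ennreal (pi * (1 + 2 / \<epsilon>) * (1 / (c1 * (1 - a)) + 1 / (c2 * a)) * x powr (- a))"
proof -
  have "(\<integral>\<^sup>+s. ennreal (exp (- \<epsilon> * (c1 * x + c2 * y)) / (cmod (1 - exp (- Complex (c1 * x + c2 * y) (t + s))))\<^sup>2 * y powr (- a))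
       * indicator {0<..} y * indicator {0..<2*pi} s \<partial>lborel)
      \<le> ennreal (pi * (1 + 2 / \<epsilon>)) * (ennreal (y powr (- a) / (c1 * x + c2 * y)) * indicator {0<..} y)" for y
  proof (cases "y > 0")
    case True
    define X where "X = c1 * x + c2 * y"
    have X: "X > 0" unfolding X_def using c x True by (intro add_pos_pos mult_pos_pos)
    define e where "e = exp (- \<epsilon> * X) * y powr (- a)"
    have e: "e \<ge> 0" by (simp add: e_def)
    define \<rho> where "\<rho> = (\<lambda>s. 1 / (cmod (1 - exp (- Complex X (t + s))))\<^sup>2)"
    have \<rho>: "\<rho> s \<ge> 0" for s by (simp add: \<rho>_def)
    have [measurable]: "\<rho> \<in> borel_measurable borel" unfolding \<rho>_def Complex_eq by measurable
    have "(\<integral>\<^sup>+s. ennreal (exp (- \<epsilon> * X) / (cmod (1 - exp (- Complex X (t + s))))\<^sup>2 * y powr (- a))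
       * indicator {0<..} y * indicator {0..<2*pi} s \<partial>lborel) \<le> (\<integral>\<^sup>+s. ennreal e * ennreal (indicator {0..2*pi} s * \<rho> s) \<partial>lborel)"
      by (rule nn_integral_mono) (use True e \<rho> in \<open>auto simp: e_def \<rho>_def indicator_def ennreal_mult[symmetric] mult_ac intro!: ennreal_leI\<close>)
    also have "\<dots> = ennreal e * (\<integral>\<^sup>+s. ennreal (indicator {0..2*pi} s * \<rho> s) \<partial>lborel)" by (rule nn_integral_cmult) measurable
    also have "(\<integral>\<^sup>+s. ennreal (indicator {0..2*pi} s * \<rho> s) \<partial>lborel) = ennreal (2 * pi / (1 - exp (-2*X)))"
      by (rule nn_integral_has_integral_lebesgue) (use \<rho> poisson_integral[OF X, of t] in \<open>auto simp: \<rho>_def\<close>)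
    also have "ennreal e * ennreal (2 * pi / (1 - exp (-2*X))) = ennreal (exp (- \<epsilon> * X) * (2 * pi / (1 - exp (- 2 * X))) * y powr (- a))"
      using X by (subst ennreal_mult[symmetric]) (auto simp: e_def mult_ac)
    also have "\<dots> \<le> ennreal (pi * (1 + 2 / \<epsilon>) / X * y powr (- a))"
      by (intro ennreal_leI mult_right_mono exp_kernel_bound \<epsilon> X) simp
    also have "\<dots> = ennreal (pi * (1 + 2 / \<epsilon>)) * (ennreal (y powr (- a) / X) * indicator {0<..} y)"
      using True \<epsilon> X by (simp add: ennreal_mult[symmetric] mult_ac)
    finally show ?thesis by (simp add: X_def)
  qed simp
  then have "(\<integral>\<^sup>+y. \<integral>\<^sup>+s. ennreal (exp (- \<epsilon> * (c1 * x + c2 * y)) / (cmod (1 - exp (- Complex (c1 * x + c2 * y) (t + s))))\<^sup>2 * y powr (- a))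
       * indicator {0<..} y * indicator {0..<2*pi} s \<partial>lborel \<partial>lborel)
     \<le> (\<integral>\<^sup>+y. ennreal (pi * (1 + 2 / \<epsilon>)) * (ennreal (y powr (- a) / (c1 * x + c2 * y)) * indicator {0<..} y) \<partial>lborel)"
    by (rule nn_integral_mono)
  also have "\<dots> = ennreal (pi * (1 + 2 / \<epsilon>)) * (\<integral>\<^sup>+y. ennreal (y powr (- a) / (c1 * x + c2 * y)) * indicator {0<..} y \<partial>lborel)"
    by (rule nn_integral_cmult) measurable
  also have "\<dots> \<le> ennreal (pi * (1 + 2 / \<epsilon>)) * ennreal ((1 / (c1 * (1 - a)) + 1 / (c2 * a)) * x powr (-a))"
    by (intro mult_left_mono nn_integral_hilbert a x c) simp
  also have "\<dots> = ennreal (pi * (1 + 2 / \<epsilon>) * (1 / (c1 * (1 - a)) + 1 / (c2 * a)) * x powr (- a))"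
    using \<epsilon> a c by (subst ennreal_mult[symmetric]) (auto simp: mult_ac)
  finally show ?thesis .
qed

context polyhedron begin

text \<open>The factors \<open>exp (2 * of_int (b j) * fst v $ j)\<close> cancel the density of
  \<open>W\<close>, which leaves one estimate per coordinate. \<open>c1\<close> and
  \<open>c2\<close> will be p - 1 and 1 in either order, according to the variable of
  integration.\<close>

lemma schur_W:
  fixes \<epsilon> cc x t :: "'n \<Rightarrow> real" and a c1 c2 :: real
  assumes \<epsilon>: "\<And>j. \<epsilon> j > 0" and a: "0 < a" "a < 1" and c: "c1 > 0" "c2 > 0" and x: "\<And>j. x j > 0" and cc: "\<And>j. cc j \<ge> 0"
  shows "(\<integral>\<^sup>+v. (\<Prod>j\<in>UNIV. ennreal (cc j * (exp (- \<epsilon> j * (c1 * x j + c2 * fst v $ j)) / (cmod (1 - exp (- Complex (c1 * x j + c2 * fst v $ j) (t j + snd v $ j))))\<^sup>2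
        * fst v $ j powr (- a)) * exp (2 * of_int (b j) * fst v $ j))) \<partial>W)
    \<le> ennreal (c0 * (\<Prod>j\<in>UNIV. cc j * (pi * (1 + 2 / \<epsilon> j) * (1 / (c1 * (1 - a)) + 1 / (c2 * a)) * x j powr (- a))))"
proof -
  define \<psi> where "\<psi> = (\<lambda>j y s. exp (- \<epsilon> j * (c1 * x j + c2 * y)) / (cmod (1 - exp (- Complex (c1 * x j + c2 * y) (t j + s))))\<^sup>2 * y powr (- a))"
  have [measurable]: "(\<lambda>(y, s). \<psi> j y s) \<in> borel_measurable (borel \<Otimes>\<^sub>M borel)" for j
    unfolding \<psi>_def Complex_eq case_prod_unfold by measurable
  have \<psi>: "\<psi> j y s \<ge> 0" for j y s by (simp add: \<psi>_def)
  have "(\<integral>\<^sup>+v. (\<Prod>j\<in>UNIV. ennreal (cc j * \<psi> j (fst v $ j) (snd v $ j) * exp (2 * of_int (b j) * fst v $ j))) \<partial>W)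
    = ennreal c0 * (\<Prod>j\<in>UNIV. \<integral>\<^sup>+y. \<integral>\<^sup>+s. ennreal (cc j * \<psi> j y s * exp (2 * of_int (b j) * y)) * ennreal (exp (- 2 * of_int (b j) * y)) * indicator {0<..} y * indicator {0..<2*pi} s \<partial>lborel \<partial>lborel)"
    by (rule nn_integral_W_prod) measurable
  also have "\<dots> \<le> ennreal c0 * (\<Prod>j\<in>UNIV. ennreal (cc j * (pi * (1 + 2 / \<epsilon> j) * (1 / (c1 * (1 - a)) + 1 / (c2 * a)) * x j powr (- a))))"
  proof (intro mult_left_mono prod_mono_ennreal)
    fix j
    have "(\<integral>\<^sup>+y. \<integral>\<^sup>+s. ennreal (cc j * \<psi> j y s * exp (2 * of_int (b j) * y)) * ennreal (exp (- 2 * of_int (b j) * y)) * indicator {0<..} y * indicator {0..<2*pi} s \<partial>lborel \<partial>lborel)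
       = (\<integral>\<^sup>+y. \<integral>\<^sup>+s. ennreal (cc j) * (ennreal (\<psi> j y s) * indicator {0<..} y * indicator {0..<2*pi} s) \<partial>lborel \<partial>lborel)"
    proof (rule nn_integral_cong, rule nn_integral_cong)
      fix y s
      have "cc j * \<psi> j y s * exp (2 * of_int (b j) * y) * exp (- 2 * of_int (b j) * y) = cc j * \<psi> j y s"
        by (simp add: exp_minus field_simps)
      then have "ennreal (cc j * \<psi> j y s * exp (2 * of_int (b j) * y)) * ennreal (exp (- 2 * of_int (b j) * y)) = ennreal (cc j) * ennreal (\<psi> j y s)"
        using cc[of j] \<psi>[of j y s] by (subst (1 2) ennreal_mult[symmetric]) simp_all
      then show "ennreal (cc j * \<psi> j y s * exp (2 * of_int (b j) * y)) * ennreal (exp (- 2 * of_int (b j) * y)) * indicator {0<..} y * indicator {0..<2*pi} s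
         = ennreal (cc j) * (ennreal (\<psi> j y s) * indicator {0<..} y * indicator {0..<2*pi} s)" by (simp add: mult.assoc)
    qed
    also have "\<dots> = (\<integral>\<^sup>+y. ennreal (cc j) * (\<integral>\<^sup>+s. ennreal (\<psi> j y s) * indicator {0<..} y * indicator {0..<2*pi} s \<partial>lborel) \<partial>lborel)"
      by (rule nn_integral_cong, rule nn_integral_cmult) measurable
    also have "\<dots> = ennreal (cc j) * (\<integral>\<^sup>+y. \<integral>\<^sup>+s. ennreal (\<psi> j y s) * indicator {0<..} y * indicator {0..<2*pi} s \<partial>lborel \<partial>lborel)"
      by (rule nn_integral_cmult) measurable
    also have "\<dots> \<le> ennreal (cc j) * ennreal (pi * (1 + 2 / \<epsilon> j) * (1 / (c1 * (1 - a)) + 1 / (c2 * a)) * x j powr (- a))"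
      unfolding \<psi>_def by (intro mult_left_mono schur_one_dim \<epsilon> a c x) simp
    also have "\<dots> = ennreal (cc j * (pi * (1 + 2 / \<epsilon> j) * (1 / (c1 * (1 - a)) + 1 / (c2 * a)) * x j powr (- a)))"
      using cc[of j] by (rule ennreal_mult'[symmetric])
    finally show "(\<integral>\<^sup>+y. \<integral>\<^sup>+s. ennreal (cc j * \<psi> j y s * exp (2 * of_int (b j) * y)) * ennreal (exp (- 2 * of_int (b j) * y)) * indicator {0<..} y * indicator {0..<2*pi} s \<partial>lborel \<partial>lborel)
       \<le> ennreal (cc j * (pi * (1 + 2 / \<epsilon> j) * (1 / (c1 * (1 - a)) + 1 / (c2 * a)) * x j powr (- a)))" .
  qed simp_all
  also have "\<dots> = ennreal (c0 * (\<Prod>j\<in>UNIV. cc j * (pi * (1 + 2 / \<epsilon> j) * (1 / (c1 * (1 - a)) + 1 / (c2 * a)) * x j powr (- a))))"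
  proof -
    have nn: "cc j * (pi * (1 + 2 / \<epsilon> j) * (1 / (c1 * (1 - a)) + 1 / (c2 * a)) * x j powr (- a)) \<ge> 0" for j
      using cc[of j] \<epsilon>[of j] a c by (intro mult_nonneg_nonneg add_nonneg_nonneg divide_nonneg_nonneg) auto
    show ?thesis using c0(1) by (subst prod_ennreal[OF nn], subst ennreal_mult[symmetric]) (auto intro!: prod_nonneg nn)
  qed
  finally show ?thesis unfolding \<psi>_def .
qed

definition XX :: "real \<Rightarrow> 'n \<Rightarrow> (real^'n) \<times> (real^'n) \<Rightarrow> (real^'n) \<times> (real^'n) \<Rightarrow> real" where
  "XX p j v w = fst v $ j + (p - 1) * fst w $ j"

text \<open>The j-th coordinate of the first point plus the conjugate of that of the twisted second
  point: in these variables \<open>monomial \<alpha> (EC v) * cnj (monomial \<alpha> (twist p (EC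
  w)))\<close> is a pure exponential.\<close>

definition Om :: "real \<Rightarrow> 'n \<Rightarrow> (real^'n) \<times> (real^'n) \<Rightarrow> (real^'n) \<times> (real^'n) \<Rightarrow> complex" where
  "Om p j v w = Complex (XX p j v w) (snd v $ j - snd w $ j)"

text \<open>The factor of \<open>NN\<close> at the lowest exponent, i.e. the first coefficient of
  the one-dimensional series.\<close>

definition aa :: "real \<Rightarrow> 'n \<Rightarrow> real" where "aa p j = p * of_int (kk p j) + 2 * of_int (b j)"

text \<open>The product of the bounds in \<open>kap_bound\<close>: a majorant of the modulus of the
  integral kernel of the projection.\<close>

definition ker :: "real \<Rightarrow> (real^'n) \<times> (real^'n) \<Rightarrow> (real^'n) \<times> (real^'n) \<Rightarrow> real" where
  "ker p v w = (\<Prod>j\<in>UNIV. (\<bar>p\<bar> + 2 * \<bar>aa p j - p\<bar>) * exp (- of_int (kk p j) * XX p j v w) / (cmod (1 - exp (- Om p j v w)))\<^sup>2) / K0"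

lemma ker_nonneg: "ker p v w \<ge> 0"
  using K0_pos unfolding ker_def by (intro divide_nonneg_nonneg prod_nonneg) auto

text \<open>In Schur's test the exponential factors of this weight compensate for the density of \<open>W\<close>, and
  the powers are those of the one-dimensional Hilbert inequality.\<close>

definition wgt :: "real \<Rightarrow> (real^'n) \<times> (real^'n) \<Rightarrow> real" where
  "wgt r x = (\<Prod>j\<in>UNIV. exp (2 * of_int (b j) * r * fst x $ j) * (if fst x $ j > 0 then fst x $ j powr (- r) else 1))"

lemma wgt_pos: "wgt r x > 0" unfolding wgt_def by (intro prod_pos) auto

lemma wgt_DD: "x \<in> DD \<Longrightarrow> wgt r x = (\<Prod>j\<in>UNIV. exp (2 * of_int (b j) * r * fst x $ j) * fst x $ j powr (- r))"
  unfolding wgt_def by (rule prod.cong) (auto simp: DD_def)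

lemma wgt_powr: "x \<in> DD \<Longrightarrow> wgt r x powr s = wgt (r * s) x"
  unfolding wgt_DD by (subst prod_powr_distrib)
    (auto simp: powr_mult exp_powr_real powr_powr mult_ac intro!: prod.cong)

lemma wgt_eq:
  assumes x: "x \<in> DD" and t: "r * s = t"
  shows "wgt r x powr s = (\<Prod>j\<in>UNIV. exp (2 * of_int (b j) * t * fst x $ j) * fst x $ j powr (- t))"
  by (rule trans[OF wgt_powr[OF x, of r s]]) (simp only: t wgt_DD[OF x])

lemma ker_schur:
  assumes p: "p > 1" and q: "q = p / (p - 1)"
  shows "\<exists>C>0. (\<forall>w\<in>DD. (\<integral>\<^sup>+v. ennreal (ker p v w * wgt (1 / (p * q)) v powr p) \<partial>W) \<le> ennreal (C * wgt (1 / (p * q)) w powr p)) \<and>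
     (\<forall>v\<in>DD. (\<integral>\<^sup>+w. ennreal (ker p v w * wgt (1 / (p * q)) w powr q) \<partial>W) \<le> ennreal (C * wgt (1 / (p * q)) v powr q))"
proof -
  define P where "P = 1 / p"
  define Q where "Q = 1 / q"
  have PQ: "p * P = 1" "Q = 1 - P" "0 < P" "P < 1" "0 < Q" "Q < 1" "q > 1" using p by (simp_all add: P_def Q_def q field_simps)
  have r: "1 / (p * q) * p = Q" "1 / (p * q) * q = P" using p PQ(7) by (simp_all add: P_def Q_def)
  \<comment> \<open>The exponential rate that is left when weight and density are taken out. It is
    \<open>aa p j\<close> divided by \<open>p\<close>, hence positive by the choice of
    \<open>kk\<close>.\<close>
  define \<epsilon> where "\<epsilon> = (\<lambda>j. of_int (kk p j) + 2 * of_int (b j) * P)"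
  have \<epsilon>: "\<epsilon> j > 0" for j
  proof -
    have "0 < (p * of_int (kk p j) + 2 * of_int (b j)) * P" using kk_pos[of p j] p PQ(3) by (intro mult_pos_pos) auto
    also have "\<dots> = (p * P) * of_int (kk p j) + 2 * of_int (b j) * P" by (simp add: algebra_simps)
    finally show ?thesis by (simp add: \<epsilon>_def PQ)
  qed
  define cc where "cc = (\<lambda>j. \<bar>p\<bar> + 2 * \<bar>aa p j - p\<bar>)"
  have cc: "cc j \<ge> 0" for j by (simp add: cc_def)
  define C1 where "C1 = c0 / K0 * (\<Prod>j\<in>UNIV. cc j * (pi * (1 + 2 / \<epsilon> j) * (1 / ((p - 1) * (1 - Q)) + 1 / (1 * Q))))"
  define C2 where "C2 = c0 / K0 * (\<Prod>j\<in>UNIV. cc j * (pi * (1 + 2 / \<epsilon> j) * (1 / (1 * (1 - P)) + 1 / ((p - 1) * P))))"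
  have C1: "C1 \<ge> 0" unfolding C1_def using c0(1) K0_pos cc \<epsilon> p PQ
    by (intro mult_nonneg_nonneg prod_nonneg divide_nonneg_nonneg add_nonneg_nonneg) (auto intro: less_imp_le)
  have C2: "C2 \<ge> 0" unfolding C2_def using c0(1) K0_pos cc \<epsilon> p PQ
    by (intro mult_nonneg_nonneg prod_nonneg divide_nonneg_nonneg add_nonneg_nonneg) (auto intro: less_imp_le)
  have s1: "(\<integral>\<^sup>+v. ennreal (ker p v w * wgt (1 / (p * q)) v powr p) \<partial>W) \<le> ennreal (C1 * wgt (1 / (p * q)) w powr p)" if w: "w \<in> DD" for w
  proof -
    define cw where "cw = (\<lambda>j. cc j * exp (2 * of_int (b j) * Q * fst w $ j))"
    have cw: "cw j \<ge> 0" for j using cc by (simp add: cw_def)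
    define \<psi> where "\<psi> = (\<lambda>j v. cw j * (exp (- \<epsilon> j * ((p - 1) * fst w $ j + 1 * fst v $ j)) / (cmod (1 - exp (- Complex ((p - 1) * fst w $ j + 1 * fst v $ j) (- snd w $ j + snd v $ j))))\<^sup>2
        * fst v $ j powr (- Q)) * exp (2 * of_int (b j) * fst v $ j))"
    have \<psi>: "\<psi> j v \<ge> 0" for j v using cw by (simp add: \<psi>_def)
    have "(\<integral>\<^sup>+v. ennreal (ker p v w * wgt (1 / (p * q)) v powr p) \<partial>W) = (\<integral>\<^sup>+v. ennreal (1 / K0) * (\<Prod>j\<in>UNIV. ennreal (\<psi> j v)) \<partial>W)"
    proof (rule nn_integral_cong)
      fix v assume "v \<in> space W"
      then have v: "v \<in> DD" by simp
      have "cc j * exp (- of_int (kk p j) * XX p j v w) / (cmod (1 - exp (- Om p j v w)))\<^sup>2 * (exp (2 * of_int (b j) * Q * fst v $ j) * fst v $ j powr (- Q)) = \<psi> j v" for j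
      proof -
        have "exp (- of_int (kk p j) * XX p j v w) * exp (2 * of_int (b j) * Q * fst v $ j)
          = exp (2 * of_int (b j) * Q * fst w $ j) * exp (- \<epsilon> j * ((p - 1) * fst w $ j + 1 * fst v $ j)) * exp (2 * of_int (b j) * fst v $ j)"
        proof -
          \<comment> \<open>The balance of weight and density: the coefficients of \<open>v\<close>
            agree because Q = 1 - P, those of \<open>w\<close> because moreover p P = 1.\<close>
          have "- of_int (kk p j) * XX p j v w + 2 * of_int (b j) * Q * fst v $ j
            = 2 * of_int (b j) * Q * fst w $ j + - \<epsilon> j * ((p - 1) * fst w $ j + 1 * fst v $ j) + 2 * of_int (b j) * fst v $ j"
          proof -
            have "- of_int (kk p j) * XX p j v w + 2 * of_int (b j) * Q * fst v $ j
              - (2 * of_int (b j) * Q * fst w $ j + - \<epsilon> j * ((p - 1) * fst w $ j + 1 * fst v $ j) + 2 * of_int (b j) * fst v $ j)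
              = 2 * of_int (b j) * fst w $ j * (p * P - 1)"
              unfolding \<epsilon>_def XX_def PQ(2) by (simp add: algebra_simps)
            then show ?thesis by (simp add: PQ(1))
          qed
          then show ?thesis by (simp only: exp_add[symmetric])
        qed
        moreover have "Om p j v w = Complex ((p - 1) * fst w $ j + 1 * fst v $ j) (- snd w $ j + snd v $ j)"
          by (simp add: Om_def XX_def add.commute)
        ultimately show ?thesis unfolding \<psi>_def cw_def by (simp add: mult_ac)
      qed
      then have pr: "(\<Prod>j\<in>UNIV. cc j * exp (- of_int (kk p j) * XX p j v w) / (cmod (1 - exp (- Om p j v w)))\<^sup>2 * (exp (2 * of_int (b j) * Q * fst v $ j) * fst v $ j powr (- Q))) = (\<Prod>j\<in>UNIV. \<psi> j v)" by (intro prod.cong) auto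
      have k: "ker p v w = (\<Prod>j\<in>UNIV. cc j * exp (- of_int (kk p j) * XX p j v w) / (cmod (1 - exp (- Om p j v w)))\<^sup>2) / K0" unfolding ker_def cc_def ..
      have "ker p v w * wgt (1 / (p * q)) v powr p = 1 / K0 * (\<Prod>j\<in>UNIV. \<psi> j v)"
        unfolding wgt_eq[OF v r(1)] k pr[symmetric] prod.distrib[of "\<lambda>j. cc j * exp (- of_int (kk p j) * XX p j v w) / (cmod (1 - exp (- Om p j v w)))\<^sup>2" "\<lambda>j. exp (2 * of_int (b j) * Q * fst v $ j) * fst v $ j powr (- Q)"] by simp
      then show "ennreal (ker p v w * wgt (1 / (p * q)) v powr p) = ennreal (1 / K0) * (\<Prod>j\<in>UNIV. ennreal (\<psi> j v))"
        using K0_pos \<psi> by (simp add: prod_ennreal ennreal_mult[symmetric] prod_nonneg)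
    qed
    also have "\<dots> = ennreal (1 / K0) * (\<integral>\<^sup>+v. (\<Prod>j\<in>UNIV. ennreal (\<psi> j v)) \<partial>W)"
      by (rule nn_integral_cmult) (rule measurable_W_borel, unfold \<psi>_def Complex_eq, measurable)
    also have "\<dots> \<le> ennreal (1 / K0) * ennreal (c0 * (\<Prod>j\<in>UNIV. cw j * (pi * (1 + 2 / \<epsilon> j) * (1 / ((p - 1) * (1 - Q)) + 1 / (1 * Q)) * fst w $ j powr (- Q))))"
      unfolding \<psi>_def using w p PQ by (intro mult_left_mono schur_W \<epsilon> cw) (auto simp: DD_def)
    also have "\<dots> = ennreal (1 / K0 * (c0 * (\<Prod>j\<in>UNIV. cw j * (pi * (1 + 2 / \<epsilon> j) * (1 / ((p - 1) * (1 - Q)) + 1 / (1 * Q)) * fst w $ j powr (- Q)))))"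
      using K0_pos by (intro ennreal_mult'[symmetric]) simp
    also have "1 / K0 * (c0 * (\<Prod>j\<in>UNIV. cw j * (pi * (1 + 2 / \<epsilon> j) * (1 / ((p - 1) * (1 - Q)) + 1 / (1 * Q)) * fst w $ j powr (- Q)))) = C1 * wgt (1 / (p * q)) w powr p"
      unfolding wgt_eq[OF w r(1)] C1_def cw_def by (simp add: prod.distrib mult_ac)
    finally show ?thesis .
  qed
  have s2: "(\<integral>\<^sup>+w. ennreal (ker p v w * wgt (1 / (p * q)) w powr q) \<partial>W) \<le> ennreal (C2 * wgt (1 / (p * q)) v powr q)" if v: "v \<in> DD" for v
  proof -
    define cw where "cw = (\<lambda>j. cc j * exp (2 * of_int (b j) * P * fst v $ j))"
    have cw: "cw j \<ge> 0" for j using cc by (simp add: cw_def)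
    define \<psi> where "\<psi> = (\<lambda>j w. cw j * (exp (- \<epsilon> j * (1 * fst v $ j + (p - 1) * fst w $ j)) / (cmod (1 - exp (- Complex (1 * fst v $ j + (p - 1) * fst w $ j) (- snd v $ j + snd w $ j))))\<^sup>2
        * fst w $ j powr (- P)) * exp (2 * of_int (b j) * fst w $ j))"
    have \<psi>: "\<psi> j w \<ge> 0" for j w using cw by (simp add: \<psi>_def)
    have "(\<integral>\<^sup>+w. ennreal (ker p v w * wgt (1 / (p * q)) w powr q) \<partial>W) = (\<integral>\<^sup>+w. ennreal (1 / K0) * (\<Prod>j\<in>UNIV. ennreal (\<psi> j w)) \<partial>W)"
    proof (rule nn_integral_cong)
      fix w assume "w \<in> space W"
      then have w: "w \<in> DD" by simp
      have "cc j * exp (- of_int (kk p j) * XX p j v w) / (cmod (1 - exp (- Om p j v w)))\<^sup>2 * (exp (2 * of_int (b j) * P * fst w $ j) * fst w $ j powr (- P)) = \<psi> j w" for j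
      proof -
        have "exp (- of_int (kk p j) * XX p j v w) * exp (2 * of_int (b j) * P * fst w $ j)
          = exp (2 * of_int (b j) * P * fst v $ j) * exp (- \<epsilon> j * (1 * fst v $ j + (p - 1) * fst w $ j)) * exp (2 * of_int (b j) * fst w $ j)"
        proof -
          have "- of_int (kk p j) * XX p j v w + 2 * of_int (b j) * P * fst w $ j
            = 2 * of_int (b j) * P * fst v $ j + - \<epsilon> j * (1 * fst v $ j + (p - 1) * fst w $ j) + 2 * of_int (b j) * fst w $ j"
          proof -
            have "- of_int (kk p j) * XX p j v w + 2 * of_int (b j) * P * fst w $ j
              - (2 * of_int (b j) * P * fst v $ j + - \<epsilon> j * (1 * fst v $ j + (p - 1) * fst w $ j) + 2 * of_int (b j) * fst w $ j)
              = 2 * of_int (b j) * fst w $ j * (p * P - 1)"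
              unfolding \<epsilon>_def XX_def by (simp add: algebra_simps)
            then show ?thesis by (simp add: PQ(1))
          qed
          then show ?thesis by (simp only: exp_add[symmetric])
        qed
        \<comment> \<open>Integration over \<open>w\<close> reverses the sign of the angle; under
          the modulus a conjugation repairs this.\<close>
        moreover have "cmod (1 - exp (- Om p j v w)) = cmod (1 - exp (- Complex (1 * fst v $ j + (p - 1) * fst w $ j) (- snd v $ j + snd w $ j)))"
        proof -
          have "Complex (1 * fst v $ j + (p - 1) * fst w $ j) (- snd v $ j + snd w $ j) = cnj (Om p j v w)"
            by (simp add: Om_def XX_def complex_eq_iff)
          then have "1 - exp (- Complex (1 * fst v $ j + (p - 1) * fst w $ j) (- snd v $ j + snd w $ j)) = cnj (1 - exp (- Om p j v w))"
            by (simp add: exp_cnj)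
          then show ?thesis by (simp only: complex_mod_cnj)
        qed
        ultimately show ?thesis unfolding \<psi>_def cw_def by (simp add: mult_ac)
      qed
      then have pr: "(\<Prod>j\<in>UNIV. cc j * exp (- of_int (kk p j) * XX p j v w) / (cmod (1 - exp (- Om p j v w)))\<^sup>2 * (exp (2 * of_int (b j) * P * fst w $ j) * fst w $ j powr (- P))) = (\<Prod>j\<in>UNIV. \<psi> j w)" by (intro prod.cong) auto
      have k: "ker p v w = (\<Prod>j\<in>UNIV. cc j * exp (- of_int (kk p j) * XX p j v w) / (cmod (1 - exp (- Om p j v w)))\<^sup>2) / K0" unfolding ker_def cc_def ..
      have "ker p v w * wgt (1 / (p * q)) w powr q = 1 / K0 * (\<Prod>j\<in>UNIV. \<psi> j w)"
        unfolding wgt_eq[OF w r(2)] k pr[symmetric] prod.distrib[of "\<lambda>j. cc j * exp (- of_int (kk p j) * XX p j v w) / (cmod (1 - exp (- Om p j v w)))\<^sup>2" "\<lambda>j. exp (2 * of_int (b j) * P * fst w $ j) * fst w $ j powr (- P)"] by simp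
      then show "ennreal (ker p v w * wgt (1 / (p * q)) w powr q) = ennreal (1 / K0) * (\<Prod>j\<in>UNIV. ennreal (\<psi> j w))"
        using K0_pos \<psi> by (simp add: prod_ennreal ennreal_mult[symmetric] prod_nonneg)
    qed
    also have "\<dots> = ennreal (1 / K0) * (\<integral>\<^sup>+w. (\<Prod>j\<in>UNIV. ennreal (\<psi> j w)) \<partial>W)"
      by (rule nn_integral_cmult) (rule measurable_W_borel, unfold \<psi>_def Complex_eq, measurable)
    also have "\<dots> \<le> ennreal (1 / K0) * ennreal (c0 * (\<Prod>j\<in>UNIV. cw j * (pi * (1 + 2 / \<epsilon> j) * (1 / (1 * (1 - P)) + 1 / ((p - 1) * P)) * fst v $ j powr (- P))))"
      unfolding \<psi>_def using v p PQ by (intro mult_left_mono schur_W \<epsilon> cw) (auto simp: DD_def)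
    also have "\<dots> = ennreal (1 / K0 * (c0 * (\<Prod>j\<in>UNIV. cw j * (pi * (1 + 2 / \<epsilon> j) * (1 / (1 * (1 - P)) + 1 / ((p - 1) * P)) * fst v $ j powr (- P)))))"
      using K0_pos by (intro ennreal_mult'[symmetric]) simp
    also have "1 / K0 * (c0 * (\<Prod>j\<in>UNIV. cw j * (pi * (1 + 2 / \<epsilon> j) * (1 / (1 * (1 - P)) + 1 / ((p - 1) * P)) * fst v $ j powr (- P)))) = C2 * wgt (1 / (p * q)) v powr q"
      unfolding wgt_eq[OF v r(2)] C2_def cw_def by (simp add: prod.distrib mult_ac)
    finally show ?thesis .
  qed
  show ?thesis
  proof (intro exI[of _ "C1 + C2 + 1"] conjI ballI)
    show "C1 + C2 + 1 > 0" using C1 C2 by simp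
    show "(\<integral>\<^sup>+v. ennreal (ker p v w * wgt (1 / (p * q)) v powr p) \<partial>W) \<le> ennreal ((C1 + C2 + 1) * wgt (1 / (p * q)) w powr p)" if "w \<in> DD" for w
      using C1 C2 by (intro order_trans[OF s1[OF that]] ennreal_leI mult_right_mono) auto
    show "(\<integral>\<^sup>+w. ennreal (ker p v w * wgt (1 / (p * q)) w powr q) \<partial>W) \<le> ennreal ((C1 + C2 + 1) * wgt (1 / (p * q)) v powr q)" if "v \<in> DD" for v
      using C1 C2 by (intro order_trans[OF s2[OF that]] ennreal_leI mult_right_mono) auto
  qed
qed

end

section \<open>The projection onto the Bergman space\<close>

context polyhedron begin

text \<open>A function of the angles through \<open>expi\<close> is periodic, so the angles may be
  shifted over the period box; the real parts and the density are untouched.\<close>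

lemma W_shift:
  fixes \<Psi> :: "(real^'n) \<times> (complex^'n) \<Rightarrow> complex"
  assumes \<Psi>: "\<Psi> \<in> borel_measurable borel"
  shows "(LINT x|W. \<Psi> (fst x, expi (snd x))) = (LINT x|W. \<Psi> (fst x, expi \<xi> * expi (snd x)))"
proof -
  define Q :: "(real^'n) \<times> (real^'n) \<Rightarrow> (real^'n) \<times> (complex^'n)" where "Q = (\<lambda>x. (fst x, expi (snd x)))"
  have Qm: "Q \<in> borel_measurable borel" unfolding Q_def borel_prod[symmetric] by measurable
  have sm: "(\<lambda>x :: (real^'n) \<times> (real^'n). (0, \<xi>) + x) \<in> borel_measurable borel"
    by (intro borel_measurable_continuous_onI continuous_intros)
  have Qs: "(\<lambda>x. Q ((0, \<xi>) + x)) \<in> borel_measurable borel" by (rule measurable_compose[OF sm Qm])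
  have per: "Q (y, x + lat m) = Q (y, x)" for y x m by (simp add: Q_def expi_lat)
  have "distr W borel Q = distr W borel (\<lambda>x. Q ((0, \<xi>) + x))"
  proof (rule measure_eqI)
    fix X assume "X \<in> sets (distr W borel Q)"
    then have X[measurable]: "X \<in> sets borel" by simp
    define \<phi> where "\<phi> = (\<lambda>x. ennreal (wt x) * indicator X (Q x) * (\<Prod>j\<in>UNIV. indicator {0<..} (fst x $ j)))"
    have \<phi>m: "\<phi> \<in> borel_measurable borel" unfolding \<phi>_def using Qm by measurable
    have DDe: "indicator DD x = (\<Prod>j\<in>UNIV. indicator {0<..} (fst x $ j)) * (indicator torus_box (snd x) :: ennreal)" for x :: "(real^'n) \<times> (real^'n)"
      unfolding indicator_DD prod.distrib by (simp add: indicator_torus_box)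
    have em: "emeasure (distr W borel R) X = (\<integral>\<^sup>+x. ennreal (wt x) * indicator X (R x) * indicator DD x \<partial>lborel)"
      if "R \<in> borel_measurable borel" for R
    proof -
      have [measurable]: "R \<in> borel_measurable borel" "R \<in> borel_measurable W" using that measurable_W_borel by auto
      have "emeasure (distr W borel R) X = (\<integral>\<^sup>+x. indicator X (R x) \<partial>W)"
        by (subst nn_integral_indicator[symmetric], simp, subst nn_integral_distr) simp_all
      also have "\<dots> = (\<integral>\<^sup>+x. ennreal (wt x) * indicator X (R x) * indicator DD x \<partial>lborel)"
        by (rule nn_integral_W) measurable
      finally show ?thesis .
    qed
    have "emeasure (distr W borel Q) X = (\<integral>\<^sup>+x. \<phi> x * indicator torus_box (snd x) \<partial>lborel)"
      unfolding em[OF Qm] DDe \<phi>_def by (simp add: mult.assoc)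
    also have "\<dots> = (\<integral>\<^sup>+x. \<phi> ((0, \<xi>) + x) * indicator torus_box (snd x) \<partial>lborel)"
      by (rule nn_integral_torus_shift_prod[OF \<phi>m, symmetric]) (simp add: \<phi>_def per wt_def)
    also have "\<dots> = emeasure (distr W borel (\<lambda>x. Q ((0, \<xi>) + x))) X"
      unfolding em[OF Qs] DDe \<phi>_def by (simp add: mult.assoc wt_def)
    finally show "emeasure (distr W borel Q) X = emeasure (distr W borel (\<lambda>x. Q ((0, \<xi>) + x))) X" .
  qed simp
  then have "(LINT y|distr W borel Q. \<Psi> y) = (LINT y|distr W borel (\<lambda>x. Q ((0, \<xi>) + x)). \<Psi> y)" by simp
  then show ?thesis
    by (simp add: integral_distr[OF measurable_W_borel[OF Qm] \<Psi>] integral_distr[OF measurable_W_borel[OF Qs] \<Psi>])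
      (simp add: Q_def expi_add)
qed

lemma expi_powi: "expi s $ j powi k = exp (\<i> * of_real (of_int k * s $ j))"
  unfolding expi_def vec_lambda_beta cis_power_int by (rule cis_conv_exp)

lemma E_imag: "E (cvec (0, s)) $ i = monomial (\<lambda>j. - B i j) (expi s)"
proof -
  have "E (cvec (0, s)) $ i = (\<Prod>j\<in>UNIV. exp (- (of_int (B i j) * Complex 0 (s $ j))))"
    by (simp add: E_def exp_sum sum_negf[symmetric])
  also have "\<dots> = monomial (\<lambda>j. - B i j) (expi s)"
    unfolding monomial_def
    by (rule prod.cong) (simp_all add: expi_powi Complex_eq mult_ac)
  finally show ?thesis .
qed

text \<open>The sum over all integer exponents in a box is a product of one-dimensional sums. The additional
  exponents, outside the range of \<open>ge\<close>, do not contribute because functions of \<open>E w\<close> are invariant under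
  the deck transformations of \<open>E\<close>.\<close>

lemma W_vanish:
  assumes H: "H \<in> borel_measurable V" and c: "c \<in> borel_measurable (borel :: (real^'n) measure)" and \<gamma>: "\<gamma> \<notin> range ge"
  shows "(LINT w|W. H (EC w) * (c (fst w) * monomial \<gamma> (expi (snd w)))) = (0 :: complex)"
proof -
  define Hx where "Hx = (\<lambda>z. if z \<in> U then H z else 0)"
  have Hx[measurable]: "Hx \<in> borel_measurable borel" unfolding Hx_def by (rule measurable_extend[OF H])
  note c[measurable]
  define \<mu> :: "complex^'n \<Rightarrow> complex^'n" where "\<mu> = (\<lambda>\<omega>. \<chi> i. monomial (\<lambda>j. - B i j) \<omega>)"
  have [measurable]: "\<mu> \<in> borel_measurable borel" unfolding \<mu>_def by (rule borel_measurable_vec_lambda) measurable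
  have \<mu>: "\<mu> (expi s) = E (cvec (0, s))" for s by (simp add: \<mu>_def vec_eq_iff E_imag)
  have \<mu>m: "\<mu> (u * v) = \<mu> u * \<mu> v" for u v by (simp add: \<mu>_def vec_eq_iff monomial_mult)
  define \<Psi> where "\<Psi> = (\<lambda>x. Hx (E (cvec (fst x, 0)) * \<mu> (snd x)) * (c (fst x) * monomial \<gamma> (snd x)))"
  have \<Psi>m: "\<Psi> \<in> borel_measurable borel" unfolding \<Psi>_def borel_prod[symmetric]
  proof -
    have [measurable]: "(\<lambda>x. cvec (fst x, 0)) \<in> borel_measurable (borel \<Otimes>\<^sub>M (borel :: (complex^'n) measure))"
      by (rule measurable_compose[OF _ cvec_measurable]) (simp add: borel_prod[symmetric])
    show "(\<lambda>x. Hx (E (cvec (fst x, 0)) * \<mu> (snd x)) * (c (fst x) * monomial \<gamma> (snd x))) \<in> borel_measurable (borel \<Otimes>\<^sub>M (borel :: (complex^'n) measure))"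
      by measurable
  qed
  have eq: "(LINT w|W. H (EC w) * (c (fst w) * monomial \<gamma> (expi (snd w)))) = (LINT w|W. \<Psi> (fst w, expi (snd w)))"
  proof (rule Bochner_Integration.integral_cong)
    fix w assume "w \<in> space W"
    then have "EC w \<in> U" using EC_U by (simp add: Ust_def)
    moreover have "E (cvec (fst w, 0)) * \<mu> (expi (snd w)) = EC w"
    proof -
      have "cvec (fst w, 0) + cvec (0, snd w) = cvec w" by (simp add: vec_eq_iff complex_eq_iff)
      then show ?thesis unfolding \<mu> E_add[symmetric] EC_def by simp
    qed
    ultimately show "H (EC w) * (c (fst w) * monomial \<gamma> (expi (snd w))) = \<Psi> (fst w, expi (snd w))"
      by (simp add: \<Psi>_def Hx_def)
  qed simp
  \<comment> \<open>If \<open>d\<close> divided every component of the vector \<gamma> A, the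
    quotient \<alpha> would satisfy \<open>ge \<alpha> = \<gamma>\<close>, because A B = d
    I.\<close>
  obtain i where i: "\<not> d dvd (\<Sum>j\<in>UNIV. \<gamma> j * A j i)"
  proof (rule ccontr)
    assume "\<not> thesis"
    then have "\<forall>i. \<exists>k. (\<Sum>j\<in>UNIV. \<gamma> j * A j i) = d * k" using that by (auto simp: dvd_def)
    then obtain \<alpha> where \<alpha>: "\<And>i. (\<Sum>j\<in>UNIV. \<gamma> j * A j i) = d * \<alpha> i" by metis
    have "d * ge \<alpha> k = d * \<gamma> k" for k
    proof -
      have "d * ge \<alpha> k = (\<Sum>i\<in>UNIV. B i k * (d * \<alpha> i))" by (simp add: ge_def sum_distrib_left mult_ac)
      also have "\<dots> = (\<Sum>i\<in>UNIV. \<Sum>j\<in>UNIV. \<gamma> j * (A j i * B i k))" unfolding \<alpha>[symmetric] by (simp add: sum_distrib_left mult_ac)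
      also have "\<dots> = (\<Sum>j\<in>UNIV. \<gamma> j * (\<Sum>i\<in>UNIV. A j i * B i k))" by (subst sum.swap) (simp add: sum_distrib_left)
      also have "\<dots> = d * \<gamma> k" by (simp add: AB if_distrib[of "\<lambda>y. _ * y"] cong: if_cong)
      finally show ?thesis .
    qed
    then have "ge \<alpha> = \<gamma>" using d_pos by (simp add: fun_eq_iff)
    then show False using \<gamma> by blast
  qed
  \<comment> \<open>A deck translation: \<open>B\<close> maps \<xi> to 2 pi times the i-th unit
    vector, so \<open>E\<close> does not notice the shift, whereas \<open>monomial \<gamma>\<close>
    acquires a factor that differs from 1 by the choice of \<open>i\<close>.\<close>
  define \<xi> :: "real^'n" where "\<xi> = (\<chi> j. 2 * pi * of_int (A j i) / of_int d)"
  have "\<mu> (expi \<xi>) = 1"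
  proof -
    have "(\<Sum>j\<in>UNIV. of_int (B k j) * Complex 0 (\<xi> $ j)) = of_int (if k = i then 1 else 0) * (2 * of_real pi * \<i>)" for k
    proof -
      have "(\<Sum>j\<in>UNIV. real_of_int (B k j) * \<xi> $ j) = 2 * pi / of_int d * of_int (\<Sum>j\<in>UNIV. B k j * A j i)"
        by (simp add: \<xi>_def sum_distrib_left mult_ac)
      also have "\<dots> = (if k = i then 2 * pi else 0)" using d_pos by (simp add: BA)
      finally have "(\<Sum>j\<in>UNIV. real_of_int (B k j) * \<xi> $ j) = (if k = i then 2 * pi else 0)" .
      then show ?thesis by (auto simp: complex_eq_iff)
    qed
    then show ?thesis unfolding \<mu> E_def by (auto simp: vec_eq_iff exp_minus exp_2pi_of_int[of 1, simplified])
  qed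
  moreover have "monomial \<gamma> (expi \<xi>) \<noteq> 1"
  proof
    define S where "S = (\<Sum>j\<in>UNIV. \<gamma> j * A j i)"
    assume "monomial \<gamma> (expi \<xi>) = 1"
    moreover have "monomial \<gamma> (expi \<xi>) = exp (\<i> * of_real (2 * pi * of_int S / of_int d))"
    proof -
      have "monomial \<gamma> (expi \<xi>) = (\<Prod>j\<in>UNIV. exp (\<i> * of_real (of_int (\<gamma> j) * \<xi> $ j)))"
        unfolding monomial_def by (rule prod.cong) (simp_all add: expi_powi)
      also have "\<dots> = exp (\<i> * of_real (\<Sum>j\<in>UNIV. of_int (\<gamma> j) * \<xi> $ j))" by (simp add: exp_sum[symmetric] sum_distrib_left)
      also have "(\<Sum>j\<in>UNIV. of_int (\<gamma> j) * \<xi> $ j) = 2 * pi * of_int S / of_int d"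
        by (simp add: \<xi>_def S_def sum_distrib_left sum_divide_distrib mult_ac)
      finally show ?thesis .
    qed
    ultimately have "exp (\<i> * of_real (2 * pi * of_int S / of_int d)) = 1" by simp
    then obtain n :: int where "2 * pi * of_int S / of_int d = of_int (2 * n) * pi" by (auto simp: exp_eq_1)
    then have "real_of_int S = of_int (n * d)" using d_pos by (simp add: field_simps)
    then have "S = n * d" by (simp only: of_int_eq_iff)
    then show False using i by (simp add: S_def)
  qed
  moreover have "(LINT w|W. \<Psi> (fst w, expi (snd w))) = (LINT w|W. \<Psi> (fst w, expi \<xi> * expi (snd w)))" by (rule W_shift[OF \<Psi>m])
  moreover have "\<Psi> (y, expi \<xi> * \<omega>) = monomial \<gamma> (expi \<xi>) * \<Psi> (y, \<omega>)" if "\<mu> (expi \<xi>) = 1" for y \<omega>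
    using that by (simp add: \<Psi>_def \<mu>m monomial_mult mult_ac)
  ultimately show ?thesis unfolding eq by simp
qed

text \<open>In logarithmic coordinates this is 1 / m \<le> Re w_j \<le> m, which keeps away from the
  boundary and from the hyperplanes; it is stated through the defining monomials so that
  measurability is evident.\<close>

definition region :: "real \<Rightarrow> (complex^'n) set" where
  "region m = {z\<in>Ust. \<forall>j. exp (- of_int d * m) \<le> cmod (monomial (A j) z) \<and> cmod (monomial (A j) z) \<le> exp (- of_int d / m)}"

lemma region_E: "E w \<in> region m \<longleftrightarrow> E w \<in> Ust \<and> (\<forall>j. Re (w $ j) \<le> m \<and> 1 / m \<le> Re (w $ j))"
proof -
  have d: "real_of_int d > 0" using d_pos by simp
  have "exp (- of_int d * m) \<le> cmod (monomial (A j) (E w)) \<longleftrightarrow> Re (w $ j) \<le> m" for j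
    using d by (simp add: norm_A_E)
  moreover have "cmod (monomial (A j) (E w)) \<le> exp (- of_int d / m) \<longleftrightarrow> 1 / m \<le> Re (w $ j)" for j
    using mult_le_cancel_left_pos[OF d, of "1 / m" "Re (w $ j)"] by (simp add: norm_A_E)
  ultimately show ?thesis unfolding region_def by auto
qed

lemma region_EC: "EC x \<in> region m \<Longrightarrow> 1 / m \<le> fst x $ j \<and> fst x $ j \<le> m"
  by (simp add: EC_def region_E)

lemma region_EX:
  assumes "z \<in> region m" obtains x where "z = E (cvec x)" "\<And>j. 1 / m \<le> fst x $ j" "\<And>j. fst x $ j \<le> m"
proof -
  obtain w where w: "z = E w" using Ust_E[of z] assms by (auto simp: region_def)
  obtain x where x: "w = cvec x" using cvec_surj by blast
  show ?thesis using that[of x] assms w x by (auto simp: region_E)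
qed

lemma region_exhaust:
  assumes "z \<in> Ust" shows "\<forall>\<^sub>F m in sequentially. z \<in> region (real m)"
proof -
  obtain w where w: "z = E w" "\<And>j. Re (w $ j) > 0" using Ust_E[OF assms] by blast
  have "\<forall>\<^sub>F m in sequentially. Re (w $ j) \<le> real m \<and> 1 / Re (w $ j) \<le> real m" for j
    by (intro eventually_conj eventually_sequentiallyI[of "nat \<lceil>Re (w $ j)\<rceil>"] eventually_sequentiallyI[of "nat \<lceil>1 / Re (w $ j)\<rceil>"]) linarith+
  then have "\<forall>\<^sub>F m in sequentially. \<forall>j. Re (w $ j) \<le> real m \<and> 1 / Re (w $ j) \<le> real m" by (simp add: eventually_all_finite)
  then show ?thesis using eventually_gt_at_top[of "0::nat"]
  proof eventually_elim
    case (elim m)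
    have "1 / real m \<le> Re (w $ j)" for j
      using elim(1)[rule_format, of j] elim(2) w(2)[of j] by (simp add: field_simps)
    then show ?case using assms elim unfolding w(1) by (auto simp: region_E)
  qed
qed

lemma Ust_sets: "Ust \<in> sets borel"
proof -
  have "{z :: complex^'n. z $ i \<noteq> 0} \<in> sets borel" for i by (rule borel_open) (intro open_Collect_neq continuous_intros)
  then have "(U \<inter> (\<Inter>i. {z :: complex^'n. z $ i \<noteq> 0})) \<in> sets borel" using U_sets by (intro sets.Int sets.finite_INT) auto
  moreover have "Ust = U \<inter> (\<Inter>i. {z :: complex^'n. z $ i \<noteq> 0})" by (auto simp: Ust_def)
  ultimately show ?thesis by simp
qed

lemma region_sets: "region m \<in> sets borel"
proof -
  have "{z \<in> space borel. \<forall>j. exp (- of_int d * m) \<le> cmod (monomial (A j) z) \<and> cmod (monomial (A j) z) \<le> exp (- of_int d / m)} \<in> sets borel"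
    by measurable
  with Ust_sets have "Ust \<inter> {z \<in> space borel. \<forall>j. exp (- of_int d * m) \<le> cmod (monomial (A j) z) \<and> cmod (monomial (A j) z) \<le> exp (- of_int d / m)} \<in> sets borel"
    by (rule sets.Int)
  moreover have "region m = Ust \<inter> {z \<in> space borel. \<forall>j. exp (- of_int d * m) \<le> cmod (monomial (A j) z) \<and> cmod (monomial (A j) z) \<le> exp (- of_int d / m)}"
    by (auto simp: region_def)
  ultimately show ?thesis by simp
qed

text \<open>The twist takes the real parts into the interval from (p - 1) / m to (p - 1) m, which
  supplies \<delta> and \<open>R\<close> in \<open>monomial_dec_bound\<close>.\<close>

lemma region_twist_bound:
  assumes p: "p > 1" and m: "m > 0"
  shows "\<exists>\<delta>>0. \<exists>C\<ge>0. \<forall>\<alpha>\<in>SS p. \<forall>z\<in>region m. cmod (monomial \<alpha> (twist p z)) \<le> C * dec p \<delta> \<alpha>"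
proof (intro exI conjI ballI)
  show "(p - 1) / m > 0" using p m by simp
  show "0 \<le> (\<Prod>j\<in>(UNIV :: 'n set). exp (\<bar>of_int (kk p j)\<bar> * ((p - 1) * m)))" by (intro prod_nonneg) simp
  fix \<alpha> z assume \<alpha>: "\<alpha> \<in> SS p" and z: "z \<in> region m"
  obtain x where x: "z = E (cvec x)" "\<And>j. 1 / m \<le> fst x $ j" "\<And>j. fst x $ j \<le> m" using region_EX[OF z] by blast
  have "twist p z = E (cvec (scl p x))" using twist_EC[of p x] by (simp add: EC_def x(1))
  moreover have "cmod (monomial \<alpha> (E (cvec (scl p x)))) \<le> (\<Prod>j\<in>UNIV. exp (\<bar>of_int (kk p j)\<bar> * ((p - 1) * m))) * dec p ((p - 1) / m) \<alpha>"
  proof (rule monomial_dec_bound)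
    show "(p - 1) / m > 0" "0 \<le> (p - 1) * m" using p m by simp_all
    show "(p - 1) / m \<le> Re (cvec (scl p x) $ j)" for j
      using mult_left_mono[OF x(2)[of j], of "p - 1"] p by (simp add: scl_def)
    show "Re (cvec (scl p x) $ j) \<le> (p - 1) * m" for j
      using mult_left_mono[OF x(3)[of j], of "p - 1"] p by (simp add: scl_def)
  qed (rule \<alpha>)
  ultimately show "cmod (monomial \<alpha> (twist p z)) \<le> (\<Prod>j\<in>UNIV. exp (\<bar>of_int (kk p j)\<bar> * ((p - 1) * m))) * dec p ((p - 1) / m) \<alpha>" by simp
qed

end

section \<open>Boundedness of the projection\<close>

context polyhedron begin

text \<open>The coefficients of the projection: functionals dual to the monomials, since a monomial
  in A^p paired with its own twist gives \<open>K0 / NN p \<alpha>\<close>.\<close>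

definition hh :: "real \<Rightarrow> (complex^'n \<Rightarrow> complex) \<Rightarrow> ('n \<Rightarrow> int) \<Rightarrow> complex" where
  "hh p H \<alpha> = of_real (NN p \<alpha> / K0) * (LINT z|V. H z * cnj (monomial \<alpha> (twist p z)))"

lemma integral_bound_V:
  fixes f :: "complex^'n \<Rightarrow> complex"
  assumes "\<And>z. z \<in> U \<Longrightarrow> cmod (f z) \<le> K" "K \<ge> 0"
  shows "cmod (LINT z|V. f z) \<le> K * measure V U"
proof -
  interpret V: finite_measure V by (rule finite_measure_V)
  have "cmod (LINT z|V. f z) \<le> (LINT z|V. cmod (f z))" by (rule integral_norm_bound)
  also have "\<dots> \<le> (LINT z|V. K)" by (rule integral_mono') (use assms in auto)
  finally show ?thesis by (simp add: mult.commute)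
qed

lemma monomial_twist_measurable: "(\<lambda>z. monomial \<alpha> (twist p z)) \<in> borel_measurable V"
  by (rule measurable_V_borel) measurable

lemma integrable_bound_W:
  fixes f :: "(real^'n) \<times> (real^'n) \<Rightarrow> complex"
  assumes "f \<in> borel_measurable W" "\<And>x. x \<in> DD \<Longrightarrow> cmod (f x) \<le> K"
  shows "integrable W f"
  by (rule finite_measure.integrable_const_bound[OF finite_measure_W, where B=K]) (use assms in \<open>auto intro: AE_I2\<close>)

text \<open>The cut-off puts a factor \<open>dec p \<delta> \<alpha>\<close> into each coefficient,
  so the series converges absolutely in norm. This majorant depends on \<open>m\<close>; the uniform
  bound comes from the kernel.\<close>

lemma hh_summable:
  assumes p: "p > 1" and m: "m > 0" and M: "\<And>z. z \<in> U \<Longrightarrow> cmod (H z) \<le> M" and supp: "\<And>z. z \<in> U \<Longrightarrow> z \<notin> region m \<Longrightarrow> H z = 0"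
  shows "(\<lambda>\<alpha>. cmod (hh p H \<alpha>) * lpN p V (monomial \<alpha>)) summable_on SS p"
proof -
  obtain \<delta> C where \<delta>: "\<delta> > 0" "C \<ge> 0" and C: "\<And>\<alpha> z. \<alpha> \<in> SS p \<Longrightarrow> z \<in> region m \<Longrightarrow> cmod (monomial \<alpha> (twist p z)) \<le> C * dec p \<delta> \<alpha>"
    using region_twist_bound[OF p m] by blast
  have p0: "p > 0" using p by simp
  obtain \<nu> where \<nu>: "\<nu> > 0" "\<And>\<alpha>. \<alpha> \<in> SS p \<Longrightarrow> \<nu> \<le> NN p \<alpha>" using NN_lower[OF p0] by blast
  define c where "c = \<bar>M\<bar> * C * measure V U / K0 * (K0 / \<nu>) powr (1 / p)"
  show ?thesis
  proof (rule summable_on_comparison_test)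
    show "(\<lambda>\<alpha>. c * (NN p \<alpha> * dec p \<delta> \<alpha>)) summable_on SS p" by (intro summable_on_cmult_right summable_dec p0 \<delta>)
    show "cmod (hh p H \<alpha>) * lpN p V (monomial \<alpha>) \<le> c * (NN p \<alpha> * dec p \<delta> \<alpha>)" if \<alpha>: "\<alpha> \<in> SS p" for \<alpha>
    proof -
      have Np: "NN p \<alpha> > 0" by (rule NN_pos[OF p0 \<alpha>])
      have "cmod (LINT z|V. H z * cnj (monomial \<alpha> (twist p z))) \<le> \<bar>M\<bar> * (C * dec p \<delta> \<alpha>) * measure V U"
      proof (rule integral_bound_V)
        fix z assume z: "z \<in> U"
        show "cmod (H z * cnj (monomial \<alpha> (twist p z))) \<le> \<bar>M\<bar> * (C * dec p \<delta> \<alpha>)"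
        proof (cases "z \<in> region m")
          case True
          have "cmod (H z) \<le> \<bar>M\<bar>" using M[OF z] by linarith
          then show ?thesis unfolding norm_mult complex_mod_cnj by (intro mult_mono C[OF \<alpha> True]) auto
        qed (use supp[OF z] \<delta> dec_pos[of p \<delta> \<alpha>] in simp)
      qed (use \<delta> dec_pos[of p \<delta> \<alpha>] in simp)
      then have "cmod (hh p H \<alpha>) \<le> NN p \<alpha> / K0 * (\<bar>M\<bar> * (C * dec p \<delta> \<alpha>) * measure V U)"
        unfolding hh_def norm_mult using Np K0_pos by (intro mult_mono) (auto simp: norm_divide)
      moreover have "lpN p V (monomial \<alpha>) \<le> (K0 / \<nu>) powr (1 / p)"
        unfolding lpN_monomial[OF p0 \<alpha>] using \<nu>(1) \<nu>(2)[OF \<alpha>] K0_pos Np p0 by (intro powr_mono2 divide_left_mono) auto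
      ultimately have "cmod (hh p H \<alpha>) * lpN p V (monomial \<alpha>) \<le> NN p \<alpha> / K0 * (\<bar>M\<bar> * (C * dec p \<delta> \<alpha>) * measure V U) * (K0 / \<nu>) powr (1 / p)"
        by (rule mult_mono') simp_all
      then show ?thesis by (simp add: c_def mult_ac)
    qed
  qed simp
qed

text \<open>The term of the kernel for an arbitrary integer vector, whether or not it is of the form
  \<open>ge \<alpha>\<close>.\<close>

definition tt :: "real \<Rightarrow> ('n \<Rightarrow> int) \<Rightarrow> (real^'n) \<times> (real^'n) \<Rightarrow> (real^'n) \<times> (real^'n) \<Rightarrow> complex" where
  "tt p \<gamma> v w = (\<Prod>j\<in>UNIV. of_real (p * of_int (\<gamma> j) + 2 * of_int (b j)) * exp (- of_int (\<gamma> j) * Om p j v w))"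

lemma tt_measurable: "tt p \<gamma> v \<in> borel_measurable W"
  by (rule measurable_W_borel) (unfold tt_def Om_def XX_def Complex_eq, measurable)

lemma hh_tt:
  assumes p: "p > 1" and H: "H \<in> borel_measurable V"
  shows "hh p H \<alpha> * monomial \<alpha> (EC v) = of_real (1 / K0) * (LINT w|W. H (EC w) * tt p (ge \<alpha>) v w)"
proof -
  note monomial_twist_measurable[measurable] H[measurable]
  have "(LINT z|V. H z * cnj (monomial \<alpha> (twist p z))) = (LINT w|W. H (EC w) * cnj (monomial \<alpha> (EC (scl p w))))"
    unfolding twist_EC[symmetric] by (rule integral_V_W) measurable
  then have "hh p H \<alpha> * monomial \<alpha> (EC v) = of_real (1 / K0) * (of_real (NN p \<alpha>) * ((LINT w|W. H (EC w) * cnj (monomial \<alpha> (EC (scl p w)))) * monomial \<alpha> (EC v)))"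
    unfolding hh_def by (simp add: mult_ac)
  also have "(LINT w|W. H (EC w) * cnj (monomial \<alpha> (EC (scl p w)))) * monomial \<alpha> (EC v)
      = (LINT w|W. H (EC w) * cnj (monomial \<alpha> (EC (scl p w))) * monomial \<alpha> (EC v))" by (rule integral_mult_left_zero[symmetric])
  also have "of_real (NN p \<alpha>) * \<dots> = (LINT w|W. of_real (NN p \<alpha>) * (H (EC w) * cnj (monomial \<alpha> (EC (scl p w))) * monomial \<alpha> (EC v)))"
    by (rule integral_mult_right_zero[symmetric])
  also have "\<dots> = (LINT w|W. H (EC w) * tt p (ge \<alpha>) v w)"
  proof (rule Bochner_Integration.integral_cong)
    fix w
    have "cnj (monomial \<alpha> (EC (scl p w))) * monomial \<alpha> (EC v) = (\<Prod>j\<in>UNIV. exp (- of_int (ge \<alpha> j) * Om p j v w))"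
    proof -
      have "cnj (Complex ((p - 1) * fst w $ j) (snd w $ j)) + Complex (fst v $ j) (snd v $ j) = Om p j v w" for j
        by (simp add: Om_def XX_def complex_eq_iff)
      then have e: "- (\<Sum>j\<in>UNIV. of_int (ge \<alpha> j) * cnj (Complex ((p - 1) * fst w $ j) (snd w $ j))) + - (\<Sum>j\<in>UNIV. of_int (ge \<alpha> j) * Complex (fst v $ j) (snd v $ j))
         = (\<Sum>j\<in>UNIV. - of_int (ge \<alpha> j) * Om p j v w)"
        unfolding sum_negf[symmetric] sum.distrib[symmetric] by (intro sum.cong refl) (metis (no_types, lifting) distrib_left mult_minus_left)
      have "cnj (monomial \<alpha> (EC (scl p w))) = exp (- (\<Sum>j\<in>UNIV. of_int (ge \<alpha> j) * cnj (Complex ((p - 1) * fst w $ j) (snd w $ j))))"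
        unfolding EC_def monomial_E exp_cnj by (simp add: scl_def)
      then show ?thesis unfolding EC_def monomial_E exp_sum[OF finite_class.finite_UNIV, symmetric] e[symmetric] exp_add by (simp add: EC_def)
    qed
    then have "of_real (NN p \<alpha>) * (cnj (monomial \<alpha> (EC (scl p w))) * monomial \<alpha> (EC v)) = tt p (ge \<alpha>) v w"
      by (simp only: tt_def NN_def of_real_prod prod.distrib)
    then show "of_real (NN p \<alpha>) * (H (EC w) * cnj (monomial \<alpha> (EC (scl p w))) * monomial \<alpha> (EC v)) = H (EC w) * tt p (ge \<alpha>) v w"
      by (metis mult.assoc mult.commute)
  qed simp
  finally show ?thesis .
qed

lemma tt_vanish:
  assumes H: "H \<in> borel_measurable V" and \<gamma>: "\<gamma> \<notin> range ge"
  shows "(LINT w|W. H (EC w) * tt p \<gamma> v w) = 0"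
proof -
  define c where "c = (\<lambda>y :: real^'n. \<Prod>j\<in>UNIV. of_real (p * of_int (\<gamma> j) + 2 * of_int (b j)) * exp (- of_int (\<gamma> j) * Complex (fst v $ j + (p - 1) * y $ j) (snd v $ j)))"
  have cm: "c \<in> borel_measurable borel" unfolding c_def Complex_eq by measurable
  have "tt p \<gamma> v w = c (fst w) * monomial \<gamma> (expi (snd w))" for w
    unfolding tt_def c_def monomial_def prod.distrib[symmetric]
  proof (rule prod.cong)
    fix j
    have "- of_int (\<gamma> j) * Om p j v w = - of_int (\<gamma> j) * Complex (fst v $ j + (p - 1) * fst w $ j) (snd v $ j) + \<i> * of_real (of_int (\<gamma> j) * snd w $ j)"
      by (simp add: Om_def XX_def complex_eq_iff algebra_simps)
    then have "exp (- of_int (\<gamma> j) * Om p j v w) = exp (- of_int (\<gamma> j) * Complex (fst v $ j + (p - 1) * fst w $ j) (snd v $ j)) * expi (snd w) $ j powi \<gamma> j"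
      unfolding expi_powi by (simp only: exp_add)
    then show "of_real (p * of_int (\<gamma> j) + 2 * of_int (b j)) * exp (- of_int (\<gamma> j) * Om p j v w)
       = of_real (p * of_int (\<gamma> j) + 2 * of_int (b j)) * exp (- of_int (\<gamma> j) * Complex (fst v $ j + (p - 1) * fst w $ j) (snd v $ j)) * expi (snd w) $ j powi \<gamma> j"
      by (simp only: mult.assoc)
  qed simp
  then show ?thesis using W_vanish[OF H cm \<gamma>] by simp
qed

lemma XX_region:
  assumes p: "p > 1" and v: "v \<in> DD" and m: "m > 0" and w: "EC w \<in> region m"
  shows "fst v $ j \<le> XX p j v w" "XX p j v w \<le> fst v $ j + (p - 1) * m" "XX p j v w > 0"
proof -
  have "0 < 1 / m" using m by simp
  then have "0 \<le> fst w $ j" "fst w $ j \<le> m" using region_EC[OF w, of j] by linarith+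
  then have "0 \<le> (p - 1) * fst w $ j" "(p - 1) * fst w $ j \<le> (p - 1) * m" using p by (auto intro: mult_left_mono)
  moreover have "fst v $ j > 0" using v by (simp add: DD_def)
  ultimately show "fst v $ j \<le> XX p j v w" "XX p j v w \<le> fst v $ j + (p - 1) * m" "XX p j v w > 0" by (auto simp: XX_def)
qed

lemma exp_int_bound: "0 < X \<Longrightarrow> X \<le> Y \<Longrightarrow> exp (- of_int k * X) \<le> exp (\<bar>of_int k\<bar> * (Y :: real))"
proof -
  assume "0 < X" "X \<le> Y"
  then have "- of_int k * X \<le> \<bar>of_int k\<bar> * X" "\<bar>of_int k\<bar> * X \<le> \<bar>of_int k\<bar> * Y"
    by (intro mult_right_mono mult_left_mono abs_ge_minus_self; simp)+
  then show ?thesis unfolding exp_le_cancel_iff by (rule order_trans)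
qed

definition psum :: "real \<Rightarrow> nat \<Rightarrow> 'n \<Rightarrow> (real^'n) \<times> (real^'n) \<Rightarrow> (real^'n) \<times> (real^'n) \<Rightarrow> complex" where
  "psum p N j v w = (\<Sum>k\<in>{kk p j..kk p j + int N}. of_real (p * of_int k + 2 * of_int (b j)) * exp (- of_int k * Om p j v w))"

text \<open>The limit of \<open>psum\<close>: the arithmetic-geometric series with ratio
  \<open>exp (- Om p j v w)\<close>, summed in closed form.\<close>

definition kap :: "real \<Rightarrow> 'n \<Rightarrow> (real^'n) \<times> (real^'n) \<Rightarrow> (real^'n) \<times> (real^'n) \<Rightarrow> complex" where
  "kap p j v w = exp (- of_int (kk p j) * Om p j v w) *
     (of_real p / (1 - exp (- Om p j v w))\<^sup>2 + of_real (aa p j - p) / (1 - exp (- Om p j v w)))"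

lemma psum_eq: "psum p N j v w = exp (- of_int (kk p j) * Om p j v w) * (\<Sum>l\<le>N. of_real (p * real l + aa p j) * exp (- Om p j v w) ^ l)"
  unfolding psum_def sum_int_interval sum_distrib_left
proof (rule sum.cong)
  fix l :: nat
  have "exp (- of_int (kk p j + int l) * Om p j v w) = exp (- of_int (kk p j) * Om p j v w) * exp (- Om p j v w) ^ l"
    unfolding exp_of_nat_mult[symmetric] exp_add[symmetric] by (simp add: algebra_simps)
  moreover have "p * of_int (kk p j + int l) + 2 * of_int (b j) = p * real l + aa p j" by (simp add: aa_def algebra_simps)
  ultimately show "of_real (p * of_int (kk p j + int l) + 2 * of_int (b j)) * exp (- of_int (kk p j + int l) * Om p j v w)
     = exp (- of_int (kk p j) * Om p j v w) * (of_real (p * real l + aa p j) * exp (- Om p j v w) ^ l)"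
    by (simp only: mult.left_commute)
qed simp

lemma Re_Om: "Re (Om p j v w) = XX p j v w" by (simp add: Om_def)

lemma psum_tendsto: "XX p j v w > 0 \<Longrightarrow> (\<lambda>N. psum p N j v w) \<longlonglongrightarrow> kap p j v w"
  unfolding psum_eq kap_def
  by (intro tendsto_mult tendsto_const arith_geometric_sums[unfolded sums_def_le]) (simp add: Re_Om)

lemma kap_bound: "XX p j v w > 0 \<Longrightarrow> cmod (kap p j v w) \<le> (\<bar>p\<bar> + 2 * \<bar>aa p j - p\<bar>) * exp (- of_int (kk p j) * XX p j v w) / (cmod (1 - exp (- Om p j v w)))\<^sup>2"
proof -
  assume X: "XX p j v w > 0"
  have "cmod (kap p j v w) \<le> exp (- of_int (kk p j) * XX p j v w) * ((\<bar>p\<bar> + 2 * \<bar>aa p j - p\<bar>) / (cmod (1 - exp (- Om p j v w)))\<^sup>2)"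
    unfolding kap_def norm_mult using X by (intro mult_mono arith_geometric_bound) (simp_all add: Re_Om)
  then show ?thesis by (simp add: mult_ac)
qed

text \<open>For fixed \<open>v\<close> one geometric majorant serves for all \<open>N\<close> and
  \<open>w\<close>, because \<open>XX\<close> is at least \<open>fst v $ j\<close>. The upper bound
  on \<open>XX\<close> from the region controls the factor with \<open>kk\<close>, which may be
  negative.\<close>

lemma psum_bound:
  assumes p: "p > 1" and v: "v \<in> DD" and m: "m > 0"
  shows "\<exists>K\<ge>0. \<forall>N w. EC w \<in> region m \<longrightarrow> cmod (psum p N j v w) \<le> K"
proof -
  define y where "y = fst v $ j"
  have y: "y > 0" using v by (simp add: DD_def y_def)
  have aa: "aa p j > 0" unfolding aa_def by (rule kk_pos) (use p in simp)
  define g where "g = (\<lambda>l. (p * real l + aa p j) * exp (- y * real l))"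
  have g: "summable g" unfolding g_def by (rule summable_arith_exp[OF y])
  have g0: "g l \<ge> 0" for l using p aa by (simp add: g_def)
  define K where "K = exp (\<bar>of_int (kk p j)\<bar> * (y + (p - 1) * m)) * suminf g"
  have "cmod (psum p N j v w) \<le> K" if w: "EC w \<in> region m" for N w
  proof -
    note X = XX_region[OF p v m w, of j]
    have "cmod (\<Sum>l\<le>N. of_real (p * real l + aa p j) * exp (- Om p j v w) ^ l) \<le> (\<Sum>l\<le>N. g l)"
    proof (rule sum_norm_le)
      fix l
      have "exp (- XX p j v w) ^ l \<le> exp (- y) ^ l" using X by (intro power_mono) (auto simp: y_def)
      also have "exp (- y) ^ l = exp (- y * real l)" by (simp add: exp_of_nat_mult[symmetric] mult.commute)
      finally have "(p * real l + aa p j) * exp (- XX p j v w) ^ l \<le> g l" unfolding g_def using p aa by (intro mult_left_mono) auto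
      then show "cmod (of_real (p * real l + aa p j) * exp (- Om p j v w) ^ l) \<le> g l"
        using p aa by (simp add: norm_mult norm_power Re_Om del: of_real_add of_real_mult)
    qed
    also have "\<dots> \<le> suminf g" by (rule sum_le_suminf[OF g]) (use g0 in auto)
    finally have s: "cmod (\<Sum>l\<le>N. of_real (p * real l + aa p j) * exp (- Om p j v w) ^ l) \<le> suminf g" .
    have "cmod (exp (- of_int (kk p j) * Om p j v w)) \<le> exp (\<bar>of_int (kk p j)\<bar> * (y + (p - 1) * m))"
      using exp_int_bound[OF X(3,2), of "kk p j"] by (simp add: Re_Om y_def)
    then show ?thesis unfolding psum_eq norm_mult K_def by (intro mult_mono s) auto
  qed
  moreover have "K \<ge> 0" unfolding K_def using g0 g by (intro mult_nonneg_nonneg suminf_nonneg) auto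
  ultimately show ?thesis by blast
qed

lemma psum_measurable: "psum p N j v \<in> borel_measurable W"
  by (rule measurable_W_borel) (unfold psum_def Om_def XX_def Complex_eq, measurable)

lemma kap_measurable: "kap p j v \<in> borel_measurable W"
  by (rule measurable_W_borel) (unfold kap_def Om_def XX_def Complex_eq, measurable)

context
  fixes p m M :: real and H :: "complex^'n \<Rightarrow> complex"
  assumes p: "p > 1" and m: "m > 0" and H: "H \<in> borel_measurable V"
    and M: "\<And>z. z \<in> U \<Longrightarrow> cmod (H z) \<le> M" and supp: "\<And>z. z \<in> U \<Longrightarrow> z \<notin> region m \<Longrightarrow> H z = 0"
begin

lemma H_EC: "(\<lambda>w. H (EC w)) \<in> borel_measurable W" by (rule measurable_EC[OF H])

lemma H_bound:
  assumes w: "w \<in> DD" and K: "K \<ge> 0" and x: "EC w \<in> region m \<Longrightarrow> cmod x \<le> K"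
  shows "cmod (H (EC w) * x) \<le> \<bar>M\<bar> * K"
proof (cases "EC w \<in> region m")
  case True
  have "cmod (H (EC w)) \<le> \<bar>M\<bar>" using M[of "EC w"] EC_U[OF w] by (force simp: Ust_def)
  then show ?thesis unfolding norm_mult by (intro mult_mono x True) auto
next
  case False
  then have "H (EC w) = 0" using supp EC_U[OF w] by (auto simp: Ust_def)
  then show ?thesis using K by simp
qed

lemma tt_integrable:
  assumes v: "v \<in> DD" shows "integrable W (\<lambda>w. H (EC w) * tt p \<gamma> v w)"
proof (rule integrable_bound_W)
  show "(\<lambda>w. H (EC w) * tt p \<gamma> v w) \<in> borel_measurable W" by (intro borel_measurable_times H_EC tt_measurable)
  fix w assume w: "w \<in> DD"
  show "cmod (H (EC w) * tt p \<gamma> v w) \<le> \<bar>M\<bar> * (\<Prod>j\<in>UNIV. \<bar>p * of_int (\<gamma> j) + 2 * of_int (b j)\<bar> * exp (\<bar>of_int (\<gamma> j)\<bar> * (fst v $ j + (p - 1) * m)))"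
  proof (rule H_bound[OF w])
    assume r: "EC w \<in> region m"
    show "cmod (tt p \<gamma> v w) \<le> (\<Prod>j\<in>UNIV. \<bar>p * of_int (\<gamma> j) + 2 * of_int (b j)\<bar> * exp (\<bar>of_int (\<gamma> j)\<bar> * (fst v $ j + (p - 1) * m)))"
      unfolding tt_def prod_norm[symmetric] norm_mult norm_of_real
    proof (intro prod_mono conjI mult_left_mono)
      fix j
      show "cmod (exp (- of_int (\<gamma> j) * Om p j v w)) \<le> exp (\<bar>of_int (\<gamma> j)\<bar> * (fst v $ j + (p - 1) * m))"
        using exp_int_bound[OF XX_region(3,2)[OF p v m r], of "\<gamma> j"] by (simp add: Re_Om)
    qed auto
  qed (auto intro!: prod_nonneg)
qed

lemma SN_psum:
  assumes v: "v \<in> DD"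
  shows "(\<Sum>\<alpha>\<in>SN p N. hh p H \<alpha> * monomial \<alpha> (EC v)) = of_real (1 / K0) * (LINT w|W. H (EC w) * (\<Prod>j\<in>UNIV. psum p N j v w))"
proof -
  define I where "I = (\<lambda>\<gamma>. LINT w|W. H (EC w) * tt p \<gamma> v w)"
  have "(\<Sum>\<alpha>\<in>SN p N. hh p H \<alpha> * monomial \<alpha> (EC v)) = of_real (1 / K0) * (\<Sum>\<alpha>\<in>SN p N. I (ge \<alpha>))"
    unfolding sum_distrib_left I_def by (rule sum.cong) (simp_all only: hh_tt[OF p H])
  also have "(\<Sum>\<alpha>\<in>SN p N. I (ge \<alpha>)) = (\<Sum>\<gamma>\<in>ge ` SN p N. I \<gamma>)"
    by (subst sum.reindex[OF inj_ge]) simp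
  \<comment> \<open>Vectors outside \<open>range ge\<close> integrate to 0, and those of the box in
    \<open>range ge\<close> already come from \<open>SN p N\<close>. The full box is what makes the
    sum factor.\<close>
  also have "\<dots> = (\<Sum>\<gamma>\<in>box p N. I \<gamma>)"
  proof (rule sum.mono_neutral_left[OF finite_box ge_SN], rule ballI)
    fix \<gamma> assume \<gamma>: "\<gamma> \<in> box p N - ge ` SN p N"
    have "\<gamma> \<notin> range ge"
    proof
      assume "\<gamma> \<in> range ge"
      then obtain \<alpha> where "\<gamma> = ge \<alpha>" by blast
      moreover from this \<gamma> have "\<alpha> \<in> SN p N" by (auto simp: box_def SN_def SS_def PiE_def Pi_def)
      ultimately show False using \<gamma> by blast
    qed
    then show "I \<gamma> = 0" unfolding I_def by (rule tt_vanish[OF H])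
  qed
  also have "\<dots> = (LINT w|W. (\<Sum>\<gamma>\<in>box p N. H (EC w) * tt p \<gamma> v w))"
    unfolding I_def by (rule Bochner_Integration.integral_sum[symmetric]) (rule tt_integrable[OF v])
  also have "\<dots> = (LINT w|W. H (EC w) * (\<Prod>j\<in>UNIV. psum p N j v w))"
  proof (rule Bochner_Integration.integral_cong)
    fix w
    have "(\<Sum>\<gamma>\<in>box p N. tt p \<gamma> v w) = (\<Prod>j\<in>UNIV. psum p N j v w)"
      unfolding box_def tt_def psum_def by (rule prod_sum_PiE) auto
    then show "(\<Sum>\<gamma>\<in>box p N. H (EC w) * tt p \<gamma> v w) = H (EC w) * (\<Prod>j\<in>UNIV. psum p N j v w)"
      by (simp only: sum_distrib_left[symmetric])
  qed simp
  finally show ?thesis .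
qed

lemma hh_growth: "growth p (hh p H)"
  using ser_lp(1)[OF _ hh_summable[OF p m M supp]] p by simp

text \<open>For fixed \<open>v\<close> dominated convergence lets the truncation tend to infinity
  under the integral; the limit kernel is then bounded factor by factor.\<close>

lemma ser_kernel:
  assumes v: "v \<in> DD"
  shows "ennreal (cmod (ser p (hh p H) (EC v))) \<le> (\<integral>\<^sup>+w. ennreal (ker p v w * cmod (H (EC w))) \<partial>W)"
proof -
  have "\<exists>K. \<forall>j. K j \<ge> 0 \<and> (\<forall>N w. EC w \<in> region m \<longrightarrow> cmod (psum p N j v w) \<le> K j)"
    using psum_bound[OF p v m] by metis
  then obtain K where K: "\<And>j. K j \<ge> (0::real)" "\<And>j N w. EC w \<in> region m \<Longrightarrow> cmod (psum p N j v w) \<le> K j" by blast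
  define f where "f = (\<lambda>N w. H (EC w) * (\<Prod>j\<in>UNIV. psum p N j v w))"
  define F where "F = (\<lambda>w. H (EC w) * (\<Prod>j\<in>UNIV. kap p j v w))"
  have XXp: "XX p j v w > 0" if "w \<in> DD" for j w
    using p v that by (auto simp: XX_def DD_def intro!: add_pos_pos mult_pos_pos)
  have Fm: "F \<in> borel_measurable W" unfolding F_def by (intro borel_measurable_times H_EC borel_measurable_prod kap_measurable)
  have fm: "f N \<in> borel_measurable W" for N unfolding f_def by (intro borel_measurable_times H_EC borel_measurable_prod psum_measurable)
  have lim: "AE w in W. (\<lambda>N. f N w) \<longlonglongrightarrow> F w"
    unfolding f_def F_def by (intro AE_I2 tendsto_mult tendsto_const tendsto_prod psum_tendsto XXp) simp
  have bd: "AE w in W. cmod (f N w) \<le> \<bar>M\<bar> * (\<Prod>j\<in>UNIV. K j)" for N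
  proof (rule AE_I2)
    fix w assume "w \<in> space W"
    then have w: "w \<in> DD" by simp
    show "cmod (f N w) \<le> \<bar>M\<bar> * (\<Prod>j\<in>UNIV. K j)" unfolding f_def
    proof (rule H_bound[OF w])
      assume "EC w \<in> region m"
      then show "cmod (\<Prod>j\<in>UNIV. psum p N j v w) \<le> (\<Prod>j\<in>UNIV. K j)" unfolding prod_norm[symmetric] by (intro prod_mono) (simp add: K)
    qed (simp add: K prod_nonneg)
  qed
  have ci: "integrable W (\<lambda>_. \<bar>M\<bar> * (\<Prod>j\<in>UNIV. K j))"
    using finite_measure.integrable_const[OF finite_measure_W] .
  have L: "(\<lambda>N. LINT w|W. f N w) \<longlonglongrightarrow> (LINT w|W. F w)" and Fi: "integrable W F"
    by (rule integral_dominated_convergence[OF Fm fm ci lim bd], rule integrable_dominated_convergence[OF Fm fm ci lim bd])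
  have "EC v \<in> U" using EC_U[OF v] by (simp add: Ust_def)
  then have "(\<lambda>N. \<Sum>\<alpha>\<in>SN p N. hh p H \<alpha> * monomial \<alpha> (EC v)) \<longlonglongrightarrow> ser p (hh p H) (EC v)"
    using p by (intro ser_tendsto hh_growth) auto
  moreover have "(\<lambda>N. \<Sum>\<alpha>\<in>SN p N. hh p H \<alpha> * monomial \<alpha> (EC v)) \<longlonglongrightarrow> of_real (1 / K0) * (LINT w|W. F w)"
    unfolding SN_psum[OF v] using L unfolding f_def by (intro tendsto_mult tendsto_const)
  ultimately have "ser p (hh p H) (EC v) = of_real (1 / K0) * (LINT w|W. F w)" by (rule LIMSEQ_unique)
  also have "\<dots> = (LINT w|W. of_real (1 / K0) * F w)" by (rule integral_mult_right_zero[symmetric])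
  finally have "ennreal (cmod (ser p (hh p H) (EC v))) \<le> (\<integral>\<^sup>+w. ennreal (cmod (of_real (1 / K0) * F w)) \<partial>W)"
    using integral_norm_bound_ennreal[of W "\<lambda>w. of_real (1 / K0) * F w"] Fi by simp
  also have "\<dots> \<le> (\<integral>\<^sup>+w. ennreal (ker p v w * cmod (H (EC w))) \<partial>W)"
  proof (rule nn_integral_mono, rule ennreal_leI)
    fix w assume "w \<in> space W"
    then have w: "w \<in> DD" by simp
    have "cmod (\<Prod>j\<in>UNIV. kap p j v w) / K0 \<le> ker p v w"
      unfolding ker_def prod_norm[symmetric] using K0_pos by (intro divide_right_mono prod_mono conjI kap_bound XXp[OF w]) auto
    from mult_right_mono[OF this norm_ge_zero[of "H (EC w)"]]
    show "cmod (of_real (1 / K0) * F w) \<le> ker p v w * cmod (H (EC w))"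
      using K0_pos by (simp add: F_def norm_mult norm_divide mult_ac)
  qed
  finally show ?thesis .
qed

lemma H_lpS: "lpS p V H"
proof -
  interpret V: finite_measure V by (rule finite_measure_V)
  have "lpI p V H \<le> (\<integral>\<^sup>+z. ennreal (\<bar>M\<bar> powr p) \<partial>V)"
    unfolding lpI_def
  proof (rule nn_integral_mono, rule ennreal_leI, rule powr_mono2)
    show "cmod (H z) \<le> \<bar>M\<bar>" if "z \<in> space V" for z using M[of z] that by force
  qed (use p in auto)
  also have "\<dots> < \<infinity>" by (simp add: ennreal_mult_eq_top_iff V.emeasure_finite less_top[symmetric])
  finally show ?thesis using H by (simp add: lpS_def)
qed

text \<open>The finiteness that Schur's test asks of the projected function comes from
  \<open>ser_lp\<close>, applicable because the function is cut off; the constant comes from the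
  kernel alone.\<close>

lemma projection_bound_aux:
  assumes q: "q = p / (p - 1)" and C: "C > 0"
    and s1: "\<And>w. w \<in> DD \<Longrightarrow> (\<integral>\<^sup>+v. ennreal (ker p v w * wgt (1 / (p * q)) v powr p) \<partial>W) \<le> ennreal (C * wgt (1 / (p * q)) w powr p)"
    and s2: "\<And>v. v \<in> DD \<Longrightarrow> (\<integral>\<^sup>+w. ennreal (ker p v w * wgt (1 / (p * q)) w powr q) \<partial>W) \<le> ennreal (C * wgt (1 / (p * q)) v powr q)"
  shows "ser p (hh p H) \<in> AA p" "lpN p V (ser p (hh p H)) \<le> C * lpN p V H"
proof -
  have q1: "q > 1" "1 / p + 1 / q = 1" using p by (simp_all add: q field_simps)
  have p1: "p \<ge> 1" "p > 0" using p by auto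
  define S where "S = ser p (hh p H)"
  have SS: "lpS p V S" unfolding S_def by (rule ser_lp(2)[OF p1(1) hh_summable[OF p m M supp]])
  have Sh: "holo_on S U" unfolding S_def by (rule ser_holo[OF p1(2) hh_growth])
  show "ser p (hh p H) \<in> AA p" using SS Sh by (simp add: AA_def lpS_def S_def)
  have eq: "lpI p V f = (\<integral>\<^sup>+w. ennreal (cmod (f (EC w)) powr p) \<partial>W)" if f: "f \<in> borel_measurable V" for f
    unfolding lpI_def by (rule nn_integral_V_W) (use f in measurable)
  have Sm: "S \<in> borel_measurable V" using SS by (simp add: lpS_def)
  have "lpI p V S \<le> ennreal (C powr p) * lpI p V H"
    unfolding eq[OF Sm] eq[OF H]
  proof (rule schur_test[where k="ker p" and \<theta>="wgt (1 / (p * q))" and q=q])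
    show "sigma_finite_measure W" using finite_measure_W by (rule finite_measure.axioms(1))
    have [measurable]: "(\<lambda>v. fst v $ j) \<in> borel_measurable W" "(\<lambda>v. snd v $ j) \<in> borel_measurable W" for j
      by (intro measurable_W_borel fst_nth_measurable snd_nth_measurable)+
    have [measurable]: "(\<lambda>x. fst (fst x) $ j) \<in> borel_measurable (W \<Otimes>\<^sub>M W)" for j
      by (rule measurable_compose[OF measurable_fst]) measurable
    have [measurable]: "(\<lambda>x. fst (snd x) $ j) \<in> borel_measurable (W \<Otimes>\<^sub>M W)" for j
      by (rule measurable_compose[OF measurable_snd]) measurable
    have [measurable]: "(\<lambda>x. snd (fst x) $ j) \<in> borel_measurable (W \<Otimes>\<^sub>M W)" for j
      by (rule measurable_compose[OF measurable_fst]) measurable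
    have [measurable]: "(\<lambda>x. snd (snd x) $ j) \<in> borel_measurable (W \<Otimes>\<^sub>M W)" for j
      by (rule measurable_compose[OF measurable_snd]) measurable
    show "(\<lambda>(v, w). ker p v w) \<in> borel_measurable (W \<Otimes>\<^sub>M W)"
      unfolding ker_def Om_def XX_def Complex_eq case_prod_unfold by measurable
    show "wgt (1 / (p * q)) \<in> borel_measurable W" unfolding wgt_def by measurable
    show "(\<lambda>w. cmod (H (EC w))) \<in> borel_measurable W" using H_EC by measurable
    show "(\<lambda>w. cmod (S (EC w))) \<in> borel_measurable W" using measurable_EC[OF Sm] by measurable
    show "ennreal (cmod (S (EC v))) \<le> (\<integral>\<^sup>+w. ennreal (ker p v w * cmod (H (EC w))) \<partial>W)" if "v \<in> space W" for v
      unfolding S_def by (rule ser_kernel) (use that in simp)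
    show "(\<integral>\<^sup>+w. ennreal (cmod (S (EC w)) powr p) \<partial>W) < \<infinity>" using SS eq[OF Sm] by (simp add: lpS_def)
    show "(\<integral>\<^sup>+w. ennreal (cmod (H (EC w)) powr p) \<partial>W) < \<infinity>" using H_lpS eq[OF H] by (simp add: lpS_def)
  qed (use p q1 C s1 s2 ker_nonneg wgt_pos in auto)
  also have "lpI p V H = ennreal (lpN p V H powr p)" by (rule lpI_eq) (use H_lpS p in \<open>auto simp: lpS_def\<close>)
  also have "ennreal (C powr p) * ennreal (lpN p V H powr p) = ennreal ((C * lpN p V H) powr p)"
    using C by (simp add: ennreal_mult[symmetric] powr_mult)
  finally show "lpN p V (ser p (hh p H)) \<le> C * lpN p V H" unfolding S_def[symmetric] using C p1 by (intro lpN_le) auto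
qed

end

text \<open>The order of the quantifiers matters: a single \<open>C\<close> for all cut-offs is what
  survives the exhaustion of \<open>U\<close> by the regions in \<open>dual_lp\<close>.\<close>

lemma projection_bound:
  assumes p: "p > 1"
  shows "\<exists>C>0. \<forall>m>0. \<forall>M H. H \<in> borel_measurable V \<longrightarrow> (\<forall>z\<in>U. cmod (H z) \<le> M) \<longrightarrow> (\<forall>z\<in>U. z \<notin> region m \<longrightarrow> H z = 0)
     \<longrightarrow> ser p (hh p H) \<in> AA p \<and> lpN p V (ser p (hh p H)) \<le> C * lpN p V H"
proof -
  define q where "q = p / (p - 1)"
  obtain C where C: "C > 0" "\<And>w. w \<in> DD \<Longrightarrow> (\<integral>\<^sup>+v. ennreal (ker p v w * wgt (1 / (p * q)) v powr p) \<partial>W) \<le> ennreal (C * wgt (1 / (p * q)) w powr p)"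
     "\<And>v. v \<in> DD \<Longrightarrow> (\<integral>\<^sup>+w. ennreal (ker p v w * wgt (1 / (p * q)) w powr q) \<partial>W) \<le> ennreal (C * wgt (1 / (p * q)) v powr q)"
    using ker_schur[OF p q_def] by blast
  show ?thesis
  proof (intro exI[of _ C] conjI allI impI C(1))
    fix m M :: real and H assume "m > 0" "H \<in> borel_measurable V" "\<forall>z\<in>U. cmod (H z) \<le> M" "\<forall>z\<in>U. z \<notin> region m \<longrightarrow> H z = 0"
    then have a: "m > 0" "H \<in> borel_measurable V" "\<And>z. z \<in> U \<Longrightarrow> cmod (H z) \<le> M" "\<And>z. z \<in> U \<Longrightarrow> z \<notin> region m \<Longrightarrow> H z = 0" by auto
    show "ser p (hh p H) \<in> AA p" by (rule projection_bound_aux(1)[OF p a q_def C])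
    show "lpN p V (ser p (hh p H)) \<le> C * lpN p V H" by (rule projection_bound_aux(2)[OF p a q_def C])
  qed
qed

end

section \<open>Representation of functionals\<close>

context polyhedron begin

lemma twist_holo_measurable: "p > 1 \<Longrightarrow> holo_on g U \<Longrightarrow> (\<lambda>z. g (twist p z)) \<in> borel_measurable V"
  using measurable_compose[OF twist_measurable_V holo_V] .

context
  fixes p q K C :: real and \<phi> :: "(complex^'n \<Rightarrow> complex) \<Rightarrow> complex" and a :: "('n \<Rightarrow> int) \<Rightarrow> complex"
  assumes p: "p > 1" and q: "q = p / (p - 1)" and K: "K \<ge> 0" and C: "C > 0"
    and add: "\<And>f g. f \<in> AA p \<Longrightarrow> g \<in> AA p \<Longrightarrow> \<phi> (\<lambda>z. f z + g z) = \<phi> f + \<phi> g"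
    and cmul: "\<And>f c. f \<in> AA p \<Longrightarrow> \<phi> (\<lambda>z. c * f z) = c * \<phi> f"
    and bd: "\<And>f. f \<in> AA p \<Longrightarrow> cmod (\<phi> f) \<le> K * lpN p V f"
    and a_eq: "\<And>\<alpha>. a \<alpha> = cnj (\<phi> (monomial \<alpha>)) * of_real (NN p \<alpha> / K0)"
    and proj: "\<And>m M H. m > 0 \<Longrightarrow> H \<in> borel_measurable V \<Longrightarrow> (\<forall>z\<in>U. cmod (H z) \<le> M) \<Longrightarrow> (\<forall>z\<in>U. z \<notin> region m \<longrightarrow> H z = 0)
     \<Longrightarrow> ser p (hh p H) \<in> AA p \<and> lpN p V (ser p (hh p H)) \<le> C * lpN p V H"
begin

lemma pq: "q > 1" "1 / p + 1 / q = 1" "p > 0" "p \<ge> 1" "(q - 1) * p = q" "q > 0"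
  using p by (simp_all add: q field_simps)

text \<open>The coefficients \<open>a\<close> are the ones that \<open>pair_monomial\<close> forces
  on a representing function. Boundedness of \<open>\<phi>\<close> on a monomial gives a power -1 /
  p of \<open>NN\<close>, and the factor \<open>NN p \<alpha> / K0\<close> raises it to 1 - 1 /
  p.\<close>

lemma a_growth: "growth p a"
proof (rule growth_powr)
  show "p > 0" "0 \<le> 1 - 1 / p" "1 - 1 / p \<le> 1" using p by simp_all
  show "K * K0 powr (1 / p - 1) + 1 > 0" using K by (simp add: add_nonneg_pos)
  fix \<alpha> assume \<alpha>: "\<alpha> \<in> SS p"
  have N: "NN p \<alpha> > 0" by (rule NN_pos[OF pq(3) \<alpha>])
  have "cmod (\<phi> (monomial \<alpha>)) \<le> K * (K0 / NN p \<alpha>) powr (1 / p)"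
    using bd[OF AA_monomial[OF pq(3) \<alpha>]] by (simp add: lpN_monomial[OF pq(3) \<alpha>])
  then have "cmod (a \<alpha>) \<le> K * (K0 / NN p \<alpha>) powr (1 / p) * (NN p \<alpha> / K0)"
    unfolding a_eq norm_mult using N K0_pos K by (intro mult_mono) (auto simp: norm_divide)
  also have "\<dots> = K * K0 powr (1 / p - 1) * NN p \<alpha> powr (1 - 1 / p)"
    using N K0_pos by (simp add: powr_divide powr_diff mult_ac)
  also have "\<dots> \<le> (K * K0 powr (1 / p - 1) + 1) * NN p \<alpha> powr (1 - 1 / p)" by (intro mult_right_mono) auto
  finally show "cmod (a \<alpha>) \<le> (K * K0 powr (1 / p - 1) + 1) * NN p \<alpha> powr (1 - 1 / p)" .
qed

text \<open>The integral I of |G|^q over the region is the pairing of \<open>G\<close> with its dual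
  function \<open>H\<close>, and up to conjugation this is \<open>\<phi>\<close> of the projection
  of \<open>H\<close>; boundedness gives I \<le> K C I^(1/p). I is finite because \<open>G\<close>
  is bounded on the region.\<close>

lemma region_estimate:
  assumes m: "m > 0"
  shows "lpI q V (\<lambda>z. indicator (region m) z *\<^sub>R ser p a (twist p z)) \<le> ennreal ((K * C) powr q)"
proof -
  interpret V: finite_measure V by (rule finite_measure_V)
  define G where "G = (\<lambda>z. ser p a (twist p z))"
  have Gm[measurable]: "G \<in> borel_measurable V" unfolding G_def by (rule twist_holo_measurable[OF p ser_holo[OF pq(3) a_growth]])
  obtain \<delta> C' where \<delta>: "\<delta> > 0" "C' \<ge> 0" and C': "\<And>\<alpha> z. \<alpha> \<in> SS p \<Longrightarrow> z \<in> region m \<Longrightarrow> cmod (monomial \<alpha> (twist p z)) \<le> C' * dec p \<delta> \<alpha>"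
    using region_twist_bound[OF p m] by blast
  obtain t where t: "t summable_on SS p" "\<And>\<alpha> z. \<alpha> \<in> SS p \<Longrightarrow> cmod (monomial \<alpha> z) \<le> C' * dec p \<delta> \<alpha> \<Longrightarrow> cmod (a \<alpha> * monomial \<alpha> z) \<le> t \<alpha>"
    using growth_bound[OF pq(3) a_growth \<delta>] by blast
  define T where "T = \<bar>infsum t (SS p)\<bar>"
  have tb: "cmod (a \<alpha> * monomial \<alpha> (twist p z)) \<le> t \<alpha>" if "z \<in> region m" "\<alpha> \<in> SS p" for z \<alpha>
    by (rule t(2)[OF that(2) C'[OF that(2,1)]])
  have GT: "cmod (G z) \<le> T" if z: "z \<in> region m" for z
    using norm_infsum_diff_le(2)[where F="{}", OF t(1) tb[OF z]] by (simp add: G_def ser_def T_def)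
  have PT: "cmod (\<Sum>\<alpha>\<in>SN p N. a \<alpha> * monomial \<alpha> (twist p z)) \<le> T" if z: "z \<in> region m" for z N
  proof -
    have "cmod (\<Sum>\<alpha>\<in>SN p N. a \<alpha> * monomial \<alpha> (twist p z)) \<le> (\<Sum>\<alpha>\<in>SN p N. t \<alpha>)"
      by (rule sum_norm_le) (use tb[OF z] SN_subset in auto)
    also have "\<dots> \<le> infsum t (SS p)"
      by (rule finite_sum_le_infsum[OF t(1) finite_SN SN_subset]) (use tb[OF z] in \<open>auto intro: order_trans[OF norm_ge_zero]\<close>)
    finally show ?thesis by (simp add: T_def)
  qed
  have indm[measurable]: "(indicator (region m) :: complex^'n \<Rightarrow> real) \<in> borel_measurable V"
    by (rule measurable_V_borel) (rule borel_measurable_indicator[OF region_sets])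
  \<comment> \<open>The extremal function of Hoelder's inequality on the region: there |H|^p and G
    cnj H both equal |G|^q, the former because (q - 1) p = q.\<close>
  define H where "H = (\<lambda>z. indicator (region m) z *\<^sub>R (of_real (cmod (G z) powr (q - 2)) * G z))"
  have Hm[measurable]: "H \<in> borel_measurable V" unfolding H_def by measurable
  have nH: "cmod (H z) = indicator (region m) z * cmod (G z) powr (q - 1)" for z
    using powr_mult_base[of "cmod (G z)" "q - 2"] by (simp add: H_def norm_mult mult.commute)
  have Hb: "cmod (H z) \<le> T powr (q - 1)" for z
    using GT[of z] pq(1) by (cases "z \<in> region m") (auto simp: nH intro!: powr_mono2)
  note pr = proj[OF m Hm, of "T powr (q - 1)"]
  have S: "ser p (hh p H) \<in> AA p" "lpN p V (ser p (hh p H)) \<le> C * lpN p V H"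
    using pr Hb by (auto simp: H_def)
  have sm: "(\<lambda>\<alpha>. cmod (hh p H \<alpha>) * lpN p V (monomial \<alpha>)) summable_on SS p"
    by (rule hh_summable[OF p m, of H "T powr (q - 1)"]) (use Hb in \<open>auto simp: H_def\<close>)
  define R where "R = (\<lambda>z. indicator (region m) z * cmod (G z) powr q)"
  have Rm[measurable]: "R \<in> borel_measurable V" unfolding R_def by measurable
  have R0: "R z \<ge> 0" for z by (simp add: R_def)
  have Rb: "R z \<le> T powr q" for z
    using GT[of z] pq(6) by (cases "z \<in> region m") (auto simp: R_def intro!: powr_mono2)
  have Ri: "integrable V R" by (rule V.integrable_const_bound[where B="T powr q"]) (use R0 Rb in auto)
  define I where "I = (LINT z|V. R z)"
  have I0: "I \<ge> 0" unfolding I_def using R0 by (rule Bochner_Integration.integral_nonneg)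
  have IR: "(\<integral>\<^sup>+z. ennreal (R z) \<partial>V) = ennreal I" unfolding I_def by (rule nn_integral_eq_integral[OF Ri]) (use R0 in auto)
  have "lpI p V H = ennreal I" unfolding IR[symmetric] lpI_def
    by (rule nn_integral_cong) (use p in \<open>auto simp: nH R_def powr_powr pq(5) indicator_def\<close>)
  then have HN: "lpN p V H = I powr (1 / p)" using I0 by (simp add: lpN_def)
  have GH: "G z * cnj (H z) = of_real (R z)" for z
  proof (cases "z \<in> region m \<and> G z \<noteq> 0")
    case True
    have "G z * cnj (H z) = of_real (cmod (G z) powr (q - 2)) * (G z * cnj (G z))" using True by (simp add: H_def mult_ac)
    also have "G z * cnj (G z) = of_real ((cmod (G z))\<^sup>2)" using complex_norm_square[of "G z"] by simp
    also have "of_real (cmod (G z) powr (q - 2)) * \<dots> = of_real (cmod (G z) powr (q - 2) * (cmod (G z))\<^sup>2)" by simp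
    also have "cmod (G z) powr (q - 2) * (cmod (G z))\<^sup>2 = cmod (G z) powr q"
      using True by (simp add: powr_diff powr_numeral)
    finally show ?thesis using True by (simp add: R_def)
  qed (use pq in \<open>auto simp: H_def R_def\<close>)
  \<comment> \<open>Term by term the integral of \<open>P N\<close> is the conjugate of
    \<open>hh p H \<alpha> * \<phi> (monomial \<alpha>)\<close>: the factor
    \<open>NN p \<alpha> / K0\<close> passes from \<open>a \<alpha>\<close> to the coefficient of
    the projection. A partial sum of \<open>G\<close> thus becomes \<open>\<phi>\<close> of a
    partial sum of the projection of \<open>H\<close>.\<close>
  define P where "P = (\<lambda>N z. (\<Sum>\<alpha>\<in>SN p N. a \<alpha> * monomial \<alpha> (twist p z)) * cnj (H z))"
  note monomial_twist_measurable[measurable]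
  have "(\<lambda>N. LINT z|V. P N z) \<longlonglongrightarrow> (LINT z|V. G z * cnj (H z))"
  proof (rule integral_dominated_convergence)
    show "(\<lambda>z. G z * cnj (H z)) \<in> borel_measurable V" by measurable
    show "P N \<in> borel_measurable V" for N unfolding P_def by measurable
    show "integrable V (\<lambda>_. T * T powr (q - 1))" by simp
    show "AE z in V. (\<lambda>N. P N z) \<longlonglongrightarrow> G z * cnj (H z)"
      unfolding P_def G_def by (intro AE_I2 tendsto_mult tendsto_const ser_tendsto pq a_growth) (simp add: twist_U p)
    show "AE z in V. cmod (P N z) \<le> T * T powr (q - 1)" for N
    proof (rule AE_I2)
      fix z
      show "cmod (P N z) \<le> T * T powr (q - 1)"
      proof (cases "z \<in> region m")
        case True
        show ?thesis unfolding P_def norm_mult complex_mod_cnj by (intro mult_mono PT[OF True] Hb) (auto simp: T_def)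
      qed (simp add: P_def H_def T_def)
    qed
  qed
  also have "(LINT z|V. G z * cnj (H z)) = of_real I" unfolding GH I_def by simp
  finally have l1: "(\<lambda>N. LINT z|V. P N z) \<longlonglongrightarrow> of_real I" .
  have PN: "(LINT z|V. P N z) = cnj (\<phi> (\<lambda>z. \<Sum>\<alpha>\<in>SN p N. hh p H \<alpha> * monomial \<alpha> z))" for N
  proof -
    have int: "integrable V (\<lambda>z. a \<alpha> * (monomial \<alpha> (twist p z) * cnj (H z)))" if \<alpha>: "\<alpha> \<in> SS p" for \<alpha>
    proof (rule V.integrable_const_bound[where B="cmod (a \<alpha>) * (C' * dec p \<delta> \<alpha> * T powr (q - 1))"], rule AE_I2)
      fix z
      have "cmod (monomial \<alpha> (twist p z) * cnj (H z)) \<le> C' * dec p \<delta> \<alpha> * T powr (q - 1)"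
      proof (cases "z \<in> region m")
        case True
        show ?thesis unfolding norm_mult complex_mod_cnj using \<delta> dec_pos[of p \<delta> \<alpha>]
          by (intro mult_mono C'[OF \<alpha> True] Hb) auto
      qed (use \<delta> dec_pos[of p \<delta> \<alpha>] in \<open>simp add: H_def\<close>)
      then show "cmod (a \<alpha> * (monomial \<alpha> (twist p z) * cnj (H z))) \<le> cmod (a \<alpha>) * (C' * dec p \<delta> \<alpha> * T powr (q - 1))"
        unfolding norm_mult[of "a \<alpha>"] by (intro mult_left_mono) auto
    qed measurable
    have "(LINT z|V. P N z) = (LINT z|V. (\<Sum>\<alpha>\<in>SN p N. a \<alpha> * (monomial \<alpha> (twist p z) * cnj (H z))))"
      unfolding P_def sum_distrib_right mult.assoc ..
    also have "\<dots> = (\<Sum>\<alpha>\<in>SN p N. LINT z|V. a \<alpha> * (monomial \<alpha> (twist p z) * cnj (H z)))"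
      by (rule Bochner_Integration.integral_sum) (use int SN_subset in blast)
    also have "\<dots> = (\<Sum>\<alpha>\<in>SN p N. cnj (hh p H \<alpha> * \<phi> (monomial \<alpha>)))"
    proof (rule sum.cong)
      fix \<alpha>
      have "(LINT z|V. a \<alpha> * (monomial \<alpha> (twist p z) * cnj (H z))) = a \<alpha> * (LINT z|V. monomial \<alpha> (twist p z) * cnj (H z))"
        by (rule integral_mult_right_zero)
      also have "(LINT z|V. monomial \<alpha> (twist p z) * cnj (H z)) = (LINT z|V. cnj (H z * cnj (monomial \<alpha> (twist p z))))"
        by (simp only: complex_cnj_mult complex_cnj_cnj mult.commute)
      also have "\<dots> = cnj (LINT z|V. H z * cnj (monomial \<alpha> (twist p z)))" by (rule Bochner_Integration.integral_cnj)
      finally show "(LINT z|V. a \<alpha> * (monomial \<alpha> (twist p z) * cnj (H z))) = cnj (hh p H \<alpha> * \<phi> (monomial \<alpha>))"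
        unfolding a_eq hh_def by (simp only: complex_cnj_mult complex_cnj_complex_of_real mult_ac)
    qed simp
    also have "\<dots> = cnj (\<Sum>\<alpha>\<in>SN p N. hh p H \<alpha> * \<phi> (monomial \<alpha>))" by (rule cnj_sum[symmetric])
    also have "(\<Sum>\<alpha>\<in>SN p N. hh p H \<alpha> * \<phi> (monomial \<alpha>)) = \<phi> (\<lambda>z. \<Sum>\<alpha>\<in>SN p N. hh p H \<alpha> * monomial \<alpha> z)"
      by (rule functional_sum[where \<phi>=\<phi>, OF pq(4) add cmul finite_SN SN_subset, symmetric])
    finally show ?thesis .
  qed
  have "(\<lambda>N. \<phi> (\<lambda>z. \<Sum>\<alpha>\<in>SN p N. hh p H \<alpha> * monomial \<alpha> z)) \<longlonglongrightarrow> \<phi> (ser p (hh p H))"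
  proof (rule LIM_zero_cancel, rule Lim_null_comparison)
    have "(\<lambda>N. K * lpN p V (\<lambda>z. ser p (hh p H) z - (\<Sum>\<alpha>\<in>SN p N. hh p H \<alpha> * monomial \<alpha> z))) \<longlonglongrightarrow> K * 0"
      by (intro tendsto_mult tendsto_const ser_lp(3)[OF pq(4) sm])
    then show "(\<lambda>N. K * lpN p V (\<lambda>z. ser p (hh p H) z - (\<Sum>\<alpha>\<in>SN p N. hh p H \<alpha> * monomial \<alpha> z))) \<longlonglongrightarrow> 0" by simp
    show "\<forall>\<^sub>F N in sequentially. norm (\<phi> (\<lambda>z. \<Sum>\<alpha>\<in>SN p N. hh p H \<alpha> * monomial \<alpha> z) - \<phi> (ser p (hh p H)))
       \<le> K * lpN p V (\<lambda>z. ser p (hh p H) z - (\<Sum>\<alpha>\<in>SN p N. hh p H \<alpha> * monomial \<alpha> z))"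
    proof (rule always_eventually, rule allI)
      fix N
      define h where "h = (\<lambda>z. \<Sum>\<alpha>\<in>SN p N. hh p H \<alpha> * monomial \<alpha> z)"
      have h: "h \<in> AA p" unfolding h_def by (rule AA_sum[OF pq(4) finite_SN SN_subset])
      have "\<phi> (\<lambda>z. ser p (hh p H) z + - 1 * h z) = \<phi> (ser p (hh p H)) + - 1 * \<phi> h"
        by (subst add[OF S(1) AA_cmul[OF pq(3) h]]) (simp only: cmul[OF h])
      moreover have "(\<lambda>z. ser p (hh p H) z + - 1 * h z) \<in> AA p" by (intro AA_add AA_cmul S(1) h pq)
      ultimately have "cmod (\<phi> (ser p (hh p H)) - \<phi> h) \<le> K * lpN p V (\<lambda>z. ser p (hh p H) z - h z)" using bd by fastforce
      then show "norm (\<phi> (\<lambda>z. \<Sum>\<alpha>\<in>SN p N. hh p H \<alpha> * monomial \<alpha> z) - \<phi> (ser p (hh p H)))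
       \<le> K * lpN p V (\<lambda>z. ser p (hh p H) z - (\<Sum>\<alpha>\<in>SN p N. hh p H \<alpha> * monomial \<alpha> z))"
        unfolding h_def by (simp add: norm_minus_commute)
    qed
  qed
  then have "(\<lambda>N. LINT z|V. P N z) \<longlonglongrightarrow> cnj (\<phi> (ser p (hh p H)))" unfolding PN by (rule tendsto_cnj)
  from LIMSEQ_unique[OF l1 this] have "of_real I = cnj (\<phi> (ser p (hh p H)))" .
  then have "cmod (of_real I) = cmod (\<phi> (ser p (hh p H)))" by (simp only: complex_mod_cnj)
  then have "I = cmod (\<phi> (ser p (hh p H)))" using I0 by simp
  also have "\<dots> \<le> K * lpN p V (ser p (hh p H))" by (rule bd[OF S(1)])
  also have "\<dots> \<le> K * (C * lpN p V H)" by (intro mult_left_mono S K)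
  finally have le: "I \<le> K * C * I powr (1 / p)" by (simp add: HN mult.assoc)
  have "I \<le> (K * C) powr q"
  \<comment> \<open>For positive finite I, division by I^(1/p) leaves I^(1/q) \<le> K C.\<close>
  proof (cases "I = 0")
    case False
    then have Ip: "I > 0" using I0 by simp
    have "I = I powr (1 / q) * I powr (1 / p)" using Ip pq(2) by (simp add: powr_add[symmetric] add.commute)
    then have "I powr (1 / q) * I powr (1 / p) \<le> K * C * I powr (1 / p)" using le by simp
    then have "I powr (1 / q) \<le> K * C" using Ip by simp
    then have "(I powr (1 / q)) powr q \<le> (K * C) powr q" using pq(6) by (intro powr_mono2) auto
    then show ?thesis using Ip pq(6) by (simp add: powr_powr)
  qed simp
  moreover have "lpI q V (\<lambda>z. indicator (region m) z *\<^sub>R ser p a (twist p z)) = ennreal I" unfolding IR[symmetric] lpI_def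
    by (rule nn_integral_cong) (use pq in \<open>auto simp: R_def G_def indicator_def\<close>)
  ultimately show ?thesis by (simp add: ennreal_leI)
qed

text \<open>The regions exhaust \<open>Ust\<close>, almost all of \<open>U\<close>, and the estimate
  on them does not depend on the region, so Fatou's lemma removes the cut-off.\<close>

lemma dual_lp: "lpS q V (\<lambda>z. ser p a (twist p z))" "lpN q V (\<lambda>z. ser p a (twist p z)) \<le> K * C"
proof -
  define G where "G = (\<lambda>z. ser p a (twist p z))"
  have Gm: "G \<in> borel_measurable V" unfolding G_def by (rule twist_holo_measurable[OF p ser_holo[OF pq(3) a_growth]])
  have im: "(\<lambda>z. indicator X z *\<^sub>R G z) \<in> borel_measurable V" if "X \<in> sets borel" for X
    using measurable_V_borel[OF borel_measurable_indicator[OF that, where 'b=real]] Gm by measurable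
  have lim: "(\<lambda>n. indicator (region (real (Suc n))) z *\<^sub>R G z) \<longlonglongrightarrow> indicator Ust z *\<^sub>R G z" for z
  proof (cases "z \<in> Ust")
    case True
    have "\<forall>\<^sub>F n in sequentially. z \<in> region (real (Suc n))"
      using region_exhaust[OF True] by (subst eventually_sequentially_Suc)
    then show ?thesis using True by (intro tendsto_eventually) (auto elim!: eventually_mono)
  next
    case False
    then have "z \<notin> region r" for r by (simp add: region_def)
    then show ?thesis using False by simp
  qed
  note F = lp_fatou[of q "\<lambda>n z. indicator (region (real (Suc n))) z *\<^sub>R G z" V "\<lambda>z. indicator Ust z *\<^sub>R G z" "K * C"]
  have c: "lpI q V (\<lambda>z. indicator (region (real (Suc n))) z *\<^sub>R G z) \<le> ennreal ((K * C) powr q)" for n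
    unfolding G_def by (rule region_estimate) simp
  have KC: "0 \<le> K * C" using K C by simp
  have ae: "AE z in V. indicator Ust z *\<^sub>R G z = G z" using AE_V by eventually_elim simp
  have "lpS q V (\<lambda>z. indicator Ust z *\<^sub>R G z)" "lpN q V (\<lambda>z. indicator Ust z *\<^sub>R G z) \<le> K * C"
    by (rule F[OF pq(6) im[OF region_sets] im[OF Ust_sets] lim KC c])+
  then show "lpS q V (\<lambda>z. ser p a (twist p z))" "lpN q V (\<lambda>z. ser p a (twist p z)) \<le> K * C"
    using Gm unfolding G_def[symmetric] lpS_def lpI_cong_AE[OF ae] lpN_cong_AE[OF ae] by auto
qed

text \<open>The difference \<Delta> of the functional and the pairing is bounded, since
  \<open>G\<close> is now known to be in L^q, and it vanishes on monomials because
  \<open>lc_ser\<close> returns the coefficients \<open>a\<close>.\<close>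

lemma dual_pair:
  assumes f: "f \<in> AA p"
  shows "\<phi> f = (LINT z|V. f z * cnj (ser p a (twist p z)))"
proof -
  define G where "G = (\<lambda>z. ser p a (twist p z))"
  have GS: "lpS q V G" unfolding G_def by (rule dual_lp)
  have gi: "integrable V (\<lambda>z. f z * cnj (G z))" "cmod (LINT z|V. f z * cnj (G z)) \<le> lpN p V f * lpN q V G" if "f \<in> AA p" for f
    using hoelder_integral[OF p pq(1,2) AA_lpS[OF that] GS] by auto
  define \<Delta> where "\<Delta> = (\<lambda>f. \<phi> f - (LINT z|V. f z * cnj (G z)))"
  have "\<Delta> f = 0"
  proof (rule functional_ext[where \<phi>=\<Delta> and K="K + lpN q V G", OF p _ _ _ _ f])
    fix f g assume fg: "f \<in> AA p" "g \<in> AA p"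
    show "\<Delta> (\<lambda>z. f z + g z) = \<Delta> f + \<Delta> g"
      by (simp add: \<Delta>_def add fg distrib_right Bochner_Integration.integral_add gi)
  next
    fix f c assume f: "f \<in> AA p"
    show "\<Delta> (\<lambda>z. c * f z) = c * \<Delta> f" by (simp add: \<Delta>_def cmul f mult.assoc right_diff_distrib)
  next
    fix f assume f: "f \<in> AA p"
    have "cmod (\<Delta> f) \<le> cmod (\<phi> f) + cmod (LINT z|V. f z * cnj (G z))" unfolding \<Delta>_def by (rule norm_triangle_ineq4)
    also have "\<dots> \<le> K * lpN p V f + lpN p V f * lpN q V G" by (intro add_mono bd gi f)
    finally show "cmod (\<Delta> f) \<le> (K + lpN q V G) * lpN p V f" by (simp add: algebra_simps)
  next
    fix \<alpha> assume \<alpha>: "\<alpha> \<in> SS p"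
    have "(LINT z|V. monomial \<alpha> z * cnj (G z)) = cnj (a \<alpha>) * of_real (K0 / NN p \<alpha>)"
      unfolding G_def pair_monomial[OF p q ser_holo[OF pq(3) a_growth] dual_lp(1) \<alpha>] lc_ser[OF pq(3) a_growth \<alpha>] ..
    also have "\<dots> = \<phi> (monomial \<alpha>)" using NN_pos[OF pq(3) \<alpha>] K0_pos by (simp add: a_eq)
    finally show "\<Delta> (monomial \<alpha>) = 0" by (simp add: \<Delta>_def)
  qed
  then show ?thesis by (simp add: \<Delta>_def G_def)
qed

end

text \<open>Pairings with monomials determine the Laurent coefficients with index in
  \<open>SS p\<close>; the others vanish by \<open>lc_zero_twist\<close>, so the difference has no
  Laurent coefficient left.\<close>

lemma pair_inj:
  assumes p: "p > 1" and q: "q = p / (p - 1)"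
    and g1: "holo_on g1 U" "lpS q V (\<lambda>z. g1 (twist p z))" and g2: "holo_on g2 U" "lpS q V (\<lambda>z. g2 (twist p z))"
    and eq: "\<And>\<alpha>. \<alpha> \<in> SS p \<Longrightarrow> (LINT z|V. monomial \<alpha> z * cnj (g1 (twist p z))) = (LINT z|V. monomial \<alpha> z * cnj (g2 (twist p z)))"
    and z: "z \<in> U"
  shows "g1 z = g2 z"
proof -
  have q1: "q > 1" "1 / p + 1 / q = 1" using p by (simp_all add: q field_simps)
  have p0: "p > 0" using p by simp
  define D where "D = (\<lambda>z. g1 z + - 1 * g2 z)"
  have Dh: "holo_on D U" unfolding D_def by (intro holo_on_add holo_on_cmul g1 g2)
  have DS: "lpS q V (\<lambda>z. D (twist p z))" unfolding D_def by (intro minkowski lp_cmul g1 g2) (use q1 in auto)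
  have "lc D \<alpha> = 0" for \<alpha>
  proof (cases "\<alpha> \<in> SS p")
    case True
    note hi = hoelder_integral(1)[OF p q1 lpS_monomial[OF p0 True]]
    have "cnj (lc D \<alpha>) * of_real (K0 / NN p \<alpha>) = (LINT z|V. monomial \<alpha> z * cnj (g1 (twist p z)) - monomial \<alpha> z * cnj (g2 (twist p z)))"
      unfolding pair_monomial[OF p q Dh DS True, symmetric]
      by (rule Bochner_Integration.integral_cong) (simp_all add: D_def right_diff_distrib)
    also have "\<dots> = 0" by (subst Bochner_Integration.integral_diff[OF hi[OF g1(2)] hi[OF g2(2)]]) (simp add: eq[OF True])
    finally show ?thesis using NN_pos[OF p0 True] K0_pos by simp
  next
    case False
    show ?thesis by (rule lc_zero_twist[OF p q Dh _ False]) (use DS in \<open>simp add: lpS_def\<close>)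
  qed
  from holo_eq_zero[OF Dh this z] show ?thesis by (simp add: D_def)
qed

text \<open>\<open>C\<close> is the same for all functionals, which is what yields the comparison of
  norms and not only surjectivity.\<close>

lemma dual_rep:
  assumes p: "p > 1" and q: "q = p / (p - 1)"
  shows "\<exists>C>0. \<forall>K\<ge>0. \<forall>\<phi>. (\<forall>f\<in>AA p. \<forall>g\<in>AA p. \<phi> (\<lambda>z. f z + g z) = \<phi> f + \<phi> g) \<longrightarrow> (\<forall>f\<in>AA p. \<forall>c. \<phi> (\<lambda>z. c * f z) = c * \<phi> f)
     \<longrightarrow> (\<forall>f\<in>AA p. cmod (\<phi> f) \<le> K * lpN p V f) \<longrightarrow>
     (\<exists>g. holo_on g U \<and> lpS q V (\<lambda>z. g (twist p z)) \<and> lpN q V (\<lambda>z. g (twist p z)) \<le> K * C \<and>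
        (\<forall>f\<in>AA p. \<phi> f = (LINT z|V. f z * cnj (g (twist p z)))))"
proof -
  have p0: "p > 0" using p by simp
  obtain C where C: "C > 0" and pr: "\<And>m M H. m > 0 \<Longrightarrow> H \<in> borel_measurable V \<Longrightarrow> (\<forall>z\<in>U. cmod (H z) \<le> M) \<Longrightarrow> (\<forall>z\<in>U. z \<notin> region m \<longrightarrow> H z = 0)
     \<Longrightarrow> ser p (hh p H) \<in> AA p \<and> lpN p V (ser p (hh p H)) \<le> C * lpN p V H"
    using projection_bound[OF p] by blast
  show ?thesis
  proof (intro exI[of _ C] conjI allI impI C)
    fix K :: real and \<phi> :: "(complex^'n \<Rightarrow> complex) \<Rightarrow> complex"
    assume K: "0 \<le> K" and "\<forall>f\<in>AA p. \<forall>g\<in>AA p. \<phi> (\<lambda>z. f z + g z) = \<phi> f + \<phi> g" "\<forall>f\<in>AA p. \<forall>c. \<phi> (\<lambda>z. c * f z) = c * \<phi> f"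
      "\<forall>f\<in>AA p. cmod (\<phi> f) \<le> K * lpN p V f"
    then have h: "\<And>f g. f \<in> AA p \<Longrightarrow> g \<in> AA p \<Longrightarrow> \<phi> (\<lambda>z. f z + g z) = \<phi> f + \<phi> g" "\<And>f c. f \<in> AA p \<Longrightarrow> \<phi> (\<lambda>z. c * f z) = c * \<phi> f"
      "\<And>f. f \<in> AA p \<Longrightarrow> cmod (\<phi> f) \<le> K * lpN p V f" by auto
    define a where "a = (\<lambda>\<alpha>. cnj (\<phi> (monomial \<alpha>)) * of_real (NN p \<alpha> / K0))"
    have a: "a \<alpha> = cnj (\<phi> (monomial \<alpha>)) * of_real (NN p \<alpha> / K0)" for \<alpha> by (simp add: a_def)
    note asm = p q K C h a pr
    show "\<exists>g. holo_on g U \<and> lpS q V (\<lambda>z. g (twist p z)) \<and> lpN q V (\<lambda>z. g (twist p z)) \<le> K * C \<and>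
        (\<forall>f\<in>AA p. \<phi> f = (LINT z|V. f z * cnj (g (twist p z))))"
      using ser_holo[OF p0 a_growth[where \<phi>=\<phi>, OF asm]] dual_lp[where \<phi>=\<phi>, OF asm] dual_pair[where \<phi>=\<phi>, OF asm]
      by (intro exI[of _ "ser p a"] conjI ballI)
  qed
qed

end

section \<open>The duality theorem\<close>

text \<open>Cramer's rule expresses the inverse by determinants of integer matrices divided by the
  determinant; multiplication clears the denominator, and its sign is moved into \<open>B\<close> so
  that \<open>d\<close> is positive.\<close>

lemma ex_int_inverse:
  fixes \<alpha> :: "'n::finite \<Rightarrow> 'n \<Rightarrow> int"
  assumes det: "det (exponent_matrix \<alpha>) \<noteq> 0"
  shows "\<exists>B d. d > 0 \<and> (\<forall>j k. (\<Sum>i\<in>UNIV. \<alpha> j i * B i k) = (if j = k then d else 0))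
     \<and> (\<forall>i k. (\<Sum>j\<in>UNIV. B i j * \<alpha> j k) = (if i = k then d else 0))"
proof -
  define M where "M = exponent_matrix \<alpha>"
  have M: "M $ j $ i = of_int (\<alpha> j i)" for i j by (simp add: M_def exponent_matrix_def)
  have Ints_det: "det N \<in> \<int>" if "\<And>i j. N $ i $ j \<in> \<int>" for N :: "real^'n^'n"
    unfolding det_def using that by (intro Ints_sum Ints_mult Ints_prod) auto
  define D where "D = det M"
  have D: "D \<noteq> 0" using det by (simp add: D_def M_def)
  define X :: "'n \<Rightarrow> 'n \<Rightarrow> real" where "X = (\<lambda>k l. det (\<chi> i j. if j = k then axis l 1 $ i else M $ i $ j))"
  have "X k l \<in> \<int>" for k l unfolding X_def by (rule Ints_det) (auto simp: M axis_def)
  then have "\<forall>k l. \<exists>b. X k l = of_int b" by (meson Ints_cases)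
  then obtain b where b: "\<And>k l. X k l = of_int (b k l)" by metis
  have "D \<in> \<int>" unfolding D_def by (rule Ints_det) (simp add: M)
  then obtain e :: int where e: "D = of_int e" by (meson Ints_cases)
  define Y :: "real^'n^'n" where "Y = (\<chi> k l. X k l / D)"
  have "M *v (\<chi> k. X k l / D) = axis l 1" for l
    using cramer[OF det, folded M_def D_def, of "\<chi> k. X k l / D" "axis l 1"] by (simp add: X_def)
  then have MY: "(\<Sum>i\<in>UNIV. M $ j $ i * (X i l / D)) = (if j = l then 1 else 0)" for j l
    by (simp add: vec_eq_iff matrix_vector_mult_def axis_def)
  then have "M ** Y = mat 1" by (simp add: Y_def vec_eq_iff matrix_matrix_mult_def mat_def)
  then have "Y ** M = mat 1" by (simp add: matrix_left_right_inverse)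
  then have YM: "(\<Sum>j\<in>UNIV. X i j / D * M $ j $ k) = (if i = k then 1 else 0)" for i k
    by (simp add: Y_def vec_eq_iff matrix_matrix_mult_def mat_def)
  define B where "B = (\<lambda>i k. sgn e * b i k)"
  have e0: "e \<noteq> 0" using D e by auto
  have sg: "sgn e * e = \<bar>e\<bar>" by (simp add: abs_sgn mult.commute)
  have 1: "(\<Sum>i\<in>UNIV. \<alpha> j i * B i k) = (if j = k then \<bar>e\<bar> else 0)" for j k
  proof -
    have "real_of_int (\<Sum>i\<in>UNIV. \<alpha> j i * B i k) = of_int (sgn e) * D * (\<Sum>i\<in>UNIV. M $ j $ i * (X i k / D))"
      using D by (simp add: B_def M b sum_distrib_left mult_ac)
    also have "\<dots> = of_int (if j = k then \<bar>e\<bar> else 0)" unfolding MY using arg_cong[OF sg, of real_of_int] by (simp add: e)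
    finally show ?thesis by (simp only: of_int_eq_iff)
  qed
  have 2: "(\<Sum>j\<in>UNIV. B i j * \<alpha> j k) = (if i = k then \<bar>e\<bar> else 0)" for i k
  proof -
    have "real_of_int (\<Sum>j\<in>UNIV. B i j * \<alpha> j k) = of_int (sgn e) * D * (\<Sum>j\<in>UNIV. X i j / D * M $ j $ k)"
      using D by (simp add: B_def M b sum_distrib_left mult_ac)
    also have "\<dots> = of_int (if i = k then \<bar>e\<bar> else 0)" unfolding YM using arg_cong[OF sg, of real_of_int] by (simp add: e)
    finally show ?thesis by (simp only: of_int_eq_iff)
  qed
  show ?thesis using 1 2 e0 by (intro exI[of _ B] exI[of _ "\<bar>e\<bar>"]) auto
qed

context polyhedron begin

lemma zero_SS: "p > 0 \<Longrightarrow> (\<lambda>_. 0) \<in> SS p"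
  by (rule SS_I) (auto simp: ge_def monomial_defined_def b_pos)

lemma bergman_space_one: "bergman_space p (\<lambda>_. 1) U = AA p"
  by (simp add: bergman_space_def AA_def bergman_one)

lemma bergman_norm_one: "bergman_norm p (\<lambda>_. 1) U f = lpN p V f"
  by (simp add: bergman_norm_def lpN_def bergman_one)

lemma bergman_space_eta:
  assumes p: "p > 1" and q: "q = p / (p - 1)"
  shows "g \<in> bergman_space q (eta q) U \<longleftrightarrow> holo_on g U \<and> lpS q V (\<lambda>z. g (twist p z))"
proof (cases "holo_on g U")
  case True
  have "q > 1" using p by (simp add: q field_simps)
  then have k: "(q - 1) * (p - 1) ^ CARD('n) > 0" using p by (intro mult_pos_pos zero_less_power) auto
  have *: "ennreal c * x < \<infinity> \<longleftrightarrow> x < \<infinity>" if "c > 0" for c x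
    using that by (auto simp: ennreal_mult_less_top)
  then show ?thesis
    using True twist_holo_measurable[OF p True] bergman_eta[OF p q holo_V[OF True]] *[OF k] by (simp add: bergman_space_def lpS_def)
qed (simp add: bergman_space_def)

lemma bergman_norm_eta:
  assumes p: "p > 1" and q: "q = p / (p - 1)" and g: "holo_on g U"
  shows "bergman_norm q (eta q) U g = ((q - 1) * (p - 1) ^ CARD('n)) powr (1 / q) * lpN q V (\<lambda>z. g (twist p z))"
proof -
  have "q > 1" using p by (simp add: q field_simps)
  then have "(q - 1) * (p - 1) ^ CARD('n) \<ge> 0" using p by simp
  then show ?thesis
    unfolding bergman_norm_def lpN_def bergman_eta[OF p q holo_V[OF g]] enn2real_mult by (simp add: powr_mult)
qed

end

theorem theorem7p8:
  fixes U :: "(complex^'n) set" and p q :: real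
  assumes "1 < p" and "q = p / (p - 1)"
    and "monomial_polyhedron U"
  defines "Ap \<equiv> bergman_space p (\<lambda>_. 1) U"
    and "Np \<equiv> bergman_norm p (\<lambda>_. 1) U"
    and "Aq \<equiv> bergman_space q (eta q) U"
    and "Nq \<equiv> bergman_norm q (eta q) U"
  shows
    \<comment> \<open>the pairing is well defined\<close>
    "(\<forall>f\<in>Ap. \<forall>g\<in>Aq. set_integrable lebesgue U (\<lambda>z. f z * cnj (g (twist p z))))
     \<comment> \<open>g maps to a bounded linear functional on A^p, conjugate-linearly\<close>
   \<and> (\<forall>g\<in>Aq. bounded_linear_functional Ap Np (\<lambda>f. pairing p U f g))
   \<and> (\<forall>g1\<in>Aq. \<forall>g2\<in>Aq. \<forall>f\<in>Ap.
        pairing p U f (\<lambda>z. g1 z + g2 z) = pairing p U f g1 + pairing p U f g2)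
   \<and> (\<forall>g\<in>Aq. \<forall>c. \<forall>f\<in>Ap. pairing p U f (\<lambda>z. c * g z) = cnj c * pairing p U f g)
     \<comment> \<open>injective\<close>
   \<and> (\<forall>g1\<in>Aq. \<forall>g2\<in>Aq. (\<forall>f\<in>Ap. pairing p U f g1 = pairing p U f g2)
        \<longrightarrow> (\<forall>z\<in>U. g1 z = g2 z))
     \<comment> \<open>onto the dual\<close>
   \<and> (\<forall>\<phi>. bounded_linear_functional Ap Np \<phi> \<longrightarrow>
        (\<exists>g\<in>Aq. \<forall>f\<in>Ap. \<phi> f = pairing p U f g))
     \<comment> \<open>isomorphism of Banach spaces: norm of g comparable with the dual norm\<close>
   \<and> (\<exists>C>0. \<forall>g\<in>Aq.
        (\<forall>f\<in>Ap. cmod (pairing p U f g) \<le> C * Nq g * Np f) \<and>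
        (\<forall>K. (\<forall>f\<in>Ap. cmod (pairing p U f g) \<le> K * Np f) \<longrightarrow> Nq g \<le> C * K))"
proof -
  obtain \<alpha> where det: "det (exponent_matrix \<alpha>) \<noteq> 0" and U: "U = monomial_polyhedron_set \<alpha>" "open U" "bounded U"
    using assms(3) unfolding monomial_polyhedron_def by blast
  obtain B d where Bd: "d > 0" "\<And>j k. (\<Sum>i\<in>UNIV. \<alpha> j i * B i k) = (if j = k then d else 0)"
    "\<And>i k. (\<Sum>j\<in>UNIV. B i j * \<alpha> j k) = (if i = k then d else 0)"
    using ex_int_inverse[OF det] by blast
  interpret polyhedron \<alpha> B d U by unfold_locales (use Bd U in auto)
  note p = assms(1) and q = assms(2)
  have q1: "q > 1" "1 / p + 1 / q = 1" "q > 0" "q \<ge> 1" and p0: "p > 0" "p \<ge> 1" using p by (simp_all add: q field_simps)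
  have Aq: "g \<in> Aq \<longleftrightarrow> holo_on g U \<and> lpS q V (\<lambda>z. g (twist p z))" for g
    unfolding Aq_def by (rule bergman_space_eta[OF p q])
  \<comment> \<open>The ratio of the weighted norm of \<open>g\<close> to the L^q norm of its
    composition with the twist.\<close>
  define k where "k = ((q - 1) * (p - 1) ^ CARD('n)) powr (1 / q)"
  have k: "k > 0" using p q1 by (simp add: k_def)
  have Nq: "bergman_norm q (eta q) U g = k * lpN q V (\<lambda>z. g (twist p z))" if "g \<in> Aq" for g
    unfolding k_def by (rule bergman_norm_eta[OF p q]) (use that Aq in blast)
  note hi = hoelder_integral[OF p q1(1,2)]
  have int: "integrable V (\<lambda>z. f z * cnj (g (twist p z)))" and
    bnd: "cmod (LINT z|V. f z * cnj (g (twist p z))) \<le> lpN p V f * lpN q V (\<lambda>z. g (twist p z))"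
    if "f \<in> AA p" "g \<in> Aq" for f g using hi[OF AA_lpS[OF that(1)], of "\<lambda>z. g (twist p z)"] that(2) Aq by auto
  have pm: "(\<lambda>z. f z * cnj (g (twist p z))) \<in> borel_measurable V" if "f \<in> AA p" "g \<in> Aq" for f g
    using int[OF that] by simp
  have pair: "pairing p U f g = (LINT z|V. f z * cnj (g (twist p z)))" if "f \<in> AA p" "g \<in> Aq" for f g
    unfolding pairing_def by (rule integrable_lebesgue_V(2)[OF pm[OF that]])
  have Aq_add: "(\<lambda>z. g1 z + g2 z) \<in> Aq" if "g1 \<in> Aq" "g2 \<in> Aq" for g1 g2
    using that minkowski(1)[OF q1(4), of V "\<lambda>z. g1 (twist p z)" "\<lambda>z. g2 (twist p z)"] by (simp add: Aq holo_on_add)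
  have Aq_cmul: "(\<lambda>z. c * g z) \<in> Aq" if "g \<in> Aq" for g c
    using that lp_cmul(1)[OF q1(3), of V "\<lambda>z. g (twist p z)" c] by (simp add: Aq holo_on_cmul)
  have lin1: "(LINT z|V. (f1 z + f2 z) * cnj (g (twist p z))) = (LINT z|V. f1 z * cnj (g (twist p z))) + (LINT z|V. f2 z * cnj (g (twist p z)))"
    if "f1 \<in> AA p" "f2 \<in> AA p" "g \<in> Aq" for f1 f2 g
    by (simp add: distrib_right Bochner_Integration.integral_add int that)
  have inj: "g1 z = g2 z" if "g1 \<in> Aq" "g2 \<in> Aq" "z \<in> U" and e: "\<And>f. f \<in> AA p \<Longrightarrow> (LINT z|V. f z * cnj (g1 (twist p z))) = (LINT z|V. f z * cnj (g2 (twist p z)))" for g1 g2 z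
    by (rule pair_inj[OF p q _ _ _ _ e that(3)]) (use that Aq AA_monomial[OF p0(1)] in auto)
  obtain C where C: "C > 0" and rep: "\<And>K \<phi>. 0 \<le> K \<Longrightarrow> (\<forall>f\<in>AA p. \<forall>g\<in>AA p. \<phi> (\<lambda>z. f z + g z) = \<phi> f + \<phi> g) \<Longrightarrow> (\<forall>f\<in>AA p. \<forall>c. \<phi> (\<lambda>z. c * f z) = c * \<phi> f)
     \<Longrightarrow> (\<forall>f\<in>AA p. cmod (\<phi> f) \<le> K * lpN p V f) \<Longrightarrow>
     (\<exists>g. holo_on g U \<and> lpS q V (\<lambda>z. g (twist p z)) \<and> lpN q V (\<lambda>z. g (twist p z)) \<le> K * C \<and>
        (\<forall>f\<in>AA p. \<phi> f = (LINT z|V. f z * cnj (g (twist p z)))))"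
    using dual_rep[OF p q] by blast
  show ?thesis unfolding Ap_def Np_def Nq_def bergman_space_one bergman_norm_one
  proof (intro conjI ballI allI impI)
    fix f g assume fg: "f \<in> AA p" "g \<in> Aq"
    show "set_integrable lebesgue U (\<lambda>z. f z * cnj (g (twist p z)))"
      using integrable_lebesgue_V(1)[OF pm[OF fg]] int[OF fg] by simp
  next
    fix g assume g: "g \<in> Aq"
    show "bounded_linear_functional (AA p) (lpN p V) (\<lambda>f. pairing p U f g)"
      unfolding bounded_linear_functional_def
    proof (intro conjI ballI allI exI)
      fix f1 f2 assume "f1 \<in> AA p" "f2 \<in> AA p"
      then show "pairing p U (\<lambda>z. f1 z + f2 z) g = pairing p U f1 g + pairing p U f2 g"
        by (simp add: pair g AA_add p0 lin1)
    next
      fix f c assume "f \<in> AA p"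
      then show "pairing p U (\<lambda>z. c * f z) g = c * pairing p U f g"
        by (simp add: pair g AA_cmul p0 mult.assoc)
    next
      fix f assume "f \<in> AA p"
      then show "cmod (pairing p U f g) \<le> lpN q V (\<lambda>z. g (twist p z)) * lpN p V f"
        using bnd[of f g] g by (simp add: pair mult.commute)
    qed
  next
    fix g1 g2 f assume "g1 \<in> Aq" "g2 \<in> Aq" "f \<in> AA p"
    then show "pairing p U f (\<lambda>z. g1 z + g2 z) = pairing p U f g1 + pairing p U f g2"
      by (simp add: pair Aq_add distrib_left Bochner_Integration.integral_add int)
  next
    fix g c f assume "g \<in> Aq" "f \<in> AA p"
    then show "pairing p U f (\<lambda>z. c * g z) = cnj c * pairing p U f g"
      by (simp add: pair Aq_cmul mult.left_commute)
  next
    fix g1 g2 z assume g: "g1 \<in> Aq" "g2 \<in> Aq" and e: "\<forall>f\<in>AA p. pairing p U f g1 = pairing p U f g2" and z: "z \<in> U"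
    show "g1 z = g2 z" by (rule inj[OF g z]) (use e g in \<open>simp add: pair\<close>)
  next
    fix \<phi> assume "bounded_linear_functional (AA p) (lpN p V) \<phi>"
    then obtain K where h: "\<forall>f\<in>AA p. \<forall>g\<in>AA p. \<phi> (\<lambda>z. f z + g z) = \<phi> f + \<phi> g" "\<forall>f\<in>AA p. \<forall>c. \<phi> (\<lambda>z. c * f z) = c * \<phi> f"
      and K: "\<forall>f\<in>AA p. cmod (\<phi> f) \<le> K * lpN p V f" unfolding bounded_linear_functional_def by blast
    have "\<forall>f\<in>AA p. cmod (\<phi> f) \<le> \<bar>K\<bar> * lpN p V f"
    proof
      fix f assume "f \<in> AA p"
      then have "cmod (\<phi> f) \<le> K * lpN p V f" using K by blast
      also have "\<dots> \<le> \<bar>K\<bar> * lpN p V f" by (intro mult_right_mono) auto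
      finally show "cmod (\<phi> f) \<le> \<bar>K\<bar> * lpN p V f" .
    qed
    from rep[OF abs_ge_zero h this] obtain g where g: "g \<in> Aq" "\<forall>f\<in>AA p. \<phi> f = (LINT z|V. f z * cnj (g (twist p z)))"
      unfolding Aq by blast
    then show "\<exists>g\<in>Aq. \<forall>f\<in>AA p. \<phi> f = pairing p U f g" by (auto simp: pair)
  next
    show "\<exists>C>0. \<forall>g\<in>Aq. (\<forall>f\<in>AA p. cmod (pairing p U f g) \<le> C * bergman_norm q (eta q) U g * lpN p V f) \<and>
        (\<forall>K. (\<forall>f\<in>AA p. cmod (pairing p U f g) \<le> K * lpN p V f) \<longrightarrow> bergman_norm q (eta q) U g \<le> C * K)"
    \<comment> \<open>The bound for the pairing asks for 1 / k, the bound for the norm of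
      \<open>g\<close> for k C; their sum serves both.\<close>
    proof (intro exI[of _ "1 / k + k * C"] conjI ballI allI impI)
      show "1 / k + k * C > 0" using k C by (intro add_pos_pos) auto
      fix g assume g: "g \<in> Aq"
      { fix f assume f: "f \<in> AA p"
        have "cmod (pairing p U f g) \<le> 1 / k * bergman_norm q (eta q) U g * lpN p V f"
          using bnd[OF f g] k by (simp add: pair f g Nq mult.commute)
        also have "\<dots> \<le> (1 / k + k * C) * bergman_norm q (eta q) U g * lpN p V f"
          using k C by (intro mult_right_mono) (auto simp: Nq g)
        finally show "cmod (pairing p U f g) \<le> (1 / k + k * C) * bergman_norm q (eta q) U g * lpN p V f" . }
      fix K assume K: "\<forall>f\<in>AA p. cmod (pairing p U f g) \<le> K * lpN p V f"
      \<comment> \<open>Tested on the constant function 1, which lies in A^p and has positive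
        norm.\<close>
      have K0: "K \<ge> 0"
      proof -
        note m = zero_SS[OF p0(1)]
        have "0 \<le> K * lpN p V (monomial (\<lambda>_. 0))"
          using K AA_monomial[OF p0(1) m] by (meson norm_ge_zero order_trans)
        moreover have "lpN p V (monomial (\<lambda>_. 0)) > 0"
          using lpN_monomial[OF p0(1) m] NN_pos[OF p0(1) m] K0_pos by simp
        ultimately show ?thesis by (simp add: zero_le_mult_iff)
      qed
      \<comment> \<open>The functional defined by \<open>g\<close> has some representative
        \<open>g'\<close> with controlled norm; injectivity identifies it with \<open>g\<close> on
        \<open>U\<close>, so the norm bound applies to \<open>g\<close> itself.\<close>
      have "\<exists>g'. holo_on g' U \<and> lpS q V (\<lambda>z. g' (twist p z)) \<and> lpN q V (\<lambda>z. g' (twist p z)) \<le> K * C \<and>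
        (\<forall>f\<in>AA p. (LINT z|V. f z * cnj (g (twist p z))) = (LINT z|V. f z * cnj (g' (twist p z))))"
      proof (rule rep[OF K0])
        show "\<forall>f\<in>AA p. cmod (LINT z|V. f z * cnj (g (twist p z))) \<le> K * lpN p V f" using K g by (simp add: pair)
        show "\<forall>f\<in>AA p. \<forall>f'\<in>AA p. (LINT z|V. (f z + f' z) * cnj (g (twist p z))) = (LINT z|V. f z * cnj (g (twist p z))) + (LINT z|V. f' z * cnj (g (twist p z)))"
          using lin1 g by blast
        show "\<forall>f\<in>AA p. \<forall>c. (LINT z|V. (c * f z) * cnj (g (twist p z))) = c * (LINT z|V. f z * cnj (g (twist p z)))"
          by (simp add: mult.assoc)
      qed
      then obtain g' where g': "g' \<in> Aq" "lpN q V (\<lambda>z. g' (twist p z)) \<le> K * C"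
        and e: "\<And>f. f \<in> AA p \<Longrightarrow> (LINT z|V. f z * cnj (g (twist p z))) = (LINT z|V. f z * cnj (g' (twist p z)))"
        unfolding Aq by blast
      have "lpN q V (\<lambda>z. g (twist p z)) = lpN q V (\<lambda>z. g' (twist p z))"
        by (rule lpN_cong_AE, rule AE_I2, rule inj[OF g g'(1) _ e]) (simp add: twist_U p)
      then have "bergman_norm q (eta q) U g \<le> k * (K * C)" using g'(2) k by (simp add: Nq g)
      also have "\<dots> \<le> (1 / k + k * C) * K" using k K0 by (simp add: algebra_simps)
      finally show "bergman_norm q (eta q) U g \<le> (1 / k + k * C) * K" .
    qed
  qed
qed

end
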